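(* Let $(\Omega^\bullet,\phi,C^{-1})$ be a triple satisfying the conditions (i)–(v) listed in the context, over a topos $\mathcal T$ ringed by the Witt ring $\mathcal W$ of a perfect field $\kappa$ of characteristic $p>0$, and let $\mathfrak W_n\Omega^i$, $F$, $V$, $d$, $R$, $Z_n\mathfrak W_1\Omega^i$, $B_n\mathfrak W_1\Omega^i$ and $C$ be as defined in the context. Let $i\ge 0$ and $n\ge1$ be integers. Then: (1) The morphism $F^n:\mathfrak W_{n+1}\Omega^i\to\sigma^n_*\mathfrak W_1\Omega^i$ induces an isomorphism of sheaves of $\kappa$-modules in $\mathcal T$: $$\mathfrak W_{n+1}\Omega^i/V(\sigma_*\mathfrak W_n\Omega^i)\overset{\sim}{\to}Z_n\mathfrak W_1\Omega^i.$$ (2) One has $C\circ F^n=F^{n-1}\circ R$ as morphisms $\mathfrak W_{n+1}\Omega^i\to Z_{n-1}\mathfrak W_1\Omega^i$, where $F^n:\mathfrak W_{n+1}\Omega^i\to Z_n\mathfrak W_1\Omega^i$, $C:Z_n\mathfrak W_1\Omega^i\to Z_{n-1}\mathfrak W_1\Omega^i$, $R:\mathfrak W_{n+1}\Omega^i\to\mathfrak W_n\Omega^i$ and $F^{n-1}:\mathfrak W_n\Omega^i\to Z_{n-1}\mathfrak W_1\Omega^i$. (3) The morphism $F^{n-1}d:\mathfrak W_n\Omega^i\to\sigma^{n-1}_*\mathfrak W_1\Omega^{i+1}$ induces an isomorphism of abelian sheaves in $\mathcal T$: $$\sigma_*\mathfrak W_n\Omega^i/F\mathfrak W_{n+1}\Omega^i\overset{\sim}{\to}B_n\mathfrak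 W_1\Omega^{i+1}.$$ (4) One has $C\circ F^nd=F^{n-1}d\circ R$ as morphisms $\sigma_*\mathfrak W_{n+1}\Omega^i\to B_n\mathfrak W_1\Omega^{i+1}$, where $F^nd:\sigma_*\mathfrak W_{n+1}\Omega^i\to B_{n+1}\mathfrak W_1\Omega^{i+1}$, $C:B_{n+1}\mathfrak W_1\Omega^{i+1}\to B_n\mathfrak W_1\Omega^{i+1}$, $R:\sigma_*\mathfrak W_{n+1}\Omega^i\to\sigma_*\mathfrak W_n\Omega^i$ and $F^{n-1}d:\sigma_*\mathfrak W_n\Omega^i\to B_n\mathfrak W_1\Omega^{i+1}$.
   Context: $\sigma$ denotes the Frobenius automorphism of $\mathcal W$ and of $\kappa$; $\sigma_*M$ is $M$ with module structure twisted through $\sigma$ (so as abelian sheaves $\sigma_*M=M$). $\Omega^\bullet$ is a bounded complex of sheaves of torsion-free $\mathcal W$-modules in $\mathcal T$, $\phi:\Omega^\bullet\to\sigma_*(\Omega^\bullet)$ is a morphism of complexes of $\mathcal W$-modules, $\Omega_1^\bullet:=\Omega^\bullet/p\Omega^\bullet$, and one assumes: (i) $\Omega^i=0$ for $i<0$; (ii) each $\Omega^i$ is $p$-torsion-free and $p$-adically complete; (iii) $\phi(\Omega^i)\subset\sigma_*\{\omega\in p^i\Omega^i\mid d\omega\in p^{i+1}\Omega^{i+1}\}$ for all $i$; (iv) there is an isomorphism of sheaves of $\kappa$-modules $C^{-1}:\Omega^i_1\overset{\sim}{\to}\sigma_*\mathcal H^i(\Omega^\bullet_1)$ for all $i$;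 (v) the composite of $p^{-i}\phi:\Omega^i\to\sigma_*(\Omega^i)$ with reduction mod $p$ factors through $\sigma_*\mathrm{Ker}(d:\Omega^i_1\to\Omega^{i+1}_1)$, and the induced morphism $\Omega^i\to\sigma_*\mathcal H^i(\Omega_1^\bullet)$ equals the composite of reduction $\Omega^i\to\Omega^i_1$ with $C^{-1}$. Set $Z^i_n:=\{\omega\in\Omega^i\mid d\omega\in p^n\Omega^{i+1}\}$, $B^i_n:=p^n\Omega^i+d\Omega^{i-1}$ and $\mathfrak W_n\Omega^i:=\sigma^n_*(Z^i_n/B^i_n)$ for $n\ge 1$. It is known that $\phi$ induces an isomorphism $\phi:\mathfrak W_n\Omega^i\overset{\sim}{\to}\sigma^{n+1}_*\{p^iZ^i_{n+1}/(p^{i+n}Z^i_1+p^{i-1}dZ^{i-1}_1)\}$. Operators: $F:\mathfrak W_{n+1}\Omega^i\to\sigma_*\mathfrak W_n\Omega^i$ is induced by $\mathrm{id}_{\Omega^i}$; $V:\sigma_*\mathfrak W_n\Omega^i\to\mathfrak W_{n+1}\Omega^i$ is induced by $p\cdot\mathrm{id}_{\Omega^i}$; $d:\mathfrak W_n\Omega^i\to\mathfrak W_n\Omega^{i+1}$ is induced by $p^{-n}d:Z^i_n\to\Omega^{i+1}$; $R:\mathfrak W_{n+1}\Omega^i\to\mathfrak W_n\Omega^i$ is the composite of multiplication by $p^i$, $\mathfrak W_{n+1}\Omega^i\overset{\sim}{\to}\sigma^{n+1}_*(p^iZ^i_{n+1}/p^iB^i_{n+1})$, the projection onto $\sigma^{n+1}_*(p^iZ^i_{n+1}/(p^{i+n}Z^i_1+p^{i-1}dZ^{i-1}_1))$,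 and the inverse of the isomorphism $\mathfrak W_n\Omega^i\overset{\sim}{\to}\sigma^{n+1}_*\{p^iZ^i_{n+1}/(p^{i+n}Z^i_1+p^{i-1}dZ^{i-1}_1)\}$ induced by $\phi$. Put $B\Omega^i_1:=\mathrm{Im}(d:\Omega^{i-1}_1\to\Omega^i_1)$. Define $\kappa$-submodules $Z_n\Omega^i_1,B_n\Omega^i_1\subset\sigma^n_*(\Omega^i_1)$ inductively: $Z_0\Omega^i_1=\Omega^i_1$, $B_0\Omega^i_1=0$, and for $n\ge1$ they contain $\sigma^n_*(B\Omega^i_1)$ and $C^{-1}$ induces $Z_{n-1}\Omega^i_1\overset{\sim}{\to}Z_n\Omega^i_1/\sigma^n_*(B\Omega^i_1)$ and $B_{n-1}\Omega^i_1\overset{\sim}{\to}B_n\Omega^i_1/\sigma^n_*(B\Omega^i_1)$. (It is known that $Z_n\Omega^i_1=\sigma^n_*\{(Z^i_n+p\Omega^i)/p\Omega^i\}$ and $B_n\Omega^i_1=\sigma^n_*\{(p^{-(n-1)}dZ^{i-1}_{n-1}+p\Omega^i)/p\Omega^i\}$ for $n\ge1$, with $Z^{i}_0=\Omega^{i}$.) Set $Z_n\mathfrak W_1\Omega^i:=Z_{n+1}\Omega^i_1/\sigma^{n+1}_*(B\Omega^i_1)$ and $B_n\mathfrak W_1\Omega^i:=B_{n+1}\Omega^i_1/\sigma^{n+1}_*(B\Omega^i_1)$, which are $\kappa$-submodules of $\sigma^n_*(\mathfrak W_1\Omega^i)=\sigma^{n+1}_*\mathcal H^i(\Omega^\bullet_1)$.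 For $n\ge 1$ the morphism $C:Z_n\mathfrak W_1\Omega^i\to Z_{n-1}\mathfrak W_1\Omega^i$ (resp. $C:B_n\mathfrak W_1\Omega^i\to B_{n-1}\mathfrak W_1\Omega^i$) is the projection of $Z_{n+1}\Omega_1^i$ (resp. $B_{n+1}\Omega^i_1$) modulo $B\Omega^i_1$ onto its quotient modulo $B_2\Omega^i_1$ (up to the twist by $\sigma$), followed by the inverse of the isomorphism induced by $C^{-1}$ from $Z_n\Omega^i_1$ (resp. $B_n\Omega^i_1$) modulo $B\Omega^i_1$. *)

theory Defs
  imports "HOL-Library.Poly_Mapping" "HOL-Algebra.AbelCoset" "HOL-Algebra.Module"
begin

section \<open>Witt vectors\<close>

text \<open>
  Polynomials over the integers in the variables $x_0, x_1, \ldots$; the two arguments of the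
  Witt sum and product polynomials are the variables of even and of odd index.
\<close>

type_synonym int_mpoly = "(nat \<Rightarrow>\<^sub>0 nat) \<Rightarrow>\<^sub>0 int"

definition mvar :: "nat \<Rightarrow> int_mpoly" where
  "mvar v = Poly_Mapping.single (Poly_Mapping.single v 1) 1"

definition mpoly_eval :: "(nat \<Rightarrow> 'k::comm_ring_1) \<Rightarrow> int_mpoly \<Rightarrow> 'k" where
  "mpoly_eval x q =
     (\<Sum>m\<in>Poly_Mapping.keys q. of_int (Poly_Mapping.lookup q m) *
        (\<Prod>v\<in>Poly_Mapping.keys m. x v ^ Poly_Mapping.lookup m v))"

definition ghost :: "nat \<Rightarrow> (nat \<Rightarrow> 'r::comm_ring_1) \<Rightarrow> nat \<Rightarrow> 'r" where
  "ghost p x n = (\<Sum>i\<le>n. of_nat (p ^ i) * x i ^ (p ^ (n - i)))"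

definition witt_sum_poly :: "nat \<Rightarrow> nat \<Rightarrow> int_mpoly" where
  "witt_sum_poly p = (THE S. \<forall>n. ghost p S n =
     ghost p (\<lambda>j. mvar (2 * j)) n + ghost p (\<lambda>j. mvar (2 * j + 1)) n)"

definition witt_prod_poly :: "nat \<Rightarrow> nat \<Rightarrow> int_mpoly" where
  "witt_prod_poly p = (THE S. \<forall>n. ghost p S n =
     ghost p (\<lambda>j. mvar (2 * j)) n * ghost p (\<lambda>j. mvar (2 * j + 1)) n)"

definition interleave :: "(nat \<Rightarrow> 'k) \<Rightarrow> (nat \<Rightarrow> 'k) \<Rightarrow> nat \<Rightarrow> 'k" where
  "interleave a b v = (if even v then a (v div 2) else b (v div 2))"

text \<open>The ring of $p$-typical Witt vectors of a field of characteristic $p$.\<close>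

definition witt_ring :: "(nat \<Rightarrow> 'k::field) ring" where
  "witt_ring =
    \<lparr> carrier = UNIV,
      mult = (\<lambda>a b n. mpoly_eval (interleave a b) (witt_prod_poly CHAR('k) n)),
      one = (\<lambda>n. if n = 0 then 1 else 0),
      zero = (\<lambda>n. 0),
      add = (\<lambda>a b n. mpoly_eval (interleave a b) (witt_sum_poly CHAR('k) n)) \<rparr>"

definition witt_frob :: "(nat \<Rightarrow> 'k::field) \<Rightarrow> nat \<Rightarrow> 'k" where
  "witt_frob a = (\<lambda>n. a n ^ CHAR('k))"

definition teichmueller :: "'k::field \<Rightarrow> nat \<Rightarrow> 'k" where
  "teichmueller c = (\<lambda>n. if n = 0 then c else 0)"


section \<open>Sites and sheaves of modules\<close>

text \<open>
  A topos is presented as the category of sheaves on a small category with a Grothendieck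
  topology; \<open>cov T U\<close> is the set of covering sieves of \<open>U\<close>, and \<open>cmp T f g\<close>
  is the composite $f \circ g$.
\<close>

record ('o, 'm) site =
  ob :: "'o set"
  ar :: "'m set"
  src :: "'m \<Rightarrow> 'o"
  tgt :: "'m \<Rightarrow> 'o"
  idn :: "'o \<Rightarrow> 'm"
  cmp :: "'m \<Rightarrow> 'm \<Rightarrow> 'm"
  cov :: "'o \<Rightarrow> 'm set set"

definition into :: "('o, 'm) site \<Rightarrow> 'o \<Rightarrow> 'm set" where
  "into T U = {f \<in> ar T. tgt T f = U}"

definition sieve :: "('o, 'm) site \<Rightarrow> 'o \<Rightarrow> 'm set \<Rightarrow> bool" where
  "sieve T U S \<longleftrightarrow> S \<subseteq> into T U \<and> (\<forall>f\<in>S. \<forall>g\<in>into T (src T f). cmp T f g \<in> S)"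

definition pullback_sieve :: "('o, 'm) site \<Rightarrow> 'm \<Rightarrow> 'm set \<Rightarrow> 'm set" where
  "pullback_sieve T f S = {g \<in> into T (src T f). cmp T f g \<in> S}"

locale grothendieck_site =
  fixes T :: "('o, 'm) site"
  assumes src_ob: "f \<in> ar T \<Longrightarrow> src T f \<in> ob T"
    and tgt_ob: "f \<in> ar T \<Longrightarrow> tgt T f \<in> ob T"
    and idn_ar: "U \<in> ob T \<Longrightarrow> idn T U \<in> ar T \<and> src T (idn T U) = U \<and> tgt T (idn T U) = U"
    and cmp_ar: "\<lbrakk>f \<in> ar T; g \<in> into T (src T f)\<rbrakk>
      \<Longrightarrow> cmp T f g \<in> ar T \<and> src T (cmp T f g) = src T g \<and> tgt T (cmp T f g) = tgt T f"
    and idn_left: "f \<in> ar T \<Longrightarrow> cmp T (idn T (tgt T f)) f = f"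
    and idn_right: "f \<in> ar T \<Longrightarrow> cmp T f (idn T (src T f)) = f"
    and cmp_assoc: "\<lbrakk>f \<in> ar T; g \<in> into T (src T f); h \<in> into T (src T g)\<rbrakk>
      \<Longrightarrow> cmp T (cmp T f g) h = cmp T f (cmp T g h)"
    and cov_sieve: "\<lbrakk>U \<in> ob T; S \<in> cov T U\<rbrakk> \<Longrightarrow> sieve T U S"
    and cov_max: "U \<in> ob T \<Longrightarrow> into T U \<in> cov T U"
    and cov_stable: "\<lbrakk>f \<in> ar T; S \<in> cov T (tgt T f)\<rbrakk> \<Longrightarrow> pullback_sieve T f S \<in> cov T (src T f)"
    and cov_trans: "\<lbrakk>U \<in> ob T; S \<in> cov T U; sieve T U S';
        \<forall>f\<in>S. pullback_sieve T f S' \<in> cov T (src T f)\<rbrakk> \<Longrightarrow> S' \<in> cov T U"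

record ('o, 'm, 'r, 'a) msheaf =
  sec :: "'o \<Rightarrow> ('r, 'a) module"
  res :: "'m \<Rightarrow> 'a \<Rightarrow> 'a"

abbreviation sects :: "('o, 'm, 'r, 'a) msheaf \<Rightarrow> 'o \<Rightarrow> 'a set" where
  "sects M U \<equiv> carrier (sec M U)"

text \<open>Sheaves of modules over the constant ring \<open>R\<close>; the scalars are all elements of the
  type \<open>'r\<close>.\<close>

locale sheaf_of_modules =
  fixes T :: "('o, 'm) site" and R :: "'r ring" and M :: "('o, 'm, 'r, 'a) msheaf"
  assumes sec_module: "U \<in> ob T \<Longrightarrow> module R (sec M U)"
    and res_add: "f \<in> ar T \<Longrightarrow>
      res M f \<in> hom (add_monoid (sec M (tgt T f))) (add_monoid (sec M (src T f)))"
    and res_smult: "\<lbrakk>f \<in> ar T; x \<in> sects M (tgt T f)\<rbrakk> \<Longrightarrow>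
      res M f (a \<odot>\<^bsub>sec M (tgt T f)\<^esub> x) = a \<odot>\<^bsub>sec M (src T f)\<^esub> res M f x"
    and res_idn: "\<lbrakk>U \<in> ob T; x \<in> sects M U\<rbrakk> \<Longrightarrow> res M (idn T U) x = x"
    and res_cmp: "\<lbrakk>f \<in> ar T; g \<in> into T (src T f); x \<in> sects M (tgt T f)\<rbrakk> \<Longrightarrow>
      res M (cmp T f g) x = res M g (res M f x)"
    and gluing: "\<lbrakk>U \<in> ob T; S \<in> cov T U; \<forall>f\<in>S. s f \<in> sects M (src T f);
        \<forall>f\<in>S. \<forall>g\<in>into T (src T f). res M g (s f) = s (cmp T f g)\<rbrakk> \<Longrightarrow>
      \<exists>!x. x \<in> sects M U \<and> (\<forall>f\<in>S. res M f x = s f)"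

subsection \<open>Morphisms\<close>

definition sheaf_ab_hom ::
  "('o, 'm) site \<Rightarrow> ('o, 'm, 'r, 'a) msheaf \<Rightarrow> ('o, 'm, 's, 'b) msheaf \<Rightarrow> ('o \<Rightarrow> 'a \<Rightarrow> 'b) \<Rightarrow> bool"
  where "sheaf_ab_hom T M P h \<longleftrightarrow>
    (\<forall>U\<in>ob T. h U \<in> hom (add_monoid (sec M U)) (add_monoid (sec P U))) \<and>
    (\<forall>f\<in>ar T. \<forall>x\<in>sects M (tgt T f). h (src T f) (res M f x) = res P f (h (tgt T f) x))"

definition sheaf_mod_hom ::
  "('o, 'm) site \<Rightarrow> ('o, 'm, 'r, 'a) msheaf \<Rightarrow> ('o, 'm, 'r, 'b) msheaf \<Rightarrow> ('o \<Rightarrow> 'a \<Rightarrow> 'b) \<Rightarrow> bool"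
  where "sheaf_mod_hom T M P h \<longleftrightarrow> sheaf_ab_hom T M P h \<and>
    (\<forall>U\<in>ob T. \<forall>a. \<forall>x\<in>sects M U. h U (a \<odot>\<^bsub>sec M U\<^esub> x) = a \<odot>\<^bsub>sec P U\<^esub> h U x)"

definition sheaf_ab_iso ::
  "('o, 'm) site \<Rightarrow> ('o, 'm, 'r, 'a) msheaf \<Rightarrow> ('o, 'm, 's, 'b) msheaf \<Rightarrow> ('o \<Rightarrow> 'a \<Rightarrow> 'b) \<Rightarrow> bool"
  where "sheaf_ab_iso T M P h \<longleftrightarrow> sheaf_ab_hom T M P h \<and>
    (\<forall>U\<in>ob T. bij_betw (h U) (sects M U) (sects P U))"

definition sheaf_mod_iso ::
  "('o, 'm) site \<Rightarrow> ('o, 'm, 'r, 'a) msheaf \<Rightarrow> ('o, 'm, 'r, 'b) msheaf \<Rightarrow> ('o \<Rightarrow> 'a \<Rightarrow> 'b) \<Rightarrow> bool"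
  where "sheaf_mod_iso T M P h \<longleftrightarrow> sheaf_mod_hom T M P h \<and>
    (\<forall>U\<in>ob T. bij_betw (h U) (sects M U) (sects P U))"

subsection \<open>Restriction of scalars\<close>

definition restrict_scalars ::
  "('s \<Rightarrow> 'r) \<Rightarrow> ('o, 'm, 'r, 'a) msheaf \<Rightarrow> ('o, 'm, 's, 'a) msheaf" where
  "restrict_scalars j M =
    \<lparr> sec = (\<lambda>U. \<lparr> carrier = sects M U, mult = mult (sec M U), one = one (sec M U),
        zero = zero (sec M U), add = add (sec M U),
        smult = (\<lambda>a x. j a \<odot>\<^bsub>sec M U\<^esub> x) \<rparr>),
      res = res M \<rparr>"

text \<open>The $n$-fold twist $\sigma^n_* M$.\<close>

definition twist :: "nat \<Rightarrow> ('o, 'm, nat \<Rightarrow> 'k::field, 'a) msheaf \<Rightarrow> ('o, 'm, nat \<Rightarrow> 'k, 'a) msheaf"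
  where "twist n = restrict_scalars (witt_frob ^^ n)"

text \<open>
  A sheaf of Witt modules annihilated by $p$ as a sheaf of modules over the residue field: a
  scalar acts through any of its lifts to the Witt ring, e.g. its multiplicative lift. It is
  only used for such sheaves.
\<close>

definition kmod :: "('o, 'm, nat \<Rightarrow> 'k::field, 'a) msheaf \<Rightarrow> ('o, 'm, 'k, 'a) msheaf"
  where "kmod = restrict_scalars teichmueller"

subsection \<open>Subsheaves and images\<close>

definition subsh :: "('o, 'm, 'r, 'a) msheaf \<Rightarrow> ('o \<Rightarrow> 'a set) \<Rightarrow> ('o, 'm, 'r, 'a) msheaf" where
  "subsh M A = M\<lparr> sec := (\<lambda>U. (sec M U)\<lparr> carrier := A U \<rparr>) \<rparr>"

text \<open>The subsheaf of \<open>M\<close> generated by a subpresheaf: the sections lying locally in it.\<close>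

definition locally_in ::
  "('o, 'm) site \<Rightarrow> ('o, 'm, 'r, 'a) msheaf \<Rightarrow> ('o \<Rightarrow> 'a set) \<Rightarrow> 'o \<Rightarrow> 'a set" where
  "locally_in T M A U = {x \<in> sects M U. \<exists>S\<in>cov T U. \<forall>f\<in>S. res M f x \<in> A (src T f)}"

definition sheaf_image ::
  "('o, 'm) site \<Rightarrow> ('o, 'm, 'r, 'b) msheaf \<Rightarrow> ('o \<Rightarrow> 'a \<Rightarrow> 'b) \<Rightarrow> ('o \<Rightarrow> 'a set) \<Rightarrow> 'o \<Rightarrow> 'b set"
  where "sheaf_image T P h A = locally_in T P (\<lambda>U. h U ` A U)"

definition sheaf_sum ::
  "('o, 'm) site \<Rightarrow> ('o, 'm, 'r, 'a) msheaf \<Rightarrow> ('o \<Rightarrow> 'a set) \<Rightarrow> ('o \<Rightarrow> 'a set) \<Rightarrow> 'o \<Rightarrow> 'a set"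
  where "sheaf_sum T M A B = locally_in T M (\<lambda>U. A U <+>\<^bsub>sec M U\<^esub> B U)"

subsection \<open>Quotient sheaves\<close>

text \<open>
  The sheafification of the presheaf $U \mapsto M(U)/N(U)$, for a subsheaf $N$ of $M$. This
  presheaf is separated, so a section over $U$ of its sheafification is an equivalence class of
  matching families of cosets indexed by covering sieves of $U$, two families being equivalent
  if they agree on a common covering refinement. Each class has a unique largest representative,
  and this is the one used here: it is encoded as a function \<open>t\<close> assigning a coset to each
  arrow of its covering sieve and the empty set to all other arrows. With this encoding,
  for $N \subseteq M' \subseteq M$ the sections of $M'/N$ literally form a subset of those
  of $M/N$.
\<close>

definition quot_sects ::
  "('o, 'm) site \<Rightarrow> ('o, 'm, 'r, 'a) msheaf \<Rightarrow> ('o \<Rightarrow> 'a set) \<Rightarrow> 'o \<Rightarrow> ('m \<Rightarrow> 'a set) set" where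
  "quot_sects T M N U = {t.
     (\<forall>g. g \<notin> into T U \<longrightarrow> t g = {}) \<and>
     {g \<in> into T U. t g \<noteq> {}} \<in> cov T U \<and>
     (\<forall>g\<in>into T U. t g = {} \<or> (\<exists>x\<in>sects M (src T g). t g = N (src T g) +>\<^bsub>sec M (src T g)\<^esub> x)) \<and>
     (\<forall>g\<in>into T U. \<forall>h\<in>into T (src T g). \<forall>x\<in>t g. res M h x \<in> t (cmp T g h)) \<and>
     (\<forall>g\<in>into T U. \<forall>x\<in>sects M (src T g).
        (\<exists>S\<in>cov T (src T g). \<forall>h\<in>S. res M h x \<in> t (cmp T g h)) \<longrightarrow> x \<in> t g)}"

text \<open>The section of $M/N$ determined by a matching family of subsets \<open>P\<close>, each empty
  or contained in a single coset: all sections that locally lie in the cosets met by \<open>P\<close>.\<close>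

definition quot_gen ::
  "('o, 'm) site \<Rightarrow> ('o, 'm, 'r, 'a) msheaf \<Rightarrow> ('o \<Rightarrow> 'a set) \<Rightarrow> 'o \<Rightarrow> ('m \<Rightarrow> 'a set) \<Rightarrow> 'm \<Rightarrow> 'a set" where
  "quot_gen T M N U P = (\<lambda>g. if g \<in> into T U then
     {x \<in> sects M (src T g). \<exists>S\<in>cov T (src T g). \<forall>h\<in>S. \<exists>y\<in>P (cmp T g h).
        res M h x \<in> N (src T h) +>\<^bsub>sec M (src T h)\<^esub> y} else {})"

definition quot ::
  "('o, 'm) site \<Rightarrow> ('o, 'm, 'r, 'a) msheaf \<Rightarrow> ('o \<Rightarrow> 'a set) \<Rightarrow> ('o, 'm, 'r, 'm \<Rightarrow> 'a set) msheaf" where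
  "quot T M N =
    \<lparr> sec = (\<lambda>U. \<lparr> carrier = quot_sects T M N U, mult = undefined, one = undefined,
        zero = (\<lambda>g. if g \<in> into T U then N (src T g) else {}),
        add = (\<lambda>t t'. quot_gen T M N U (\<lambda>g. t g <+>\<^bsub>sec M (src T g)\<^esub> t' g)),
        smult = (\<lambda>a t. quot_gen T M N U (\<lambda>g. (\<lambda>x. a \<odot>\<^bsub>sec M (src T g)\<^esub> x) ` t g)) \<rparr>),
      res = (\<lambda>f t g. if g \<in> into T (src T f) then t (cmp T f g) else {}) \<rparr>"

definition quot_proj ::
  "('o, 'm) site \<Rightarrow> ('o, 'm, 'r, 'a) msheaf \<Rightarrow> ('o \<Rightarrow> 'a set) \<Rightarrow> 'o \<Rightarrow> 'a \<Rightarrow> 'm \<Rightarrow> 'a set" where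
  "quot_proj T M N U x =
     (\<lambda>g. if g \<in> into T U then N (src T g) +>\<^bsub>sec M (src T g)\<^esub> res M g x else {})"

text \<open>The morphism $M/N \to P$ induced by a morphism $h : M \to P$ that kills $N$: the value
  at \<open>t\<close> is the section of \<open>P\<close> restricting to \<open>h x\<close> wherever \<open>x\<close> represents \<open>t\<close>.\<close>

definition induced ::
  "('o, 'm) site \<Rightarrow> ('o, 'm, 'r, 'b) msheaf \<Rightarrow> ('o \<Rightarrow> 'a \<Rightarrow> 'b) \<Rightarrow> 'o \<Rightarrow> ('m \<Rightarrow> 'a set) \<Rightarrow> 'b" where
  "induced T P h U t = (THE y. y \<in> sects P U \<and>
     (\<forall>g\<in>into T U. \<forall>x\<in>t g. res P g y = h (src T g) x))"

text \<open>The morphism $M/N \to M'/N'$ induced by a morphism $h : M \to M'$ mapping $N$ to $N'$.\<close>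

definition quot_map ::
  "('o, 'm) site \<Rightarrow> ('o, 'm, 'r, 'b) msheaf \<Rightarrow> ('o \<Rightarrow> 'b set) \<Rightarrow> ('o \<Rightarrow> 'a \<Rightarrow> 'b) \<Rightarrow>
     'o \<Rightarrow> ('m \<Rightarrow> 'a set) \<Rightarrow> 'm \<Rightarrow> 'b set" where
  "quot_map T M' N' h = induced T (quot T M' N') (\<lambda>U x. quot_proj T M' N' U (h U x))"


section \<open>The triple and its de Rham--Witt sheaves\<close>

record ('o, 'm, 'k, 'a) frob_triple =
  site_of :: "('o, 'm) site"
  Om :: "int \<Rightarrow> ('o, 'm, nat \<Rightarrow> 'k, 'a) msheaf"
  diff :: "int \<Rightarrow> 'o \<Rightarrow> 'a \<Rightarrow> 'a"
  phi :: "int \<Rightarrow> 'o \<Rightarrow> 'a \<Rightarrow> 'a"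
  Cinv :: "int \<Rightarrow> 'o \<Rightarrow> ('m \<Rightarrow> 'a set) \<Rightarrow> 'm \<Rightarrow> ('m \<Rightarrow> 'a set) set"

context
  fixes D :: "('o, 'm, 'k::field, 'a) frob_triple"
begin

abbreviation (input) "ST \<equiv> site_of D"

definition pmul :: "nat \<Rightarrow> int \<Rightarrow> 'o \<Rightarrow> 'a \<Rightarrow> 'a" where
  "pmul k i U x = add_pow (sec (Om D i) U) (CHAR('k) ^ k) x"

text \<open>$p^{-k}x$, for \<open>x\<close> a section of $p^k\Omega^i$ (where $\Omega^i$ is $p$-torsion-free).\<close>

definition pdiv :: "nat \<Rightarrow> int \<Rightarrow> 'o \<Rightarrow> 'a \<Rightarrow> 'a" where
  "pdiv k i U x = (THE y. y \<in> sects (Om D i) U \<and> pmul k i U y = x)"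

definition p_img :: "nat \<Rightarrow> int \<Rightarrow> ('o \<Rightarrow> 'a set) \<Rightarrow> 'o \<Rightarrow> 'a set" where
  "p_img k i A = sheaf_image ST (Om D i) (pmul k i) A"

text \<open>\<open>d_img i A\<close> is the subsheaf $dA$ of $\Omega^i$, for $A \subseteq \Omega^{i-1}$.\<close>

definition d_img :: "int \<Rightarrow> ('o \<Rightarrow> 'a set) \<Rightarrow> 'o \<Rightarrow> 'a set" where
  "d_img i A = sheaf_image ST (Om D i) (diff D (i - 1)) A"

definition pOm :: "nat \<Rightarrow> int \<Rightarrow> 'o \<Rightarrow> 'a set" where
  "pOm k i = p_img k i (sects (Om D i))"

subsection \<open>The complex modulo $p$ and its cohomology\<close>

definition Om1 :: "int \<Rightarrow> ('o, 'm, nat \<Rightarrow> 'k, 'm \<Rightarrow> 'a set) msheaf" where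
  "Om1 i = quot ST (Om D i) (pOm 1 i)"

definition red :: "int \<Rightarrow> 'o \<Rightarrow> 'a \<Rightarrow> 'm \<Rightarrow> 'a set" where
  "red i = quot_proj ST (Om D i) (pOm 1 i)"

definition diff1 :: "int \<Rightarrow> 'o \<Rightarrow> ('m \<Rightarrow> 'a set) \<Rightarrow> 'm \<Rightarrow> 'a set" where
  "diff1 i = quot_map ST (Om D (i + 1)) (pOm 1 (i + 1)) (diff D i)"

definition Ker1 :: "int \<Rightarrow> 'o \<Rightarrow> ('m \<Rightarrow> 'a set) set" where
  "Ker1 i U = {x \<in> sects (Om1 i) U. diff1 i U x = \<zero>\<^bsub>sec (Om1 (i + 1)) U\<^esub>}"

definition BOm1 :: "int \<Rightarrow> 'o \<Rightarrow> ('m \<Rightarrow> 'a set) set" where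
  "BOm1 i = sheaf_image ST (Om1 i) (diff1 (i - 1)) (sects (Om1 (i - 1)))"

definition H1 :: "int \<Rightarrow> ('o, 'm, nat \<Rightarrow> 'k, 'm \<Rightarrow> ('m \<Rightarrow> 'a set) set) msheaf" where
  "H1 i = quot ST (subsh (Om1 i) (Ker1 i)) (BOm1 i)"

definition cls1 :: "int \<Rightarrow> 'o \<Rightarrow> ('m \<Rightarrow> 'a set) \<Rightarrow> 'm \<Rightarrow> ('m \<Rightarrow> 'a set) set" where
  "cls1 i = quot_proj ST (subsh (Om1 i) (Ker1 i)) (BOm1 i)"

subsection \<open>The sheaves $\mathfrak W_n\Omega^i$ and their operators\<close>

definition Zsub :: "nat \<Rightarrow> int \<Rightarrow> 'o \<Rightarrow> 'a set" where
  "Zsub n i U = {x \<in> sects (Om D i) U. diff D i U x \<in> pOm n (i + 1) U}"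

definition Bsub :: "nat \<Rightarrow> int \<Rightarrow> 'o \<Rightarrow> 'a set" where
  "Bsub n i = sheaf_sum ST (Om D i) (pOm n i) (d_img i (sects (Om D (i - 1))))"

definition WOm :: "nat \<Rightarrow> int \<Rightarrow> ('o, 'm, nat \<Rightarrow> 'k, 'm \<Rightarrow> 'a set) msheaf" where
  "WOm n i = twist n (quot ST (subsh (Om D i) (Zsub n i)) (Bsub n i))"

definition WF :: "nat \<Rightarrow> int \<Rightarrow> 'o \<Rightarrow> ('m \<Rightarrow> 'a set) \<Rightarrow> 'm \<Rightarrow> 'a set" where
  "WF n i = quot_map ST (subsh (Om D i) (Zsub n i)) (Bsub n i) (\<lambda>U x. x)"

definition WV :: "nat \<Rightarrow> int \<Rightarrow> 'o \<Rightarrow> ('m \<Rightarrow> 'a set) \<Rightarrow> 'm \<Rightarrow> 'a set" where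
  "WV n i = quot_map ST (subsh (Om D i) (Zsub (Suc n) i)) (Bsub (Suc n) i) (pmul 1 i)"

definition Wd :: "nat \<Rightarrow> int \<Rightarrow> 'o \<Rightarrow> ('m \<Rightarrow> 'a set) \<Rightarrow> 'm \<Rightarrow> 'a set" where
  "Wd n i = quot_map ST (subsh (Om D (i + 1)) (Zsub n (i + 1))) (Bsub n (i + 1))
     (\<lambda>U x. pdiv n (i + 1) U (diff D i U x))"

text \<open>
  $p^{i+n}Z^i_1 + p^{i-1}dZ^{i-1}_1$. For $i = 0$ the second summand vanishes, since
  $\Omega^{-1} = 0$; the truncation \<open>nat (i - 1) = 0\<close> is then harmless.
\<close>

definition Nphi :: "nat \<Rightarrow> int \<Rightarrow> 'o \<Rightarrow> 'a set" where
  "Nphi n i = sheaf_sum ST (Om D i) (p_img (nat i + n) i (Zsub 1 i))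
     (p_img (nat (i - 1)) i (d_img i (Zsub 1 (i - 1))))"

text \<open>The three maps whose composite (the last one inverted) is \<open>R\<close>: multiplication by
  $p^i$, the projection from $p^iZ^i_{n+1}/p^iB^i_{n+1}$, and the isomorphism induced by
  \<open>phi\<close>.\<close>

definition R_mul :: "nat \<Rightarrow> int \<Rightarrow> 'o \<Rightarrow> ('m \<Rightarrow> 'a set) \<Rightarrow> 'm \<Rightarrow> 'a set" where
  "R_mul n i = quot_map ST (subsh (Om D i) (p_img (nat i) i (Zsub (Suc n) i)))
     (p_img (nat i) i (Bsub (Suc n) i)) (pmul (nat i) i)"

definition R_proj :: "nat \<Rightarrow> int \<Rightarrow> 'o \<Rightarrow> ('m \<Rightarrow> 'a set) \<Rightarrow> 'm \<Rightarrow> 'a set" where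
  "R_proj n i = quot_map ST (subsh (Om D i) (p_img (nat i) i (Zsub (Suc n) i))) (Nphi n i) (\<lambda>U x. x)"

definition R_phi :: "nat \<Rightarrow> int \<Rightarrow> 'o \<Rightarrow> ('m \<Rightarrow> 'a set) \<Rightarrow> 'm \<Rightarrow> 'a set" where
  "R_phi n i = quot_map ST (subsh (Om D i) (p_img (nat i) i (Zsub (Suc n) i))) (Nphi n i) (phi D i)"

definition WR :: "nat \<Rightarrow> int \<Rightarrow> 'o \<Rightarrow> ('m \<Rightarrow> 'a set) \<Rightarrow> 'm \<Rightarrow> 'a set" where
  "WR n i U t = the_inv_into (sects (WOm n i) U) (R_phi n i U) (R_proj n i U (R_mul n i U t))"

text \<open>$F^m : \mathfrak W_{m+1}\Omega^i \to \mathfrak W_1\Omega^i$\<close>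

primrec WF_iter :: "nat \<Rightarrow> int \<Rightarrow> 'o \<Rightarrow> ('m \<Rightarrow> 'a set) \<Rightarrow> 'm \<Rightarrow> 'a set" where
  "WF_iter 0 i U t = t"
| "WF_iter (Suc m) i U t = WF_iter m i U (WF (Suc m) i U t)"

subsection \<open>The sheaves $Z_n\mathfrak W_1\Omega^i$ and $B_n\mathfrak W_1\Omega^i$\<close>

text \<open>
  The common inductive step defining $Z_n\Omega^i_1$ and $B_n\Omega^i_1$: the subsheaf of
  $\mathrm{Ker}(d)$ that contains $B\Omega^i_1$ and whose quotient by $B\Omega^i_1$ is the image
  of \<open>A\<close> under $C^{-1}$.
\<close>

definition Cinv_step :: "int \<Rightarrow> ('o \<Rightarrow> ('m \<Rightarrow> 'a set) set) \<Rightarrow> 'o \<Rightarrow> ('m \<Rightarrow> 'a set) set" where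
  "Cinv_step i A U = {x \<in> Ker1 i U. cls1 i U x \<in> Cinv D i U ` A U}"

primrec ZOm1 :: "nat \<Rightarrow> int \<Rightarrow> 'o \<Rightarrow> ('m \<Rightarrow> 'a set) set" where
  "ZOm1 0 i = sects (Om1 i)"
| "ZOm1 (Suc n) i = Cinv_step i (ZOm1 n i)"

primrec BnOm1 :: "nat \<Rightarrow> int \<Rightarrow> 'o \<Rightarrow> ('m \<Rightarrow> 'a set) set" where
  "BnOm1 0 i = (\<lambda>U. {\<zero>\<^bsub>sec (Om1 i) U\<^esub>})"
| "BnOm1 (Suc n) i = Cinv_step i (BnOm1 n i)"

definition ZW :: "nat \<Rightarrow> int \<Rightarrow> ('o, 'm, nat \<Rightarrow> 'k, 'm \<Rightarrow> ('m \<Rightarrow> 'a set) set) msheaf" where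
  "ZW n i = twist (Suc n) (quot ST (subsh (Om1 i) (ZOm1 (Suc n) i)) (BOm1 i))"

definition BW :: "nat \<Rightarrow> int \<Rightarrow> ('o, 'm, nat \<Rightarrow> 'k, 'm \<Rightarrow> ('m \<Rightarrow> 'a set) set) msheaf" where
  "BW n i = twist (Suc n) (quot ST (subsh (Om1 i) (BnOm1 (Suc n) i)) (BOm1 i))"

text \<open>
  \<open>C\<close> for the filtration \<open>X\<close> (either \<open>ZOm1\<close> or \<open>BnOm1\<close>): the projection
  $X_{n+1}/B\Omega^i_1 \to X_{n+1}/B_2\Omega^i_1$ followed by the inverse of the isomorphism
  $X_n/B\Omega^i_1 \to X_{n+1}/B_2\Omega^i_1$ induced by $C^{-1}$.
\<close>

definition C_proj :: "(nat \<Rightarrow> int \<Rightarrow> 'o \<Rightarrow> ('m \<Rightarrow> 'a set) set) \<Rightarrow> nat \<Rightarrow> int \<Rightarrow>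
    'o \<Rightarrow> ('m \<Rightarrow> ('m \<Rightarrow> 'a set) set) \<Rightarrow> 'm \<Rightarrow> ('m \<Rightarrow> 'a set) set" where
  "C_proj X n i = quot_map ST (subsh (Om1 i) (X (Suc n) i)) (BnOm1 2 i) (\<lambda>U x. x)"

definition C_inv :: "(nat \<Rightarrow> int \<Rightarrow> 'o \<Rightarrow> ('m \<Rightarrow> 'a set) set) \<Rightarrow> nat \<Rightarrow> int \<Rightarrow>
    'o \<Rightarrow> ('m \<Rightarrow> ('m \<Rightarrow> 'a set) set) \<Rightarrow> 'm \<Rightarrow> ('m \<Rightarrow> 'a set) set" where
  "C_inv X n i = induced ST (quot ST (subsh (Om1 i) (X (Suc n) i)) (BnOm1 2 i))
     (\<lambda>U x. C_proj X n i U (Cinv D i U x))"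

definition C_op :: "(nat \<Rightarrow> int \<Rightarrow> 'o \<Rightarrow> ('m \<Rightarrow> 'a set) set) \<Rightarrow> nat \<Rightarrow> int \<Rightarrow>
    'o \<Rightarrow> ('m \<Rightarrow> ('m \<Rightarrow> 'a set) set) \<Rightarrow> 'm \<Rightarrow> ('m \<Rightarrow> 'a set) set" where
  "C_op X n i U t = the_inv_into (sects (quot ST (subsh (Om1 i) (X n i)) (BOm1 i)) U)
     (C_inv X n i U) (C_proj X n i U t)"

definition CZ :: "nat \<Rightarrow> int \<Rightarrow> 'o \<Rightarrow> ('m \<Rightarrow> ('m \<Rightarrow> 'a set) set) \<Rightarrow> 'm \<Rightarrow> ('m \<Rightarrow> 'a set) set" where
  "CZ = C_op ZOm1"

definition CB :: "nat \<Rightarrow> int \<Rightarrow> 'o \<Rightarrow> ('m \<Rightarrow> ('m \<Rightarrow> 'a set) set) \<Rightarrow> 'm \<Rightarrow> ('m \<Rightarrow> 'a set) set" where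
  "CB = C_op BnOm1"

text \<open>The identification $\mathfrak W_1\Omega^i = \sigma_*\mathcal H^i(\Omega^\bullet_1)$ is
  induced by reduction modulo $p$. The operators $F^n$ and $F^{n-1}d$ with values in
  $\mathfrak W_1\Omega^i$ are composed with it: \<open>WFn n\<close> is $F^n$ on
  $\mathfrak W_{n+1}\Omega^i$ and \<open>WFd n\<close> is $F^{n-1}d$ on $\mathfrak W_n\Omega^i$.\<close>

definition W1_ident :: "int \<Rightarrow> 'o \<Rightarrow> ('m \<Rightarrow> 'a set) \<Rightarrow> 'm \<Rightarrow> ('m \<Rightarrow> 'a set) set" where
  "W1_ident i = quot_map ST (subsh (Om1 i) (Ker1 i)) (BOm1 i) (red i)"

definition WFn :: "nat \<Rightarrow> int \<Rightarrow> 'o \<Rightarrow> ('m \<Rightarrow> 'a set) \<Rightarrow> 'm \<Rightarrow> ('m \<Rightarrow> 'a set) set" where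
  "WFn n i U t = W1_ident i U (WF_iter n i U t)"

definition WFd :: "nat \<Rightarrow> int \<Rightarrow> 'o \<Rightarrow> ('m \<Rightarrow> 'a set) \<Rightarrow> 'm \<Rightarrow> ('m \<Rightarrow> 'a set) set" where
  "WFd n i U t = WFn (n - 1) (i + 1) U (Wd n i U t)"

subsection \<open>Standing assumptions\<close>

text \<open>The canonical map $\Omega^i \to \varprojlim_n \Omega^i/p^n\Omega^i$ is an isomorphism.\<close>

definition p_complete :: "int \<Rightarrow> bool" where
  "p_complete i \<longleftrightarrow> (\<forall>U\<in>ob ST. bij_betw (\<lambda>x n. quot_proj ST (Om D i) (pOm n i) U x) (sects (Om D i) U)
     {s. \<forall>n. s n \<in> sects (quot ST (Om D i) (pOm n i)) U \<and>
         quot_map ST (Om D i) (pOm n i) (\<lambda>V x. x) U (s (Suc n)) = s n})"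

end

locale dR_triple =
  fixes D :: "('o, 'm, 'k::field, 'a) frob_triple"
  assumes site: "grothendieck_site (site_of D)"
    and Om_sheaf: "sheaf_of_modules (site_of D) witt_ring (Om D i)"
    and diff_hom: "sheaf_mod_hom (site_of D) (Om D i) (Om D (i + 1)) (diff D i)"
    and diff_diff: "\<lbrakk>U \<in> ob (site_of D); x \<in> sects (Om D i) U\<rbrakk> \<Longrightarrow>
      diff D (i + 1) U (diff D i U x) = \<zero>\<^bsub>sec (Om D (i + 1 + 1)) U\<^esub>"
    and bounded: "\<exists>a b. \<forall>i U. U \<in> ob (site_of D) \<and> (i < a \<or> b < i) \<longrightarrow>
      sects (Om D i) U = {\<zero>\<^bsub>sec (Om D i) U\<^esub>}"
    and torsion_free: "\<lbrakk>U \<in> ob (site_of D); x \<in> sects (Om D i) U;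
        w \<odot>\<^bsub>sec (Om D i) U\<^esub> x = \<zero>\<^bsub>sec (Om D i) U\<^esub>\<rbrakk> \<Longrightarrow>
      w = \<zero>\<^bsub>witt_ring\<^esub> \<or> x = \<zero>\<^bsub>sec (Om D i) U\<^esub>"
    and phi_hom: "sheaf_mod_hom (site_of D) (Om D i) (twist 1 (Om D i)) (phi D i)"
    and phi_diff: "\<lbrakk>U \<in> ob (site_of D); x \<in> sects (Om D i) U\<rbrakk> \<Longrightarrow>
      phi D (i + 1) U (diff D i U x) = diff D i U (phi D i U x)"
    and cond_i: "\<lbrakk>i < 0; U \<in> ob (site_of D)\<rbrakk> \<Longrightarrow> sects (Om D i) U = {\<zero>\<^bsub>sec (Om D i) U\<^esub>}"
    and cond_ii_torsion: "\<lbrakk>U \<in> ob (site_of D); x \<in> sects (Om D i) U;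
        pmul D 1 i U x = \<zero>\<^bsub>sec (Om D i) U\<^esub>\<rbrakk> \<Longrightarrow> x = \<zero>\<^bsub>sec (Om D i) U\<^esub>"
    and cond_ii_complete: "p_complete D i"
    and cond_iii: "\<lbrakk>U \<in> ob (site_of D); x \<in> sects (Om D i) U\<rbrakk> \<Longrightarrow>
      phi D i U x \<in> pOm D (nat i) i U \<and>
      diff D i U (phi D i U x) \<in> pOm D (nat (i + 1)) (i + 1) U"
    and cond_iv: "sheaf_mod_iso (site_of D) (kmod (Om1 D i)) (kmod (twist 1 (H1 D i))) (Cinv D i)"
    and cond_v: "\<lbrakk>U \<in> ob (site_of D); x \<in> sects (Om D i) U\<rbrakk> \<Longrightarrow>
      red D i U (pdiv D (nat i) i U (phi D i U x)) \<in> Ker1 D i U \<and>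
      cls1 D i U (red D i U (pdiv D (nat i) i U (phi D i U x))) = Cinv D i U (red D i U x)"

end

theory Submission
  imports Defs
begin

text \<open>
  Put $\psi = p^{-i}\phi$ on $\Omega^i$, so that $d\psi = p\psi d$ and $\psi$ lifts $C^{-1}$. Bijectivity of
  $C^{-1}$ gives, locally and by induction on $n$,
  $Z_{n+1} = \psi(Z_n) + p^{n+1}\Omega^i + d\Omega^{i-1}$, and $\psi(y) \in B_{n+1}$ only if $y \in pB_n$. Hence
  $\phi$ induces the isomorphism defining $R$, and $R$ is determined by
  $R[\psi(y) + b] = [y]$ for $y \in Z_n$, $b \in B_{n+1}$. It also follows that $Z_n\Omega^i_1$ and
  $B_{n+1}\Omega^{i+1}_1$ are the reductions modulo $p$ of $Z_n$ and $p^{-n}dZ_n$, on whose quotients $C$ is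
  $[\psi(y) + b] \mapsto [y]$, respectively $[p^{-n-1}d\psi(y)] \mapsto [p^{-n}dy]$; this gives (2) and (4).
  Assertions (1) and (3) are then the computations of the kernels: if $x = pu + dw$ lies in $Z_{n+1}$ then
  $u \in Z_n$, and if $p^{-n}dx = pu + dw$ then $x - p^nw \in Z_{n+1}$.
\<close>

section \<open>Sites and the local modality\<close>

text \<open>In a topos a section of a sum, an image or a quotient has representatives only on a
  cover. So every decomposition is a statement under \<open>loc\<close> ("true on some cover") and
  serves to prove things that are themselves local: membership in a subsheaf, equality of sections
  or of morphisms. Division by p is the exception: Omega is p-torsion-free, so p^k Omega needs no
  sheafification and a quotient by p^k is one global section. The relation d psi = p psi d arises
  because phi is p^i psi in degree i but p^(i+1) psi in degree i + 1. Its factor p is why psi raises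
  the level of Z_n by one and R lowers it. Surjectivity of C^{-1} gives the case n = 0 of the
  decomposition of Z_{n+1}, injectivity gives the induction step. The known facts quoted with the
  definitions (the isomorphism induced by phi, the descriptions of Z_n and B_n modulo p) are derived
  here from this decomposition, because R and C are defined through \<open>the_inv_into\<close>,
  which carries information only for bijective maps.\<close>

definition loc :: "('o, 'm) site \<Rightarrow> 'o \<Rightarrow> ('m \<Rightarrow> bool) \<Rightarrow> bool" where
  "loc T U \<Phi> \<longleftrightarrow> (\<exists>S\<in>cov T U. \<forall>f\<in>S. \<Phi> f)"

context grothendieck_site
begin

lemma intoD:
  assumes "f \<in> into T U"
  shows "f \<in> ar T" "tgt T f = U" "src T f \<in> ob T" "U \<in> ob T"
  using assms src_ob tgt_ob by (auto simp: into_def)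

lemma into_self: "f \<in> ar T \<Longrightarrow> f \<in> into T (tgt T f)"
  by (simp add: into_def)

lemma idn_into: "U \<in> ob T \<Longrightarrow> idn T U \<in> into T U"
  using idn_ar by (simp add: into_def)

lemma src_idn: "U \<in> ob T \<Longrightarrow> src T (idn T U) = U"
  using idn_ar by simp

lemma cmp_into: "\<lbrakk>f \<in> into T U; g \<in> into T (src T f)\<rbrakk> \<Longrightarrow> cmp T f g \<in> into T U"
  using cmp_ar by (auto simp: into_def)

lemma src_cmp: "\<lbrakk>f \<in> into T U; g \<in> into T (src T f)\<rbrakk> \<Longrightarrow> src T (cmp T f g) = src T g"
  using cmp_ar by (auto simp: into_def)

lemma cmp_assoc': "\<lbrakk>f \<in> into T U; g \<in> into T (src T f); h \<in> into T (src T g)\<rbrakk>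
    \<Longrightarrow> cmp T (cmp T f g) h = cmp T f (cmp T g h)"
  using cmp_assoc by (auto simp: into_def)

lemma cmp_idn: "f \<in> into T U \<Longrightarrow> cmp T f (idn T (src T f)) = f"
  using idn_right by (auto simp: into_def)

lemma idn_cmp: "f \<in> into T U \<Longrightarrow> cmp T (idn T U) f = f"
  using idn_left by (auto simp: into_def)

lemma cov_into: "\<lbrakk>U \<in> ob T; S \<in> cov T U; f \<in> S\<rbrakk> \<Longrightarrow> f \<in> into T U"
  using cov_sieve by (auto simp: sieve_def)

lemma cov_cmp: "\<lbrakk>U \<in> ob T; S \<in> cov T U; f \<in> S; g \<in> into T (src T f)\<rbrakk> \<Longrightarrow> cmp T f g \<in> S"
  using cov_sieve by (auto simp: sieve_def)

lemma cov_pullback: "\<lbrakk>S \<in> cov T U; f \<in> into T U\<rbrakk> \<Longrightarrow> pullback_sieve T f S \<in> cov T (src T f)"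
  using cov_stable by (auto simp: into_def)

text \<open>Over an arrow of \<open>S\<close> the larger sieve pulls back to the maximal sieve, so
  transitivity of the topology applies.\<close>

lemma cov_mono:
  assumes U: "U \<in> ob T" and S: "S \<in> cov T U" and S': "sieve T U S'" and sub: "S \<subseteq> S'"
  shows "S' \<in> cov T U"
proof (rule cov_trans[OF U S S'], intro ballI)
  fix f assume f: "f \<in> S"
  have "pullback_sieve T f S' = into T (src T f)"
    using f sub S' by (auto simp: pullback_sieve_def sieve_def)
  then show "pullback_sieve T f S' \<in> cov T (src T f)"
    using cov_max intoD(3)[OF cov_into[OF U S f]] by simp
qed

text \<open>Along an arrow of \<open>S\<close> the intersection has the same pullback as
  \<open>S'\<close>, and this covers by stability.\<close>

lemma cov_inter:
  assumes U: "U \<in> ob T" and S: "S \<in> cov T U" and S': "S' \<in> cov T U"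
  shows "S \<inter> S' \<in> cov T U"
proof (rule cov_trans[OF U S])
  show "sieve T U (S \<inter> S')"
    using cov_sieve[OF U S] cov_sieve[OF U S'] by (auto simp: sieve_def)
  show "\<forall>f\<in>S. pullback_sieve T f (S \<inter> S') \<in> cov T (src T f)"
  proof
    fix f assume f: "f \<in> S"
    have "pullback_sieve T f (S \<inter> S') = pullback_sieve T f S'"
      using cov_cmp[OF U S f] by (auto simp: pullback_sieve_def)
    then show "pullback_sieve T f (S \<inter> S') \<in> cov T (src T f)"
      using cov_pullback[OF S' cov_into[OF U S f]] by simp
  qed
qed

section \<open>Calculus of properties that hold on a cover\<close>

lemma loc_mono:
  assumes "loc T U \<Phi>" "U \<in> ob T" "\<And>f. \<lbrakk>f \<in> into T U; \<Phi> f\<rbrakk> \<Longrightarrow> \<Psi> f"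
  shows "loc T U \<Psi>"
  using assms cov_into unfolding loc_def by metis

lemma loc_all:
  assumes "U \<in> ob T" "\<And>f. f \<in> into T U \<Longrightarrow> \<Phi> f"
  shows "loc T U \<Phi>"
  using assms cov_max unfolding loc_def by blast

lemma loc_conj:
  assumes "loc T U \<Phi>" "loc T U \<Psi>" "U \<in> ob T"
  shows "loc T U (\<lambda>f. \<Phi> f \<and> \<Psi> f)"
proof -
  obtain S S' where "S \<in> cov T U" "\<forall>f\<in>S. \<Phi> f" "S' \<in> cov T U" "\<forall>f\<in>S'. \<Psi> f"
    using assms(1,2) unfolding loc_def by blast
  then show ?thesis
    unfolding loc_def using cov_inter[OF assms(3)] by (intro bexI[of _ "S \<inter> S'"]) auto
qed

lemma loc_pullback:
  assumes "loc T U \<Phi>" "f \<in> into T U"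
  shows "loc T (src T f) (\<lambda>g. \<Phi> (cmp T f g))"
proof -
  obtain S where S: "S \<in> cov T U" "\<forall>f\<in>S. \<Phi> f"
    using assms(1) unfolding loc_def by blast
  show ?thesis
    unfolding loc_def using cov_pullback[OF S(1) assms(2)] S(2)
    by (intro bexI[of _ "pullback_sieve T f S"]) (auto simp: pullback_sieve_def)
qed

text \<open>Covers chosen over the members of a first cover compose to one cover of
  \<open>U\<close>. Nested local choices are flattened by this rule.\<close>

lemma loc_trans:
  assumes U: "U \<in> ob T" and "loc T U \<Phi>"
    and step: "\<And>f. \<lbrakk>f \<in> into T U; \<Phi> f\<rbrakk> \<Longrightarrow> loc T (src T f) (\<lambda>g. \<Psi> (cmp T f g))"
  shows "loc T U \<Psi>"
proof -
  obtain S where S: "S \<in> cov T U" "\<forall>f\<in>S. \<Phi> f"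
    using assms(2) unfolding loc_def by blast
  have "\<forall>f\<in>S. \<exists>S'\<in>cov T (src T f). \<forall>g\<in>S'. \<Psi> (cmp T f g)"
    using step S cov_into[OF U S(1)] unfolding loc_def by blast
  then obtain R where R: "\<And>f. f \<in> S \<Longrightarrow> R f \<in> cov T (src T f)"
    and R': "\<And>f g. \<lbrakk>f \<in> S; g \<in> R f\<rbrakk> \<Longrightarrow> \<Psi> (cmp T f g)"
    by metis
  \<comment> \<open>All composites of a member of the cover with a member of its chosen refinement.
    They form a sieve because each \<open>R f\<close> is one, and the pullback along
    \<open>f\<close> contains \<open>R f\<close>, so the sieve covers.\<close>
  define S' where "S' = {cmp T f g | f g. f \<in> S \<and> g \<in> R f}"
  have fin: "f \<in> into T U" if "f \<in> S" for f
    using cov_into[OF U S(1) that] .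
  have gin: "g \<in> into T (src T f)" if "f \<in> S" "g \<in> R f" for f g
    using cov_into[OF intoD(3)[OF fin[OF that(1)]] R[OF that(1)] that(2)] .
  have sv: "sieve T U S'"
    unfolding sieve_def
  proof (intro conjI subsetI ballI)
    fix x assume "x \<in> S'"
    then show "x \<in> into T U"
      using cmp_into fin gin unfolding S'_def by blast
  next
    fix x h assume "x \<in> S'" and h: "h \<in> into T (src T x)"
    then obtain f g where fg: "f \<in> S" "g \<in> R f" "x = cmp T f g"
      unfolding S'_def by blast
    have h': "h \<in> into T (src T g)"
      using h src_cmp[OF fin[OF fg(1)] gin[OF fg(1,2)]] fg(3) by simp
    have "cmp T g h \<in> R f"
      using cov_cmp[OF intoD(3)[OF fin[OF fg(1)]] R[OF fg(1)] fg(2) h'] .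
    then show "cmp T x h \<in> S'"
      using cmp_assoc'[OF fin[OF fg(1)] gin[OF fg(1,2)] h'] fg unfolding S'_def by auto
  qed
  have "S' \<in> cov T U"
  proof (rule cov_trans[OF U S(1) sv], intro ballI)
    fix f assume f: "f \<in> S"
    have "pullback_sieve T f S' \<supseteq> R f"
      using gin[OF f] f by (auto simp: pullback_sieve_def S'_def)
    moreover have "sieve T (src T f) (pullback_sieve T f S')"
      unfolding sieve_def pullback_sieve_def
    proof (intro conjI subsetI ballI)
      fix g h assume g: "g \<in> {g \<in> into T (src T f). cmp T f g \<in> S'}" and h: "h \<in> into T (src T g)"
      then show "cmp T g h \<in> {g \<in> into T (src T f). cmp T f g \<in> S'}"
        using sv cmp_into src_cmp[OF fin[OF f], of g] cmp_assoc'[OF fin[OF f] _ h]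
        unfolding sieve_def by (metis (no_types, lifting) mem_Collect_eq)
    qed auto
    ultimately show "pullback_sieve T f S' \<in> cov T (src T f)"
      using cov_mono[OF intoD(3)[OF fin[OF f]] R[OF f]] by blast
  qed
  then show ?thesis
    unfolding loc_def using R' by (intro bexI[of _ S']) (auto simp: S'_def)
qed

end

section \<open>Sheaves of abelian groups\<close>

text \<open>Scalars are left out, so that one theory serves Omega^i, its subsheaves, quotients and
  twists, whose scalar actions differ. Linearity is treated separately in the section on
  scalars.\<close>

locale ab_sheaf =
  fixes T :: "('o, 'm) site" and M :: "('o, 'm, 'r, 'a) msheaf"
  assumes grp: "U \<in> ob T \<Longrightarrow> abelian_group (sec M U)"
    and res_closed: "\<lbrakk>f \<in> into T U; x \<in> sects M U\<rbrakk> \<Longrightarrow> res M f x \<in> sects M (src T f)"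
    and res_plus: "\<lbrakk>f \<in> into T U; x \<in> sects M U; y \<in> sects M U\<rbrakk> \<Longrightarrow>
      res M f (x \<oplus>\<^bsub>sec M U\<^esub> y) = res M f x \<oplus>\<^bsub>sec M (src T f)\<^esub> res M f y"
    and res_id: "\<lbrakk>U \<in> ob T; x \<in> sects M U\<rbrakk> \<Longrightarrow> res M (idn T U) x = x"
    and res_comp: "\<lbrakk>f \<in> into T U; g \<in> into T (src T f); x \<in> sects M U\<rbrakk> \<Longrightarrow>
      res M (cmp T f g) x = res M g (res M f x)"
    and glue: "\<lbrakk>U \<in> ob T; S \<in> cov T U; \<forall>f\<in>S. s f \<in> sects M (src T f);
        \<forall>f\<in>S. \<forall>g\<in>into T (src T f). res M g (s f) = s (cmp T f g)\<rbrakk> \<Longrightarrow>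
      \<exists>!x. x \<in> sects M U \<and> (\<forall>f\<in>S. res M f x = s f)"

lemma sheaf_of_modules_imp_ab_sheaf:
  assumes "grothendieck_site T" "sheaf_of_modules T R M"
  shows "ab_sheaf T M"
proof -
  interpret grothendieck_site T by fact
  interpret sheaf_of_modules T R M by fact
  show ?thesis
  proof (rule ab_sheaf.intro)
    show "abelian_group (sec M U)" if "U \<in> ob T" for U
      using sec_module[OF that] by (simp add: module_def)
    show "res M f x \<in> sects M (src T f)" if "f \<in> into T U" "x \<in> sects M U" for f U x
      using res_add[of f] that by (auto simp: into_def hom_def)
    show "res M f (x \<oplus>\<^bsub>sec M U\<^esub> y) = res M f x \<oplus>\<^bsub>sec M (src T f)\<^esub> res M f y"
      if "f \<in> into T U" "x \<in> sects M U" "y \<in> sects M U" for f U x y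
      using res_add[of f] that by (auto simp: into_def hom_def)
  qed (use res_idn res_cmp gluing in \<open>auto simp: into_def\<close>)
qed

text \<open>The last clause makes membership local. It turns a presheaf of subgroups into a
  subsheaf, and it is the rule by which local decompositions yield membership over all of
  \<open>U\<close>.\<close>

definition subsheaf ::
  "('o, 'm) site \<Rightarrow> ('o, 'm, 'r, 'a) msheaf \<Rightarrow> ('o \<Rightarrow> 'a set) \<Rightarrow> bool" where
  "subsheaf T M A \<longleftrightarrow>
     (\<forall>U\<in>ob T. A U \<subseteq> sects M U \<and> \<zero>\<^bsub>sec M U\<^esub> \<in> A U \<and>
        (\<forall>x\<in>A U. \<forall>y\<in>A U. x \<oplus>\<^bsub>sec M U\<^esub> y \<in> A U) \<and> (\<forall>x\<in>A U. \<ominus>\<^bsub>sec M U\<^esub> x \<in> A U)) \<and>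
     (\<forall>U. \<forall>f\<in>into T U. \<forall>x\<in>A U. res M f x \<in> A (src T f)) \<and>
     (\<forall>U\<in>ob T. \<forall>x\<in>sects M U. loc T U (\<lambda>f. res M f x \<in> A (src T f)) \<longrightarrow> x \<in> A U)"

lemma subsheafD:
  assumes "subsheaf T M A"
  shows subsheaf_in: "\<lbrakk>U \<in> ob T; x \<in> A U\<rbrakk> \<Longrightarrow> x \<in> sects M U"
    and subsheaf_zero: "U \<in> ob T \<Longrightarrow> \<zero>\<^bsub>sec M U\<^esub> \<in> A U"
    and subsheaf_add: "\<lbrakk>U \<in> ob T; x \<in> A U; y \<in> A U\<rbrakk> \<Longrightarrow> x \<oplus>\<^bsub>sec M U\<^esub> y \<in> A U"
    and subsheaf_neg: "\<lbrakk>U \<in> ob T; x \<in> A U\<rbrakk> \<Longrightarrow> \<ominus>\<^bsub>sec M U\<^esub> x \<in> A U"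
    and subsheaf_res: "\<lbrakk>f \<in> into T U; x \<in> A U\<rbrakk> \<Longrightarrow> res M f x \<in> A (src T f)"
    and subsheaf_loc: "\<lbrakk>U \<in> ob T; x \<in> sects M U; loc T U (\<lambda>f. res M f x \<in> A (src T f))\<rbrakk> \<Longrightarrow> x \<in> A U"
  using assms unfolding subsheaf_def by blast+

lemma subsheaf_minus:
  assumes "subsheaf T M A" "U \<in> ob T" "x \<in> A U" "y \<in> A U"
  shows "x \<ominus>\<^bsub>sec M U\<^esub> y \<in> A U"
  unfolding a_minus_def
  by (rule subsheaf_add[OF assms(1-3) subsheaf_neg[OF assms(1,2,4)]])

lemma (in abelian_group) add_minus_cancel:
  assumes "x \<in> carrier G" "y \<in> carrier G"
  shows "(x \<oplus> y) \<ominus> y = x" "(x \<ominus> y) \<oplus> y = x" "(x \<ominus> y = \<zero>) \<longleftrightarrow> x = y"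
proof -
  show "(x \<oplus> y) \<ominus> y = x"
    unfolding minus_eq using assms by (subst a_assoc) (auto simp: r_neg)
  show *: "(x \<ominus> y) \<oplus> y = x"
    unfolding minus_eq using assms by (subst a_assoc) (auto simp: l_neg)
  show "(x \<ominus> y = \<zero>) \<longleftrightarrow> x = y"
    using * l_zero[OF assms(2)] r_neg[OF assms(2)] minus_eq[of y y] by auto
qed

context grothendieck_site
begin

text \<open>This is the uniqueness half of gluing, applied to the family of restrictions of
  \<open>x\<close>.\<close>

lemma sheaf_eqI:
  assumes M: "ab_sheaf T M" and U: "U \<in> ob T" and x: "x \<in> sects M U" and y: "y \<in> sects M U"
    and l: "loc T U (\<lambda>f. res M f x = res M f y)"
  shows "x = y"
proof -
  interpret M: ab_sheaf T M by fact
  obtain S where S: "S \<in> cov T U" "\<forall>f\<in>S. res M f x = res M f y"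
    using l unfolding loc_def by blast
  have "\<exists>!z. z \<in> sects M U \<and> (\<forall>f\<in>S. res M f z = res M f x)"
    using M.res_closed[OF cov_into[OF U S(1)] x] M.res_comp[OF cov_into[OF U S(1)] _ x]
    by (intro M.glue[OF U S(1)]) auto
  then show ?thesis
    using x y S(2) by metis
qed

lemma res_zero:
  assumes M: "ab_sheaf T M" and f: "f \<in> into T U"
  shows "res M f \<zero>\<^bsub>sec M U\<^esub> = \<zero>\<^bsub>sec M (src T f)\<^esub>"
proof -
  interpret M: ab_sheaf T M by fact
  interpret A: abelian_group "sec M U" using M.grp intoD[OF f] by simp
  interpret B: abelian_group "sec M (src T f)" using M.grp intoD[OF f] by simp
  show ?thesis
    using M.res_plus[OF f A.zero_closed A.zero_closed] M.res_closed[OF f A.zero_closed]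
    by (metis A.l_zero A.zero_closed B.add.l_cancel_one')
qed

lemma res_neg:
  assumes M: "ab_sheaf T M" and f: "f \<in> into T U" and x: "x \<in> sects M U"
  shows "res M f (\<ominus>\<^bsub>sec M U\<^esub> x) = \<ominus>\<^bsub>sec M (src T f)\<^esub> res M f x"
proof -
  interpret M: ab_sheaf T M by fact
  interpret A: abelian_group "sec M U" using M.grp intoD[OF f] by simp
  interpret B: abelian_group "sec M (src T f)" using M.grp intoD[OF f] by simp
  show ?thesis
    using M.res_plus[OF f A.a_inv_closed[OF x] x] M.res_closed[OF f] x res_zero[OF M f]
    by (metis A.a_inv_closed A.l_neg B.minus_equality)
qed

lemma res_minus:
  assumes M: "ab_sheaf T M" and f: "f \<in> into T U" and x: "x \<in> sects M U" and y: "y \<in> sects M U"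
  shows "res M f (x \<ominus>\<^bsub>sec M U\<^esub> y) = res M f x \<ominus>\<^bsub>sec M (src T f)\<^esub> res M f y"
proof -
  interpret M: ab_sheaf T M by fact
  interpret A: abelian_group "sec M U" using M.grp intoD[OF f] by simp
  show ?thesis
    using M.res_plus[OF f x A.a_inv_closed[OF y]] res_neg[OF M f y] by (simp add: a_minus_def)
qed

lemma subsheaf_zero_sub:
  assumes M: "ab_sheaf T M"
  shows "subsheaf T M (\<lambda>U. {\<zero>\<^bsub>sec M U\<^esub>})"
proof -
  interpret M: ab_sheaf T M by fact
  show ?thesis
    unfolding subsheaf_def
  proof (intro conjI ballI allI impI)
    fix U x assume U: "U \<in> ob T" and x: "x \<in> sects M U"
      and l: "loc T U (\<lambda>f. res M f x \<in> {\<zero>\<^bsub>sec M (src T f)\<^esub>})"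
    interpret A: abelian_group "sec M U" using M.grp U by simp
    have "x = \<zero>\<^bsub>sec M U\<^esub>"
      using l by (intro sheaf_eqI[OF M U x A.zero_closed] loc_mono[OF l U]) (simp add: res_zero[OF M])
    then show "x \<in> {\<zero>\<^bsub>sec M U\<^esub>}" by simp
  next
    fix U assume U: "U \<in> ob T"
    interpret A: abelian_group "sec M U" using M.grp U by simp
    show "{\<zero>\<^bsub>sec M U\<^esub>} \<subseteq> sects M U" "\<zero>\<^bsub>sec M U\<^esub> \<in> {\<zero>\<^bsub>sec M U\<^esub>}" by auto
    show "\<ominus>\<^bsub>sec M U\<^esub> x \<in> {\<zero>\<^bsub>sec M U\<^esub>}" if "x \<in> {\<zero>\<^bsub>sec M U\<^esub>}" for x using that by simp
    show "x \<oplus>\<^bsub>sec M U\<^esub> y \<in> {\<zero>\<^bsub>sec M U\<^esub>}" if "x \<in> {\<zero>\<^bsub>sec M U\<^esub>}" "y \<in> {\<zero>\<^bsub>sec M U\<^esub>}" for x y using that by simp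
  qed (simp add: res_zero[OF M])
qed

text \<open>A matching family in \<open>A\<close> is glued in \<open>M\<close>; locality of
  membership then puts the glued section back into \<open>A\<close>.\<close>

lemma ab_sheaf_subsh:
  assumes M: "ab_sheaf T M" and A: "subsheaf T M A"
  shows "ab_sheaf T (subsh M A)"
proof -
  interpret M: ab_sheaf T M by fact
  have in_M: "x \<in> sects M U" if "U \<in> ob T" "x \<in> A U" for U x
    using subsheaf_in[OF A] that .
  show ?thesis
  proof (rule ab_sheaf.intro)
    fix U assume U: "U \<in> ob T"
    interpret G: abelian_group "sec M U" using M.grp U by simp
    show "abelian_group (sec (subsh M A) U)"
    proof (rule abelian_groupI)
      show "\<exists>y\<in>carrier (sec (subsh M A) U). y \<oplus>\<^bsub>sec (subsh M A) U\<^esub> x = \<zero>\<^bsub>sec (subsh M A) U\<^esub>"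
        if "x \<in> carrier (sec (subsh M A) U)" for x
        using subsheaf_neg[OF A U] in_M[OF U] G.l_neg that by (auto simp: subsh_def)
    qed (use in_M[OF U] subsheaf_add[OF A U] subsheaf_zero[OF A U] in \<open>auto simp: subsh_def G.a_ac\<close>)
  next
    fix U S s
    assume U: "U \<in> ob T" and S: "S \<in> cov T U" and s: "\<forall>f\<in>S. s f \<in> sects (subsh M A) (src T f)"
      and m: "\<forall>f\<in>S. \<forall>g\<in>into T (src T f). res (subsh M A) g (s f) = s (cmp T f g)"
    have s': "s f \<in> A (src T f)" if "f \<in> S" for f
      using s that by (simp add: subsh_def)
    have "\<exists>!x. x \<in> sects M U \<and> (\<forall>f\<in>S. res M f x = s f)"
      using m in_M[OF intoD(3)[OF cov_into[OF U S]] s'] by (intro M.glue[OF U S]) (auto simp: subsh_def)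
    moreover have "x \<in> A U" if "x \<in> sects M U" "\<forall>f\<in>S. res M f x = s f" for x
      using subsheaf_loc[OF A U that(1)] that(2) S s' unfolding loc_def by metis
    ultimately have "\<exists>!x. x \<in> A U \<and> (\<forall>f\<in>S. res M f x = s f)"
      using in_M[OF U] by metis
    then show "\<exists>!x. x \<in> sects (subsh M A) U \<and> (\<forall>f\<in>S. res (subsh M A) f x = s f)"
      by (simp add: subsh_def)
  next
    fix f U x assume f: "f \<in> into T U" and x: "x \<in> sects (subsh M A) U"
    note U = intoD(4)[OF f]
    have xM: "x \<in> sects M U" using in_M[OF U] x by (simp add: subsh_def)
    show "res (subsh M A) f x \<in> sects (subsh M A) (src T f)"
      using subsheaf_res[OF A f] x by (simp add: subsh_def)
    show "res (subsh M A) (cmp T f g) x = res (subsh M A) g (res (subsh M A) f x)"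
      if "g \<in> into T (src T f)" for g
      using M.res_comp[OF f that xM] by (simp add: subsh_def)
    show "res (subsh M A) f (x \<oplus>\<^bsub>sec (subsh M A) U\<^esub> y)
        = res (subsh M A) f x \<oplus>\<^bsub>sec (subsh M A) (src T f)\<^esub> res (subsh M A) f y"
      if "y \<in> sects (subsh M A) U" for y
      using M.res_plus[OF f xM] in_M[OF U] that by (simp add: subsh_def)
  qed (use M.res_id in_M in \<open>auto simp: subsh_def\<close>)
qed

end

lemma subsh_simps [simp]:
  "sects (subsh M A) U = A U" "res (subsh M A) = res M"
  "add (sec (subsh M A) U) = add (sec M U)" "zero (sec (subsh M A) U) = zero (sec M U)"
  "smult (sec (subsh M A) U) = smult (sec M U)"
  by (simp_all add: subsh_def)

lemma restrict_scalars_simps [simp]: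
  "sects (restrict_scalars j M) U = sects M U" "res (restrict_scalars j M) = res M"
  "add (sec (restrict_scalars j M) U) = add (sec M U)"
  "zero (sec (restrict_scalars j M) U) = zero (sec M U)"
  "smult (sec (restrict_scalars j M) U) a x = smult (sec M U) (j a) x"
  by (simp_all add: restrict_scalars_def)

lemma twist_simps [simp]:
  "sects (twist n M) U = sects M U" "res (twist n M) = res M"
  "add (sec (twist n M) U) = add (sec M U)" "zero (sec (twist n M) U) = zero (sec M U)"
  "smult (sec (twist n M) U) a x = smult (sec M U) ((witt_frob ^^ n) a) x"
  by (simp_all add: twist_def)

lemma kmod_simps [simp]:
  "sects (kmod M) U = sects M U" "res (kmod M) = res M"
  "add (sec (kmod M) U) = add (sec M U)" "zero (sec (kmod M) U) = zero (sec M U)"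
  "smult (sec (kmod M) U) a x = smult (sec M U) (teichmueller a) x"
  by (simp_all add: kmod_def)

section \<open>Quotient sheaves\<close>

locale quot_sheaf = grothendieck_site T + M: ab_sheaf T M
  for T :: "('o, 'm) site" and M :: "('o, 'm, 'r, 'a) msheaf" +
  fixes N :: "'o \<Rightarrow> 'a set"
  assumes N: "subsheaf T M N"
begin

lemma ab_M: "ab_sheaf T M"
  by (rule M.ab_sheaf_axioms)

text \<open>Congruence modulo \<open>N\<close>, with membership of both sections built in. The coset
  of \<open>x\<close> is then the set of all \<open>y\<close> with \<open>eqv V y x\<close>, and
  cosets can be handled by equational reasoning.\<close>

definition eqv :: "'o \<Rightarrow> 'a \<Rightarrow> 'a \<Rightarrow> bool" where
  "eqv V x y \<longleftrightarrow> x \<in> sects M V \<and> y \<in> sects M V \<and> x \<ominus>\<^bsub>sec M V\<^esub> y \<in> N V"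

lemma eqvD: "eqv V x y \<Longrightarrow> x \<in> sects M V" "eqv V x y \<Longrightarrow> y \<in> sects M V"
  by (auto simp: eqv_def)

lemma eqv_refl:
  assumes V: "V \<in> ob T" and x: "x \<in> sects M V"
  shows "eqv V x x"
proof -
  interpret G: abelian_group "sec M V" using M.grp[OF V] .
  show ?thesis
    using x subsheaf_zero[OF N V] G.add_minus_cancel(3)[OF x x] by (simp add: eqv_def)
qed

lemma eqv_sym:
  assumes V: "V \<in> ob T" and e: "eqv V x y"
  shows "eqv V y x"
proof -
  interpret G: abelian_group "sec M V" using M.grp[OF V] .
  note c = eqvD[OF e]
  have "y \<ominus>\<^bsub>sec M V\<^esub> x = \<ominus>\<^bsub>sec M V\<^esub> (x \<ominus>\<^bsub>sec M V\<^esub> y)"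
    using c by (simp add: G.minus_eq G.minus_add G.minus_minus G.a_ac)
  then show ?thesis
    using e c subsheaf_neg[OF N V] by (simp add: eqv_def)
qed

lemma eqv_trans:
  assumes V: "V \<in> ob T" and e: "eqv V x y" and e': "eqv V y z"
  shows "eqv V x z"
proof -
  interpret G: abelian_group "sec M V" using M.grp[OF V] .
  note c = eqvD[OF e] eqvD[OF e']
  have "x \<ominus>\<^bsub>sec M V\<^esub> z = ((x \<ominus>\<^bsub>sec M V\<^esub> y) \<oplus>\<^bsub>sec M V\<^esub> y) \<ominus>\<^bsub>sec M V\<^esub> z"
    using c by (simp add: G.add_minus_cancel)
  also have "\<dots> = (x \<ominus>\<^bsub>sec M V\<^esub> y) \<oplus>\<^bsub>sec M V\<^esub> (y \<ominus>\<^bsub>sec M V\<^esub> z)"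
    using c by (simp add: G.minus_eq G.a_assoc)
  finally show ?thesis
    using e e' subsheaf_add[OF N V] by (simp add: eqv_def)
qed

lemma eqv_add:
  assumes V: "V \<in> ob T" and e: "eqv V x y" and e': "eqv V x' y'"
  shows "eqv V (x \<oplus>\<^bsub>sec M V\<^esub> x') (y \<oplus>\<^bsub>sec M V\<^esub> y')"
proof -
  interpret G: abelian_group "sec M V" using M.grp[OF V] .
  note c = eqvD[OF e] eqvD[OF e']
  have "(x \<oplus>\<^bsub>sec M V\<^esub> x') \<ominus>\<^bsub>sec M V\<^esub> (y \<oplus>\<^bsub>sec M V\<^esub> y')
      = (x \<ominus>\<^bsub>sec M V\<^esub> y) \<oplus>\<^bsub>sec M V\<^esub> (x' \<ominus>\<^bsub>sec M V\<^esub> y')"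
    using c by (simp add: G.minus_eq G.minus_add G.a_ac)
  then show ?thesis
    using e e' subsheaf_add[OF N V] by (simp add: eqv_def)
qed

lemma eqv_res:
  assumes f: "f \<in> into T V" and e: "eqv V x y"
  shows "eqv (src T f) (res M f x) (res M f y)"
  using eqvD[OF e] e subsheaf_res[OF N f, of "x \<ominus>\<^bsub>sec M V\<^esub> y"] res_minus[OF ab_M f, of x y]
    M.res_closed[OF f] by (simp add: eqv_def)

lemma eqv_loc:
  assumes V: "V \<in> ob T" and "x \<in> sects M V" "y \<in> sects M V"
    and l: "loc T V (\<lambda>f. eqv (src T f) (res M f x) (res M f y))"
  shows "eqv V x y"
proof -
  interpret G: abelian_group "sec M V" using M.grp[OF V] .
  have "x \<ominus>\<^bsub>sec M V\<^esub> y \<in> N V"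
    using assms(2,3) by (intro subsheaf_loc[OF N V] loc_mono[OF l V])
      (auto simp: eqv_def res_minus[OF ab_M])
  then show ?thesis
    using assms by (simp add: eqv_def)
qed

lemma coset_eqv:
  assumes V: "V \<in> ob T" and x: "x \<in> sects M V"
  shows "N V +>\<^bsub>sec M V\<^esub> x = {y. eqv V y x}"
proof -
  interpret G: abelian_group "sec M V" using M.grp[OF V] .
  show ?thesis
  proof (rule Set.set_eqI, rule iffI)
    fix y assume "y \<in> N V +>\<^bsub>sec M V\<^esub> x"
    then obtain h where h: "h \<in> N V" "y = h \<oplus>\<^bsub>sec M V\<^esub> x"
      by (auto simp: a_r_coset_def r_coset_def)
    then show "y \<in> {y. eqv V y x}"
      using x subsheaf_in[OF N V h(1)] G.add_minus_cancel by (simp add: eqv_def)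
  next
    fix y assume y: "y \<in> {y. eqv V y x}"
    then have "y = (y \<ominus>\<^bsub>sec M V\<^esub> x) \<oplus>\<^bsub>sec M V\<^esub> x"
      using x G.add_minus_cancel by (simp add: eqv_def)
    then show "y \<in> N V +>\<^bsub>sec M V\<^esub> x"
      using y by (auto simp: a_r_coset_def r_coset_def eqv_def)
  qed
qed

lemma coset_eqv_mem: "\<lbrakk>V \<in> ob T; y \<in> sects M V\<rbrakk> \<Longrightarrow> x \<in> N V +>\<^bsub>sec M V\<^esub> y \<longleftrightarrow> eqv V x y"
  by (simp add: coset_eqv)

text \<open>Translation of the encoding into \<open>loc\<close> and \<open>eqv\<close>. The encoding
  is opened only here and in the converse rule \<open>quot_sectsI\<close>.\<close>

lemma quot_sectsD:
  assumes "t \<in> quot_sects T M N U"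
  shows quot_supp: "g \<notin> into T U \<Longrightarrow> t g = {}"
    and quot_loc: "U \<in> ob T \<Longrightarrow> loc T U (\<lambda>g. \<exists>x. x \<in> t g)"
    and quot_in: "\<lbrakk>g \<in> into T U; x \<in> t g\<rbrakk> \<Longrightarrow> x \<in> sects M (src T g)"
    and quot_eqv: "\<lbrakk>g \<in> into T U; x \<in> t g\<rbrakk> \<Longrightarrow> y \<in> t g \<longleftrightarrow> eqv (src T g) y x"
    and quot_res: "\<lbrakk>g \<in> into T U; x \<in> t g; h \<in> into T (src T g)\<rbrakk> \<Longrightarrow> res M h x \<in> t (cmp T g h)"
    and quot_sat: "\<lbrakk>g \<in> into T U; x \<in> sects M (src T g);
      loc T (src T g) (\<lambda>h. res M h x \<in> t (cmp T g h))\<rbrakk> \<Longrightarrow> x \<in> t g"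
proof -
  note t = assms[unfolded quot_sects_def mem_Collect_eq]
  show "g \<notin> into T U \<Longrightarrow> t g = {}" using t by blast
  show "loc T U (\<lambda>g. \<exists>x. x \<in> t g)" if "U \<in> ob T"
    unfolding loc_def by (rule bexI[of _ "{g \<in> into T U. t g \<noteq> {}}"]) (use t in auto)
  show e: "y \<in> t g \<longleftrightarrow> eqv (src T g) y x" if g: "g \<in> into T U" and x: "x \<in> t g" for g x y
  proof -
    note V = intoD(3)[OF g]
    obtain z where z: "z \<in> sects M (src T g)" "t g = N (src T g) +>\<^bsub>sec M (src T g)\<^esub> z"
      using t g x by blast
    then have "t g = {y. eqv (src T g) y z}"
      using coset_eqv[OF V] by simp
    then show ?thesis
      using x eqv_trans[OF V] eqv_sym[OF V] by blast
  qed
  show "x \<in> sects M (src T g)" if g: "g \<in> into T U" and x: "x \<in> t g"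
    using e[OF g x, of x] x by (simp add: eqv_def)
  show "res M h x \<in> t (cmp T g h)" if "g \<in> into T U" "x \<in> t g" "h \<in> into T (src T g)"
    using t that by blast
  show "x \<in> t g" if "g \<in> into T U" "x \<in> sects M (src T g)"
      "loc T (src T g) (\<lambda>h. res M h x \<in> t (cmp T g h))"
    using t that unfolding loc_def by blast
qed

lemma quot_sectsI:
  assumes U: "U \<in> ob T"
    and supp: "\<And>g. g \<notin> into T U \<Longrightarrow> t g = {}"
    and cover: "loc T U (\<lambda>g. \<exists>x. x \<in> t g)"
    and M: "\<And>g x. \<lbrakk>g \<in> into T U; x \<in> t g\<rbrakk> \<Longrightarrow> x \<in> sects M (src T g)"
    and eqv: "\<And>g x y. \<lbrakk>g \<in> into T U; x \<in> t g\<rbrakk> \<Longrightarrow> y \<in> t g \<longleftrightarrow> eqv (src T g) y x"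
    and res: "\<And>g x h. \<lbrakk>g \<in> into T U; x \<in> t g; h \<in> into T (src T g)\<rbrakk> \<Longrightarrow> res M h x \<in> t (cmp T g h)"
    and sat: "\<And>g x. \<lbrakk>g \<in> into T U; x \<in> sects M (src T g);
      loc T (src T g) (\<lambda>h. res M h x \<in> t (cmp T g h))\<rbrakk> \<Longrightarrow> x \<in> t g"
  shows "t \<in> quot_sects T M N U"
  unfolding quot_sects_def mem_Collect_eq
proof (intro conjI allI ballI impI)
  obtain S where S: "S \<in> cov T U" "\<forall>g\<in>S. \<exists>x. x \<in> t g"
    using cover unfolding loc_def by blast
  have "sieve T U {g \<in> into T U. t g \<noteq> {}}"
    unfolding sieve_def using res cmp_into by blast
  then show "{g \<in> into T U. t g \<noteq> {}} \<in> cov T U"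
    using S cov_into[OF U S(1)] by (intro cov_mono[OF U S(1)]) auto
next
  fix g assume g: "g \<in> into T U"
  show "t g = {} \<or> (\<exists>x\<in>sects M (src T g). t g = N (src T g) +>\<^bsub>sec M (src T g)\<^esub> x)"
  proof (cases "t g = {}")
    case False
    then obtain x where x: "x \<in> t g" by blast
    have "t g = {y. eqv (src T g) y x}"
      using eqv[OF g x] by blast
    then show ?thesis
      using M[OF g x] coset_eqv[OF intoD(3)[OF g]] by auto
  qed simp
qed (use supp res sat in \<open>auto simp: loc_def\<close>)

text \<open>The largest representatives are saturated, so two sections that share a representative
  on a cover have the same cosets everywhere.\<close>

lemma quot_eqI:
  assumes U: "U \<in> ob T" and t: "t \<in> quot_sects T M N U" and t': "t' \<in> quot_sects T M N U"
    and l: "loc T U (\<lambda>g. \<exists>x. x \<in> t g \<and> x \<in> t' g)"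
  shows "t = t'"
proof -
  have sub: "x \<in> t' g"
    if t: "t \<in> quot_sects T M N U" and t': "t' \<in> quot_sects T M N U"
      and l: "loc T U (\<lambda>g. \<exists>x. x \<in> t g \<and> x \<in> t' g)" and x: "x \<in> t g" for t t' g x
  proof -
    have g: "g \<in> into T U" using quot_supp[OF t] x by blast
    note V = intoD(3)[OF g]
    show ?thesis
    proof (rule quot_sat[OF t' g quot_in[OF t g x]], rule loc_mono[OF loc_pullback[OF l g] V])
      fix h assume h: "h \<in> into T (src T g)" and "\<exists>x. x \<in> t (cmp T g h) \<and> x \<in> t' (cmp T g h)"
      then obtain z where z: "z \<in> t (cmp T g h)" "z \<in> t' (cmp T g h)" by blast
      show "res M h x \<in> t' (cmp T g h)"
        using quot_eqv[OF t cmp_into[OF g h] z(1)] quot_eqv[OF t' cmp_into[OF g h] z(2)]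
          quot_res[OF t g x h] by simp
    qed
  qed
  have l': "loc T U (\<lambda>g. \<exists>x. x \<in> t' g \<and> x \<in> t g)"
    by (rule loc_mono[OF l U]) blast
  show ?thesis
  proof
    fix g
    show "t g = t' g"
      using sub[OF t t' l] sub[OF t' t l'] by blast
  qed
qed

text \<open>A single check behind sums, negatives, scalar multiples and gluing: \<open>P\<close> has
  to be nonempty on a cover, to stay within one class at each arrow, and to be compatible with
  restriction up to congruence. Saturation of the generated family follows by
  \<open>loc_trans\<close>.\<close>

lemma quot_gen_sects:
  assumes U: "U \<in> ob T"
    and PM: "\<And>g y. \<lbrakk>g \<in> into T U; y \<in> P g\<rbrakk> \<Longrightarrow> y \<in> sects M (src T g)"
    and Peq: "\<And>g y y'. \<lbrakk>g \<in> into T U; y \<in> P g; y' \<in> P g\<rbrakk> \<Longrightarrow> eqv (src T g) y y'"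
    and Pres: "\<And>g h y. \<lbrakk>g \<in> into T U; h \<in> into T (src T g); y \<in> P g\<rbrakk>
      \<Longrightarrow> \<exists>y'\<in>P (cmp T g h). eqv (src T h) (res M h y) y'"
    and Pcov: "loc T U (\<lambda>g. \<exists>y. y \<in> P g)"
  shows "quot_gen T M N U P \<in> quot_sects T M N U \<and>
    (\<forall>g z. g \<in> into T U \<longrightarrow> z \<in> P g \<longrightarrow> z \<in> quot_gen T M N U P g)"
proof -
  define t where "t = quot_gen T M N U P"
  have mem: "x \<in> t g \<longleftrightarrow> x \<in> sects M (src T g) \<and>
      loc T (src T g) (\<lambda>h. \<exists>y\<in>P (cmp T g h). eqv (src T h) (res M h x) y)"
    if g: "g \<in> into T U" for g x
  proof -
    have "(\<exists>S\<in>cov T (src T g). \<forall>h\<in>S. \<exists>y\<in>P (cmp T g h). res M h x \<in> N (src T h) +>\<^bsub>sec M (src T h)\<^esub> y)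
      \<longleftrightarrow> (\<exists>S\<in>cov T (src T g). \<forall>h\<in>S. \<exists>y\<in>P (cmp T g h). eqv (src T h) (res M h x) y)"
    proof (intro bex_cong ball_cong refl)
      fix S h y assume S: "S \<in> cov T (src T g)" and hS: "h \<in> S" and y: "y \<in> P (cmp T g h)"
      have h: "h \<in> into T (src T g)" using cov_into[OF intoD(3)[OF g] S hS] .
      have "y \<in> sects M (src T h)" using PM[OF cmp_into[OF g h] y] src_cmp[OF g h] by simp
      then show "(res M h x \<in> N (src T h) +>\<^bsub>sec M (src T h)\<^esub> y) = eqv (src T h) (res M h x) y"
        using coset_eqv_mem intoD(3)[OF h] by blast
    qed
    then show ?thesis
      using g by (simp add: t_def quot_gen_def loc_def)
  qed
  have supp: "t g = {}" if "g \<notin> into T U" for g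
    using that by (simp add: t_def quot_gen_def)
  have Pt: "y \<in> t g" if g: "g \<in> into T U" and y: "y \<in> P g" for g y
    unfolding mem[OF g] using PM[OF g y] Pres[OF g _ y] by (intro conjI loc_all intoD(3)[OF g]) auto
  have ts: "t \<in> quot_sects T M N U"
  proof (rule quot_sectsI[OF U supp])
    show "loc T U (\<lambda>g. \<exists>x. x \<in> t g)"
      by (rule loc_mono[OF Pcov U]) (use Pt in blast)
    fix g x assume g: "g \<in> into T U"
    note V = intoD(3)[OF g]
    {
      assume x: "x \<in> t g"
      then show "x \<in> sects M (src T g)" using mem[OF g] by simp
      have lx: "loc T (src T g) (\<lambda>h. \<exists>y\<in>P (cmp T g h). eqv (src T h) (res M h x) y)"
        using x mem[OF g] by simp
      show "y \<in> t g \<longleftrightarrow> eqv (src T g) y x" for y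
      proof
        assume y: "y \<in> t g"
        then have ly: "loc T (src T g) (\<lambda>h. \<exists>y'\<in>P (cmp T g h). eqv (src T h) (res M h y) y')"
          using mem[OF g] by simp
        show "eqv (src T g) y x"
        proof (rule eqv_loc[OF V])
          show "y \<in> sects M (src T g)" "x \<in> sects M (src T g)" using x y mem[OF g] by auto
          show "loc T (src T g) (\<lambda>h. eqv (src T h) (res M h y) (res M h x))"
          proof (rule loc_mono[OF loc_conj[OF lx ly V] V])
            fix h assume h: "h \<in> into T (src T g)"
              and "(\<exists>y\<in>P (cmp T g h). eqv (src T h) (res M h x) y) \<and>
                (\<exists>y'\<in>P (cmp T g h). eqv (src T h) (res M h y) y')"
            then obtain z z' where z: "z \<in> P (cmp T g h)" "eqv (src T h) (res M h x) z"
              "z' \<in> P (cmp T g h)" "eqv (src T h) (res M h y) z'" by blast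
            have "eqv (src T h) z' z"
              using Peq[OF cmp_into[OF g h] z(3,1)] src_cmp[OF g h] by simp
            then show "eqv (src T h) (res M h y) (res M h x)"
              using z eqv_trans[OF intoD(3)[OF h]] eqv_sym[OF intoD(3)[OF h]] by blast
          qed
        qed
      next
        assume e: "eqv (src T g) y x"
        show "y \<in> t g"
          unfolding mem[OF g]
        proof (intro conjI loc_mono[OF lx V])
          show "y \<in> sects M (src T g)" using eqvD[OF e] by simp
          fix h assume h: "h \<in> into T (src T g)" and "\<exists>y\<in>P (cmp T g h). eqv (src T h) (res M h x) y"
          then show "\<exists>z\<in>P (cmp T g h). eqv (src T h) (res M h y) z"
            using eqv_res[OF h e] eqv_trans[OF intoD(3)[OF h]] by blast
        qed
      qed
      show "res M h x \<in> t (cmp T g h)" if h: "h \<in> into T (src T g)" for h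
        unfolding mem[OF cmp_into[OF g h]] src_cmp[OF g h]
      proof (intro conjI loc_mono[OF loc_pullback[OF lx h]] intoD(3)[OF h])
        show "res M h x \<in> sects M (src T h)"
          using M.res_closed[OF h] x mem[OF g] by simp
        fix k assume k: "k \<in> into T (src T h)"
          and *: "\<exists>y\<in>P (cmp T g (cmp T h k)). eqv (src T (cmp T h k)) (res M (cmp T h k) x) y"
        show "\<exists>y\<in>P (cmp T (cmp T g h) k). eqv (src T k) (res M k (res M h x)) y"
          using * M.res_comp[OF h k] x mem[OF g] cmp_assoc'[OF g h k] src_cmp[OF h k] by simp
      qed
    }
    assume x: "x \<in> sects M (src T g)" and l: "loc T (src T g) (\<lambda>h. res M h x \<in> t (cmp T g h))"
    show "x \<in> t g"
      unfolding mem[OF g]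
    proof (intro conjI x loc_trans[OF V l])
      fix h assume h: "h \<in> into T (src T g)" and "res M h x \<in> t (cmp T g h)"
      then have l': "loc T (src T h) (\<lambda>k. \<exists>y\<in>P (cmp T (cmp T g h) k). eqv (src T k) (res M k (res M h x)) y)"
        using mem[OF cmp_into[OF g h]] src_cmp[OF g h] by simp
      show "loc T (src T h) (\<lambda>k. \<exists>y\<in>P (cmp T g (cmp T h k)).
          eqv (src T (cmp T h k)) (res M (cmp T h k) x) y)"
        by (rule loc_mono[OF l' intoD(3)[OF h]])
          (use M.res_comp[OF h _ x] cmp_assoc'[OF g h] src_cmp[OF h] in simp)
    qed
  qed
  show ?thesis using ts Pt by (simp add: t_def)
qed

section \<open>The projection onto the quotient and its representatives\<close>

abbreviation "Q \<equiv> quot T M N"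
abbreviation "pr \<equiv> quot_proj T M N"

lemma quot_carrier: "sects Q U = quot_sects T M N U"
  by (simp add: quot_def)

lemma quot_res_eq: "res Q f t = (\<lambda>g. if g \<in> into T (src T f) then t (cmp T f g) else {})"
  by (simp add: quot_def)

lemma pr_mem:
  assumes g: "g \<in> into T U" and x: "x \<in> sects M U"
  shows "y \<in> pr U x g \<longleftrightarrow> eqv (src T g) y (res M g x)"
  using coset_eqv_mem[OF intoD(3)[OF g] M.res_closed[OF g x]] g by (simp add: quot_proj_def)

lemma pr_closed:
  assumes U: "U \<in> ob T" and x: "x \<in> sects M U"
  shows "pr U x \<in> quot_sects T M N U"
proof (rule quot_sectsI[OF U])
  show "pr U x g = {}" if "g \<notin> into T U" for g
    using that by (simp add: quot_proj_def)
  have self: "res M g x \<in> pr U x g" if g: "g \<in> into T U" for g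
    using pr_mem[OF g x] eqv_refl[OF intoD(3)[OF g] M.res_closed[OF g x]] by simp
  then show "loc T U (\<lambda>g. \<exists>y. y \<in> pr U x g)"
    by (intro loc_all[OF U]) blast
  fix g y assume g: "g \<in> into T U"
  note V = intoD(3)[OF g]
  {
    assume y: "y \<in> pr U x g"
    then have e: "eqv (src T g) y (res M g x)" using pr_mem[OF g x] by simp
    then show "y \<in> sects M (src T g)" by (rule eqvD)
    show "z \<in> pr U x g \<longleftrightarrow> eqv (src T g) z y" for z
      unfolding pr_mem[OF g x] using e eqv_trans[OF V] eqv_sym[OF V] by blast
    show "res M h y \<in> pr U x (cmp T g h)" if h: "h \<in> into T (src T g)" for h
      unfolding pr_mem[OF cmp_into[OF g h] x] M.res_comp[OF g h x] src_cmp[OF g h]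
      by (rule eqv_res[OF h e])
  }
  assume y: "y \<in> sects M (src T g)" and l: "loc T (src T g) (\<lambda>h. res M h y \<in> pr U x (cmp T g h))"
  show "y \<in> pr U x g"
    unfolding pr_mem[OF g x]
    by (rule eqv_loc[OF V y M.res_closed[OF g x]], rule loc_mono[OF l V])
      (simp add: pr_mem[OF cmp_into[OF g] x] M.res_comp[OF g _ x] src_cmp[OF g])
qed

lemma res_quot_closed:
  assumes f: "f \<in> into T U" and t: "t \<in> quot_sects T M N U"
  shows "res Q f t \<in> quot_sects T M N (src T f)"
proof (rule quot_sectsI[OF intoD(3)[OF f]])
  show "res Q f t g = {}" if "g \<notin> into T (src T f)" for g
    using that by (simp add: quot_res_eq)
  show "loc T (src T f) (\<lambda>g. \<exists>x. x \<in> res Q f t g)"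
    by (rule loc_mono[OF loc_pullback[OF quot_loc[OF t intoD(4)[OF f]] f] intoD(3)[OF f]])
      (simp add: quot_res_eq)
  fix g x assume g: "g \<in> into T (src T f)"
  note fg = cmp_into[OF f g] and s = src_cmp[OF f g]
  have r: "res Q f t g = t (cmp T f g)" using g by (simp add: quot_res_eq)
  have r': "res Q f t (cmp T g h) = t (cmp T (cmp T f g) h)" if h: "h \<in> into T (src T g)" for h
    using cmp_into[OF g h] cmp_assoc'[OF f g h] by (simp add: quot_res_eq)
  {
    assume x: "x \<in> res Q f t g"
    show "x \<in> sects M (src T g)" using quot_in[OF t fg] x r s by simp
    show "y \<in> res Q f t g \<longleftrightarrow> eqv (src T g) y x" for y
      using quot_eqv[OF t fg] x r s by simp
    show "res M h x \<in> res Q f t (cmp T g h)" if h: "h \<in> into T (src T g)" for h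
      using quot_res[OF t fg] x r s r'[OF h] h by simp
  }
  assume x: "x \<in> sects M (src T g)" and l: "loc T (src T g) (\<lambda>h. res M h x \<in> res Q f t (cmp T g h))"
  have "loc T (src T g) (\<lambda>h. res M h x \<in> t (cmp T (cmp T f g) h))"
    by (rule loc_mono[OF l intoD(3)[OF g]]) (simp add: r')
  then show "x \<in> res Q f t g"
    unfolding r using quot_sat[OF t fg] x s by simp
qed

lemma res_quot_pr:
  assumes f: "f \<in> into T U" and x: "x \<in> sects M U"
  shows "res Q f (pr U x) = pr (src T f) (res M f x)"
proof
  fix g
  show "res Q f (pr U x) g = pr (src T f) (res M f x) g"
    using M.res_comp[OF f _ x] cmp_into[OF f] src_cmp[OF f]
    by (simp add: quot_res_eq quot_proj_def)
qed

text \<open>The dictionary between the encoding and classes. The backward direction evaluates the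
  restricted section at the identity arrow, where its value is \<open>t g\<close>.\<close>

lemma mem_iff_pr:
  assumes t: "t \<in> quot_sects T M N U" and g: "g \<in> into T U" and x: "x \<in> sects M (src T g)"
  shows "x \<in> t g \<longleftrightarrow> res Q g t = pr (src T g) x"
proof
  note V = intoD(3)[OF g]
  assume xt: "x \<in> t g"
  show "res Q g t = pr (src T g) x"
  proof (rule quot_eqI[OF V res_quot_closed[OF g t] pr_closed[OF V x]], rule loc_all[OF V])
    fix h assume h: "h \<in> into T (src T g)"
    show "\<exists>z. z \<in> res Q g t h \<and> z \<in> pr (src T g) x h"
      using quot_res[OF t g xt h] h pr_mem[OF h x] eqv_refl[OF intoD(3)[OF h] M.res_closed[OF h x]]
      by (auto simp: quot_res_eq)
  qed
next
  note V = intoD(3)[OF g]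
  assume "res Q g t = pr (src T g) x"
  then have "res Q g t (idn T (src T g)) = pr (src T g) x (idn T (src T g))" by simp
  moreover have "x \<in> pr (src T g) x (idn T (src T g))"
    using pr_mem[OF idn_into[OF V] x] M.res_id[OF V x] eqv_refl[OF V x] src_idn[OF V] by simp
  ultimately show "x \<in> t g"
    using idn_into[OF V] cmp_idn[OF g] by (simp add: quot_res_eq)
qed

lemma loc_pr:
  assumes U: "U \<in> ob T" and t: "t \<in> quot_sects T M N U"
  shows "loc T U (\<lambda>g. \<exists>x\<in>sects M (src T g). res Q g t = pr (src T g) x)"
  by (rule loc_mono[OF quot_loc[OF t U] U]) (use mem_iff_pr[OF t] quot_in[OF t] in blast)

lemma pr_eq_iff:
  assumes U: "U \<in> ob T" and x: "x \<in> sects M U" and y: "y \<in> sects M U"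
  shows "pr U x = pr U y \<longleftrightarrow> eqv U x y"
proof -
  have "res Q (idn T U) (pr U y) = pr U y"
    using res_quot_pr[OF idn_into[OF U] y] M.res_id[OF U y] src_idn[OF U] by simp
  then show ?thesis
    using mem_iff_pr[OF pr_closed[OF U y] idn_into[OF U], of x] x src_idn[OF U]
      pr_mem[OF idn_into[OF U] y, of x] M.res_id[OF U y] by auto
qed

section \<open>Group structure and gluing of the quotient sheaf\<close>

lemma quot_add_props:
  assumes U: "U \<in> ob T" and t: "t \<in> quot_sects T M N U" and t': "t' \<in> quot_sects T M N U"
  shows "t \<oplus>\<^bsub>sec Q U\<^esub> t' \<in> quot_sects T M N U"
    and "\<lbrakk>g \<in> into T U; x \<in> t g; y \<in> t' g\<rbrakk> \<Longrightarrow> x \<oplus>\<^bsub>sec M (src T g)\<^esub> y \<in> (t \<oplus>\<^bsub>sec Q U\<^esub> t') g"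
proof -
  define P where "P = (\<lambda>g. t g <+>\<^bsub>sec M (src T g)\<^esub> t' g)"
  have Pm: "z \<in> P g \<longleftrightarrow> (\<exists>x\<in>t g. \<exists>y\<in>t' g. z = x \<oplus>\<^bsub>sec M (src T g)\<^esub> y)" for z g
    by (auto simp: P_def set_add_def set_mult_def)
  have gen: "quot_gen T M N U P \<in> quot_sects T M N U \<and>
      (\<forall>g z. g \<in> into T U \<longrightarrow> z \<in> P g \<longrightarrow> z \<in> quot_gen T M N U P g)"
  proof (rule quot_gen_sects[OF U])
    fix g z assume g: "g \<in> into T U"
    note V = intoD(3)[OF g]
    interpret G: abelian_group "sec M (src T g)" using M.grp[OF V] .
    {
      fix h assume h: "h \<in> into T (src T g)" and "z \<in> P g"
      then obtain x y where xy: "x \<in> t g" "y \<in> t' g" "z = x \<oplus>\<^bsub>sec M (src T g)\<^esub> y" using Pm by blast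
      note c = quot_in[OF t g xy(1)] quot_in[OF t' g xy(2)]
      have "res M h z \<in> P (cmp T g h)"
        using Pm quot_res[OF t g xy(1) h] quot_res[OF t' g xy(2) h] M.res_plus[OF h c] xy(3)
          src_cmp[OF g h] by auto
      then show "\<exists>y'\<in>P (cmp T g h). eqv (src T h) (res M h z) y'"
        using eqv_refl[OF intoD(3)[OF h] M.res_closed[OF h G.a_closed[OF c]]] xy(3) by blast
    }
    show "z \<in> sects M (src T g)" if "z \<in> P g"
      using that Pm quot_in[OF t g] quot_in[OF t' g] by auto
    show "eqv (src T g) z z'" if z: "z \<in> P g" and z': "z' \<in> P g" for z'
    proof -
      obtain x y where xy: "x \<in> t g" "y \<in> t' g" "z = x \<oplus>\<^bsub>sec M (src T g)\<^esub> y"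
        using z Pm by blast
      obtain x' y' where xy': "x' \<in> t g" "y' \<in> t' g" "z' = x' \<oplus>\<^bsub>sec M (src T g)\<^esub> y'"
        using z' Pm by blast
      show ?thesis
        unfolding xy(3) xy'(3)
        using quot_eqv[OF t g xy'(1)] quot_eqv[OF t' g xy'(2)] xy by (intro eqv_add[OF V]) auto
    qed
  next
    show "loc T U (\<lambda>g. \<exists>y. y \<in> P g)"
      by (rule loc_mono[OF loc_conj[OF quot_loc[OF t U] quot_loc[OF t' U] U] U]) (use Pm in blast)
  qed
  have eq: "t \<oplus>\<^bsub>sec Q U\<^esub> t' = quot_gen T M N U P"
    by (simp add: quot_def P_def)
  show "t \<oplus>\<^bsub>sec Q U\<^esub> t' \<in> quot_sects T M N U" using eq gen by simp
  show "x \<oplus>\<^bsub>sec M (src T g)\<^esub> y \<in> (t \<oplus>\<^bsub>sec Q U\<^esub> t') g" if "g \<in> into T U" "x \<in> t g" "y \<in> t' g"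
    using eq gen[THEN conjunct2, rule_format, OF that(1), of "x \<oplus>\<^bsub>sec M (src T g)\<^esub> y"] Pm that by auto
qed

lemma quot_zero: "\<zero>\<^bsub>sec Q U\<^esub> = (\<lambda>g. if g \<in> into T U then N (src T g) else {})"
  by (simp add: quot_def)

lemma zero_eqv: "\<lbrakk>V \<in> ob T\<rbrakk> \<Longrightarrow> x \<in> N V \<longleftrightarrow> eqv V x \<zero>\<^bsub>sec M V\<^esub>"
proof -
  assume V: "V \<in> ob T"
  interpret G: abelian_group "sec M V" using M.grp[OF V] .
  have z: "\<ominus>\<^bsub>sec M V\<^esub> \<zero>\<^bsub>sec M V\<^esub> = \<zero>\<^bsub>sec M V\<^esub>"
    using G.r_neg[OF G.zero_closed] by simp
  show ?thesis
    using subsheaf_in[OF N V] by (auto simp: eqv_def G.minus_eq z)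
qed

lemma pr_zero: "U \<in> ob T \<Longrightarrow> pr U \<zero>\<^bsub>sec M U\<^esub> = \<zero>\<^bsub>sec Q U\<^esub>"
proof
  fix g assume U: "U \<in> ob T"
  interpret G: abelian_group "sec M U" using M.grp[OF U] .
  show "pr U \<zero>\<^bsub>sec M U\<^esub> g = \<zero>\<^bsub>sec Q U\<^esub> g"
  proof (cases "g \<in> into T U")
    case True
    show ?thesis
      using pr_mem[OF True G.zero_closed] zero_eqv[OF intoD(3)[OF True]] True
        res_zero[OF ab_M True] by (auto simp: quot_zero)
  qed (simp add: quot_zero quot_proj_def)
qed

lemma quot_mem_zero:
  assumes "g \<in> into T U"
  shows "\<zero>\<^bsub>sec M (src T g)\<^esub> \<in> \<zero>\<^bsub>sec Q U\<^esub> g"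
  using assms subsheaf_zero[OF N intoD(3)[OF assms]] by (simp add: quot_zero)

text \<open>Common to negation and scalar multiplication: an operation on \<open>M\<close> that
  respects congruence and restriction descends, and its value on a class contains the images of all
  representatives.\<close>

lemma quot_gen_image:
  assumes U: "U \<in> ob T" and t: "t \<in> quot_sects T M N U"
    and sM: "\<And>V x. \<lbrakk>V \<in> ob T; x \<in> sects M V\<rbrakk> \<Longrightarrow> s V x \<in> sects M V"
    and seq: "\<And>V x y. \<lbrakk>V \<in> ob T; eqv V x y\<rbrakk> \<Longrightarrow> eqv V (s V x) (s V y)"
    and sres: "\<And>V f x. \<lbrakk>f \<in> into T V; x \<in> sects M V\<rbrakk> \<Longrightarrow> res M f (s V x) = s (src T f) (res M f x)"
  shows "quot_gen T M N U (\<lambda>g. s (src T g) ` t g) \<in> quot_sects T M N U"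
    and "\<lbrakk>g \<in> into T U; x \<in> t g\<rbrakk> \<Longrightarrow> s (src T g) x \<in> quot_gen T M N U (\<lambda>g. s (src T g) ` t g) g"
proof -
  let ?P = "\<lambda>g. s (src T g) ` t g"
  have "quot_gen T M N U ?P \<in> quot_sects T M N U \<and>
      (\<forall>g z. g \<in> into T U \<longrightarrow> z \<in> ?P g \<longrightarrow> z \<in> quot_gen T M N U ?P g)"
  proof (rule quot_gen_sects[OF U])
    fix g z assume g: "g \<in> into T U"
    note V = intoD(3)[OF g]
    {
      fix h assume h: "h \<in> into T (src T g)" and "z \<in> ?P g"
      then obtain x where x: "x \<in> t g" "z = s (src T g) x" by blast
      note c = quot_in[OF t g x(1)]
      have "res M h z \<in> ?P (cmp T g h)"
        using quot_res[OF t g x(1) h] sres[OF h c] x src_cmp[OF g h] by auto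
      then show "\<exists>y'\<in>?P (cmp T g h). eqv (src T h) (res M h z) y'"
        using eqv_refl[OF intoD(3)[OF h] M.res_closed[OF h sM[OF V c]]] x(2) by blast
    }
    show "z \<in> sects M (src T g)" if "z \<in> ?P g"
      using that quot_in[OF t g] sM[OF V] by auto
    show "eqv (src T g) z z'" if "z \<in> ?P g" "z' \<in> ?P g" for z'
      using that quot_eqv[OF t g] seq[OF V] by blast
  next
    show "loc T U (\<lambda>g. \<exists>y. y \<in> ?P g)"
      by (rule loc_mono[OF quot_loc[OF t U] U]) blast
  qed
  then show "quot_gen T M N U ?P \<in> quot_sects T M N U"
    and "\<lbrakk>g \<in> into T U; x \<in> t g\<rbrakk> \<Longrightarrow> s (src T g) x \<in> quot_gen T M N U ?P g"
    by auto
qed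

lemma quot_neg_ex:
  assumes U: "U \<in> ob T" and t: "t \<in> quot_sects T M N U"
  shows "\<exists>t'\<in>quot_sects T M N U. \<forall>g\<in>into T U. \<forall>x\<in>t g. \<ominus>\<^bsub>sec M (src T g)\<^esub> x \<in> t' g"
proof -
  let ?s = "\<lambda>V x. \<ominus>\<^bsub>sec M V\<^esub> x"
  have "?s V x \<in> sects M V" if "V \<in> ob T" "x \<in> sects M V" for V x
    using abelian_group.a_inv_closed[OF M.grp[OF that(1)] that(2)] .
  moreover have "eqv V (?s V x) (?s V y)" if V: "V \<in> ob T" and e: "eqv V x y" for V x y
  proof -
    interpret G: abelian_group "sec M V" using M.grp[OF V] .
    note c = eqvD[OF e]
    have "(\<ominus>\<^bsub>sec M V\<^esub> x) \<ominus>\<^bsub>sec M V\<^esub> (\<ominus>\<^bsub>sec M V\<^esub> y) = \<ominus>\<^bsub>sec M V\<^esub> (x \<ominus>\<^bsub>sec M V\<^esub> y)"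
      using c by (simp add: G.minus_eq G.minus_add G.minus_minus)
    then show ?thesis
      using e c subsheaf_neg[OF N V] by (simp add: eqv_def)
  qed
  moreover have "res M f (?s V x) = ?s (src T f) (res M f x)" if "f \<in> into T V" "x \<in> sects M V" for V f x
    using res_neg[OF ab_M that] .
  ultimately have "quot_gen T M N U (\<lambda>g. ?s (src T g) ` t g) \<in> quot_sects T M N U"
    "\<And>g x. \<lbrakk>g \<in> into T U; x \<in> t g\<rbrakk> \<Longrightarrow> ?s (src T g) x \<in> quot_gen T M N U (\<lambda>g. ?s (src T g) ` t g) g"
    using quot_gen_image[OF U t, of ?s] by blast+
  then show ?thesis by blast
qed

text \<open>Sums given by \<open>quot_gen\<close> have no closed form, so each group law is compared
  on representatives over a cover on which all arguments have one.\<close>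

lemma quot_group:
  assumes U: "U \<in> ob T"
  shows "abelian_group (sec Q U)"
proof (rule abelian_groupI)
  note add = quot_add_props[OF U]
  have z: "\<zero>\<^bsub>sec Q U\<^esub> \<in> quot_sects T M N U"
    using pr_zero[OF U] pr_closed[OF U] abelian_monoid.zero_closed[OF abelian_group.axioms(1)[OF M.grp[OF U]]]
    by metis
  note in_G = intoD(3)
  show "\<zero>\<^bsub>sec Q U\<^esub> \<in> carrier (sec Q U)" using z by (simp add: quot_carrier)
  show "t \<oplus>\<^bsub>sec Q U\<^esub> t' \<in> carrier (sec Q U)" if "t \<in> carrier (sec Q U)" "t' \<in> carrier (sec Q U)" for t t'
    using that add by (simp add: quot_carrier)
  show "t \<oplus>\<^bsub>sec Q U\<^esub> t' \<oplus>\<^bsub>sec Q U\<^esub> t'' = t \<oplus>\<^bsub>sec Q U\<^esub> (t' \<oplus>\<^bsub>sec Q U\<^esub> t'')"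
    if "t \<in> carrier (sec Q U)" "t' \<in> carrier (sec Q U)" "t'' \<in> carrier (sec Q U)" for t t' t''
  proof -
    note t = that[unfolded quot_carrier]
    show ?thesis
    proof (rule quot_eqI[OF U add(1)[OF add(1)[OF t(1,2)] t(3)] add(1)[OF t(1) add(1)[OF t(2,3)]]],
        rule loc_mono[OF loc_conj[OF quot_loc[OF t(1) U] loc_conj[OF quot_loc[OF t(2) U] quot_loc[OF t(3) U] U] U] U])
      fix g assume g: "g \<in> into T U" and "(\<exists>x. x \<in> t g) \<and> (\<exists>x. x \<in> t' g) \<and> (\<exists>x. x \<in> t'' g)"
      then obtain x y z where m: "x \<in> t g" "y \<in> t' g" "z \<in> t'' g" by blast
      interpret G: abelian_group "sec M (src T g)" using M.grp[OF intoD(3)[OF g]] .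
      show "\<exists>x. x \<in> (t \<oplus>\<^bsub>sec Q U\<^esub> t' \<oplus>\<^bsub>sec Q U\<^esub> t'') g \<and> x \<in> (t \<oplus>\<^bsub>sec Q U\<^esub> (t' \<oplus>\<^bsub>sec Q U\<^esub> t'')) g"
        using add(2)[OF add(1)[OF t(1,2)] t(3) g add(2)[OF t(1,2) g m(1,2)] m(3)]
          add(2)[OF t(1) add(1)[OF t(2,3)] g m(1) add(2)[OF t(2,3) g m(2,3)]]
          G.a_assoc[OF quot_in[OF t(1) g m(1)] quot_in[OF t(2) g m(2)] quot_in[OF t(3) g m(3)]]
        by auto
    qed
  qed
  show "t \<oplus>\<^bsub>sec Q U\<^esub> t' = t' \<oplus>\<^bsub>sec Q U\<^esub> t" if "t \<in> carrier (sec Q U)" "t' \<in> carrier (sec Q U)" for t t'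
  proof -
    note t = that[unfolded quot_carrier]
    show ?thesis
    proof (rule quot_eqI[OF U add(1)[OF t] add(1)[OF t(2,1)]],
        rule loc_mono[OF loc_conj[OF quot_loc[OF t(1) U] quot_loc[OF t(2) U] U] U])
      fix g assume g: "g \<in> into T U" and "(\<exists>x. x \<in> t g) \<and> (\<exists>x. x \<in> t' g)"
      then obtain x y where m: "x \<in> t g" "y \<in> t' g" by blast
      interpret G: abelian_group "sec M (src T g)" using M.grp[OF intoD(3)[OF g]] .
      show "\<exists>x. x \<in> (t \<oplus>\<^bsub>sec Q U\<^esub> t') g \<and> x \<in> (t' \<oplus>\<^bsub>sec Q U\<^esub> t) g"
        using add(2)[OF t g m] add(2)[OF t(2,1) g m(2,1)]
          G.a_comm[OF quot_in[OF t(1) g m(1)] quot_in[OF t(2) g m(2)]] by auto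
    qed
  qed
  show "\<zero>\<^bsub>sec Q U\<^esub> \<oplus>\<^bsub>sec Q U\<^esub> t = t" if "t \<in> carrier (sec Q U)" for t
  proof -
    note t = that[unfolded quot_carrier]
    show ?thesis
    proof (rule quot_eqI[OF U add(1)[OF z t] t], rule loc_mono[OF quot_loc[OF t U] U])
      fix g assume g: "g \<in> into T U" and "\<exists>x. x \<in> t g"
      then obtain x where m: "x \<in> t g" by blast
      interpret G: abelian_group "sec M (src T g)" using M.grp[OF intoD(3)[OF g]] .
      show "\<exists>x. x \<in> (\<zero>\<^bsub>sec Q U\<^esub> \<oplus>\<^bsub>sec Q U\<^esub> t) g \<and> x \<in> t g"
        using add(2)[OF z t g quot_mem_zero[OF g] m] m G.l_zero[OF quot_in[OF t g m]] by auto
    qed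
  qed
  show "\<exists>t'\<in>carrier (sec Q U). t' \<oplus>\<^bsub>sec Q U\<^esub> t = \<zero>\<^bsub>sec Q U\<^esub>" if "t \<in> carrier (sec Q U)" for t
  proof -
    note t = that[unfolded quot_carrier]
    obtain t' where t': "t' \<in> quot_sects T M N U"
      and neg: "\<forall>g\<in>into T U. \<forall>x\<in>t g. \<ominus>\<^bsub>sec M (src T g)\<^esub> x \<in> t' g"
      using quot_neg_ex[OF U t] by blast
    have "t' \<oplus>\<^bsub>sec Q U\<^esub> t = \<zero>\<^bsub>sec Q U\<^esub>"
    proof (rule quot_eqI[OF U add(1)[OF t' t] z], rule loc_mono[OF quot_loc[OF t U] U])
      fix g assume g: "g \<in> into T U" and "\<exists>x. x \<in> t g"
      then obtain x where m: "x \<in> t g" by blast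
      interpret G: abelian_group "sec M (src T g)" using M.grp[OF intoD(3)[OF g]] .
      show "\<exists>x. x \<in> (t' \<oplus>\<^bsub>sec Q U\<^esub> t) g \<and> x \<in> \<zero>\<^bsub>sec Q U\<^esub> g"
        using add(2)[OF t' t g neg[rule_format, OF g m] m] quot_mem_zero[OF g]
          G.l_neg[OF quot_in[OF t g m]] by auto
    qed
    then show ?thesis using t' by (auto simp: quot_carrier)
  qed
qed

lemma mem_res_quot:
  "h \<in> into T (src T f) \<Longrightarrow> x \<in> res Q f t h \<longleftrightarrow> x \<in> t (cmp T f h)"
  by (simp add: quot_res_eq)

lemma res_quot_add:
  assumes f: "f \<in> into T U" and t: "t \<in> quot_sects T M N U" and t': "t' \<in> quot_sects T M N U"
  shows "res Q f (t \<oplus>\<^bsub>sec Q U\<^esub> t') = res Q f t \<oplus>\<^bsub>sec Q (src T f)\<^esub> res Q f t'"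
proof -
  note U = intoD(4)[OF f] and V = intoD(3)[OF f]
  note r = res_quot_closed[OF f t] res_quot_closed[OF f t']
  show ?thesis
  proof (rule quot_eqI[OF V res_quot_closed[OF f quot_add_props(1)[OF U t t']] quot_add_props(1)[OF V r]],
      rule loc_mono[OF loc_conj[OF quot_loc[OF r(1) V] quot_loc[OF r(2) V] V] V])
    fix g assume g: "g \<in> into T (src T f)" and "(\<exists>x. x \<in> res Q f t g) \<and> (\<exists>x. x \<in> res Q f t' g)"
    then obtain x y where m: "x \<in> res Q f t g" "y \<in> res Q f t' g" by blast
    then have m': "x \<in> t (cmp T f g)" "y \<in> t' (cmp T f g)" using mem_res_quot[OF g] by auto
    show "\<exists>x. x \<in> res Q f (t \<oplus>\<^bsub>sec Q U\<^esub> t') g \<and> x \<in> (res Q f t \<oplus>\<^bsub>sec Q (src T f)\<^esub> res Q f t') g"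
      using quot_add_props(2)[OF V r g m] quot_add_props(2)[OF U t t' cmp_into[OF f g] m']
        mem_res_quot[OF g] src_cmp[OF f g] by auto
  qed
qed

lemma quot_glue:
  assumes U: "U \<in> ob T" and S: "S \<in> cov T U" and s: "\<forall>f\<in>S. s f \<in> quot_sects T M N (src T f)"
    and m: "\<forall>f\<in>S. \<forall>g\<in>into T (src T f). res Q g (s f) = s (cmp T f g)"
  shows "\<exists>!t. t \<in> quot_sects T M N U \<and> (\<forall>f\<in>S. res Q f t = s f)"
proof (rule ex_ex1I)
  \<comment> \<open>At a cover arrow \<open>g\<close> the glued section must take the value of
    \<open>s g\<close> at the identity. The matching condition makes this value at a composite
    \<open>cmp T f g\<close> equal to \<open>s f g\<close>.\<close>
  define P where "P = (\<lambda>g. if g \<in> S then s g (idn T (src T g)) else {})"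
  have fin: "f \<in> into T U" if "f \<in> S" for f using cov_into[OF U S that] .
  have Ps: "P (cmp T f g) = s f g" if f: "f \<in> S" and g: "g \<in> into T (src T f)" for f g
  proof -
    have "s (cmp T f g) (idn T (src T g)) = res Q g (s f) (idn T (src T g))"
      using m f g by simp
    also have "\<dots> = s f g"
      using cmp_idn[OF g] idn_into[OF intoD(3)[OF g]] by (simp add: quot_res_eq)
    finally show ?thesis
      using cov_cmp[OF U S f g] src_cmp[OF fin[OF f] g] by (simp add: P_def)
  qed
  have Pm: "g \<in> S \<and> y \<in> s g (idn T (src T g)) \<and> idn T (src T g) \<in> into T (src T g)" if "y \<in> P g" for y g
    using that idn_into intoD(3) fin by (auto simp: P_def split: if_splits)
  have gen: "quot_gen T M N U P \<in> quot_sects T M N U \<and>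
      (\<forall>g z. g \<in> into T U \<longrightarrow> z \<in> P g \<longrightarrow> z \<in> quot_gen T M N U P g)"
  proof (rule quot_gen_sects[OF U])
    fix g y assume g: "g \<in> into T U"
    note V = intoD(3)[OF g]
    {
      assume y: "y \<in> P g"
      note gS = Pm[OF y] and sg = s[rule_format, OF conjunct1[OF Pm[OF y]]]
      show yM: "y \<in> sects M (src T g)"
        using quot_in[OF sg idn_into[OF V]] gS src_idn[OF V] by simp
      show "eqv (src T g) y y'" if "y' \<in> P g" for y'
        using quot_eqv[OF sg idn_into[OF V]] gS Pm[OF that] src_idn[OF V] by auto
      show "\<exists>y'\<in>P (cmp T g h). eqv (src T h) (res M h y) y'" if h: "h \<in> into T (src T g)" for h
      proof
        have "res M h y \<in> s g (cmp T (idn T (src T g)) h)"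
          using quot_res[OF sg idn_into[OF V]] gS h src_idn[OF V] by simp
        then show "res M h y \<in> P (cmp T g h)"
          using idn_cmp[OF h] Ps gS h by simp
        show "eqv (src T h) (res M h y) (res M h y)"
          using eqv_refl[OF intoD(3)[OF h] M.res_closed[OF h yM]] .
      qed
    }
  next
    have l: "loc T U (\<lambda>f. f \<in> S)" unfolding loc_def using S by blast
    show "loc T U (\<lambda>g. \<exists>y. y \<in> P g)"
    proof (rule loc_trans[OF U l])
      fix f assume f: "f \<in> into T U" and fS: "f \<in> S"
      show "loc T (src T f) (\<lambda>g. \<exists>y. y \<in> P (cmp T f g))"
        by (rule loc_mono[OF quot_loc[OF s[rule_format, OF fS] intoD(3)[OF f]] intoD(3)[OF f]])
          (use Ps[OF fS] in auto)
    qed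
  qed
  show "\<exists>t. t \<in> quot_sects T M N U \<and> (\<forall>f\<in>S. res Q f t = s f)"
  proof (intro exI[of _ "quot_gen T M N U P"] conjI ballI)
    show "quot_gen T M N U P \<in> quot_sects T M N U" using gen by simp
    fix f assume fS: "f \<in> S"
    note f = fin[OF fS]
    note V = intoD(3)[OF f] and sf = s[rule_format, OF fS]
    show "res Q f (quot_gen T M N U P) = s f"
    proof (rule quot_eqI[OF V res_quot_closed[OF f conjunct1[OF gen]] sf], rule loc_mono[OF quot_loc[OF sf V] V])
      fix g assume g: "g \<in> into T (src T f)" and "\<exists>x. x \<in> s f g"
      then obtain x where x: "x \<in> s f g" by blast
      then show "\<exists>x. x \<in> res Q f (quot_gen T M N U P) g \<and> x \<in> s f g"
        using Ps[OF fS g] gen cmp_into[OF f g] mem_res_quot[OF g] by (intro exI[of _ x]) auto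
    qed
  qed
  fix t t' assume t: "t \<in> quot_sects T M N U \<and> (\<forall>f\<in>S. res Q f t = s f)"
    and t': "t' \<in> quot_sects T M N U \<and> (\<forall>f\<in>S. res Q f t' = s f)"
  have l: "loc T U (\<lambda>f. f \<in> S)" unfolding loc_def using S by blast
  show "t = t'"
  proof (rule quot_eqI[OF U conjunct1[OF t] conjunct1[OF t']],
      rule loc_mono[OF loc_conj[OF l quot_loc[OF conjunct1[OF t] U] U] U])
    fix g assume g: "g \<in> into T U" and "g \<in> S \<and> (\<exists>x. x \<in> t g)"
    then obtain x where gS: "g \<in> S" and x: "x \<in> t g" by blast
    have "res Q g t' = pr (src T g) x"
      using mem_iff_pr[OF conjunct1[OF t] g quot_in[OF conjunct1[OF t] g x]] x t t' gS by simp
    then show "\<exists>x. x \<in> t g \<and> x \<in> t' g"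
      using mem_iff_pr[OF conjunct1[OF t'] g quot_in[OF conjunct1[OF t] g x]] x by blast
  qed
qed

lemma ab_quot: "ab_sheaf T Q"
proof (rule ab_sheaf.intro)
  show "abelian_group (sec Q U)" if "U \<in> ob T" for U
    using quot_group[OF that] .
  show "res Q f x \<in> sects Q (src T f)" if "f \<in> into T U" "x \<in> sects Q U" for f U x
    using that res_quot_closed by (simp add: quot_carrier)
  show "res Q f (x \<oplus>\<^bsub>sec Q U\<^esub> y) = res Q f x \<oplus>\<^bsub>sec Q (src T f)\<^esub> res Q f y"
    if "f \<in> into T U" "x \<in> sects Q U" "y \<in> sects Q U" for f U x y
    using that res_quot_add by (simp add: quot_carrier)
  show "res Q (idn T U) t = t" if U: "U \<in> ob T" and t: "t \<in> sects Q U" for U t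
  proof
    fix g
    show "res Q (idn T U) t g = t g"
      using idn_cmp[of g U] src_idn[OF U] quot_supp[OF t[unfolded quot_carrier], of g]
      by (simp add: quot_res_eq)
  qed
  show "res Q (cmp T f g) t = res Q g (res Q f t)"
    if f: "f \<in> into T U" and g: "g \<in> into T (src T f)" for f g U t
  proof
    fix h
    show "res Q (cmp T f g) t h = res Q g (res Q f t) h"
      using src_cmp[OF f g] cmp_assoc'[OF f g] cmp_into[OF g] by (simp add: quot_res_eq)
  qed
  show "\<exists>!x. x \<in> sects Q U \<and> (\<forall>f\<in>S. res Q f x = s f)"
    if "U \<in> ob T" "S \<in> cov T U" "\<forall>f\<in>S. s f \<in> sects Q (src T f)"
      "\<forall>f\<in>S. \<forall>g\<in>into T (src T f). res Q g (s f) = s (cmp T f g)" for U S s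
    using quot_glue that by (simp add: quot_carrier)
qed

lemma pr_add:
  assumes U: "U \<in> ob T" and x: "x \<in> sects M U" and y: "y \<in> sects M U"
  shows "pr U (x \<oplus>\<^bsub>sec M U\<^esub> y) = pr U x \<oplus>\<^bsub>sec Q U\<^esub> pr U y"
proof -
  interpret G: abelian_group "sec M U" using M.grp[OF U] .
  note p = pr_closed[OF U x] pr_closed[OF U y]
  have self: "res M g x \<in> pr U x g" if g: "g \<in> into T U" and x: "x \<in> sects M U" for g x
    using pr_mem[OF g x] eqv_refl[OF intoD(3)[OF g] M.res_closed[OF g x]] by simp
  show ?thesis
    by (rule quot_eqI[OF U pr_closed[OF U G.a_closed[OF x y]] quot_add_props(1)[OF U p]], rule loc_all[OF U])
      (use self[OF _ G.a_closed[OF x y]] quot_add_props(2)[OF U p _ self[OF _ x] self[OF _ y]]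
        M.res_plus[OF _ x y] in auto)
qed

lemma pr_hom: "sheaf_ab_hom T M Q pr"
  unfolding sheaf_ab_hom_def hom_def
  using pr_closed pr_add res_quot_pr into_self tgt_ob by (auto simp: quot_carrier)

lemma pr_eq_zero_iff:
  assumes U: "U \<in> ob T" and x: "x \<in> sects M U"
  shows "pr U x = \<zero>\<^bsub>sec Q U\<^esub> \<longleftrightarrow> x \<in> N U"
proof -
  interpret G: abelian_group "sec M U" using M.grp[OF U] .
  show ?thesis
    using pr_eq_iff[OF U x G.zero_closed] pr_zero[OF U] zero_eqv[OF U] by simp
qed

end

section \<open>Morphisms\<close>

context grothendieck_site
begin

lemma homI:
  assumes "\<And>U x. \<lbrakk>U \<in> ob T; x \<in> sects M U\<rbrakk> \<Longrightarrow> h U x \<in> sects P U"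
    and "\<And>U x y. \<lbrakk>U \<in> ob T; x \<in> sects M U; y \<in> sects M U\<rbrakk> \<Longrightarrow>
      h U (x \<oplus>\<^bsub>sec M U\<^esub> y) = h U x \<oplus>\<^bsub>sec P U\<^esub> h U y"
    and "\<And>U f x. \<lbrakk>f \<in> into T U; x \<in> sects M U\<rbrakk> \<Longrightarrow> res P f (h U x) = h (src T f) (res M f x)"
  shows "sheaf_ab_hom T M P h"
  unfolding sheaf_ab_hom_def hom_def using assms into_self by auto

lemma
  assumes "sheaf_ab_hom T M P h"
  shows hom_closed: "\<lbrakk>U \<in> ob T; x \<in> sects M U\<rbrakk> \<Longrightarrow> h U x \<in> sects P U"
    and hom_add: "\<lbrakk>U \<in> ob T; x \<in> sects M U; y \<in> sects M U\<rbrakk> \<Longrightarrow>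
      h U (x \<oplus>\<^bsub>sec M U\<^esub> y) = h U x \<oplus>\<^bsub>sec P U\<^esub> h U y"
    and hom_res: "\<lbrakk>f \<in> into T U; x \<in> sects M U\<rbrakk> \<Longrightarrow> res P f (h U x) = h (src T f) (res M f x)"
  using assms unfolding sheaf_ab_hom_def hom_def into_def by auto

lemma hom_zero:
  assumes "ab_sheaf T M" "ab_sheaf T P" "sheaf_ab_hom T M P h" "U \<in> ob T"
  shows "h U \<zero>\<^bsub>sec M U\<^esub> = \<zero>\<^bsub>sec P U\<^esub>"
proof -
  interpret A: abelian_group "sec M U" using ab_sheaf.grp[OF assms(1,4)] .
  interpret B: abelian_group "sec P U" using ab_sheaf.grp[OF assms(2,4)] .
  have c: "h U \<zero>\<^bsub>sec M U\<^esub> \<in> sects P U" using hom_closed[OF assms(3,4)] by simp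
  have "h U \<zero>\<^bsub>sec M U\<^esub> \<oplus>\<^bsub>sec P U\<^esub> h U \<zero>\<^bsub>sec M U\<^esub> = h U \<zero>\<^bsub>sec M U\<^esub>"
    using hom_add[OF assms(3,4) A.zero_closed A.zero_closed] by simp
  then show ?thesis using c by (metis B.add.l_cancel_one')
qed

lemma hom_neg:
  assumes "ab_sheaf T M" "ab_sheaf T P" "sheaf_ab_hom T M P h" "U \<in> ob T" "x \<in> sects M U"
  shows "h U (\<ominus>\<^bsub>sec M U\<^esub> x) = \<ominus>\<^bsub>sec P U\<^esub> h U x"
proof -
  interpret A: abelian_group "sec M U" using ab_sheaf.grp[OF assms(1,4)] .
  interpret B: abelian_group "sec P U" using ab_sheaf.grp[OF assms(2,4)] .
  have "h U (\<ominus>\<^bsub>sec M U\<^esub> x) \<oplus>\<^bsub>sec P U\<^esub> h U x = \<zero>\<^bsub>sec P U\<^esub>"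
    using hom_add[OF assms(3,4) A.a_inv_closed[OF assms(5)] assms(5)] hom_zero[OF assms(1-4)]
      A.l_neg[OF assms(5)] by simp
  then show ?thesis
    using hom_closed[OF assms(3,4)] assms(5) by (metis A.a_inv_closed B.minus_equality)
qed

lemma hom_minus:
  assumes "ab_sheaf T M" "ab_sheaf T P" "sheaf_ab_hom T M P h" "U \<in> ob T"
    "x \<in> sects M U" "y \<in> sects M U"
  shows "h U (x \<ominus>\<^bsub>sec M U\<^esub> y) = h U x \<ominus>\<^bsub>sec P U\<^esub> h U y"
proof -
  interpret A: abelian_group "sec M U" using ab_sheaf.grp[OF assms(1,4)] .
  show ?thesis
    using hom_add[OF assms(3-5) A.a_inv_closed[OF assms(6)]] hom_neg[OF assms(1-4,6)]
    by (simp add: a_minus_def)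
qed

lemma hom_cong:
  assumes "sheaf_ab_hom T M P h" "\<And>U x. \<lbrakk>U \<in> ob T; x \<in> sects M U\<rbrakk> \<Longrightarrow> h' U x = h U x"
    and M: "ab_sheaf T M"
  shows "sheaf_ab_hom T M P h'"
proof (rule homI)
  fix U x assume U: "U \<in> ob T" and x: "x \<in> sects M U"
  interpret A: abelian_group "sec M U" using ab_sheaf.grp[OF M U] .
  show "h' U x \<in> sects P U" using hom_closed[OF assms(1) U x] assms(2)[OF U x] by simp
  show "h' U (x \<oplus>\<^bsub>sec M U\<^esub> y) = h' U x \<oplus>\<^bsub>sec P U\<^esub> h' U y" if "y \<in> sects M U" for y
    using hom_add[OF assms(1) U x that] assms(2)[OF U] x that by simp
next
  fix U f x assume f: "f \<in> into T U" and x: "x \<in> sects M U"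
  show "res P f (h' U x) = h' (src T f) (res M f x)"
    using hom_res[OF assms(1) f x] assms(2)[OF intoD(4)[OF f] x]
      assms(2)[OF intoD(3)[OF f] ab_sheaf.res_closed[OF M f x]] by simp
qed

lemma hom_comp:
  assumes "sheaf_ab_hom T M P h" "sheaf_ab_hom T P Q k"
  shows "sheaf_ab_hom T M Q (\<lambda>U x. k U (h U x))"
  by (rule homI) (simp_all add: hom_closed[OF assms(1)] hom_closed[OF assms(2)]
      hom_add[OF assms(1)] hom_add[OF assms(2)] hom_res[OF assms(1)] hom_res[OF assms(2)] intoD)

lemma hom_subsh:
  assumes "sheaf_ab_hom T M P h" "\<And>U x. \<lbrakk>U \<in> ob T; x \<in> A U\<rbrakk> \<Longrightarrow> x \<in> sects M U"
    "\<And>U x. \<lbrakk>U \<in> ob T; x \<in> A U\<rbrakk> \<Longrightarrow> h U x \<in> B U"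
  shows "sheaf_ab_hom T (subsh M A) (subsh P B) h"
  by (rule homI) (use assms(2,3) in \<open>simp_all add: hom_add[OF assms(1)] hom_res[OF assms(1)] intoD\<close>)

lemma hom_domain:
  assumes "sheaf_ab_hom T M P h" "\<And>U x. \<lbrakk>U \<in> ob T; x \<in> A U\<rbrakk> \<Longrightarrow> x \<in> sects M U"
  shows "sheaf_ab_hom T (subsh M A) P h"
  by (rule homI) (use assms(2) in \<open>simp_all add: hom_closed[OF assms(1)] hom_add[OF assms(1)] hom_res[OF assms(1)] intoD\<close>)

lemma hom_incl:
  "(\<And>U x. \<lbrakk>U \<in> ob T; x \<in> A U\<rbrakk> \<Longrightarrow> x \<in> B U) \<Longrightarrow> sheaf_ab_hom T (subsh M A) (subsh M B) (\<lambda>U x. x)"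
  by (rule homI) simp_all

lemma trivial_kernel_inj:
  assumes M: "ab_sheaf T M" and P: "ab_sheaf T P" and h: "sheaf_ab_hom T M P h" and U: "U \<in> ob T"
    and ker: "\<And>x. \<lbrakk>x \<in> sects M U; h U x = \<zero>\<^bsub>sec P U\<^esub>\<rbrakk> \<Longrightarrow> x = \<zero>\<^bsub>sec M U\<^esub>"
  shows "inj_on (h U) (sects M U)"
proof (rule inj_onI)
  fix x y assume xy: "x \<in> sects M U" "y \<in> sects M U" "h U x = h U y"
  interpret A: abelian_group "sec M U" using ab_sheaf.grp[OF M U] .
  interpret B: abelian_group "sec P U" using ab_sheaf.grp[OF P U] .
  have "h U (x \<ominus>\<^bsub>sec M U\<^esub> y) = \<zero>\<^bsub>sec P U\<^esub>"
    using hom_minus[OF M P h U xy(1,2)] xy(3) hom_closed[OF h U xy(2)] B.add_minus_cancel(3) by simp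
  then have "x \<ominus>\<^bsub>sec M U\<^esub> y = \<zero>\<^bsub>sec M U\<^esub>" using ker A.minus_closed[OF xy(1,2)] by blast
  then show "x = y" using A.add_minus_cancel(3)[OF xy(1,2)] by blast
qed

text \<open>Injectivity makes local preimages unique, hence matching, so they glue to a preimage of
  the whole section.\<close>

lemma inj_loc_surj_bij:
  assumes M: "ab_sheaf T M" and P: "ab_sheaf T P" and h: "sheaf_ab_hom T M P h" and U: "U \<in> ob T"
    and inj: "\<And>V. V \<in> ob T \<Longrightarrow> inj_on (h V) (sects M V)"
    and surj: "\<And>y. y \<in> sects P U \<Longrightarrow> loc T U (\<lambda>f. \<exists>x\<in>sects M (src T f). res P f y = h (src T f) x)"
  shows "bij_betw (h U) (sects M U) (sects P U)"
proof -
  interpret M: ab_sheaf T M by fact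
  interpret P: ab_sheaf T P by fact
  have "\<exists>x\<in>sects M U. h U x = y" if y: "y \<in> sects P U" for y
  proof -
    obtain S where S: "S \<in> cov T U" and "\<forall>f\<in>S. \<exists>x\<in>sects M (src T f). res P f y = h (src T f) x"
      using surj[OF y] unfolding loc_def by blast
    then obtain s where s: "\<forall>f\<in>S. s f \<in> sects M (src T f)"
      and hs: "\<And>f. f \<in> S \<Longrightarrow> res P f y = h (src T f) (s f)" by metis
    have fin: "f \<in> into T U" if "f \<in> S" for f using cov_into[OF U S that] .
    have "res M g (s f) = s (cmp T f g)" if f: "f \<in> S" and g: "g \<in> into T (src T f)" for f g
    proof (rule inj_onD[OF inj[OF intoD(3)[OF g]]])
      have fg: "cmp T f g \<in> S" using cov_cmp[OF U S f g] .
      show "h (src T g) (res M g (s f)) = h (src T g) (s (cmp T f g))"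
        using hom_res[OF h g, of "s f"] s f fg hs[OF f] hs[OF fg] src_cmp[OF fin[OF f] g]
          P.res_comp[OF fin[OF f] g y] by simp
      show "res M g (s f) \<in> sects M (src T g)" using M.res_closed[OF g] s f by simp
      show "s (cmp T f g) \<in> sects M (src T g)" using s fg src_cmp[OF fin[OF f] g] by auto
    qed
    then obtain x where x: "x \<in> sects M U" "\<forall>f\<in>S. res M f x = s f"
      using M.glue[OF U S s] by blast
    have l: "loc T U (\<lambda>f. f \<in> S)" unfolding loc_def using S by blast
    have "h U x = y"
      by (rule sheaf_eqI[OF P U hom_closed[OF h U x(1)] y], rule loc_mono[OF l U])
        (use x hs hom_res[OF h _ x(1)] in auto)
    then show ?thesis using x(1) by blast
  qed
  then show ?thesis
    using inj[OF U] hom_closed[OF h U] unfolding bij_betw_def by blast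
qed

lemma iso_inverse:
  assumes M: "ab_sheaf T M" and P: "ab_sheaf T P" and h: "sheaf_ab_hom T M P h"
    and bij: "\<And>U. U \<in> ob T \<Longrightarrow> bij_betw (h U) (sects M U) (sects P U)"
  shows "sheaf_ab_hom T P M (\<lambda>U. the_inv_into (sects M U) (h U))"
proof (rule homI)
  let ?i = "\<lambda>U. the_inv_into (sects M U) (h U)"
  have inv: "?i U y \<in> sects M U" "h U (?i U y) = y" if "U \<in> ob T" "y \<in> sects P U" for U y
    using the_inv_into_into[of "h U" "sects M U" y "sects M U"] f_the_inv_into_f[of "h U" "sects M U" y]
      bij[OF that(1)] that(2) by (auto simp: bij_betw_def)
  have inv': "?i U (h U x) = x" if "U \<in> ob T" "x \<in> sects M U" for U x
    using the_inv_into_f_f[of "h U" "sects M U" x] bij[OF that(1)] that(2) by (auto simp: bij_betw_def)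
  fix U x assume U: "U \<in> ob T" and x: "x \<in> sects P U"
  interpret A: abelian_group "sec M U" using ab_sheaf.grp[OF M U] .
  show "?i U x \<in> sects M U" using inv U x by blast
  show "?i U (x \<oplus>\<^bsub>sec P U\<^esub> y) = ?i U x \<oplus>\<^bsub>sec M U\<^esub> ?i U y" if y: "y \<in> sects P U" for y
    using hom_add[OF h U inv(1)[OF U x] inv(1)[OF U y]] inv(2)[OF U x] inv(2)[OF U y]
      inv'[OF U A.a_closed[OF inv(1)[OF U x] inv(1)[OF U y]]] by simp
next
  let ?i = "\<lambda>U. the_inv_into (sects M U) (h U)"
  fix U f x assume f: "f \<in> into T U" and x: "x \<in> sects P U"
  note U = intoD(4)[OF f] and V = intoD(3)[OF f]
  have "x \<in> h U ` sects M U" by (simp only: bij_betw_imp_surj_on[OF bij[OF U]] x)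
  then obtain z where z: "z \<in> sects M U" "h U z = x" by blast
  have "?i U x = z"
    using the_inv_into_f_f[OF bij_betw_imp_inj_on[OF bij[OF U]] z(1)] z(2) by simp
  moreover have "res P f x = h (src T f) (res M f z)" using hom_res[OF h f z(1)] z(2) by simp
  ultimately show "res M f (?i U x) = ?i (src T f) (res P f x)"
    using the_inv_into_f_f[OF bij_betw_imp_inj_on[OF bij[OF V]] ab_sheaf.res_closed[OF M f z(1)]] by simp
qed

end

section \<open>Epimorphisms of sheaves\<close>

definition sheaf_epi ::
  "('o, 'm) site \<Rightarrow> ('o, 'm, 'r, 'a) msheaf \<Rightarrow> ('o, 'm, 's, 'b) msheaf \<Rightarrow> ('o \<Rightarrow> 'a \<Rightarrow> 'b) \<Rightarrow> bool"
  where "sheaf_epi T M P h \<longleftrightarrow> sheaf_ab_hom T M P h \<and> (\<forall>U\<in>ob T. \<forall>y\<in>sects P U.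
    loc T U (\<lambda>f. \<exists>x\<in>sects M (src T f). res P f y = h (src T f) x))"

lemma sheaf_epi_hom: "sheaf_epi T M P h \<Longrightarrow> sheaf_ab_hom T M P h"
  by (simp add: sheaf_epi_def)

lemma sheaf_epi_loc: "\<lbrakk>sheaf_epi T M P h; U \<in> ob T; y \<in> sects P U\<rbrakk>
    \<Longrightarrow> loc T U (\<lambda>f. \<exists>x\<in>sects M (src T f). res P f y = h (src T f) x)"
  by (simp add: sheaf_epi_def)

lemma (in quot_sheaf) pr_epi: "sheaf_epi T M Q pr"
  unfolding sheaf_epi_def using pr_hom loc_pr by (simp add: quot_carrier)

context grothendieck_site
begin

lemma epi_comp:
  assumes Q: "ab_sheaf T Q" and h: "sheaf_epi T M P h" and k: "sheaf_epi T P Q k"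
  shows "sheaf_epi T M Q (\<lambda>U x. k U (h U x))"
  unfolding sheaf_epi_def
proof (intro conjI ballI hom_comp[OF sheaf_epi_hom[OF h] sheaf_epi_hom[OF k]])
  interpret Q: ab_sheaf T Q by fact
  fix U y assume U: "U \<in> ob T" and y: "y \<in> sects Q U"
  show "loc T U (\<lambda>f. \<exists>x\<in>sects M (src T f). res Q f y = k (src T f) (h (src T f) x))"
  proof (rule loc_trans[OF U sheaf_epi_loc[OF k U y]])
    fix f assume f: "f \<in> into T U" and "\<exists>x\<in>sects P (src T f). res Q f y = k (src T f) x"
    then obtain z where z: "z \<in> sects P (src T f)" "res Q f y = k (src T f) z" by blast
    show "loc T (src T f) (\<lambda>g. \<exists>x\<in>sects M (src T (cmp T f g)).
        res Q (cmp T f g) y = k (src T (cmp T f g)) (h (src T (cmp T f g)) x))"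
    proof (rule loc_mono[OF sheaf_epi_loc[OF h intoD(3)[OF f] z(1)] intoD(3)[OF f]])
      fix g assume g: "g \<in> into T (src T f)" and "\<exists>x\<in>sects M (src T g). res P g z = h (src T g) x"
      then show "\<exists>x\<in>sects M (src T (cmp T f g)).
          res Q (cmp T f g) y = k (src T (cmp T f g)) (h (src T (cmp T f g)) x)"
        using Q.res_comp[OF f g y] z hom_res[OF sheaf_epi_hom[OF k] g z(1)] src_cmp[OF f g] by auto
    qed
  qed
qed

text \<open>Every section of \<open>Q\<close> is locally a value of the epimorphism, so a morphism
  out of a quotient is determined by what it does to classes.\<close>

lemma epi_eqI:
  assumes P: "ab_sheaf T P" and epi: "sheaf_epi T A Q \<pi>"
    and f: "sheaf_ab_hom T Q P f" and g: "sheaf_ab_hom T Q P g"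
    and eq: "\<And>V x. \<lbrakk>V \<in> ob T; x \<in> sects A V\<rbrakk> \<Longrightarrow> f V (\<pi> V x) = g V (\<pi> V x)"
    and U: "U \<in> ob T" and t: "t \<in> sects Q U"
  shows "f U t = g U t"
proof (rule sheaf_eqI[OF P U hom_closed[OF f U t] hom_closed[OF g U t]],
    rule loc_mono[OF sheaf_epi_loc[OF epi U t] U])
  fix e assume e: "e \<in> into T U" and "\<exists>x\<in>sects A (src T e). res Q e t = \<pi> (src T e) x"
  then show "res P e (f U t) = res P e (g U t)"
    using eq[OF intoD(3)[OF e]] hom_res[OF f e t] hom_res[OF g e t] by auto
qed

text \<open>The criterion behind every isomorphism of the development. On classes \<open>k\<close>
  is given by a visible map \<open>b\<close> on representatives, so it is enough that
  \<open>b\<close> is locally surjective and that its kernel dies in \<open>Q\<close>. Injectivity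
  is tested on a cover where a section has a representative.\<close>

lemma epi_bij:
  assumes Q: "ab_sheaf T Q" and P: "ab_sheaf T P"
    and epi: "sheaf_epi T A Q \<pi>" and k: "sheaf_ab_hom T Q P k" and b: "sheaf_epi T A P b"
    and eq: "\<And>V x. \<lbrakk>V \<in> ob T; x \<in> sects A V\<rbrakk> \<Longrightarrow> k V (\<pi> V x) = b V x"
    and ker: "\<And>V x. \<lbrakk>V \<in> ob T; x \<in> sects A V; b V x = \<zero>\<^bsub>sec P V\<^esub>\<rbrakk> \<Longrightarrow> \<pi> V x = \<zero>\<^bsub>sec Q V\<^esub>"
    and U: "U \<in> ob T"
  shows "bij_betw (k U) (sects Q U) (sects P U)"
proof (rule inj_loc_surj_bij[OF Q P k U])
  fix V assume V: "V \<in> ob T"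
  show "inj_on (k V) (sects Q V)"
  proof (rule trivial_kernel_inj[OF Q P k V])
    fix t assume t: "t \<in> sects Q V" and 0: "k V t = \<zero>\<^bsub>sec P V\<^esub>"
    interpret A: abelian_group "sec Q V" using ab_sheaf.grp[OF Q V] .
    show "t = \<zero>\<^bsub>sec Q V\<^esub>"
    proof (rule sheaf_eqI[OF Q V t A.zero_closed], rule loc_mono[OF sheaf_epi_loc[OF epi V t] V])
      fix e assume e: "e \<in> into T V" and "\<exists>x\<in>sects A (src T e). res Q e t = \<pi> (src T e) x"
      then obtain x where x: "x \<in> sects A (src T e)" "res Q e t = \<pi> (src T e) x" by blast
      have "b (src T e) x = \<zero>\<^bsub>sec P (src T e)\<^esub>"
        using eq[OF intoD(3)[OF e] x(1)] x(2) hom_res[OF k e t] 0 res_zero[OF P e] by simp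
      then show "res Q e t = res Q e \<zero>\<^bsub>sec Q V\<^esub>"
        using ker[OF intoD(3)[OF e] x(1)] x(2) res_zero[OF Q e] by simp
    qed
  qed
next
  fix y assume y: "y \<in> sects P U"
  show "loc T U (\<lambda>f. \<exists>x\<in>sects Q (src T f). res P f y = k (src T f) x)"
  proof (rule loc_mono[OF sheaf_epi_loc[OF b U y] U])
    fix e assume e: "e \<in> into T U" and "\<exists>x\<in>sects A (src T e). res P e y = b (src T e) x"
    then show "\<exists>x\<in>sects Q (src T e). res P e y = k (src T e) x"
      using eq[OF intoD(3)[OF e]] hom_closed[OF sheaf_epi_hom[OF epi] intoD(3)[OF e]] by metis
  qed
qed

end

section \<open>The universal property of the quotient sheaf\<close>

context quot_sheaf
begin

context
  fixes P :: "('o, 'm, 's, 'b) msheaf" and h :: "'o \<Rightarrow> 'a \<Rightarrow> 'b"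
  assumes P: "ab_sheaf T P" and h: "sheaf_ab_hom T M P h"
    and kill: "\<And>V x. \<lbrakk>V \<in> ob T; x \<in> N V\<rbrakk> \<Longrightarrow> h V x = \<zero>\<^bsub>sec P V\<^esub>"
begin

lemma hom_eqv:
  assumes V: "V \<in> ob T" and e: "eqv V x y"
  shows "h V x = h V y"
proof -
  interpret B: abelian_group "sec P V" using ab_sheaf.grp[OF P V] .
  have "h V x \<ominus>\<^bsub>sec P V\<^esub> h V y = \<zero>\<^bsub>sec P V\<^esub>"
    using e kill[OF V] hom_minus[OF ab_M P h V eqvD[OF e]] by (simp add: eqv_def)
  then show ?thesis
    using B.add_minus_cancel(3) hom_closed[OF h V] eqvD[OF e] by blast
qed

text \<open>Justifies the description in \<open>induced\<close>: the values of \<open>h\<close> on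
  chosen representatives match because \<open>h\<close> kills \<open>N\<close>, and they glue to a
  section that does not depend on the choice.\<close>

lemma induced_props:
  assumes U: "U \<in> ob T" and t: "t \<in> quot_sects T M N U"
  shows "induced T P h U t \<in> sects P U \<and> (\<forall>g\<in>into T U. \<forall>x\<in>t g. res P g (induced T P h U t) = h (src T g) x)"
proof -
  interpret P: ab_sheaf T P by (rule P)
  obtain S where S: "S \<in> cov T U" "\<forall>g\<in>S. \<exists>x. x \<in> t g"
    using quot_loc[OF t U] unfolding loc_def by blast
  then obtain r where r: "\<And>g. g \<in> S \<Longrightarrow> r g \<in> t g" by metis
  have fin: "f \<in> into T U" if "f \<in> S" for f using cov_into[OF U S(1) that] .
  have rM: "r f \<in> sects M (src T f)" if "f \<in> S" for f using quot_in[OF t fin r] that by blast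
  have "\<exists>!y. y \<in> sects P U \<and> (\<forall>f\<in>S. res P f y = h (src T f) (r f))"
  proof (rule P.glue[OF U S(1)]; intro ballI)
    fix f assume f: "f \<in> S"
    show "h (src T f) (r f) \<in> sects P (src T f)" using hom_closed[OF h intoD(3)[OF fin[OF f]] rM[OF f]] .
    fix g assume g: "g \<in> into T (src T f)"
    have "eqv (src T g) (res M g (r f)) (r (cmp T f g))"
      using quot_eqv[OF t cmp_into[OF fin[OF f] g] r[OF cov_cmp[OF U S(1) f g]]]
        quot_res[OF t fin[OF f] r[OF f] g] src_cmp[OF fin[OF f] g] by simp
    then show "res P g (h (src T f) (r f)) = h (src T (cmp T f g)) (r (cmp T f g))"
      using hom_res[OF h g rM[OF f]] hom_eqv[OF intoD(3)[OF g]] src_cmp[OF fin[OF f] g] by simp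
  qed
  then obtain y where y: "y \<in> sects P U" "\<forall>f\<in>S. res P f y = h (src T f) (r f)" by blast
  have l: "loc T U (\<lambda>f. f \<in> S)" unfolding loc_def using S by blast
  have y': "res P g y = h (src T g) x" if g: "g \<in> into T U" and x: "x \<in> t g" for g x
  proof (rule sheaf_eqI[OF P intoD(3)[OF g]])
    note xM = quot_in[OF t g x]
    show "res P g y \<in> sects P (src T g)" using P.res_closed[OF g y(1)] .
    show "h (src T g) x \<in> sects P (src T g)" using hom_closed[OF h intoD(3)[OF g] xM] .
    show "loc T (src T g) (\<lambda>f. res P f (res P g y) = res P f (h (src T g) x))"
    proof (rule loc_mono[OF loc_pullback[OF l g] intoD(3)[OF g]])
      fix k assume k: "k \<in> into T (src T g)" and gk: "cmp T g k \<in> S"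
      have "eqv (src T k) (res M k x) (r (cmp T g k))"
        using quot_eqv[OF t cmp_into[OF g k] r[OF gk]] quot_res[OF t g x k] src_cmp[OF g k] by simp
      then show "res P k (res P g y) = res P k (h (src T g) x)"
        using P.res_comp[OF g k y(1)] y(2) gk hom_res[OF h k xM] hom_eqv[OF intoD(3)[OF k]]
          src_cmp[OF g k] by simp
    qed
  qed
  have "\<exists>!y. y \<in> sects P U \<and> (\<forall>g\<in>into T U. \<forall>x\<in>t g. res P g y = h (src T g) x)"
  proof (rule ex1I[of _ y])
    show "y \<in> sects P U \<and> (\<forall>g\<in>into T U. \<forall>x\<in>t g. res P g y = h (src T g) x)" using y y' by blast
    fix z assume z: "z \<in> sects P U \<and> (\<forall>g\<in>into T U. \<forall>x\<in>t g. res P g z = h (src T g) x)"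
    show "z = y"
      by (rule sheaf_eqI[OF P U conjunct1[OF z] y(1)], rule loc_mono[OF l U]) (use z y r in auto)
  qed
  then show ?thesis
    unfolding induced_def by (rule theI')
qed

lemma induced_pr:
  assumes U: "U \<in> ob T" and x: "x \<in> sects M U"
  shows "induced T P h U (pr U x) = h U x"
proof -
  interpret P: ab_sheaf T P by (rule P)
  note p = induced_props[OF U pr_closed[OF U x]]
  show ?thesis
  proof (rule sheaf_eqI[OF P U conjunct1[OF p] hom_closed[OF h U x]], rule loc_all[OF U])
    fix g assume g: "g \<in> into T U"
    have "res M g x \<in> pr U x g"
      using pr_mem[OF g x] eqv_refl[OF intoD(3)[OF g] M.res_closed[OF g x]] by simp
    then show "res P g (induced T P h U (pr U x)) = res P g (h U x)"
      using p g hom_res[OF h g x] by auto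
  qed
qed

lemma induced_hom: "sheaf_ab_hom T Q P (induced T P h)"
proof (rule homI)
  interpret P: ab_sheaf T P by (rule P)
  let ?k = "induced T P h"
  fix U t assume U: "U \<in> ob T" and "t \<in> sects Q U"
  then have t: "t \<in> quot_sects T M N U" by (simp add: quot_carrier)
  note p = induced_props[OF U t]
  show "?k U t \<in> sects P U" using p by simp
  fix t' assume "t' \<in> sects Q U"
  then have t': "t' \<in> quot_sects T M N U" by (simp add: quot_carrier)
  note p' = induced_props[OF U t']
  note p'' = induced_props[OF U quot_add_props(1)[OF U t t']]
  interpret B: abelian_group "sec P U" using P.grp[OF U] .
  show "?k U (t \<oplus>\<^bsub>sec Q U\<^esub> t') = ?k U t \<oplus>\<^bsub>sec P U\<^esub> ?k U t'"
  proof (rule sheaf_eqI[OF P U conjunct1[OF p''] B.a_closed[OF conjunct1[OF p] conjunct1[OF p']]],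
      rule loc_mono[OF loc_conj[OF quot_loc[OF t U] quot_loc[OF t' U] U] U])
    fix g assume g: "g \<in> into T U" and "(\<exists>x. x \<in> t g) \<and> (\<exists>x. x \<in> t' g)"
    then obtain x y where xy: "x \<in> t g" "y \<in> t' g" by blast
    note a = quot_add_props(2)[OF U t t' g xy]
    show "res P g (?k U (t \<oplus>\<^bsub>sec Q U\<^esub> t')) = res P g (?k U t \<oplus>\<^bsub>sec P U\<^esub> ?k U t')"
      using p p' p'' g xy a P.res_plus[OF g conjunct1[OF p] conjunct1[OF p']]
        hom_add[OF h intoD(3)[OF g] quot_in[OF t g xy(1)] quot_in[OF t' g xy(2)]] by auto
  qed
next
  interpret P: ab_sheaf T P by (rule P)
  let ?k = "induced T P h"
  fix U f t assume f: "f \<in> into T U" and "t \<in> sects Q U"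
  then have t: "t \<in> quot_sects T M N U" by (simp add: quot_carrier)
  note U = intoD(4)[OF f] and V = intoD(3)[OF f]
  note p = induced_props[OF U t] and rt = res_quot_closed[OF f t]
  note p' = induced_props[OF V rt]
  show "res P f (?k U t) = ?k (src T f) (res Q f t)"
  proof (rule sheaf_eqI[OF P V P.res_closed[OF f conjunct1[OF p]] conjunct1[OF p']],
      rule loc_mono[OF quot_loc[OF rt V] V])
    fix g assume g: "g \<in> into T (src T f)" and "\<exists>x. x \<in> res Q f t g"
    then obtain x where x: "x \<in> res Q f t g" "x \<in> t (cmp T f g)" using mem_res_quot[OF g] by blast
    show "res P g (res P f (?k U t)) = res P g (?k (src T f) (res Q f t))"
      using p p' x g P.res_comp[OF f g conjunct1[OF p]] cmp_into[OF f g] src_cmp[OF f g] by auto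
  qed
qed

end

text \<open>Scalar multiplication of the quotient is defined by \<open>quot_gen\<close>, from which
  additivity is not visible. It is identified with the morphism induced by sending \<open>x\<close>
  to the class of its multiple by \<open>a\<close>, which is additive.\<close>

lemma pr_smult:
  assumes s: "sheaf_ab_hom T M M (\<lambda>V x. a \<odot>\<^bsub>sec M V\<^esub> x)"
    and st: "\<And>V x. \<lbrakk>V \<in> ob T; x \<in> N V\<rbrakk> \<Longrightarrow> a \<odot>\<^bsub>sec M V\<^esub> x \<in> N V"
  shows "\<lbrakk>U \<in> ob T; x \<in> sects M U\<rbrakk> \<Longrightarrow> a \<odot>\<^bsub>sec Q U\<^esub> pr U x = pr U (a \<odot>\<^bsub>sec M U\<^esub> x)"
    and "sheaf_ab_hom T Q Q (\<lambda>V t. a \<odot>\<^bsub>sec Q V\<^esub> t)"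
proof -
  let ?s = "\<lambda>V x. a \<odot>\<^bsub>sec M V\<^esub> x"
  let ?k = "induced T Q (\<lambda>V x. pr V (a \<odot>\<^bsub>sec M V\<^esub> x))"
  note h = hom_comp[OF s pr_hom]
  have kill: "pr V (a \<odot>\<^bsub>sec M V\<^esub> x) = \<zero>\<^bsub>sec Q V\<^esub>" if "V \<in> ob T" "x \<in> N V" for V x
    using pr_eq_zero_iff[OF that(1) hom_closed[OF s that(1) subsheaf_in[OF N that]]] st[OF that] by simp
  have eqv: "eqv V (?s V x) (?s V y)" if V: "V \<in> ob T" and e: "eqv V x y" for V x y
    using e hom_minus[OF ab_M ab_M s V eqvD[OF e]] st[OF V, of "x \<ominus>\<^bsub>sec M V\<^esub> y"] hom_closed[OF s V]
    by (simp add: eqv_def)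
  have eq: "a \<odot>\<^bsub>sec Q U\<^esub> t = ?k U t" if U: "U \<in> ob T" and "t \<in> sects Q U" for U t
  proof -
    have t: "t \<in> quot_sects T M N U" using that by (simp add: quot_carrier)
    have g: "a \<odot>\<^bsub>sec Q U\<^esub> t \<in> quot_sects T M N U"
        "\<And>g x. \<lbrakk>g \<in> into T U; x \<in> t g\<rbrakk> \<Longrightarrow> a \<odot>\<^bsub>sec M (src T g)\<^esub> x \<in> (a \<odot>\<^bsub>sec Q U\<^esub> t) g"
      using quot_gen_image[OF U t, of ?s] hom_closed[OF s] eqv hom_res[OF s]
      by (simp_all add: quot_def)
    note p = induced_props[OF ab_quot h kill U t]
    show ?thesis
    proof (rule quot_eqI[OF U g(1)], goal_cases)
      case 1
      then show ?case using p by (simp add: quot_carrier)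
    next
      case 2
      show ?case
      proof (rule loc_mono[OF quot_loc[OF t U] U])
        fix e assume e: "e \<in> into T U" and "\<exists>x. x \<in> t e"
        then obtain x where x: "x \<in> t e" by blast
        have sx: "a \<odot>\<^bsub>sec M (src T e)\<^esub> x \<in> sects M (src T e)"
          using hom_closed[OF s intoD(3)[OF e] quot_in[OF t e x]] .
        have "a \<odot>\<^bsub>sec M (src T e)\<^esub> x \<in> ?k U t e"
          using p e x mem_iff_pr[OF _ e sx, of "?k U t"] by (auto simp: quot_carrier)
        then show "\<exists>x. x \<in> (a \<odot>\<^bsub>sec Q U\<^esub> t) e \<and> x \<in> ?k U t e"
          using g(2)[OF e x] by blast
      qed
    qed
  qed
  show "a \<odot>\<^bsub>sec Q U\<^esub> pr U x = pr U (a \<odot>\<^bsub>sec M U\<^esub> x)" if "U \<in> ob T" "x \<in> sects M U"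
    using eq[OF that(1)] induced_pr[OF ab_quot h kill that] pr_closed[OF that] by (simp add: quot_carrier)
  show "sheaf_ab_hom T Q Q (\<lambda>V t. a \<odot>\<^bsub>sec Q V\<^esub> t)"
    by (rule hom_cong[OF induced_hom[OF ab_quot h kill] _ ab_quot]) (use eq in auto)
qed

lemma quot_map_props:
  assumes Q': "quot_sheaf T M' N'" and h: "sheaf_ab_hom T M M' h"
    and kill: "\<And>V x. \<lbrakk>V \<in> ob T; x \<in> N V\<rbrakk> \<Longrightarrow> h V x \<in> N' V"
  shows "sheaf_ab_hom T Q (quot T M' N') (quot_map T M' N' h)"
    and "\<lbrakk>U \<in> ob T; x \<in> sects M U\<rbrakk> \<Longrightarrow> quot_map T M' N' h U (pr U x) = quot_proj T M' N' U (h U x)"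
proof -
  interpret Q': quot_sheaf T M' N' by fact
  note hh = hom_comp[OF h Q'.pr_hom]
  have k: "quot_proj T M' N' V (h V x) = \<zero>\<^bsub>sec (quot T M' N') V\<^esub>" if "V \<in> ob T" "x \<in> N V" for V x
    using Q'.pr_eq_zero_iff[OF that(1) hom_closed[OF h that(1) subsheaf_in[OF N that]]] kill[OF that] by simp
  show "sheaf_ab_hom T Q (quot T M' N') (quot_map T M' N' h)"
    unfolding quot_map_def by (rule induced_hom[OF Q'.ab_quot hh k])
  show "quot_map T M' N' h U (pr U x) = quot_proj T M' N' U (h U x)" if "U \<in> ob T" "x \<in> sects M U"
    unfolding quot_map_def by (rule induced_pr[OF Q'.ab_quot hh k that])
qed

end

section \<open>Images, sums and preimages of subsheaves\<close>

definition stable :: "('o, 'm) site \<Rightarrow> ('o \<Rightarrow> 'a \<Rightarrow> 'a) \<Rightarrow> ('o \<Rightarrow> 'a set) \<Rightarrow> bool" where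
  "stable T s A \<longleftrightarrow> (\<forall>U\<in>ob T. \<forall>x\<in>A U. s U x \<in> A U)"

lemma stableD: "\<lbrakk>stable T s A; U \<in> ob T; x \<in> A U\<rbrakk> \<Longrightarrow> s U x \<in> A U"
  by (simp add: stable_def)

text \<open>A coset involves the addition and not the carrier, so one projection serves all
  subquotients with the same denominator.\<close>

lemma quot_proj_subsh [simp]: "quot_proj T (subsh M A) N = quot_proj T M N"
  by (intro ext) (simp add: quot_proj_def a_r_coset_def r_coset_def)

context grothendieck_site
begin

lemma mem_locally_in:
  "x \<in> locally_in T M A U \<longleftrightarrow> x \<in> sects M U \<and> loc T U (\<lambda>f. res M f x \<in> A (src T f))"
  by (simp add: locally_in_def loc_def)

text \<open>Locality of the result is \<open>loc_trans\<close>; two memberships are added on a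
  common cover.\<close>

lemma subsheaf_locally_in:
  assumes M: "ab_sheaf T M"
    and sub: "\<And>U x. \<lbrakk>U \<in> ob T; x \<in> A U\<rbrakk> \<Longrightarrow> x \<in> sects M U"
    and zero: "\<And>U. U \<in> ob T \<Longrightarrow> \<zero>\<^bsub>sec M U\<^esub> \<in> A U"
    and add: "\<And>U x y. \<lbrakk>U \<in> ob T; x \<in> A U; y \<in> A U\<rbrakk> \<Longrightarrow> x \<oplus>\<^bsub>sec M U\<^esub> y \<in> A U"
    and neg: "\<And>U x. \<lbrakk>U \<in> ob T; x \<in> A U\<rbrakk> \<Longrightarrow> \<ominus>\<^bsub>sec M U\<^esub> x \<in> A U"
  shows "subsheaf T M (locally_in T M A)"
  unfolding subsheaf_def
proof (intro conjI ballI allI impI)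
  interpret M: ab_sheaf T M by fact
  fix U assume U: "U \<in> ob T"
  interpret G: abelian_group "sec M U" using M.grp[OF U] .
  show "locally_in T M A U \<subseteq> sects M U" by (auto simp: mem_locally_in)
  show "\<zero>\<^bsub>sec M U\<^esub> \<in> locally_in T M A U"
    unfolding mem_locally_in
    by (intro conjI G.zero_closed loc_all[OF U]) (simp add: res_zero[OF M] zero intoD)
  show "x \<oplus>\<^bsub>sec M U\<^esub> y \<in> locally_in T M A U"
    if "x \<in> locally_in T M A U" "y \<in> locally_in T M A U" for x y
  proof -
    have x: "x \<in> sects M U" "loc T U (\<lambda>f. res M f x \<in> A (src T f))"
      and y: "y \<in> sects M U" "loc T U (\<lambda>f. res M f y \<in> A (src T f))"
      using that by (auto simp: mem_locally_in)
    have "loc T U (\<lambda>f. res M f (x \<oplus>\<^bsub>sec M U\<^esub> y) \<in> A (src T f))"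
      by (rule loc_mono[OF loc_conj[OF x(2) y(2) U] U])
        (use M.res_plus[OF _ x(1) y(1)] add intoD(3) in simp)
    then show ?thesis using x(1) y(1) by (simp add: mem_locally_in)
  qed
  show "\<ominus>\<^bsub>sec M U\<^esub> x \<in> locally_in T M A U" if "x \<in> locally_in T M A U" for x
  proof -
    have x: "x \<in> sects M U" "loc T U (\<lambda>f. res M f x \<in> A (src T f))"
      using that by (auto simp: mem_locally_in)
    have "loc T U (\<lambda>f. res M f (\<ominus>\<^bsub>sec M U\<^esub> x) \<in> A (src T f))"
      by (rule loc_mono[OF x(2) U]) (use res_neg[OF M _ x(1)] neg intoD(3) in simp)
    then show ?thesis using x(1) by (simp add: mem_locally_in)
  qed
  show "x \<in> locally_in T M A U"
    if x: "x \<in> sects M U" and l: "loc T U (\<lambda>f. res M f x \<in> locally_in T M A (src T f))" for x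
    unfolding mem_locally_in
  proof (intro conjI x loc_trans[OF U l])
    fix f assume f: "f \<in> into T U" and "res M f x \<in> locally_in T M A (src T f)"
    then have l': "loc T (src T f) (\<lambda>g. res M g (res M f x) \<in> A (src T g))" by (simp add: mem_locally_in)
    show "loc T (src T f) (\<lambda>g. res M (cmp T f g) x \<in> A (src T (cmp T f g)))"
      by (rule loc_mono[OF l' intoD(3)[OF f]]) (simp add: M.res_comp[OF f _ x] src_cmp[OF f])
  qed
next
  interpret M: ab_sheaf T M by fact
  fix U f x assume f: "f \<in> into T U" and "x \<in> locally_in T M A U"
  then have x: "x \<in> sects M U" and l: "loc T U (\<lambda>f. res M f x \<in> A (src T f))"
    by (auto simp: mem_locally_in)
  show "res M f x \<in> locally_in T M A (src T f)"
    unfolding mem_locally_in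
    by (intro conjI M.res_closed[OF f x] loc_mono[OF loc_pullback[OF l f] intoD(3)[OF f]])
      (simp add: M.res_comp[OF f _ x] src_cmp[OF f])
qed

lemma mem_sheaf_image:
  "x \<in> sheaf_image T P h A U \<longleftrightarrow> x \<in> sects P U \<and> loc T U (\<lambda>f. \<exists>a\<in>A (src T f). res P f x = h (src T f) a)"
  unfolding sheaf_image_def mem_locally_in by (simp add: image_iff)

lemma sheaf_imageI:
  assumes P: "ab_sheaf T P" and h: "sheaf_ab_hom T M P h" and A: "subsheaf T M A"
    and U: "U \<in> ob T" and a: "a \<in> A U"
  shows "h U a \<in> sheaf_image T P h A U"
proof -
  have aM: "a \<in> sects M U" using subsheaf_in[OF A U a] .
  show ?thesis
    unfolding mem_sheaf_image
    using hom_closed[OF h U aM] hom_res[OF h _ aM] subsheaf_res[OF A _ a]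
    by (intro conjI loc_all[OF U]) auto
qed

lemma subsheaf_image:
  assumes M: "ab_sheaf T M" and P: "ab_sheaf T P" and h: "sheaf_ab_hom T M P h" and A: "subsheaf T M A"
  shows "subsheaf T P (sheaf_image T P h A)"
  unfolding sheaf_image_def
proof (rule subsheaf_locally_in[OF P])
  fix U assume U: "U \<in> ob T"
  interpret G: abelian_group "sec M U" using ab_sheaf.grp[OF M U] .
  note AM = subsheaf_in[OF A U]
  show "x \<in> sects P U" if "x \<in> h U ` A U" for x
    using that hom_closed[OF h U AM] by blast
  show "\<zero>\<^bsub>sec P U\<^esub> \<in> h U ` A U"
    using hom_zero[OF M P h U] subsheaf_zero[OF A U] by (metis imageI)
  show "x \<oplus>\<^bsub>sec P U\<^esub> y \<in> h U ` A U" if "x \<in> h U ` A U" "y \<in> h U ` A U" for x y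
    using that hom_add[OF h U AM AM] subsheaf_add[OF A U] by (auto simp: image_iff) metis
  show "\<ominus>\<^bsub>sec P U\<^esub> x \<in> h U ` A U" if "x \<in> h U ` A U" for x
    using that hom_neg[OF M P h U AM] subsheaf_neg[OF A U] by (auto simp: image_iff) metis
qed

lemma image_epi:
  assumes M: "ab_sheaf T M" and P: "ab_sheaf T P" and h: "sheaf_ab_hom T M P h" and A: "subsheaf T M A"
  shows "sheaf_epi T (subsh M A) (subsh P (sheaf_image T P h A)) h"
  unfolding sheaf_epi_def
proof (intro conjI ballI hom_subsh[OF h])
  show "x \<in> sects M U" if "U \<in> ob T" "x \<in> A U" for U x using subsheaf_in[OF A that] .
  show "h U x \<in> sheaf_image T P h A U" if "U \<in> ob T" "x \<in> A U" for U x using sheaf_imageI[OF P h A that] .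
  show "loc T U (\<lambda>f. \<exists>x\<in>sects (subsh M A) (src T f). res (subsh P (sheaf_image T P h A)) f y = h (src T f) x)"
    if "U \<in> ob T" "y \<in> sects (subsh P (sheaf_image T P h A)) U" for U y
    using that by (simp add: mem_sheaf_image)
qed

text \<open>For an injective morphism local preimages glue, so the sheaf image is the plain image.
  This applies to multiplication by p^k, as Omega is torsion-free.\<close>

lemma sheaf_image_inj:
  assumes M: "ab_sheaf T M" and P: "ab_sheaf T P" and h: "sheaf_ab_hom T M P h" and A: "subsheaf T M A"
    and ker: "\<And>V x. \<lbrakk>V \<in> ob T; x \<in> sects M V; h V x = \<zero>\<^bsub>sec P V\<^esub>\<rbrakk> \<Longrightarrow> x = \<zero>\<^bsub>sec M V\<^esub>"
    and U: "U \<in> ob T"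
  shows "sheaf_image T P h A U = h U ` A U"
proof -
  note epi = image_epi[OF M P h A]
  have inj: "inj_on (h V) (A V)" if V: "V \<in> ob T" for V
    using inj_on_subset[OF trivial_kernel_inj[OF M P h V ker[OF V]]] subsheaf_in[OF A V] by blast
  have "bij_betw (h U) (sects (subsh M A) U) (sects (subsh P (sheaf_image T P h A)) U)"
    by (rule inj_loc_surj_bij[OF ab_sheaf_subsh[OF M A] ab_sheaf_subsh[OF P subsheaf_image[OF M P h A]]
          sheaf_epi_hom[OF epi] U])
      (use inj sheaf_epi_loc[OF epi U] in auto)
  then show ?thesis by (simp add: bij_betw_def)
qed

lemma mem_sheaf_sum:
  "x \<in> sheaf_sum T M A B U \<longleftrightarrow> x \<in> sects M U \<and>
    loc T U (\<lambda>f. \<exists>a\<in>A (src T f). \<exists>b\<in>B (src T f). res M f x = a \<oplus>\<^bsub>sec M (src T f)\<^esub> b)"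
  unfolding sheaf_sum_def mem_locally_in by (simp add: set_add_def set_mult_def)

lemma subsheaf_sum:
  assumes M: "ab_sheaf T M" and A: "subsheaf T M A" and B: "subsheaf T M B"
  shows "subsheaf T M (sheaf_sum T M A B)"
  unfolding sheaf_sum_def
proof (rule subsheaf_locally_in[OF M])
  fix U assume U: "U \<in> ob T"
  interpret G: abelian_group "sec M U" using ab_sheaf.grp[OF M U] .
  note AM = subsheaf_in[OF A U] and BM = subsheaf_in[OF B U]
  have mem: "z \<in> A U <+>\<^bsub>sec M U\<^esub> B U \<longleftrightarrow> (\<exists>a\<in>A U. \<exists>b\<in>B U. z = a \<oplus>\<^bsub>sec M U\<^esub> b)" for z
    by (auto simp: set_add_def set_mult_def)
  show "x \<in> sects M U" if "x \<in> A U <+>\<^bsub>sec M U\<^esub> B U" for x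
    using that AM BM unfolding mem by auto
  show "\<zero>\<^bsub>sec M U\<^esub> \<in> A U <+>\<^bsub>sec M U\<^esub> B U"
    unfolding mem using subsheaf_zero[OF A U] subsheaf_zero[OF B U] by force
  show "x \<oplus>\<^bsub>sec M U\<^esub> y \<in> A U <+>\<^bsub>sec M U\<^esub> B U"
    if xy: "x \<in> A U <+>\<^bsub>sec M U\<^esub> B U" "y \<in> A U <+>\<^bsub>sec M U\<^esub> B U" for x y
  proof -
    obtain a b a' b' where ab: "a \<in> A U" "b \<in> B U" "x = a \<oplus>\<^bsub>sec M U\<^esub> b"
      "a' \<in> A U" "b' \<in> B U" "y = a' \<oplus>\<^bsub>sec M U\<^esub> b'" using xy unfolding mem by blast
    have "x \<oplus>\<^bsub>sec M U\<^esub> y = (a \<oplus>\<^bsub>sec M U\<^esub> a') \<oplus>\<^bsub>sec M U\<^esub> (b \<oplus>\<^bsub>sec M U\<^esub> b')"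
      using ab AM BM by (simp add: G.a_ac)
    then show ?thesis unfolding mem using subsheaf_add[OF A U ab(1,4)] subsheaf_add[OF B U ab(2,5)] by blast
  qed
  show "\<ominus>\<^bsub>sec M U\<^esub> x \<in> A U <+>\<^bsub>sec M U\<^esub> B U" if x: "x \<in> A U <+>\<^bsub>sec M U\<^esub> B U" for x
  proof -
    obtain a b where ab: "a \<in> A U" "b \<in> B U" "x = a \<oplus>\<^bsub>sec M U\<^esub> b" using x unfolding mem by blast
    have "\<ominus>\<^bsub>sec M U\<^esub> x = (\<ominus>\<^bsub>sec M U\<^esub> a) \<oplus>\<^bsub>sec M U\<^esub> (\<ominus>\<^bsub>sec M U\<^esub> b)"
      using ab AM BM by (simp add: G.minus_add)
    then show ?thesis unfolding mem using subsheaf_neg[OF A U ab(1)] subsheaf_neg[OF B U ab(2)] by blast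
  qed
qed

lemma sheaf_sumI:
  assumes M: "ab_sheaf T M" and A: "subsheaf T M A" and B: "subsheaf T M B"
    and U: "U \<in> ob T" and a: "a \<in> A U" and b: "b \<in> B U"
  shows "a \<oplus>\<^bsub>sec M U\<^esub> b \<in> sheaf_sum T M A B U"
proof -
  interpret M: ab_sheaf T M by fact
  interpret G: abelian_group "sec M U" using M.grp[OF U] .
  note c = subsheaf_in[OF A U a] subsheaf_in[OF B U b]
  show ?thesis
    unfolding mem_sheaf_sum
    using c M.res_plus[OF _ c] subsheaf_res[OF A _ a] subsheaf_res[OF B _ b]
    by (intro conjI loc_all[OF U] bexI) simp_all
qed

lemma sheaf_sumI1:
  assumes M: "ab_sheaf T M" and A: "subsheaf T M A" and B: "subsheaf T M B"
    and U: "U \<in> ob T" and a: "a \<in> A U"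
  shows "a \<in> sheaf_sum T M A B U"
proof -
  interpret G: abelian_group "sec M U" using ab_sheaf.grp[OF M U] .
  show ?thesis using sheaf_sumI[OF M A B U a subsheaf_zero[OF B U]] subsheaf_in[OF A U a] by simp
qed

lemma sheaf_sumI2:
  assumes M: "ab_sheaf T M" and A: "subsheaf T M A" and B: "subsheaf T M B"
    and U: "U \<in> ob T" and b: "b \<in> B U"
  shows "b \<in> sheaf_sum T M A B U"
proof -
  interpret G: abelian_group "sec M U" using ab_sheaf.grp[OF M U] .
  show ?thesis using sheaf_sumI[OF M A B U subsheaf_zero[OF A U] b] subsheaf_in[OF B U b] by simp
qed

text \<open>An induction principle for a generated subsheaf: with a preimage subsheaf as
  \<open>C\<close> it derives a property of all sections from the generators.\<close>

lemma sheaf_sum_least: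
  assumes M: "ab_sheaf T M" and C: "subsheaf T M C"
    and A: "\<And>V x. \<lbrakk>V \<in> ob T; x \<in> A V\<rbrakk> \<Longrightarrow> x \<in> C V" and B: "\<And>V x. \<lbrakk>V \<in> ob T; x \<in> B V\<rbrakk> \<Longrightarrow> x \<in> C V"
    and U: "U \<in> ob T" and x: "x \<in> sheaf_sum T M A B U"
  shows "x \<in> C U"
proof (rule subsheaf_loc[OF C U])
  show "x \<in> sects M U" using x by (simp add: mem_sheaf_sum)
  have "loc T U (\<lambda>f. \<exists>a\<in>A (src T f). \<exists>b\<in>B (src T f). res M f x = a \<oplus>\<^bsub>sec M (src T f)\<^esub> b)"
    using x by (simp add: mem_sheaf_sum)
  then show "loc T U (\<lambda>f. res M f x \<in> C (src T f))"
    by (rule loc_mono[OF _ U]) (use A B subsheaf_add[OF C] intoD(3) in auto)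
qed

lemma sheaf_image_least:
  assumes C: "subsheaf T P C"
    and A: "\<And>V x. \<lbrakk>V \<in> ob T; x \<in> A V\<rbrakk> \<Longrightarrow> h V x \<in> C V"
    and U: "U \<in> ob T" and x: "x \<in> sheaf_image T P h A U"
  shows "x \<in> C U"
proof (rule subsheaf_loc[OF C U])
  show "x \<in> sects P U" using x by (simp add: mem_sheaf_image)
  have "loc T U (\<lambda>f. \<exists>a\<in>A (src T f). res P f x = h (src T f) a)"
    using x by (simp add: mem_sheaf_image)
  then show "loc T U (\<lambda>f. res P f x \<in> C (src T f))"
    by (rule loc_mono[OF _ U]) (use A intoD(3) in auto)
qed

lemma subsheaf_full:
  assumes M: "ab_sheaf T M"
  shows "subsheaf T M (sects M)"
  unfolding subsheaf_def
proof (intro conjI ballI allI impI)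
  fix U assume U: "U \<in> ob T"
  interpret G: abelian_group "sec M U" using ab_sheaf.grp[OF M U] .
  show "\<zero>\<^bsub>sec M U\<^esub> \<in> sects M U" by simp
  show "x \<oplus>\<^bsub>sec M U\<^esub> y \<in> sects M U" if "x \<in> sects M U" "y \<in> sects M U" for x y using that by simp
  show "\<ominus>\<^bsub>sec M U\<^esub> x \<in> sects M U" if "x \<in> sects M U" for x using that by simp
qed (simp_all add: ab_sheaf.res_closed[OF M])

lemma image_full_epi:
  assumes P: "ab_sheaf T P" and h: "sheaf_ab_hom T M P h" and M: "ab_sheaf T M"
  shows "sheaf_epi T M (subsh P (sheaf_image T P h (sects M))) h"
  unfolding sheaf_epi_def
proof (intro conjI ballI homI)
  show "h U x \<in> sects (subsh P (sheaf_image T P h (sects M))) U" if "U \<in> ob T" "x \<in> sects M U" for U x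
    using sheaf_imageI[OF P h subsheaf_full[OF M] that] by simp
qed (simp_all add: hom_add[OF h] hom_res[OF h] mem_sheaf_image)

definition res_stable :: "('o, 'm, 'r, 'b) msheaf \<Rightarrow> ('o \<Rightarrow> 'b set) \<Rightarrow> bool" where
  "res_stable M A \<longleftrightarrow> (\<forall>U. \<forall>f\<in>into T U. \<forall>x\<in>A U. x \<in> sects M U \<and> res M f x \<in> A (src T f))"

text \<open>Merges two layers of "locally" into one: the cover for the sum and the covers for the
  two summands are refined to a single cover with actual representatives.\<close>

lemma sum_of_locally_in:
  assumes M: "ab_sheaf T M" and A: "res_stable M A" and B: "res_stable M B"
    and U: "U \<in> ob T" and x: "x \<in> sheaf_sum T M (locally_in T M A) (locally_in T M B) U"
  shows "x \<in> locally_in T M (\<lambda>V. A V <+>\<^bsub>sec M V\<^esub> B V) U"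
proof -
  interpret M: ab_sheaf T M by fact
  have xM: "x \<in> sects M U" using x by (simp add: mem_sheaf_sum)
  have l: "loc T U (\<lambda>f. \<exists>a\<in>locally_in T M A (src T f). \<exists>b\<in>locally_in T M B (src T f).
      res M f x = a \<oplus>\<^bsub>sec M (src T f)\<^esub> b)"
    using x by (simp add: mem_sheaf_sum)
  show ?thesis
    unfolding mem_locally_in
  proof (intro conjI xM loc_trans[OF U l])
    fix f assume f: "f \<in> into T U" and "\<exists>a\<in>locally_in T M A (src T f). \<exists>b\<in>locally_in T M B (src T f).
        res M f x = a \<oplus>\<^bsub>sec M (src T f)\<^esub> b"
    then obtain a b where "a \<in> locally_in T M A (src T f)" "b \<in> locally_in T M B (src T f)"
      and ab: "res M f x = a \<oplus>\<^bsub>sec M (src T f)\<^esub> b" by blast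
    then have a: "a \<in> sects M (src T f)" "loc T (src T f) (\<lambda>g. res M g a \<in> A (src T g))"
      and b: "b \<in> sects M (src T f)" "loc T (src T f) (\<lambda>g. res M g b \<in> B (src T g))"
      by (auto simp: mem_locally_in)
    show "loc T (src T f) (\<lambda>g. res M (cmp T f g) x
        \<in> A (src T (cmp T f g)) <+>\<^bsub>sec M (src T (cmp T f g))\<^esub> B (src T (cmp T f g)))"
    proof (rule loc_mono[OF loc_conj[OF a(2) b(2) intoD(3)[OF f]] intoD(3)[OF f]])
      fix g assume g: "g \<in> into T (src T f)" and *: "res M g a \<in> A (src T g) \<and> res M g b \<in> B (src T g)"
      have "res M (cmp T f g) x = res M g a \<oplus>\<^bsub>sec M (src T g)\<^esub> res M g b"
        using M.res_comp[OF f g xM] ab M.res_plus[OF g a(1) b(1)] by simp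
      then show "res M (cmp T f g) x
          \<in> A (src T (cmp T f g)) <+>\<^bsub>sec M (src T (cmp T f g))\<^esub> B (src T (cmp T f g))"
        using * src_cmp[OF f g] by (auto simp: set_add_def set_mult_def)
    qed
  qed
qed

lemma res_stable_image:
  assumes "sheaf_ab_hom T M P h" "subsheaf T M A"
  shows "res_stable P (\<lambda>V. h V ` A V)"
  unfolding res_stable_def
proof (intro allI ballI, elim imageE, intro conjI)
  fix U f x a assume f: "f \<in> into T U" and a: "x = h U a" "a \<in> A U"
  note aM = subsheaf_in[OF assms(2) intoD(4)[OF f] a(2)]
  show "x \<in> sects P U" using hom_closed[OF assms(1) intoD(4)[OF f] aM] a(1) by simp
  show "res P f x \<in> h (src T f) ` A (src T f)"
    using hom_res[OF assms(1) f aM] a(1) subsheaf_res[OF assms(2) f a(2)] by simp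
qed

lemma res_stable_sum:
  assumes M: "ab_sheaf T M" and A: "res_stable M A" and B: "res_stable M B"
  shows "res_stable M (\<lambda>V. A V <+>\<^bsub>sec M V\<^esub> B V)"
  unfolding res_stable_def
proof (intro allI ballI)
  interpret M: ab_sheaf T M by fact
  fix U f x assume f: "f \<in> into T U" and "x \<in> A U <+>\<^bsub>sec M U\<^esub> B U"
  then obtain a b where ab: "a \<in> A U" "b \<in> B U" "x = a \<oplus>\<^bsub>sec M U\<^esub> b"
    by (auto simp: set_add_def set_mult_def)
  interpret G: abelian_group "sec M U" using M.grp[OF intoD(4)[OF f]] .
  have c: "a \<in> sects M U" "b \<in> sects M U" using A B f ab unfolding res_stable_def by blast+
  have "res M f a \<in> A (src T f)" "res M f b \<in> B (src T f)" using A B f ab unfolding res_stable_def by blast+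
  then show "x \<in> sects M U \<and> res M f x \<in> A (src T f) <+>\<^bsub>sec M (src T f)\<^esub> B (src T f)"
    using c ab(3) M.res_plus[OF f c] by (auto simp: set_add_def set_mult_def)
qed

section \<open>Subsheaves of subsheaves and preimages\<close>

lemma subsheaf_cancel:
  assumes M: "ab_sheaf T M" and A: "subsheaf T M A" and U: "U \<in> ob T"
    and a: "a \<in> A U" and b: "b \<in> sects M U" and ab: "a \<oplus>\<^bsub>sec M U\<^esub> b \<in> A U"
  shows "b \<in> A U"
proof -
  interpret G: abelian_group "sec M U" using ab_sheaf.grp[OF M U] .
  note aM = subsheaf_in[OF A U a]
  have "(a \<oplus>\<^bsub>sec M U\<^esub> b) \<ominus>\<^bsub>sec M U\<^esub> a = b"
    using G.add_minus_cancel(1)[OF b aM] G.a_comm[OF aM b] by simp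
  then show ?thesis using subsheaf_minus[OF A U ab a] by simp
qed

text \<open>The additive inverse is defined from the carrier, so the two inverses do not agree by
  definition when the carrier shrinks.\<close>

lemma a_inv_subsh:
  assumes M: "ab_sheaf T M" and A: "subsheaf T M A" and U: "U \<in> ob T" and x: "x \<in> A U"
  shows "\<ominus>\<^bsub>sec (subsh M A) U\<^esub> x = \<ominus>\<^bsub>sec M U\<^esub> x"
proof -
  interpret G: abelian_group "sec M U" using ab_sheaf.grp[OF M U] .
  interpret H: abelian_group "sec (subsh M A) U" using ab_sheaf.grp[OF ab_sheaf_subsh[OF M A] U] .
  show ?thesis
    using H.minus_equality[of "\<ominus>\<^bsub>sec M U\<^esub> x" x] G.l_neg[OF subsheaf_in[OF A U x]]
      subsheaf_neg[OF A U x] x by simp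
qed

lemma minus_subsh:
  assumes M: "ab_sheaf T M" and A: "subsheaf T M A" and U: "U \<in> ob T" and x: "x \<in> A U" and y: "y \<in> A U"
  shows "x \<ominus>\<^bsub>sec (subsh M A) U\<^esub> y = x \<ominus>\<^bsub>sec M U\<^esub> y"
  using a_inv_subsh[OF M A U y] by (simp add: a_minus_def)

lemma subsheaf_subsh:
  assumes M: "ab_sheaf T M" and A: "subsheaf T M A" and B: "subsheaf T M B"
    and BA: "\<And>U x. \<lbrakk>U \<in> ob T; x \<in> B U\<rbrakk> \<Longrightarrow> x \<in> A U"
  shows "subsheaf T (subsh M A) B"
  unfolding subsheaf_def
proof (intro conjI ballI allI impI)
  fix U assume U: "U \<in> ob T"
  show "B U \<subseteq> sects (subsh M A) U" using BA[OF U] by auto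
  show "\<ominus>\<^bsub>sec (subsh M A) U\<^esub> x \<in> B U" if "x \<in> B U" for x
    using a_inv_subsh[OF M A U BA[OF U that]] subsheaf_neg[OF B U that] by simp
  show "x \<in> B U" if "x \<in> sects (subsh M A) U" "loc T U (\<lambda>f. res (subsh M A) f x \<in> B (src T f))" for x
    using that subsheaf_loc[OF B U subsheaf_in[OF A U]] by simp
qed (simp_all add: subsheaf_zero[OF B] subsheaf_add[OF B] subsheaf_res[OF B])

lemma subsheaf_of_subsh:
  assumes M: "ab_sheaf T M" and A: "subsheaf T M A" and B: "subsheaf T (subsh M A) B"
  shows "subsheaf T M B"
  unfolding subsheaf_def
proof (intro conjI ballI allI impI)
  fix U assume U: "U \<in> ob T"
  have BA: "x \<in> A U" if "U \<in> ob T" "x \<in> B U" for U x using subsheaf_in[OF B that] by simp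
  show "B U \<subseteq> sects M U" using subsheaf_in[OF A U BA[OF U]] by blast
  show "\<zero>\<^bsub>sec M U\<^esub> \<in> B U" using subsheaf_zero[OF B U] by simp
  show "x \<oplus>\<^bsub>sec M U\<^esub> y \<in> B U" if "x \<in> B U" "y \<in> B U" for x y using subsheaf_add[OF B U that] by simp
  show "\<ominus>\<^bsub>sec M U\<^esub> x \<in> B U" if "x \<in> B U" for x
    using a_inv_subsh[OF M A U BA[OF U that]] subsheaf_neg[OF B U that] by simp
  show "x \<in> B U" if x: "x \<in> sects M U" and l: "loc T U (\<lambda>f. res M f x \<in> B (src T f))" for x
  proof -
    have "x \<in> A U" by (rule subsheaf_loc[OF A U x], rule loc_mono[OF l U]) (use BA intoD(3) in auto)
    then show ?thesis using subsheaf_loc[OF B U, of x] l by simp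
  qed
next
  fix U f x assume "f \<in> into T U" "x \<in> B U"
  then show "res M f x \<in> B (src T f)" using subsheaf_res[OF B] by simp
qed

lemma subsheaf_preimage:
  assumes M: "ab_sheaf T M" and P: "ab_sheaf T P" and h: "sheaf_ab_hom T M P h" and B: "subsheaf T P B"
  shows "subsheaf T M (\<lambda>U. {x \<in> sects M U. h U x \<in> B U})"
  unfolding subsheaf_def
proof (intro conjI ballI allI impI)
  fix U assume U: "U \<in> ob T"
  interpret G: abelian_group "sec M U" using ab_sheaf.grp[OF M U] .
  show "{x \<in> sects M U. h U x \<in> B U} \<subseteq> sects M U" by blast
  show "\<zero>\<^bsub>sec M U\<^esub> \<in> {x \<in> sects M U. h U x \<in> B U}"
    using hom_zero[OF M P h U] subsheaf_zero[OF B U] by simp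
  show "x \<oplus>\<^bsub>sec M U\<^esub> y \<in> {x \<in> sects M U. h U x \<in> B U}"
    if "x \<in> {x \<in> sects M U. h U x \<in> B U}" "y \<in> {x \<in> sects M U. h U x \<in> B U}" for x y
    using that hom_add[OF h U] subsheaf_add[OF B U] by simp
  show "\<ominus>\<^bsub>sec M U\<^esub> x \<in> {x \<in> sects M U. h U x \<in> B U}" if "x \<in> {x \<in> sects M U. h U x \<in> B U}" for x
    using that hom_neg[OF M P h U] subsheaf_neg[OF B U] by simp
  fix x assume x: "x \<in> sects M U"
    and l: "loc T U (\<lambda>f. res M f x \<in> {x \<in> sects M (src T f). h (src T f) x \<in> B (src T f)})"
  have "h U x \<in> B U"
    by (rule subsheaf_loc[OF B U hom_closed[OF h U x]], rule loc_mono[OF l U]) (use hom_res[OF h _ x] in auto)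
  then show "x \<in> {x \<in> sects M U. h U x \<in> B U}" using x by simp
next
  fix U f x assume "f \<in> into T U" "x \<in> {x \<in> sects M U. h U x \<in> B U}"
  then show "res M f x \<in> {x \<in> sects M (src T f). h (src T f) x \<in> B (src T f)}"
    using hom_res[OF h, of f U x] subsheaf_res[OF B, of f U "h U x"] ab_sheaf.res_closed[OF M, of f U x]
    by simp
qed

lemma stable_locally_in:
  assumes s: "sheaf_ab_hom T M M s" and A: "\<And>V x. \<lbrakk>V \<in> ob T; x \<in> A V\<rbrakk> \<Longrightarrow> s V x \<in> A V"
  shows "stable T s (locally_in T M A)"
  unfolding stable_def
proof (intro ballI)
  fix U x assume U: "U \<in> ob T" and "x \<in> locally_in T M A U"
  then have x: "x \<in> sects M U" and l: "loc T U (\<lambda>f. res M f x \<in> A (src T f))"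
    by (auto simp: mem_locally_in)
  show "s U x \<in> locally_in T M A U"
    unfolding mem_locally_in
    by (intro conjI hom_closed[OF s U x] loc_mono[OF l U])
      (use hom_res[OF s _ x] A intoD(3) in auto)
qed

lemma stable_image:
  assumes s: "sheaf_ab_hom T P P s" and A: "stable T s' A"
    and eq: "\<And>V x. \<lbrakk>V \<in> ob T; x \<in> A V\<rbrakk> \<Longrightarrow> s V (h V x) = h V (s' V x)"
  shows "stable T s (sheaf_image T P h A)"
  unfolding sheaf_image_def
  by (rule stable_locally_in[OF s]) (use eq stableD[OF A] in auto)

text \<open>Since \<open>N\<close> lies in \<open>A\<close>, a class of \<open>A'\<close> modulo
  \<open>N\<close> that meets \<open>A\<close> is contained in \<open>A\<close>. Hence a saturated
  family for \<open>A\<close> is also one for \<open>A'\<close>, and the inclusion is the identity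
  on sections.\<close>

lemma subquot_incl:
  assumes M: "ab_sheaf T M" and A: "subsheaf T M A" and A': "subsheaf T M A'" and N: "subsheaf T M N"
    and NA: "\<And>U x. \<lbrakk>U \<in> ob T; x \<in> N U\<rbrakk> \<Longrightarrow> x \<in> A U" and AA': "\<And>U x. \<lbrakk>U \<in> ob T; x \<in> A U\<rbrakk> \<Longrightarrow> x \<in> A' U"
  shows "sheaf_ab_hom T (quot T (subsh M A) N) (quot T (subsh M A') N) (\<lambda>U t. t)"
proof -
  interpret M: ab_sheaf T M by fact
  have NA': "\<And>U x. \<lbrakk>U \<in> ob T; x \<in> N U\<rbrakk> \<Longrightarrow> x \<in> A' U" using NA AA' by blast
  interpret q: quot_sheaf T "subsh M A" N
    by (intro quot_sheaf.intro grothendieck_site_axioms ab_sheaf_subsh[OF M A] quot_sheaf_axioms.intro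
        subsheaf_subsh[OF M A N NA])
  interpret q': quot_sheaf T "subsh M A'" N
    by (intro quot_sheaf.intro grothendieck_site_axioms ab_sheaf_subsh[OF M A'] quot_sheaf_axioms.intro
        subsheaf_subsh[OF M A' N NA'])
  have eqv: "q'.eqv V y x \<longleftrightarrow> q.eqv V y x" if V: "V \<in> ob T" and x: "x \<in> A V" for V x y
  proof -
    interpret G: abelian_group "sec M V" using M.grp[OF V] .
    have "y \<in> A V" if y: "y \<in> A' V" and "y \<ominus>\<^bsub>sec M V\<^esub> x \<in> N V"
    proof -
      have "(y \<ominus>\<^bsub>sec M V\<^esub> x) \<oplus>\<^bsub>sec M V\<^esub> x \<in> A V"
        using subsheaf_add[OF A V NA[OF V that(2)] x] .
      then show ?thesis
        using G.add_minus_cancel(2)[OF subsheaf_in[OF A' V y] subsheaf_in[OF A V x]] by simp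
    qed
    then show ?thesis
      using x AA'[OF V] minus_subsh[OF M A V _ x, of y] minus_subsh[OF M A' V _ AA'[OF V x], of y]
      by (auto simp: q.eqv_def q'.eqv_def)
  qed
  have sub: "t \<in> quot_sects T (subsh M A') N U"
    if U: "U \<in> ob T" and t: "t \<in> quot_sects T (subsh M A) N U" for U t
  proof (rule q'.quot_sectsI[OF U q.quot_supp[OF t] q.quot_loc[OF t U]])
    fix g x assume g: "g \<in> into T U"
    note V = intoD(3)[OF g]
    {
      assume x: "x \<in> t g"
      have xA: "x \<in> A (src T g)" using q.quot_in[OF t g x] by simp
      show "x \<in> sects (subsh M A') (src T g)" using AA'[OF V xA] by simp
      show "y \<in> t g \<longleftrightarrow> q'.eqv (src T g) y x" for y
        using q.quot_eqv[OF t g x] eqv[OF V xA] by simp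
      show "res (subsh M A') h x \<in> t (cmp T g h)" if "h \<in> into T (src T g)" for h
        using q.quot_res[OF t g x that] by simp
    }
    assume x: "x \<in> sects (subsh M A') (src T g)"
      and l: "loc T (src T g) (\<lambda>h. res (subsh M A') h x \<in> t (cmp T g h))"
    have "x \<in> A (src T g)"
    proof (rule subsheaf_loc[OF A V])
      show "x \<in> sects M (src T g)" using subsheaf_in[OF A' V] x by simp
      show "loc T (src T g) (\<lambda>h. res M h x \<in> A (src T h))"
        by (rule loc_mono[OF l V]) (use q.quot_in[OF t cmp_into[OF g]] src_cmp[OF g] in auto)
    qed
    then show "x \<in> t g" using q.quot_sat[OF t g, of x] l by simp
  qed auto
  show ?thesis
  proof (rule homI)
    show "t \<in> sects (quot T (subsh M A') N) U" if "U \<in> ob T" "t \<in> sects (quot T (subsh M A) N) U" for U t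
      using sub that by (simp add: q.quot_carrier q'.quot_carrier)
    show "t \<oplus>\<^bsub>sec (quot T (subsh M A) N) U\<^esub> t' = t \<oplus>\<^bsub>sec (quot T (subsh M A') N) U\<^esub> t'"
      if U: "U \<in> ob T" and "t \<in> sects (quot T (subsh M A) N) U" "t' \<in> sects (quot T (subsh M A) N) U" for U t t'
    proof -
      have t: "t \<in> quot_sects T (subsh M A) N U" "t' \<in> quot_sects T (subsh M A) N U"
        using that by (auto simp: q.quot_carrier)
      show ?thesis
      proof (rule q'.quot_eqI[OF U sub[OF U q.quot_add_props(1)[OF U t]]
            q'.quot_add_props(1)[OF U sub[OF U t(1)] sub[OF U t(2)]]],
          rule loc_mono[OF loc_conj[OF q.quot_loc[OF t(1) U] q.quot_loc[OF t(2) U] U] U])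
        fix g assume g: "g \<in> into T U" and "(\<exists>x. x \<in> t g) \<and> (\<exists>x. x \<in> t' g)"
        then obtain x y where xy: "x \<in> t g" "y \<in> t' g" by blast
        show "\<exists>x. x \<in> (t \<oplus>\<^bsub>sec (quot T (subsh M A) N) U\<^esub> t') g \<and> x \<in> (t \<oplus>\<^bsub>sec (quot T (subsh M A') N) U\<^esub> t') g"
          using q.quot_add_props(2)[OF U t g xy]
            q'.quot_add_props(2)[OF U sub[OF U t(1)] sub[OF U t(2)] g xy] by auto
      qed
    qed
    show "res (quot T (subsh M A') N) f t = res (quot T (subsh M A) N) f t" for f t
      by (simp add: q.quot_res_eq q'.quot_res_eq)
  qed
qed

end

section \<open>Twists leave the underlying abelian sheaves unchanged\<close>

lemma sheaf_ab_hom_twist_left [simp]: "sheaf_ab_hom T (twist n M) P h \<longleftrightarrow> sheaf_ab_hom T M P h"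
  by (simp add: sheaf_ab_hom_def hom_def)

lemma sheaf_ab_hom_twist_right [simp]: "sheaf_ab_hom T M (twist n P) h \<longleftrightarrow> sheaf_ab_hom T M P h"
  by (simp add: sheaf_ab_hom_def hom_def)

lemma sheaf_ab_hom_kmod_left [simp]: "sheaf_ab_hom T (kmod M) P h \<longleftrightarrow> sheaf_ab_hom T M P h"
  by (simp add: sheaf_ab_hom_def hom_def)

lemma sheaf_ab_hom_kmod_right [simp]: "sheaf_ab_hom T M (kmod P) h \<longleftrightarrow> sheaf_ab_hom T M P h"
  by (simp add: sheaf_ab_hom_def hom_def)

lemma abelian_group_cong_imp:
  assumes "carrier G = carrier H" "add G = add H" "zero G = zero H" "abelian_group G"
  shows "abelian_group H"
proof -
  interpret G: abelian_group G by fact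
  show ?thesis
    by (rule abelian_groupI)
      (use assms(1-3)[symmetric] G.l_neg G.a_inv_closed in \<open>auto simp: G.a_ac\<close>)
qed

lemma abelian_group_cong:
  assumes "carrier G = carrier H" "add G = add H" "zero G = zero H"
  shows "abelian_group G \<longleftrightarrow> abelian_group H"
  using abelian_group_cong_imp[of G H] abelian_group_cong_imp[of H G] assms by auto

lemma ab_sheaf_twist [simp]: "ab_sheaf T (twist n M) \<longleftrightarrow> ab_sheaf T M"
proof -
  have "abelian_group (sec (twist n M) U) \<longleftrightarrow> abelian_group (sec M U)" for U
    by (rule abelian_group_cong) simp_all
  then show ?thesis by (simp add: ab_sheaf_def)
qed

lemma (in abelian_group) add_pow_simps:
  assumes "x \<in> carrier G"
  shows "add_pow G (0::nat) x = \<zero>" "add_pow G (Suc n) x = add_pow G n x \<oplus> x" "add_pow G n x \<in> carrier G"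
  using assms by (auto simp: add.nat_pow_Suc)

lemma (in abelian_group) add_pow_additive:
  assumes "abelian_group H" "x \<in> carrier G"
    and "\<And>x. x \<in> carrier G \<Longrightarrow> h x \<in> carrier H"
    and "\<And>x y. \<lbrakk>x \<in> carrier G; y \<in> carrier G\<rbrakk> \<Longrightarrow> h (x \<oplus> y) = h x \<oplus>\<^bsub>H\<^esub> h y"
    and "h \<zero> = \<zero>\<^bsub>H\<^esub>"
  shows "h (add_pow G (n::nat) x) = add_pow H n (h x)"
proof -
  interpret H: abelian_group H by fact
  show ?thesis
    by (induction n) (use assms in \<open>simp_all add: add_pow_simps H.add_pow_simps\<close>)
qed

section \<open>The divided Frobenius\<close>

locale dRW = dR_triple D for D :: "('o, 'm, 'k::field, 'a) frob_triple" +
  assumes char_pos: "CHAR('k) > 0"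
begin

sublocale grothendieck_site "site_of D"
  by (rule site)

abbreviation "T \<equiv> site_of D"
abbreviation "\<Omega> \<equiv> Om D"
abbreviation "Sec i \<equiv> sects (Om D i)"
abbreviation "P \<equiv> pmul D"
abbreviation "d \<equiv> diff D"
abbreviation "Z \<equiv> Zsub D"
abbreviation "B \<equiv> Bsub D"

section \<open>Sections of Omega: powers of p and the differential\<close>

lemma ab_Om: "ab_sheaf T (\<Omega> i)"
  using sheaf_of_modules_imp_ab_sheaf[OF site Om_sheaf] .

lemma grp_Om: "U \<in> ob T \<Longrightarrow> abelian_group (sec (\<Omega> i) U)"
  using ab_sheaf.grp[OF ab_Om] .

lemma d_hom: "sheaf_ab_hom T (\<Omega> i) (\<Omega> (i + 1)) (d i)"
  using diff_hom by (simp add: sheaf_mod_hom_def)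

lemma d_hom': "sheaf_ab_hom T (\<Omega> (i - 1)) (\<Omega> i) (d (i - 1))"
  using d_hom[of "i - 1"] by simp

lemma phi_ab_hom: "sheaf_ab_hom T (\<Omega> i) (\<Omega> i) (phi D i)"
  using phi_hom[of i] by (simp add: sheaf_mod_hom_def)

lemma P_hom: "sheaf_ab_hom T (\<Omega> i) (\<Omega> i) (P k i)"
proof (rule homI)
  fix U x assume U: "U \<in> ob T" and x: "x \<in> Sec i U"
  interpret G: abelian_group "sec (\<Omega> i) U" using grp_Om[OF U] .
  show "P k i U x \<in> Sec i U" using x by (simp add: pmul_def)
  show "P k i U (x \<oplus>\<^bsub>sec (\<Omega> i) U\<^esub> y) = P k i U x \<oplus>\<^bsub>sec (\<Omega> i) U\<^esub> P k i U y" if "y \<in> Sec i U" for y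
    using x that by (simp add: pmul_def G.add.pow_mult_distrib G.a_comm)
next
  fix U f x assume f: "f \<in> into T U" and x: "x \<in> Sec i U"
  note U = intoD(4)[OF f] and V = intoD(3)[OF f]
  interpret G: abelian_group "sec (\<Omega> i) U" using grp_Om[OF U] .
  interpret S: ab_sheaf T "\<Omega> i" by (rule ab_Om)
  show "res (\<Omega> i) f (P k i U x) = P k i (src T f) (res (\<Omega> i) f x)"
    unfolding pmul_def
    by (rule G.add_pow_additive[OF grp_Om[OF V] x S.res_closed[OF f] S.res_plus[OF f] res_zero[OF ab_Om f]])
qed

text \<open>Additivity alone gives commutation with p^k. The lemma serves d, psi and multiplication
  by scalars.\<close>

lemma hom_P:
  assumes "sheaf_ab_hom T (\<Omega> i) (\<Omega> j) h" "U \<in> ob T" "x \<in> Sec i U"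
  shows "h U (P k i U x) = P k j U (h U x)"
proof -
  interpret G: abelian_group "sec (\<Omega> i) U" using grp_Om[OF assms(2)] .
  show ?thesis
    unfolding pmul_def
    by (rule G.add_pow_additive[OF grp_Om[OF assms(2)] assms(3) hom_closed[OF assms(1,2)]
          hom_add[OF assms(1,2)] hom_zero[OF ab_Om ab_Om assms(1,2)]])
qed

lemma P_P: "\<lbrakk>U \<in> ob T; x \<in> Sec i U\<rbrakk> \<Longrightarrow> P j i U (P k i U x) = P (j + k) i U x"
proof -
  assume U: "U \<in> ob T" and x: "x \<in> Sec i U"
  interpret G: abelian_group "sec (\<Omega> i) U" using grp_Om[OF U] .
  show ?thesis using x by (simp add: pmul_def G.add.nat_pow_pow power_add mult.commute)
qed

lemma P_0: "\<lbrakk>U \<in> ob T; x \<in> Sec i U\<rbrakk> \<Longrightarrow> P 0 i U x = x"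
proof -
  assume U: "U \<in> ob T" and x: "x \<in> Sec i U"
  interpret G: abelian_group "sec (\<Omega> i) U" using grp_Om[OF U] .
  show ?thesis using x by (simp add: pmul_def)
qed

lemmas Om_closed [simp] = hom_closed[OF P_hom] hom_closed[OF d_hom] hom_closed[OF d_hom']
lemmas P_add = hom_add[OF P_hom] and d_add = hom_add[OF d_hom] and d_add' = hom_add[OF d_hom']
lemmas d_P = hom_P[OF d_hom] and d_P' = hom_P[OF d_hom']
lemmas P_res = hom_res[OF P_hom] and d_res = hom_res[OF d_hom] and d_res' = hom_res[OF d_hom']
lemmas P_zero = hom_zero[OF ab_Om ab_Om P_hom] and d_zero = hom_zero[OF ab_Om ab_Om d_hom]
  and d_zero' = hom_zero[OF ab_Om ab_Om d_hom']
lemmas d_minus = hom_minus[OF ab_Om ab_Om d_hom]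
lemmas O_res = ab_sheaf.res_closed[OF ab_Om]

lemma O_plus [simp]: "\<lbrakk>U \<in> ob T; x \<in> Sec i U; y \<in> Sec i U\<rbrakk> \<Longrightarrow> x \<oplus>\<^bsub>sec (\<Omega> i) U\<^esub> y \<in> Sec i U"
  using abelian_groupE(1)[OF grp_Om] by blast

lemma O_zero [simp]: "U \<in> ob T \<Longrightarrow> \<zero>\<^bsub>sec (\<Omega> i) U\<^esub> \<in> Sec i U"
  using abelian_groupE(2)[OF grp_Om] by blast

lemma O_neg [simp]: "\<lbrakk>U \<in> ob T; x \<in> Sec i U\<rbrakk> \<Longrightarrow> \<ominus>\<^bsub>sec (\<Omega> i) U\<^esub> x \<in> Sec i U"
  using abelian_group.a_inv_closed[OF grp_Om] by blast

lemma O_minus [simp]: "\<lbrakk>U \<in> ob T; x \<in> Sec i U; y \<in> Sec i U\<rbrakk> \<Longrightarrow> x \<ominus>\<^bsub>sec (\<Omega> i) U\<^esub> y \<in> Sec i U"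
  by (simp add: a_minus_def)

lemma O_r_zero [simp]: "\<lbrakk>U \<in> ob T; x \<in> Sec i U\<rbrakk> \<Longrightarrow> x \<oplus>\<^bsub>sec (\<Omega> i) U\<^esub> \<zero>\<^bsub>sec (\<Omega> i) U\<^esub> = x"
  using abelian_monoid.r_zero[OF abelian_group.axioms(1)[OF grp_Om]] .

lemma dd: "\<lbrakk>U \<in> ob T; x \<in> Sec (i - 1) U\<rbrakk> \<Longrightarrow> d i U (d (i - 1) U x) = \<zero>\<^bsub>sec (\<Omega> (i + 1)) U\<^esub>"
  using diff_diff[of U x "i - 1"] by simp

lemma P_torsion: "\<lbrakk>U \<in> ob T; x \<in> Sec i U; P k i U x = \<zero>\<^bsub>sec (\<Omega> i) U\<^esub>\<rbrakk> \<Longrightarrow> x = \<zero>\<^bsub>sec (\<Omega> i) U\<^esub>"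
proof (induction k)
  case (Suc k)
  have "P 1 i U (P k i U x) = \<zero>\<^bsub>sec (\<Omega> i) U\<^esub>"
    using P_P[OF Suc.prems(1,2), of 1 k] Suc.prems(3) by simp
  then have "P k i U x = \<zero>\<^bsub>sec (\<Omega> i) U\<^esub>"
    using cond_ii_torsion[OF Suc.prems(1) Om_closed(1)[OF Suc.prems(1,2)]] by simp
  then show ?case using Suc.IH Suc.prems by blast
qed (simp add: P_0)

text \<open>Torsion-freeness in the form in which it is used: a common factor p^k may be cancelled
  from an equation of sections.\<close>

lemma P_inj:
  assumes U: "U \<in> ob T" and x: "x \<in> Sec i U" and y: "y \<in> Sec i U" and eq: "P k i U x = P k i U y"
  shows "x = y"
  by (rule inj_onD[OF trivial_kernel_inj[OF ab_Om ab_Om P_hom U P_torsion[OF U]] eq x y])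

lemma pdiv_eq: "\<lbrakk>U \<in> ob T; y \<in> Sec i U\<rbrakk> \<Longrightarrow> pdiv D k i U (P k i U y) = y"
  unfolding pdiv_def using P_inj by (intro the_equality) auto

section \<open>The subsheaves p^k Omega, Z_n and B_n\<close>

lemma full: "subsheaf T (\<Omega> i) (Sec i)"
  by (rule subsheaf_full[OF ab_Om])

lemma p_img_eq: "\<lbrakk>subsheaf T (\<Omega> i) A; U \<in> ob T\<rbrakk> \<Longrightarrow> p_img D k i A U = P k i U ` A U"
  unfolding p_img_def by (rule sheaf_image_inj[OF ab_Om ab_Om P_hom _ P_torsion])

lemma mem_pOm: "U \<in> ob T \<Longrightarrow> x \<in> pOm D k i U \<longleftrightarrow> (\<exists>y\<in>Sec i U. x = P k i U y)"
  unfolding pOm_def by (simp add: p_img_eq[OF full] image_iff)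

lemma pOmE:
  assumes "x \<in> pOm D k i U" "U \<in> ob T"
  obtains y where "y \<in> Sec i U" "x = P k i U y"
  using assms mem_pOm by auto

lemma pOmI: "\<lbrakk>U \<in> ob T; y \<in> Sec i U\<rbrakk> \<Longrightarrow> P k i U y \<in> pOm D k i U"
  by (auto simp: mem_pOm)

lemma sub_p_img: "subsheaf T (\<Omega> i) A \<Longrightarrow> subsheaf T (\<Omega> i) (p_img D k i A)"
  unfolding p_img_def by (rule subsheaf_image[OF ab_Om ab_Om P_hom])

lemma sub_pOm: "subsheaf T (\<Omega> i) (pOm D k i)"
  unfolding pOm_def by (rule sub_p_img[OF full])

lemma sub_d_img: "subsheaf T (\<Omega> (i - 1)) A \<Longrightarrow> subsheaf T (\<Omega> i) (d_img D i A)"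
  unfolding d_img_def by (rule subsheaf_image[OF ab_Om ab_Om d_hom'])

lemma d_imgI: "\<lbrakk>subsheaf T (\<Omega> (i - 1)) A; U \<in> ob T; x \<in> A U\<rbrakk> \<Longrightarrow> d (i - 1) U x \<in> d_img D i A U"
  unfolding d_img_def by (rule sheaf_imageI[OF ab_Om d_hom'])

lemma sub_Z: "subsheaf T (\<Omega> i) (Z n i)"
  unfolding Zsub_def by (rule subsheaf_preimage[OF ab_Om ab_Om d_hom sub_pOm])

lemma mem_Z: "U \<in> ob T \<Longrightarrow> x \<in> Z n i U \<longleftrightarrow> x \<in> Sec i U \<and> (\<exists>y\<in>Sec (i + 1) U. d i U x = P n (i + 1) U y)"
  by (simp add: Zsub_def mem_pOm)

lemma Z_in: "\<lbrakk>U \<in> ob T; x \<in> Z n i U\<rbrakk> \<Longrightarrow> x \<in> Sec i U"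
  by (simp add: mem_Z)

lemma Z_0: "\<lbrakk>U \<in> ob T\<rbrakk> \<Longrightarrow> Z 0 i U = Sec i U"
  by (auto simp: mem_Z) (metis Om_closed(2) P_0)

lemma Z_mono: "\<lbrakk>U \<in> ob T; x \<in> Z n i U; m \<le> n\<rbrakk> \<Longrightarrow> x \<in> Z m i U"
proof -
  assume U: "U \<in> ob T" and x: "x \<in> Z n i U" and mn: "m \<le> n"
  obtain y where "y \<in> Sec (i + 1) U" "d i U x = P n (i + 1) U y" using x mem_Z[OF U] by blast
  then have "d i U x = P m (i + 1) U (P (n - m) (i + 1) U y)" "P (n - m) (i + 1) U y \<in> Sec (i + 1) U"
    using P_P[OF U] mn U by simp_all
  then show ?thesis using x mem_Z[OF U] by blast
qed

lemma sub_B: "subsheaf T (\<Omega> i) (B n i)"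
  unfolding Bsub_def by (intro subsheaf_sum[OF ab_Om] sub_pOm sub_d_img full)

lemma B_in: "\<lbrakk>U \<in> ob T; x \<in> B n i U\<rbrakk> \<Longrightarrow> x \<in> Sec i U"
  using subsheaf_in[OF sub_B] .

lemma P_in_B: "\<lbrakk>U \<in> ob T; x \<in> Sec i U\<rbrakk> \<Longrightarrow> P n i U x \<in> B n i U"
  unfolding Bsub_def by (intro sheaf_sumI1[OF ab_Om] sub_pOm sub_d_img full pOmI)

lemma pOm_in_B: "\<lbrakk>U \<in> ob T; x \<in> pOm D n i U\<rbrakk> \<Longrightarrow> x \<in> B n i U"
  by (auto simp: mem_pOm intro: P_in_B)

lemma d_in_B: "\<lbrakk>U \<in> ob T; x \<in> Sec (i - 1) U\<rbrakk> \<Longrightarrow> d (i - 1) U x \<in> B n i U"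
  unfolding Bsub_def by (intro sheaf_sumI2[OF ab_Om] sub_pOm sub_d_img d_imgI full)

lemma B_least:
  assumes C: "subsheaf T (\<Omega> i) C"
    and P: "\<And>V x. \<lbrakk>V \<in> ob T; x \<in> Sec i V\<rbrakk> \<Longrightarrow> P n i V x \<in> C V"
    and d: "\<And>V x. \<lbrakk>V \<in> ob T; x \<in> Sec (i - 1) V\<rbrakk> \<Longrightarrow> d (i - 1) V x \<in> C V"
    and U: "U \<in> ob T" and x: "x \<in> B n i U"
  shows "x \<in> C U"
proof (rule sheaf_sum_least[OF ab_Om C _ _ U x[unfolded Bsub_def]])
  show "x \<in> C V" if "V \<in> ob T" "x \<in> pOm D n i V" for V x
    using P that by (auto simp: mem_pOm)
  show "x \<in> C V" if "V \<in> ob T" "x \<in> d_img D i (Sec (i - 1)) V" for V x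
    by (rule sheaf_image_least[OF C d that[unfolded d_img_def]])
qed

lemma B_mono:
  assumes U: "U \<in> ob T" and x: "x \<in> B n i U" and mn: "m \<le> n"
  shows "x \<in> B m i U"
proof (rule B_least[OF sub_B _ d_in_B U x])
  fix V x assume V: "V \<in> ob T" and x: "x \<in> Sec i V"
  have "P n i V x = P m i V (P (n - m) i V x)" using P_P[OF V x] mn by simp
  then show "P n i V x \<in> B m i V" using P_in_B[OF V, of "P (n - m) i V x"] V x by simp
qed

lemma P_B:
  assumes U: "U \<in> ob T" and x: "x \<in> B n i U"
  shows "P 1 i U x \<in> B (Suc n) i U"
proof -
  have "x \<in> {x \<in> Sec i U. P 1 i U x \<in> B (Suc n) i U}"
  proof (rule B_least[OF subsheaf_preimage[OF ab_Om ab_Om P_hom sub_B] _ _ U x])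
    show "P n i V y \<in> {x \<in> Sec i V. P 1 i V x \<in> B (Suc n) i V}" if "V \<in> ob T" "y \<in> Sec i V" for V y
      using that P_P[OF that, of 1 n] P_in_B[OF that, of "Suc n"] by simp
    show "d (i - 1) V y \<in> {x \<in> Sec i V. P 1 i V x \<in> B (Suc n) i V}" if "V \<in> ob T" "y \<in> Sec (i - 1) V" for V y
      using that d_P'[OF that, of 1] d_in_B[OF that(1), of "P 1 (i - 1) V y" i "Suc n"] by simp
  qed
  then show ?thesis by simp
qed

lemma B_loc:
  assumes U: "U \<in> ob T" and x: "x \<in> B n i U"
  shows "loc T U (\<lambda>f. \<exists>u\<in>Sec i (src T f). \<exists>w\<in>Sec (i - 1) (src T f).
    res (\<Omega> i) f x = P n i (src T f) u \<oplus>\<^bsub>sec (\<Omega> i) (src T f)\<^esub> d (i - 1) (src T f) w)"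
proof -
  have "x \<in> locally_in T (\<Omega> i) (\<lambda>V. P n i V ` Sec i V <+>\<^bsub>sec (\<Omega> i) V\<^esub> d (i - 1) V ` Sec (i - 1) V) U"
    by (rule sum_of_locally_in[OF ab_Om res_stable_image[OF P_hom full] res_stable_image[OF d_hom' full] U])
      (use x in \<open>simp add: Bsub_def pOm_def p_img_def d_img_def sheaf_image_def\<close>)
  then show ?thesis
    unfolding mem_locally_in by (simp add: set_add_def set_mult_def)
qed

text \<open>The divided Frobenius p^{-i} phi. In negative degrees \<open>nat i\<close> is 0 and
  nothing is divided, which is harmless because Omega^i = 0 there.\<close>

definition psi :: "int \<Rightarrow> 'o \<Rightarrow> 'a \<Rightarrow> 'a" where
  "psi i U x = pdiv D (nat i) i U (phi D i U x)"

lemma psi_eq: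
  assumes U: "U \<in> ob T" and x: "x \<in> Sec i U"
  shows "psi i U x \<in> Sec i U" and P_psi: "P (nat i) i U (psi i U x) = phi D i U x"
proof -
  obtain y where y: "y \<in> Sec i U" "phi D i U x = P (nat i) i U y"
    using cond_iii[OF U x] mem_pOm[OF U] by blast
  then have "psi i U x = y" unfolding psi_def using pdiv_eq[OF U] by simp
  then show "psi i U x \<in> Sec i U" "P (nat i) i U (psi i U x) = phi D i U x" using y by auto
qed

text \<open>Additivity and compatibility with restriction hold for phi and survive the cancellation
  of p^i.\<close>

lemma psi_hom: "sheaf_ab_hom T (\<Omega> i) (\<Omega> i) (psi i)"
proof (rule homI)
  fix U x assume U: "U \<in> ob T" and x: "x \<in> Sec i U"
  note c = psi_eq(1)[OF U]
  show "psi i U x \<in> Sec i U" using c[OF x] .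
  show "psi i U (x \<oplus>\<^bsub>sec (\<Omega> i) U\<^esub> y) = psi i U x \<oplus>\<^bsub>sec (\<Omega> i) U\<^esub> psi i U y" if y: "y \<in> Sec i U" for y
  proof (rule P_inj[OF U, of _ _ _ "nat i"])
    show "P (nat i) i U (psi i U (x \<oplus>\<^bsub>sec (\<Omega> i) U\<^esub> y)) = P (nat i) i U (psi i U x \<oplus>\<^bsub>sec (\<Omega> i) U\<^esub> psi i U y)"
      using P_add[OF U c[OF x] c[OF y]] P_psi[OF U x] P_psi[OF U y] P_psi[OF U O_plus[OF U x y]]
        hom_add[OF phi_ab_hom U x y] by simp
  qed (use c x y U in simp_all)
next
  fix U f x assume f: "f \<in> into T U" and x: "x \<in> Sec i U"
  note U = intoD(4)[OF f] and V = intoD(3)[OF f] and rx = O_res[OF f x]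
  show "res (\<Omega> i) f (psi i U x) = psi i (src T f) (res (\<Omega> i) f x)"
  proof (rule P_inj[OF V, of _ _ _ "nat i"])
    show "P (nat i) i (src T f) (res (\<Omega> i) f (psi i U x)) = P (nat i) i (src T f) (psi i (src T f) (res (\<Omega> i) f x))"
      using P_psi[OF U x] P_psi[OF V rx] P_res[OF f psi_eq(1)[OF U x], of "nat i"]
        hom_res[OF phi_ab_hom f x] by simp
  qed (use psi_eq(1) O_res[OF f] U V x rx in simp_all)
qed

lemmas psi_closed [simp] = psi_eq(1)
lemmas psi_add = hom_add[OF psi_hom] and psi_P = hom_P[OF psi_hom] and psi_res = hom_res[OF psi_hom]
  and psi_minus = hom_minus[OF ab_Om ab_Om psi_hom] and psi_zero = hom_zero[OF ab_Om ab_Om psi_hom]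

lemma d_psi:
  assumes U: "U \<in> ob T" and x: "x \<in> Sec i U"
  shows "d i U (psi i U x) = P 1 (i + 1) U (psi (i + 1) U (d i U x))"
proof (cases "i < 0")
  case True
  then have "x = \<zero>\<^bsub>sec (\<Omega> i) U\<^esub>" using cond_i[OF True U] x by simp
  then show ?thesis using U by (simp add: psi_zero d_zero P_zero)
next
  case False
  then have n: "nat (i + 1) = nat i + 1" by simp
  have dx: "d i U x \<in> Sec (i + 1) U" using U x by simp
  show ?thesis
  proof (rule P_inj[OF U, of _ _ _ "nat i"])
    have "P (nat i) (i + 1) U (d i U (psi i U x)) = d i U (phi D i U x)"
      using d_P[OF U psi_closed[OF U x], of "nat i"] P_psi[OF U x] by simp
    also have "\<dots> = phi D (i + 1) U (d i U x)" using phi_diff[OF U x] by simp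
    also have "\<dots> = P (nat i + 1) (i + 1) U (psi (i + 1) U (d i U x))"
      using P_psi[OF U dx] n by simp
    also have "\<dots> = P (nat i) (i + 1) U (P 1 (i + 1) U (psi (i + 1) U (d i U x)))"
      using P_P[OF U psi_closed[OF U dx], of "nat i" 1] by simp
    finally show "P (nat i) (i + 1) U (d i U (psi i U x))
      = P (nat i) (i + 1) U (P 1 (i + 1) U (psi (i + 1) U (d i U x)))" .
  qed (use U x dx in simp_all)
qed

lemma d_psi': "\<lbrakk>U \<in> ob T; x \<in> Sec (i - 1) U\<rbrakk> \<Longrightarrow>
    d (i - 1) U (psi (i - 1) U x) = P 1 i U (psi i U (d (i - 1) U x))"
  using d_psi[of U x "i - 1"] by simp

lemma psi_Z:
  assumes U: "U \<in> ob T" and x: "x \<in> Z n i U"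
  shows "psi i U x \<in> Z (Suc n) i U"
proof -
  obtain y where y: "y \<in> Sec (i + 1) U" "d i U x = P n (i + 1) U y" using x mem_Z[OF U] by blast
  have "d i U (psi i U x) = P (Suc n) (i + 1) U (psi (i + 1) U y)"
    using d_psi[OF U Z_in[OF U x]] y psi_P[OF U y(1)] P_P[OF U psi_closed[OF U y(1)], of 1 n] by simp
  then show ?thesis using mem_Z[OF U] psi_closed[OF U] y(1) Z_in[OF U x] by blast
qed

end

section \<open>The inverse Cartier isomorphism\<close>

context dRW
begin

section \<open>Reduction of the complex modulo p\<close>

lemma quot_Om1: "quot_sheaf T (\<Omega> i) (pOm D 1 i)"
  by (intro quot_sheaf.intro quot_sheaf_axioms.intro grothendieck_site_axioms ab_Om sub_pOm)

lemma ab_Om1: "ab_sheaf T (Om1 D i)"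
  unfolding Om1_def by (rule quot_sheaf.ab_quot[OF quot_Om1])

lemma red_epi: "sheaf_epi T (\<Omega> i) (Om1 D i) (red D i)"
  unfolding Om1_def red_def by (rule quot_sheaf.pr_epi[OF quot_Om1])

lemmas red_hom = sheaf_epi_hom[OF red_epi]
lemmas red_closed [simp] = hom_closed[OF red_hom]
lemmas red_minus = hom_minus[OF ab_Om ab_Om1 red_hom]
lemmas red_res = hom_res[OF red_hom] and red_add = hom_add[OF red_hom]

lemma red_eq_zero: "\<lbrakk>U \<in> ob T; x \<in> Sec i U\<rbrakk> \<Longrightarrow> red D i U x = \<zero>\<^bsub>sec (Om1 D i) U\<^esub> \<longleftrightarrow> x \<in> pOm D 1 i U"
  unfolding red_def Om1_def by (rule quot_sheaf.pr_eq_zero_iff[OF quot_Om1])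

lemma diff1_props:
  shows diff1_hom: "sheaf_ab_hom T (Om1 D i) (Om1 D (i + 1)) (diff1 D i)"
    and diff1_red: "\<lbrakk>U \<in> ob T; x \<in> Sec i U\<rbrakk> \<Longrightarrow> diff1 D i U (red D i U x) = red D (i + 1) U (d i U x)"
proof -
  have k: "d i V x \<in> pOm D 1 (i + 1) V" if V: "V \<in> ob T" and x: "x \<in> pOm D 1 i V" for V x
    using x d_P[OF V] V by (auto simp: mem_pOm intro!: bexI[rotated])
  show "sheaf_ab_hom T (Om1 D i) (Om1 D (i + 1)) (diff1 D i)"
    unfolding Om1_def diff1_def by (rule quot_sheaf.quot_map_props(1)[OF quot_Om1 quot_Om1 d_hom k])
  show "diff1 D i U (red D i U x) = red D (i + 1) U (d i U x)" if "U \<in> ob T" "x \<in> Sec i U"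
    unfolding diff1_def red_def by (rule quot_sheaf.quot_map_props(2)[OF quot_Om1 quot_Om1 d_hom k that])
qed

lemma diff1_hom': "sheaf_ab_hom T (Om1 D (i - 1)) (Om1 D i) (diff1 D (i - 1))"
  using diff1_hom[of "i - 1"] by simp

lemma diff1_red': "\<lbrakk>U \<in> ob T; x \<in> Sec (i - 1) U\<rbrakk> \<Longrightarrow>
    diff1 D (i - 1) U (red D (i - 1) U x) = red D i U (d (i - 1) U x)"
  using diff1_red[of U x "i - 1"] by simp

lemma sub_Ker1: "subsheaf T (Om1 D i) (Ker1 D i)"
proof -
  have eq: "Ker1 D i = (\<lambda>U. {x \<in> sects (Om1 D i) U. diff1 D i U x \<in> {\<zero>\<^bsub>sec (Om1 D (i + 1)) U\<^esub>}})"
    by (intro ext) (auto simp: Ker1_def)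
  show ?thesis
    unfolding eq by (rule subsheaf_preimage[OF ab_Om1 ab_Om1 diff1_hom subsheaf_zero_sub[OF ab_Om1]])
qed

lemma Ker1_in: "x \<in> Ker1 D i U \<Longrightarrow> x \<in> sects (Om1 D i) U"
  by (simp add: Ker1_def)

lemma red_Ker1: "\<lbrakk>U \<in> ob T; x \<in> Sec i U\<rbrakk> \<Longrightarrow> red D i U x \<in> Ker1 D i U \<longleftrightarrow> x \<in> Z 1 i U"
  by (simp add: Ker1_def diff1_red red_eq_zero Zsub_def)

lemma sub_BOm1: "subsheaf T (Om1 D i) (BOm1 D i)"
  unfolding BOm1_def by (rule subsheaf_image[OF ab_Om1 ab_Om1 diff1_hom' subsheaf_full[OF ab_Om1]])

text \<open>Reduction modulo p is an epimorphism, so boundaries of Omega_1 are reached from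
  Omega^{i-1} itself: locally each of them is the reduction of some dw.\<close>

lemma BOm1_epi: "sheaf_epi T (\<Omega> (i - 1)) (subsh (Om1 D i) (BOm1 D i)) (\<lambda>U w. red D i U (d (i - 1) U w))"
proof -
  have "sheaf_epi T (Om1 D (i - 1)) (subsh (Om1 D i) (BOm1 D i)) (diff1 D (i - 1))"
    unfolding BOm1_def by (rule image_full_epi[OF ab_Om1 diff1_hom' ab_Om1])
  from epi_comp[OF ab_sheaf_subsh[OF ab_Om1 sub_BOm1] red_epi this]
  have e: "sheaf_epi T (\<Omega> (i - 1)) (subsh (Om1 D i) (BOm1 D i))
      (\<lambda>U w. diff1 D (i - 1) U (red D (i - 1) U w))" .
  show ?thesis
    unfolding sheaf_epi_def
  proof (intro conjI ballI)
    show "sheaf_ab_hom T (\<Omega> (i - 1)) (subsh (Om1 D i) (BOm1 D i)) (\<lambda>U w. red D i U (d (i - 1) U w))"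
      by (rule hom_cong[OF sheaf_epi_hom[OF e] _ ab_Om]) (simp add: diff1_red')
    fix U y assume U: "U \<in> ob T" and y: "y \<in> sects (subsh (Om1 D i) (BOm1 D i)) U"
    show "loc T U (\<lambda>f. \<exists>x\<in>Sec (i - 1) (src T f). res (subsh (Om1 D i) (BOm1 D i)) f y
        = red D i (src T f) (d (i - 1) (src T f) x))"
      by (rule loc_mono[OF sheaf_epi_loc[OF e U y] U]) (metis diff1_red' intoD(3))
  qed
qed

lemma BOm1_loc: "\<lbrakk>U \<in> ob T; y \<in> BOm1 D i U\<rbrakk> \<Longrightarrow> loc T U (\<lambda>f. \<exists>w\<in>Sec (i - 1) (src T f).
    res (Om1 D i) f y = red D i (src T f) (d (i - 1) (src T f) w))"
  using sheaf_epi_loc[OF BOm1_epi, of U y i] by simp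

lemma red_d_BOm1: "\<lbrakk>U \<in> ob T; w \<in> Sec (i - 1) U\<rbrakk> \<Longrightarrow> red D i U (d (i - 1) U w) \<in> BOm1 D i U"
  using hom_closed[OF sheaf_epi_hom[OF BOm1_epi], of U w i] by simp

lemma BOm1_Ker1:
  assumes U: "U \<in> ob T" and y: "y \<in> BOm1 D i U"
  shows "y \<in> Ker1 D i U"
proof (rule subsheaf_loc[OF sub_Ker1 U subsheaf_in[OF sub_BOm1 U y]], rule loc_mono[OF BOm1_loc[OF U y] U])
  fix f assume f: "f \<in> into T U"
  note V = intoD(3)[OF f]
  assume "\<exists>w\<in>Sec (i - 1) (src T f). res (Om1 D i) f y = red D i (src T f) (d (i - 1) (src T f) w)"
  then obtain w where w: "w \<in> Sec (i - 1) (src T f)"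
    "res (Om1 D i) f y = red D i (src T f) (d (i - 1) (src T f) w)" by blast
  have "d (i - 1) (src T f) w \<in> Z 1 i (src T f)"
    using V w(1) dd[OF V w(1)] subsheaf_zero[OF sub_pOm V] by (simp add: Zsub_def)
  then show "res (Om1 D i) f y \<in> Ker1 D i (src T f)"
    using red_Ker1[OF V] w V by simp
qed

text \<open>For the direction from the reduction back to x: locally x and some dw have the same
  reduction, so x - dw lies in p Omega and x in B_1.\<close>

lemma red_BOm1:
  assumes U: "U \<in> ob T" and x: "x \<in> Sec i U"
  shows "red D i U x \<in> BOm1 D i U \<longleftrightarrow> x \<in> B 1 i U"
proof
  assume xB: "x \<in> B 1 i U"
  have "x \<in> {x \<in> Sec i U. red D i U x \<in> BOm1 D i U}"
  proof (rule B_least[OF subsheaf_preimage[OF ab_Om ab_Om1 red_hom sub_BOm1] _ _ U xB])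
    show "P 1 i V y \<in> {x \<in> Sec i V. red D i V x \<in> BOm1 D i V}" if "V \<in> ob T" "y \<in> Sec i V" for V y
      using that red_eq_zero[OF that(1), of "P 1 i V y" i] pOmI[OF that] subsheaf_zero[OF sub_BOm1 that(1)]
      by simp
    show "d (i - 1) V y \<in> {x \<in> Sec i V. red D i V x \<in> BOm1 D i V}" if "V \<in> ob T" "y \<in> Sec (i - 1) V" for V y
      using that red_d_BOm1 by simp
  qed
  then show "red D i U x \<in> BOm1 D i U" by simp
next
  assume b: "red D i U x \<in> BOm1 D i U"
  show "x \<in> B 1 i U"
  proof (rule subsheaf_loc[OF sub_B U x], rule loc_mono[OF BOm1_loc[OF U b] U])
    fix f assume f: "f \<in> into T U"
    note V = intoD(3)[OF f]
    assume "\<exists>w\<in>Sec (i - 1) (src T f). res (Om1 D i) f (red D i U x) = red D i (src T f) (d (i - 1) (src T f) w)"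
    then obtain w where w: "w \<in> Sec (i - 1) (src T f)"
      "res (Om1 D i) f (red D i U x) = red D i (src T f) (d (i - 1) (src T f) w)" by blast
    let ?x = "res (\<Omega> i) f x" and ?w = "d (i - 1) (src T f) w"
    have c: "?x \<in> Sec i (src T f)" "?w \<in> Sec i (src T f)" using O_res[OF f x] V w(1) by simp_all
    interpret G: abelian_group "sec (\<Omega> i) (src T f)" using grp_Om[OF V] .
    interpret H: abelian_group "sec (Om1 D i) (src T f)" using ab_sheaf.grp[OF ab_Om1 V] .
    have "red D i (src T f) (?x \<ominus>\<^bsub>sec (\<Omega> i) (src T f)\<^esub> ?w) = \<zero>\<^bsub>sec (Om1 D i) (src T f)\<^esub>"
      using red_minus[OF V c] w(2) red_res[OF f x] H.add_minus_cancel(3) c V by simp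
    then have "?x \<ominus>\<^bsub>sec (\<Omega> i) (src T f)\<^esub> ?w \<in> pOm D 1 i (src T f)"
      using red_eq_zero[OF V] c V by simp
    then have "(?x \<ominus>\<^bsub>sec (\<Omega> i) (src T f)\<^esub> ?w) \<oplus>\<^bsub>sec (\<Omega> i) (src T f)\<^esub> ?w \<in> B 1 i (src T f)"
      using subsheaf_add[OF sub_B V pOm_in_B[OF V] d_in_B[OF V w(1)]] by simp
    then show "?x \<in> B 1 i (src T f)" using G.add_minus_cancel(2)[OF c] by simp
  qed
qed

section \<open>Cohomology modulo p and the Cartier map\<close>

lemma quot_H1: "quot_sheaf T (subsh (Om1 D i) (Ker1 D i)) (BOm1 D i)"
  by (intro quot_sheaf.intro quot_sheaf_axioms.intro grothendieck_site_axioms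
      ab_sheaf_subsh[OF ab_Om1 sub_Ker1] subsheaf_subsh[OF ab_Om1 sub_Ker1 sub_BOm1 BOm1_Ker1])

lemma ab_H1: "ab_sheaf T (H1 D i)"
  unfolding H1_def by (rule quot_sheaf.ab_quot[OF quot_H1])

lemma cls1_hom: "sheaf_ab_hom T (subsh (Om1 D i) (Ker1 D i)) (H1 D i) (cls1 D i)"
  unfolding H1_def cls1_def by (rule quot_sheaf.pr_hom[OF quot_H1])

lemma cls1_eq_zero: "\<lbrakk>U \<in> ob T; x \<in> Ker1 D i U\<rbrakk> \<Longrightarrow> cls1 D i U x = \<zero>\<^bsub>sec (H1 D i) U\<^esub> \<longleftrightarrow> x \<in> BOm1 D i U"
  unfolding H1_def cls1_def using quot_sheaf.pr_eq_zero_iff[OF quot_H1, of U x i] by simp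

lemma Cinv_hom: "sheaf_ab_hom T (Om1 D i) (H1 D i) (Cinv D i)"
  using cond_iv[of i] by (simp add: sheaf_mod_iso_def sheaf_mod_hom_def)

lemma Cinv_bij: "U \<in> ob T \<Longrightarrow> bij_betw (Cinv D i U) (sects (Om1 D i) U) (sects (H1 D i) U)"
  using cond_iv[of i] by (simp add: sheaf_mod_iso_def)

text \<open>The inverse of $C^{-1}$. It turns each step of the inductive definition of $Z_n\Omega^i_1$ and
  $B_n\Omega^i_1$ into a preimage, and it induces $C$ on the quotients modulo $B\Omega^i_1$.\<close>

definition cartier :: "int \<Rightarrow> 'o \<Rightarrow> ('m \<Rightarrow> 'a set) \<Rightarrow> 'm \<Rightarrow> 'a set" where
  "cartier i U x = the_inv_into (sects (Om1 D i) U) (Cinv D i U) (cls1 D i U x)"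

lemma cartier_hom: "sheaf_ab_hom T (subsh (Om1 D i) (Ker1 D i)) (Om1 D i) (cartier i)"
  using hom_comp[OF cls1_hom iso_inverse[OF ab_Om1 ab_H1 Cinv_hom Cinv_bij]]
  unfolding cartier_def .

lemma cartier_eq_iff:
  assumes U: "U \<in> ob T" and x: "x \<in> Ker1 D i U" and y: "y \<in> sects (Om1 D i) U"
  shows "cartier i U x = y \<longleftrightarrow> cls1 D i U x = Cinv D i U y"
proof -
  have c: "cls1 D i U x \<in> sects (H1 D i) U" using hom_closed[OF cls1_hom U] x by simp
  note b = bij_betw_imp_inj_on[OF Cinv_bij[OF U]]
  have "Cinv D i U (cartier i U x) = cls1 D i U x"
    unfolding cartier_def by (rule f_the_inv_into_f_bij_betw[OF Cinv_bij[OF U]]) (use c in blast)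
  then show ?thesis
    using the_inv_into_f_f[OF b y] unfolding cartier_def by metis
qed

lemma cartier_closed [simp]: "\<lbrakk>U \<in> ob T; x \<in> Ker1 D i U\<rbrakk> \<Longrightarrow> cartier i U x \<in> sects (Om1 D i) U"
  using hom_closed[OF cartier_hom, of U x i] by simp

text \<open>Two facts determine the kernel: C^{-1} is injective, and passing to cohomology kills
  exactly the boundaries.\<close>

lemma cartier_eq_zero:
  assumes U: "U \<in> ob T" and x: "x \<in> Ker1 D i U"
  shows "cartier i U x = \<zero>\<^bsub>sec (Om1 D i) U\<^esub> \<longleftrightarrow> x \<in> BOm1 D i U"
proof -
  interpret H: abelian_group "sec (Om1 D i) U" using ab_sheaf.grp[OF ab_Om1 U] .
  show ?thesis
    using cartier_eq_iff[OF U x H.zero_closed] hom_zero[OF ab_Om1 ab_H1 Cinv_hom U]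
      cls1_eq_zero[OF U x] by simp
qed

lemma cartier_minus:
  assumes U: "U \<in> ob T" and x: "x \<in> Ker1 D i U" and y: "y \<in> Ker1 D i U"
  shows "cartier i U (x \<ominus>\<^bsub>sec (Om1 D i) U\<^esub> y) = cartier i U x \<ominus>\<^bsub>sec (Om1 D i) U\<^esub> cartier i U y"
  using hom_minus[where x = x and y = y, OF ab_sheaf_subsh[OF ab_Om1 sub_Ker1] ab_Om1 cartier_hom[of i] U] x y
    minus_subsh[OF ab_Om1 sub_Ker1 U x y] by simp

lemma cartier_res: "\<lbrakk>f \<in> into T U; x \<in> Ker1 D i U\<rbrakk> \<Longrightarrow>
    res (Om1 D i) f (cartier i U x) = cartier i (src T f) (res (Om1 D i) f x)"
  using hom_res[OF cartier_hom, of f U x i] by simp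

lemma red_psi_Ker1: "\<lbrakk>U \<in> ob T; x \<in> Sec i U\<rbrakk> \<Longrightarrow> red D i U (psi i U x) \<in> Ker1 D i U"
  using cond_v[of U x i] unfolding psi_def by blast

lemma cartier_red_psi: "\<lbrakk>U \<in> ob T; x \<in> Sec i U\<rbrakk> \<Longrightarrow> cartier i U (red D i U (psi i U x)) = red D i U x"
  using cartier_eq_iff[OF _ red_psi_Ker1, of U x i "red D i U x"] cond_v[of U x i] unfolding psi_def by simp

text \<open>Injectivity of C^{-1} in lifted form: C^{-1} of the reduction of x is the cohomology
  class of psi(x), which vanishes when psi(x) is in B_1.\<close>

lemma psi_inj:
  assumes U: "U \<in> ob T" and x: "x \<in> Sec i U" and b: "psi i U x \<in> B 1 i U"
  shows "x \<in> pOm D 1 i U"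
proof -
  have "red D i U (psi i U x) \<in> BOm1 D i U" using red_BOm1[OF U psi_closed[OF U x]] b by simp
  then have "red D i U x = \<zero>\<^bsub>sec (Om1 D i) U\<^esub>"
    using cartier_eq_zero[OF U red_psi_Ker1[OF U x]] cartier_red_psi[OF U x] by simp
  then show ?thesis using red_eq_zero[OF U x] by simp
qed

text \<open>$L_k = \psi(Z_k) + p^{k+1}\Omega^i + d\Omega^{i-1}$ turns out to be $Z_{k+1}$.\<close>

definition L :: "nat \<Rightarrow> int \<Rightarrow> 'o \<Rightarrow> 'a set" where
  "L k i = sheaf_sum T (\<Omega> i) (sheaf_image T (\<Omega> i) (psi i) (Z k i)) (B (Suc k) i)"

section \<open>The decomposition of Z_{k+1} by psi\<close>

lemma sub_psi_img: "subsheaf T (\<Omega> i) (sheaf_image T (\<Omega> i) (psi i) (Z k i))"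
  by (rule subsheaf_image[OF ab_Om ab_Om psi_hom sub_Z])

lemma sub_L: "subsheaf T (\<Omega> i) (L k i)"
  unfolding L_def by (rule subsheaf_sum[OF ab_Om sub_psi_img sub_B])

lemma psi_in_L: "\<lbrakk>U \<in> ob T; y \<in> Z k i U\<rbrakk> \<Longrightarrow> psi i U y \<in> L k i U"
  unfolding L_def by (rule sheaf_sumI1[OF ab_Om sub_psi_img sub_B _ sheaf_imageI[OF ab_Om psi_hom sub_Z]])

lemma B_in_L: "\<lbrakk>U \<in> ob T; y \<in> B (Suc k) i U\<rbrakk> \<Longrightarrow> y \<in> L k i U"
  unfolding L_def by (rule sheaf_sumI2[OF ab_Om sub_psi_img sub_B])

lemma L_least:
  assumes C: "subsheaf T (\<Omega> i) C"
    and psi: "\<And>V x. \<lbrakk>V \<in> ob T; x \<in> Z k i V\<rbrakk> \<Longrightarrow> psi i V x \<in> C V"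
    and P: "\<And>V x. \<lbrakk>V \<in> ob T; x \<in> Sec i V\<rbrakk> \<Longrightarrow> P (Suc k) i V x \<in> C V"
    and d: "\<And>V x. \<lbrakk>V \<in> ob T; x \<in> Sec (i - 1) V\<rbrakk> \<Longrightarrow> d (i - 1) V x \<in> C V"
    and U: "U \<in> ob T" and x: "x \<in> L k i U"
  shows "x \<in> C U"
proof (rule sheaf_sum_least[OF ab_Om C _ _ U x[unfolded L_def]])
  show "x \<in> C V" if "V \<in> ob T" "x \<in> sheaf_image T (\<Omega> i) (psi i) (Z k i) V" for V x
    by (rule sheaf_image_least[OF C psi that])
  show "x \<in> C V" if "V \<in> ob T" "x \<in> B (Suc k) i V" for V x
    by (rule B_least[OF C P d that])
qed

lemma L_loc:
  assumes U: "U \<in> ob T" and x: "x \<in> L k i U"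
  shows "loc T U (\<lambda>f. \<exists>y\<in>Z k i (src T f). \<exists>u\<in>Sec i (src T f). \<exists>w\<in>Sec (i - 1) (src T f).
    res (\<Omega> i) f x = psi i (src T f) y \<oplus>\<^bsub>sec (\<Omega> i) (src T f)\<^esub>
      (P (Suc k) i (src T f) u \<oplus>\<^bsub>sec (\<Omega> i) (src T f)\<^esub> d (i - 1) (src T f) w))"
proof -
  let ?B = "\<lambda>V. P (Suc k) i V ` Sec i V <+>\<^bsub>sec (\<Omega> i) V\<^esub> d (i - 1) V ` Sec (i - 1) V"
  have eq: "B (Suc k) i V \<subseteq> locally_in T (\<Omega> i) ?B V" if "V \<in> ob T" for V
    using B_loc[OF that] subsheaf_in[OF sub_B that]
    by (fastforce simp: mem_locally_in set_add_def set_mult_def)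
  have st: "res_stable (\<Omega> i) ?B"
    by (rule res_stable_sum[OF ab_Om res_stable_image[OF P_hom full] res_stable_image[OF d_hom' full]])
  have "x \<in> sheaf_sum T (\<Omega> i) (locally_in T (\<Omega> i) (\<lambda>V. psi i V ` Z k i V)) (locally_in T (\<Omega> i) ?B) U"
    unfolding mem_sheaf_sum
  proof (intro conjI)
    show "x \<in> Sec i U" using subsheaf_in[OF sub_L U x] .
    have l: "loc T U (\<lambda>f. \<exists>a\<in>sheaf_image T (\<Omega> i) (psi i) (Z k i) (src T f). \<exists>b\<in>B (Suc k) i (src T f).
        res (\<Omega> i) f x = a \<oplus>\<^bsub>sec (\<Omega> i) (src T f)\<^esub> b)"
      using x by (simp add: L_def mem_sheaf_sum)
    show "loc T U (\<lambda>f. \<exists>a\<in>locally_in T (\<Omega> i) (\<lambda>V. psi i V ` Z k i V) (src T f).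
        \<exists>b\<in>locally_in T (\<Omega> i) ?B (src T f). res (\<Omega> i) f x = a \<oplus>\<^bsub>sec (\<Omega> i) (src T f)\<^esub> b)"
      by (rule loc_mono[OF l U]) (use eq[OF intoD(3)] in \<open>unfold sheaf_image_def, blast\<close>)
  qed
  from sum_of_locally_in[OF ab_Om res_stable_image[OF psi_hom sub_Z] st U this]
  show ?thesis
    unfolding mem_locally_in by (simp add: set_add_def set_mult_def)
qed

text \<open>Surjectivity of C^{-1} in lifted form. The Cartier image of x modulo p lifts locally to
  some y; then the reduction of x - psi(y) is killed by the Cartier map, so x - psi(y) lies in
  B_1.\<close>

lemma psi_surj:
  assumes U: "U \<in> ob T" and x: "x \<in> Z 1 i U"
  shows "x \<in> L 0 i U"
proof -
  note xO = Z_in[OF U x]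
  have k: "red D i U x \<in> Ker1 D i U" using red_Ker1[OF U xO] x by simp
  show ?thesis
  proof (rule subsheaf_loc[OF sub_L U xO], rule loc_mono[OF sheaf_epi_loc[OF red_epi U cartier_closed[OF U k]] U])
    fix f assume f: "f \<in> into T U"
    note V = intoD(3)[OF f]
    assume "\<exists>y\<in>Sec i (src T f). res (Om1 D i) f (cartier i U (red D i U x)) = red D i (src T f) y"
    then obtain y where y: "y \<in> Sec i (src T f)"
      "res (Om1 D i) f (cartier i U (red D i U x)) = red D i (src T f) y" by blast
    let ?V = "src T f" and ?x = "res (\<Omega> i) f x" and ?y = "psi i (src T f) y"
    have c: "?x \<in> Sec i ?V" "?y \<in> Sec i ?V" using O_res[OF f xO] V y(1) by simp_all
    interpret G: abelian_group "sec (\<Omega> i) ?V" using grp_Om[OF V] .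
    interpret H: abelian_group "sec (Om1 D i) ?V" using ab_sheaf.grp[OF ab_Om1 V] .
    have kx: "red D i ?V ?x \<in> Ker1 D i ?V"
      using subsheaf_res[OF sub_Ker1 f k] red_res[OF f xO] by simp
    note ky = red_psi_Ker1[OF V y(1)]
    have "cartier i ?V (red D i ?V ?x) = cartier i ?V (red D i ?V ?y)"
      using cartier_res[OF f k] red_res[OF f xO] y(2) cartier_red_psi[OF V y(1)] by simp
    then have "cartier i ?V (red D i ?V ?x \<ominus>\<^bsub>sec (Om1 D i) ?V\<^esub> red D i ?V ?y) = \<zero>\<^bsub>sec (Om1 D i) ?V\<^esub>"
      using cartier_minus[OF V kx ky] H.add_minus_cancel(3) cartier_closed[OF V ky] by simp
    then have "red D i ?V (?x \<ominus>\<^bsub>sec (\<Omega> i) ?V\<^esub> ?y) \<in> BOm1 D i ?V"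
      using cartier_eq_zero[OF V subsheaf_minus[OF sub_Ker1 V kx ky]] red_minus[OF V c] by simp
    then have "?x \<ominus>\<^bsub>sec (\<Omega> i) ?V\<^esub> ?y \<in> B 1 i ?V"
      using red_BOm1[OF V] c V by simp
    then have "(?x \<ominus>\<^bsub>sec (\<Omega> i) ?V\<^esub> ?y) \<oplus>\<^bsub>sec (\<Omega> i) ?V\<^esub> ?y \<in> L 0 i ?V"
      using y(1) V by (intro subsheaf_add[OF sub_L V B_in_L[OF V] psi_in_L[OF V]]) (simp_all add: Z_0)
    then show "?x \<in> L 0 i ?V" using G.add_minus_cancel(2)[OF c] by simp
  qed
qed

text \<open>The power of p can be moved inside: p^{k+1} psi(y) = psi(p^{k+1} y), and p^{k+1} y lies
  in Z_{k+1} for every y.\<close>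

lemma P_L:
  assumes U: "U \<in> ob T" and u: "u \<in> L 0 i U"
  shows "P (Suc k) i U u \<in> L (Suc k) i U"
proof -
  have "u \<in> {u \<in> Sec i U. P (Suc k) i U u \<in> L (Suc k) i U}"
  proof (rule L_least[OF subsheaf_preimage[OF ab_Om ab_Om P_hom sub_L] _ _ _ U u])
    fix V y assume V: "V \<in> ob T"
    show "psi i V y \<in> {u \<in> Sec i V. P (Suc k) i V u \<in> L (Suc k) i V}" if "y \<in> Z 0 i V"
    proof -
      have y: "y \<in> Sec i V" using Z_in[OF V that] .
      have "P (Suc k) i V y \<in> Z (Suc k) i V"
        using V y d_P[OF V y, of "Suc k"] by (auto simp: mem_Z)
      then have "psi i V (P (Suc k) i V y) \<in> L (Suc k) i V" using psi_in_L[OF V] by blast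
      then show ?thesis using psi_P[OF V y] V y by simp
    qed
    show "P (Suc 0) i V y \<in> {u \<in> Sec i V. P (Suc k) i V u \<in> L (Suc k) i V}" if y: "y \<in> Sec i V"
      using B_in_L[OF V P_in_B[OF V y]] P_P[OF V y, of "Suc k" "Suc 0"] V y by simp
    show "d (i - 1) V y \<in> {u \<in> Sec i V. P (Suc k) i V u \<in> L (Suc k) i V}" if y: "y \<in> Sec (i - 1) V"
      using B_in_L[OF V d_in_B[OF V, of "P (Suc k) (i - 1) V y" i]] d_P'[OF V y, of "Suc k"] V y by simp
  qed
  then show ?thesis by simp
qed

text \<open>Write dy = p^k e. The differential of the element is p^{k+1} (psi(e) + du), and
  divisibility by p^{k+2} forces psi(e) + du into p Omega. Then psi(e) lies in B_1, so p divides e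
  and y is in Z_{k+1}. Hence p also divides du, so u is in Z_1, which is contained in L_0, and
  p^{k+1} u is absorbed into L_{k+1}.\<close>

lemma Z_L_step:
  assumes V: "V \<in> ob T" and y: "y \<in> Z k i V" and u: "u \<in> Sec i V" and w: "w \<in> Sec (i - 1) V"
    and x: "psi i V y \<oplus>\<^bsub>sec (\<Omega> i) V\<^esub> (P (Suc k) i V u \<oplus>\<^bsub>sec (\<Omega> i) V\<^esub> d (i - 1) V w) \<in> Z (Suc (Suc k)) i V"
  shows "psi i V y \<oplus>\<^bsub>sec (\<Omega> i) V\<^esub> (P (Suc k) i V u \<oplus>\<^bsub>sec (\<Omega> i) V\<^esub> d (i - 1) V w) \<in> L (Suc k) i V"
proof -
  interpret G: abelian_group "sec (\<Omega> (i + 1)) V" using grp_Om[OF V] .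
  have yO: "y \<in> Sec i V" using Z_in[OF V y] .
  obtain e where e: "e \<in> Sec (i + 1) V" "d i V y = P k (i + 1) V e" using y mem_Z[OF V] by auto
  obtain v where v: "v \<in> Sec (i + 1) V"
    "d i V (psi i V y \<oplus>\<^bsub>sec (\<Omega> i) V\<^esub> (P (Suc k) i V u \<oplus>\<^bsub>sec (\<Omega> i) V\<^esub> d (i - 1) V w)) = P (Suc (Suc k)) (i + 1) V v"
    using x mem_Z[OF V] by auto
  let ?pe = "psi (i + 1) V e"
  have dpsi: "d i V (psi i V y) = P (Suc k) (i + 1) V ?pe"
    using d_psi[OF V yO] e psi_P[OF V e(1)] P_P[OF V psi_closed[OF V e(1)], of 1 k] by simp
  have "P (Suc k) (i + 1) V (?pe \<oplus>\<^bsub>sec (\<Omega> (i + 1)) V\<^esub> d i V u)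
    = d i V (psi i V y \<oplus>\<^bsub>sec (\<Omega> i) V\<^esub> (P (Suc k) i V u \<oplus>\<^bsub>sec (\<Omega> i) V\<^esub> d (i - 1) V w))"
    using V yO u w e(1) by (simp add: d_add P_add dpsi d_P dd)
  also have "\<dots> = P (Suc k) (i + 1) V (P 1 (i + 1) V v)"
    using v P_P[OF V v(1), of "Suc k" 1] by simp
  \<comment> \<open>Cancelling p^{k+1} leaves a congruence modulo p, to which the injectivity of
    C^{-1} applies.\<close>
  finally have eq: "?pe \<oplus>\<^bsub>sec (\<Omega> (i + 1)) V\<^esub> d i V u = P 1 (i + 1) V v"
    by (rule P_inj[OF V, rotated 2]) (use V u v(1) e(1) in simp_all)
  have eq': "d i V u \<oplus>\<^bsub>sec (\<Omega> (i + 1)) V\<^esub> ?pe \<in> B 1 (i + 1) V"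
    using eq P_in_B[OF V v(1), of 1] G.a_comm[of ?pe "d i V u"] V u e(1) by simp
  have "d i V u \<in> B 1 (i + 1) V" using d_in_B[OF V, of u "i + 1" 1] u by simp
  from subsheaf_cancel[OF ab_Om sub_B V this _ eq'] have "?pe \<in> B 1 (i + 1) V" using V e(1) by simp
  then obtain e' where e': "e' \<in> Sec (i + 1) V" "e = P 1 (i + 1) V e'"
    using psi_inj[OF V e(1)] mem_pOm[OF V] by blast
  have yZ: "y \<in> Z (Suc k) i V"
    using e e' P_P[OF V e'(1), of k 1] yO mem_Z[OF V] by auto
  \<comment> \<open>Since p divides e it also divides psi(e), so du alone is divisible by p.\<close>
  have "?pe \<in> pOm D 1 (i + 1) V"
    using e' psi_P[OF V e'(1)] pOmI[OF V psi_closed[OF V e'(1)]] by simp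
  from subsheaf_cancel[OF ab_Om sub_pOm V this, of "d i V u"] have "d i V u \<in> pOm D 1 (i + 1) V"
    using V u eq pOmI[OF V v(1)] by simp
  then have "u \<in> Z 1 i V" using u by (simp add: Zsub_def)
  then have uL: "P (Suc k) i V u \<in> L (Suc k) i V" using P_L[OF V psi_surj[OF V]] by blast
  show ?thesis
    using psi_in_L[OF V yZ] uL B_in_L[OF V d_in_B[OF V w]]
    by (intro subsheaf_add[OF sub_L V])
qed

text \<open>Z_{k+2} is contained in Z_{k+1}, so the induction hypothesis already decomposes x one
  level lower. \<open>Z_L_step\<close> improves this decomposition on a cover.\<close>

lemma Z_L: "\<lbrakk>U \<in> ob T; x \<in> Z (Suc k) i U\<rbrakk> \<Longrightarrow> x \<in> L k i U"
proof (induction k arbitrary: U x)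
  case 0
  then show ?case using psi_surj by simp
next
  case (Suc k)
  have x': "x \<in> L k i U" using Suc.IH[OF Suc.prems(1)] Z_mono[OF Suc.prems] by simp
  show ?case
  proof (rule subsheaf_loc[OF sub_L Suc.prems(1) Z_in[OF Suc.prems]], rule loc_mono[OF L_loc[OF Suc.prems(1) x'] Suc.prems(1)])
    fix f assume f: "f \<in> into T U"
    assume "\<exists>y\<in>Z k i (src T f). \<exists>u\<in>Sec i (src T f). \<exists>w\<in>Sec (i - 1) (src T f).
      res (\<Omega> i) f x = psi i (src T f) y \<oplus>\<^bsub>sec (\<Omega> i) (src T f)\<^esub>
      (P (Suc k) i (src T f) u \<oplus>\<^bsub>sec (\<Omega> i) (src T f)\<^esub> d (i - 1) (src T f) w)"
    then show "res (\<Omega> i) f x \<in> L (Suc k) i (src T f)"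
      using Z_L_step[OF intoD(3)[OF f]] subsheaf_res[OF sub_Z f Suc.prems(2)] by metis
  qed
qed

text \<open>Such a w lies in Z_1, so locally w = psi(a) + p b + d c. Applying d and cancelling the
  factor p of d psi = p psi d leaves v = psi(da) + db.\<close>

lemma div_d_loc:
  assumes U: "U \<in> ob T" and w: "w \<in> Sec (i - 1) U" and v: "v \<in> Sec i U" and dw: "d (i - 1) U w = P 1 i U v"
  shows "loc T U (\<lambda>f. \<exists>a\<in>Sec (i - 1) (src T f). \<exists>b\<in>Sec (i - 1) (src T f).
    res (\<Omega> i) f v = psi i (src T f) (d (i - 1) (src T f) a) \<oplus>\<^bsub>sec (\<Omega> i) (src T f)\<^esub> d (i - 1) (src T f) b)"
proof -
  have wZ: "w \<in> Z 1 (i - 1) U" using w v dw mem_Z[OF U, of w 1 "i - 1"] by auto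
  show ?thesis
  proof (rule loc_mono[OF L_loc[OF U psi_surj[OF U wZ]] U])
    fix f assume f: "f \<in> into T U"
    note V = intoD(3)[OF f]
    let ?V = "src T f"
    assume "\<exists>y\<in>Z 0 (i - 1) ?V. \<exists>u\<in>Sec (i - 1) ?V. \<exists>w'\<in>Sec (i - 1 - 1) ?V.
      res (\<Omega> (i - 1)) f w = psi (i - 1) ?V y \<oplus>\<^bsub>sec (\<Omega> (i - 1)) ?V\<^esub>
      (P (Suc 0) (i - 1) ?V u \<oplus>\<^bsub>sec (\<Omega> (i - 1)) ?V\<^esub> d (i - 1 - 1) ?V w')"
    then obtain y u c where y: "y \<in> Sec (i - 1) ?V" and u: "u \<in> Sec (i - 1) ?V" and c: "c \<in> Sec (i - 1 - 1) ?V"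
      and eq: "res (\<Omega> (i - 1)) f w = psi (i - 1) ?V y \<oplus>\<^bsub>sec (\<Omega> (i - 1)) ?V\<^esub>
      (P (Suc 0) (i - 1) ?V u \<oplus>\<^bsub>sec (\<Omega> (i - 1)) ?V\<^esub> d (i - 1 - 1) ?V c)"
      using Z_in[OF V] by blast
    define c' where "c' = d (i - 1 - 1) ?V c"
    have c': "c' \<in> Sec (i - 1) ?V" using Om_closed(3)[OF V c] by (simp add: c'_def)
    have ddc: "d (i - 1) ?V c' = \<zero>\<^bsub>sec (\<Omega> i) ?V\<^esub>" using dd[OF V c] by (simp add: c'_def)
    have "P 1 i ?V (res (\<Omega> i) f v) = d (i - 1) ?V (res (\<Omega> (i - 1)) f w)"
      using P_res[OF f v, of 1] d_res'[OF f w] dw by simp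
    also have "\<dots> = P 1 i ?V (psi i ?V (d (i - 1) ?V y) \<oplus>\<^bsub>sec (\<Omega> i) ?V\<^esub> d (i - 1) ?V u)"
      unfolding eq c'_def[symmetric] using V y u c' by (simp add: d_add' d_psi' d_P' ddc P_add)
    finally have "res (\<Omega> i) f v = psi i ?V (d (i - 1) ?V y) \<oplus>\<^bsub>sec (\<Omega> i) ?V\<^esub> d (i - 1) ?V u"
      by (rule P_inj[OF V, rotated 2]) (use V y u O_res[OF f v] in simp_all)
    then show "\<exists>a\<in>Sec (i - 1) ?V. \<exists>b\<in>Sec (i - 1) ?V.
        res (\<Omega> i) f v = psi i ?V (d (i - 1) ?V a) \<oplus>\<^bsub>sec (\<Omega> i) ?V\<^esub> d (i - 1) ?V b"
      using y u by blast
  qed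
qed

text \<open>Moving psi(da) to the left leaves only terms of B_{m+1} on the right.\<close>

lemma psi_B_step:
  assumes V: "V \<in> ob T" and z: "z \<in> Sec i V" and u: "u \<in> Sec i V" and a: "a \<in> Sec (i - 1) V" and b: "b \<in> Sec (i - 1) V"
    and eq: "psi i V z = P (Suc m) i V u \<oplus>\<^bsub>sec (\<Omega> i) V\<^esub> (psi i V (d (i - 1) V a) \<oplus>\<^bsub>sec (\<Omega> i) V\<^esub> d (i - 1) V b)"
  shows "psi i V (z \<ominus>\<^bsub>sec (\<Omega> i) V\<^esub> d (i - 1) V a) \<in> B (Suc m) i V"
proof -
  interpret G: abelian_group "sec (\<Omega> i) V" using grp_Om[OF V] .
  let ?pda = "psi i V (d (i - 1) V a)" and ?c = "P (Suc m) i V u \<oplus>\<^bsub>sec (\<Omega> i) V\<^esub> d (i - 1) V b"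
  have c: "?pda \<in> Sec i V" "?c \<in> Sec i V" "P (Suc m) i V u \<in> Sec i V" "d (i - 1) V b \<in> Sec i V" using V u a b by simp_all
  have "psi i V z = ?c \<oplus>\<^bsub>sec (\<Omega> i) V\<^esub> ?pda"
    using c unfolding eq by (simp add: G.a_ac)
  then have "psi i V (z \<ominus>\<^bsub>sec (\<Omega> i) V\<^esub> d (i - 1) V a) = ?c"
    using psi_minus[OF V z, of "d (i - 1) V a"] G.add_minus_cancel(1)[OF c(2,1)] V a by simp
  then show ?thesis
    using subsheaf_add[OF sub_B V P_in_B[OF V u] d_in_B[OF V b]] by simp
qed

text \<open>Injectivity of C^{-1} gives y = p z. In the induction step p psi(z) = p^{m+2} u + dw, so
  dw = p v and psi(z) = p^{m+1} u + v, where v = psi(da) + db locally. Thus psi(z - da) lies in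
  B_{m+1}, the induction hypothesis puts z - da into p B_m, and z lies in B_{m+1}.\<close>

lemma psi_B:
  "\<lbrakk>U \<in> ob T; y \<in> Sec i U; psi i U y \<in> B (Suc m) i U\<rbrakk> \<Longrightarrow> \<exists>z\<in>B m i U. y = P 1 i U z"
proof (induction m arbitrary: U y)
  case 0
  have "x \<in> B 0 i U" if "x \<in> Sec i U" for x
    using P_in_B[OF 0(1) that, of 0] P_0[OF 0(1) that] by simp
  then show ?case using psi_inj[OF 0(1,2)] 0(3) mem_pOm[OF 0(1)] by auto
next
  case (Suc m)
  note U = Suc.prems(1) and y = Suc.prems(2)
  \<comment> \<open>The witness is global because division by p is unique; only its membership in
    B_{m+1} has to be checked on covers.\<close>
  obtain z where z: "z \<in> Sec i U" "y = P 1 i U z"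
    using psi_inj[OF U y B_mono[OF U Suc.prems(3)]] mem_pOm[OF U] by auto
  have Ppsi: "psi i U y = P 1 i U (psi i U z)" using psi_P[OF U z(1)] z(2) by simp
  have "z \<in> B (Suc m) i U"
  proof (rule subsheaf_loc[OF sub_B U z(1)], rule loc_trans[OF U B_loc[OF U Suc.prems(3)]])
    fix f assume f: "f \<in> into T U"
    note V = intoD(3)[OF f]
    let ?V = "src T f" and ?z = "res (\<Omega> i) f z"
    assume "\<exists>u\<in>Sec i ?V. \<exists>w\<in>Sec (i - 1) ?V. res (\<Omega> i) f (psi i U y)
        = P (Suc (Suc m)) i ?V u \<oplus>\<^bsub>sec (\<Omega> i) ?V\<^esub> d (i - 1) ?V w"
    then obtain u w where u: "u \<in> Sec i ?V" and w: "w \<in> Sec (i - 1) ?V"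
      and eq: "res (\<Omega> i) f (psi i U y) = P (Suc (Suc m)) i ?V u \<oplus>\<^bsub>sec (\<Omega> i) ?V\<^esub> d (i - 1) ?V w" by blast
    have zV: "?z \<in> Sec i ?V" using O_res[OF f z(1)] .
    have PP: "P (Suc (Suc m)) i ?V u = P 1 i ?V (P (Suc m) i ?V u)"
      using P_P[OF V u, of 1 "Suc m"] by simp
    have lhs: "res (\<Omega> i) f (psi i U y) = P 1 i ?V (psi i ?V ?z)"
      using Ppsi P_res[OF f psi_closed[OF U z(1)], of 1] psi_res[OF f z(1)] by simp
    have "P (Suc (Suc m)) i ?V u \<oplus>\<^bsub>sec (\<Omega> i) ?V\<^esub> d (i - 1) ?V w \<in> pOm D 1 i ?V"
      unfolding eq[symmetric] lhs using pOmI[OF V psi_closed[OF V zV]] .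
    from subsheaf_cancel[OF ab_Om sub_pOm V _ _ this] have "d (i - 1) ?V w \<in> pOm D 1 i ?V"
      unfolding PP using pOmI[OF V, of "P (Suc m) i ?V u" i 1] V u w by simp
    then obtain v where v: "v \<in> Sec i ?V" "d (i - 1) ?V w = P 1 i ?V v" using mem_pOm[OF V] by auto
    have psiz: "psi i ?V ?z = P (Suc m) i ?V u \<oplus>\<^bsub>sec (\<Omega> i) ?V\<^esub> v"
    proof (rule P_inj[OF V])
      show "P 1 i ?V (psi i ?V ?z) = P 1 i ?V (P (Suc m) i ?V u \<oplus>\<^bsub>sec (\<Omega> i) ?V\<^esub> v)"
        using lhs eq PP v(2) P_add[OF V _ v(1), of "P (Suc m) i ?V u" 1] V u by simp
    qed (use V u v(1) zV in simp_all)
    show "loc T ?V (\<lambda>g. res (\<Omega> i) (cmp T f g) z \<in> B (Suc m) i (src T (cmp T f g)))"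
    proof (rule loc_mono[OF div_d_loc[OF V w v] V])
      fix g assume g: "g \<in> into T ?V"
      note W = intoD(3)[OF g]
      let ?W = "src T g" and ?z' = "res (\<Omega> i) g (res (\<Omega> i) f z)"
      assume "\<exists>a\<in>Sec (i - 1) ?W. \<exists>b\<in>Sec (i - 1) ?W. res (\<Omega> i) g v
        = psi i ?W (d (i - 1) ?W a) \<oplus>\<^bsub>sec (\<Omega> i) ?W\<^esub> d (i - 1) ?W b"
      then obtain a b where a: "a \<in> Sec (i - 1) ?W" and b: "b \<in> Sec (i - 1) ?W"
        and ab: "res (\<Omega> i) g v = psi i ?W (d (i - 1) ?W a) \<oplus>\<^bsub>sec (\<Omega> i) ?W\<^esub> d (i - 1) ?W b" by blast
      interpret G: abelian_group "sec (\<Omega> i) ?W" using grp_Om[OF W] .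
      have z': "?z' \<in> Sec i ?W" using O_res[OF g zV] .
      have Pu: "P (Suc m) i ?V u \<in> Sec i ?V" using V u by simp
      have e: "psi i ?W ?z' = P (Suc m) i ?W (res (\<Omega> i) g u) \<oplus>\<^bsub>sec (\<Omega> i) ?W\<^esub>
          (psi i ?W (d (i - 1) ?W a) \<oplus>\<^bsub>sec (\<Omega> i) ?W\<^esub> d (i - 1) ?W b)"
        using psi_res[OF g zV] psiz ab P_res[OF g u, of "Suc m"]
          ab_sheaf.res_plus[OF ab_Om g Pu v(1)] by simp
      \<comment> \<open>The induction hypothesis is applied to z - da and not to z: only after
        psi(da) is removed does the right side lie in B_{m+1}.\<close>
      from psi_B_step[OF W z' O_res[OF g u] a b e]
      obtain c where c: "c \<in> B m i ?W" "?z' \<ominus>\<^bsub>sec (\<Omega> i) ?W\<^esub> d (i - 1) ?W a = P 1 i ?W c"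
        using Suc.IH[OF W O_minus[OF W z' Om_closed(3)[OF W a]]] by blast
      have "(?z' \<ominus>\<^bsub>sec (\<Omega> i) ?W\<^esub> d (i - 1) ?W a) \<oplus>\<^bsub>sec (\<Omega> i) ?W\<^esub> d (i - 1) ?W a \<in> B (Suc m) i ?W"
        using subsheaf_add[OF sub_B W P_B[OF W c(1)] d_in_B[OF W a]] c(2) by simp
      then have "?z' \<in> B (Suc m) i ?W" using G.add_minus_cancel(2)[OF z'] W a by simp
      then show "res (\<Omega> i) (cmp T f g) z \<in> B (Suc m) i (src T (cmp T f g))"
        using ab_sheaf.res_comp[OF ab_Om f g z(1)] src_cmp[OF f g] by simp
    qed
  qed
  then show ?case using z(2) by blast
qed

end

section \<open>The operator $R$\<close>

context dRW
begin

lemma psi_Z1: "\<lbrakk>U \<in> ob T; x \<in> Sec i U\<rbrakk> \<Longrightarrow> psi i U x \<in> Z 1 i U"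
  using psi_Z[of U x 0 i] by (simp add: Z_0)

lemma P_Z:
  assumes U: "U \<in> ob T" and z: "z \<in> Z m i U"
  shows "P k i U z \<in> Z (k + m) i U"
proof -
  obtain y where y: "y \<in> Sec (i + 1) U" "d i U z = P m (i + 1) U y" using z mem_Z[OF U] by auto
  have "d i U (P k i U z) = P (k + m) (i + 1) U y"
    using d_P[OF U Z_in[OF U z], of k] y P_P[OF U y(1)] by simp
  then show ?thesis using y(1) mem_Z[OF U] U Z_in[OF U z] by auto
qed

lemma P_Sec_Z: "\<lbrakk>U \<in> ob T; x \<in> Sec i U\<rbrakk> \<Longrightarrow> P k i U x \<in> Z k i U"
  using P_Z[of U x 0 i k] by (simp add: Z_0)

lemma d_Z: "\<lbrakk>U \<in> ob T; w \<in> Sec (i - 1) U\<rbrakk> \<Longrightarrow> d (i - 1) U w \<in> Z n i U"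
  using dd[of U w i] subsheaf_zero[OF sub_pOm] by (simp add: Zsub_def)

lemma B_Z: "\<lbrakk>U \<in> ob T; x \<in> B n i U\<rbrakk> \<Longrightarrow> x \<in> Z n i U"
  by (rule B_least[OF sub_Z P_Sec_Z d_Z])

lemma negative_degree:
  assumes "i \<le> 0" "U \<in> ob T" "w \<in> Sec (i - 1) U"
  shows "w = \<zero>\<^bsub>sec (\<Omega> (i - 1)) U\<^esub>" "d (i - 1) U w = \<zero>\<^bsub>sec (\<Omega> i) U\<^esub>"
proof -
  show w: "w = \<zero>\<^bsub>sec (\<Omega> (i - 1)) U\<^esub>" using cond_i[of "i - 1" U] assms by simp
  show "d (i - 1) U w = \<zero>\<^bsub>sec (\<Omega> i) U\<^esub>" unfolding w by (rule d_zero'[OF assms(2)])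
qed

lemma nat_Suc: "0 < i \<Longrightarrow> nat i = Suc (nat (i - 1))"
  by simp

text \<open>Turns p^{i-1} dw into p^i v, where dw = p v. If i is at most 0, both truncated exponents
  are 0 and the equation rests on Omega^{i-1} = 0, which makes dw and v vanish.\<close>

lemma div_exact:
  assumes U: "U \<in> ob T" and w: "w \<in> Z 1 (i - 1) U"
  shows "\<exists>v\<in>Sec i U. d (i - 1) U w = P 1 i U v \<and> P (nat (i - 1)) i U (d (i - 1) U w) = P (nat i) i U v"
proof -
  obtain v where v: "v \<in> Sec i U" "d (i - 1) U w = P 1 i U v" using w mem_Z[OF U, of w 1 "i - 1"] by auto
  show ?thesis
  proof (cases "i \<le> 0")
    case True
    note 0 = negative_degree(2)[OF True U Z_in[OF U w]]
    have "v = \<zero>\<^bsub>sec (\<Omega> i) U\<^esub>" by (rule P_torsion[OF U v(1), of 1]) (use v 0 in simp)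
    then show ?thesis using 0 P_zero[OF U] U by (intro bexI[of _ "\<zero>\<^bsub>sec (\<Omega> i) U\<^esub>"]) simp_all
  next
    case False
    then have "P (nat (i - 1)) i U (P 1 i U v) = P (nat i) i U v"
      using P_P[OF U v(1), of "nat (i - 1)" 1] nat_Suc[of i] by simp
    then show ?thesis using v by auto
  qed
qed

section \<open>The denominator p^{i+n} Z_1 + p^{i-1} d Z_1\<close>

lemma sub_Nphi: "subsheaf T (\<Omega> i) (Nphi D n i)"
  unfolding Nphi_def by (intro subsheaf_sum[OF ab_Om] sub_p_img sub_d_img sub_Z)

lemma Nphi_Z: "\<lbrakk>U \<in> ob T; z \<in> Z 1 i U\<rbrakk> \<Longrightarrow> P (nat i) i U (P n i U z) \<in> Nphi D n i U"
proof -
  assume U: "U \<in> ob T" and z: "z \<in> Z 1 i U"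
  have "P (nat i) i U (P n i U z) \<in> p_img D (nat i + n) i (Z 1 i) U"
    unfolding p_img_eq[OF sub_Z U] using P_P[OF U Z_in[OF U z], of "nat i" n] z by auto
  then show ?thesis
    unfolding Nphi_def by (rule sheaf_sumI1[OF ab_Om sub_p_img[OF sub_Z] sub_p_img[OF sub_d_img[OF sub_Z]] U])
qed

lemma Nphi_d: "\<lbrakk>U \<in> ob T; w \<in> Z 1 (i - 1) U\<rbrakk> \<Longrightarrow> P (nat (i - 1)) i U (d (i - 1) U w) \<in> Nphi D n i U"
proof -
  assume U: "U \<in> ob T" and w: "w \<in> Z 1 (i - 1) U"
  have "P (nat (i - 1)) i U (d (i - 1) U w) \<in> p_img D (nat (i - 1)) i (d_img D i (Z 1 (i - 1))) U"
    unfolding p_img_eq[OF sub_d_img[OF sub_Z] U] using d_imgI[OF sub_Z U w] by auto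
  then show ?thesis
    unfolding Nphi_def by (rule sheaf_sumI2[OF ab_Om sub_p_img[OF sub_Z] sub_p_img[OF sub_d_img[OF sub_Z]] U])
qed

text \<open>A common factor p^i is pulled out of both summands, so that it can be cancelled against
  phi = p^i psi. The section v stands for p^{-1} dw.\<close>

lemma Nphi_loc:
  assumes U: "U \<in> ob T" and x: "x \<in> Nphi D n i U"
  shows "loc T U (\<lambda>f. \<exists>z\<in>Z 1 i (src T f). \<exists>w\<in>Sec (i - 1) (src T f). \<exists>v\<in>Sec i (src T f).
    d (i - 1) (src T f) w = P 1 i (src T f) v \<and>
    res (\<Omega> i) f x = P (nat i) i (src T f) (P n i (src T f) z \<oplus>\<^bsub>sec (\<Omega> i) (src T f)\<^esub> v))"
proof -
  let ?A = "\<lambda>V. P (nat i + n) i V ` Z 1 i V" and ?E = "\<lambda>V. d (i - 1) V ` Z 1 (i - 1) V"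
  let ?B = "\<lambda>V. P (nat (i - 1)) i V ` ?E V"
  have stE: "res_stable (\<Omega> i) ?E" by (rule res_stable_image[OF d_hom' sub_Z])
  have stB: "res_stable (\<Omega> i) ?B"
    unfolding res_stable_def
  proof (intro allI ballI, elim imageE, hypsubst)
    fix V f w assume f: "f \<in> into T V" and w: "w \<in> Z 1 (i - 1) V"
    note V = intoD(4)[OF f]
    have c: "d (i - 1) V w \<in> Sec i V" using V Z_in[OF V w] by simp
    show "P (nat (i - 1)) i V (d (i - 1) V w) \<in> Sec i V
        \<and> res (\<Omega> i) f (P (nat (i - 1)) i V (d (i - 1) V w)) \<in> ?B (src T f)"
      using V c P_res[OF f c, of "nat (i - 1)"] d_res'[OF f Z_in[OF V w]] subsheaf_res[OF sub_Z f w] by auto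
  qed
  have l1: "p_img D (nat i + n) i (Z 1 i) V = locally_in T (\<Omega> i) ?A V" for V
    by (simp add: p_img_def sheaf_image_def)
  \<comment> \<open>Here an image is taken twice. Multiplication by p^{i-1} is a plain image by
    injectivity, so only the cover belonging to d remains.\<close>
  have l2: "p_img D (nat (i - 1)) i (d_img D i (Z 1 (i - 1))) V \<subseteq> locally_in T (\<Omega> i) ?B V"
    if V: "V \<in> ob T" for V
  proof
    fix y assume "y \<in> p_img D (nat (i - 1)) i (d_img D i (Z 1 (i - 1))) V"
    then obtain e where e: "e \<in> d_img D i (Z 1 (i - 1)) V" "y = P (nat (i - 1)) i V e"
      unfolding p_img_eq[OF sub_d_img[OF sub_Z] V] by blast
    have eO: "e \<in> Sec i V" using subsheaf_in[OF sub_d_img[OF sub_Z] V e(1)] .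
    have l: "loc T V (\<lambda>f. res (\<Omega> i) f e \<in> ?E (src T f))"
      using e(1) by (simp add: d_img_def sheaf_image_def mem_locally_in)
    show "y \<in> locally_in T (\<Omega> i) ?B V"
      unfolding mem_locally_in
      by (intro conjI loc_mono[OF l V]) (use e(2) V eO P_res[OF _ eO, of _ "nat (i - 1)"] in auto)
  qed
  have "x \<in> sheaf_sum T (\<Omega> i) (locally_in T (\<Omega> i) ?A) (locally_in T (\<Omega> i) ?B) U"
    unfolding mem_sheaf_sum
  proof (intro conjI)
    show "x \<in> Sec i U" using subsheaf_in[OF sub_Nphi U x] .
    have l: "loc T U (\<lambda>f. \<exists>a\<in>p_img D (nat i + n) i (Z 1 i) (src T f).
        \<exists>b\<in>p_img D (nat (i - 1)) i (d_img D i (Z 1 (i - 1))) (src T f). res (\<Omega> i) f x = a \<oplus>\<^bsub>sec (\<Omega> i) (src T f)\<^esub> b)"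
      using x by (simp add: Nphi_def mem_sheaf_sum)
    show "loc T U (\<lambda>f. \<exists>a\<in>locally_in T (\<Omega> i) ?A (src T f).
        \<exists>b\<in>locally_in T (\<Omega> i) ?B (src T f). res (\<Omega> i) f x = a \<oplus>\<^bsub>sec (\<Omega> i) (src T f)\<^esub> b)"
      by (rule loc_mono[OF l U]) (use l1 l2[OF intoD(3)] in blast)
  qed
  from sum_of_locally_in[OF ab_Om res_stable_image[OF P_hom sub_Z] stB U this]
  have l: "loc T U (\<lambda>f. res (\<Omega> i) f x \<in> ?A (src T f) <+>\<^bsub>sec (\<Omega> i) (src T f)\<^esub> ?B (src T f))"
    by (simp add: mem_locally_in)
  show ?thesis
  proof (rule loc_mono[OF l U])
    fix f assume f: "f \<in> into T U" and "res (\<Omega> i) f x \<in> ?A (src T f) <+>\<^bsub>sec (\<Omega> i) (src T f)\<^esub> ?B (src T f)"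
    then obtain z w where z: "z \<in> Z 1 i (src T f)" and w: "w \<in> Z 1 (i - 1) (src T f)"
      and eq: "res (\<Omega> i) f x = P (nat i + n) i (src T f) z \<oplus>\<^bsub>sec (\<Omega> i) (src T f)\<^esub>
        P (nat (i - 1)) i (src T f) (d (i - 1) (src T f) w)"
      by (auto simp: set_add_def set_mult_def)
    note V = intoD(3)[OF f]
    obtain v where v: "v \<in> Sec i (src T f)" "d (i - 1) (src T f) w = P 1 i (src T f) v"
      "P (nat (i - 1)) i (src T f) (d (i - 1) (src T f) w) = P (nat i) i (src T f) v"
      using div_exact[OF V w] by blast
    have zO: "z \<in> Sec i (src T f)" using Z_in[OF V z] .
    have "res (\<Omega> i) f x = P (nat i) i (src T f) (P n i (src T f) z \<oplus>\<^bsub>sec (\<Omega> i) (src T f)\<^esub> v)"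
      unfolding eq v(3) using P_add[OF V _ v(1), of "P n i (src T f) z" "nat i"] P_P[OF V zO, of "nat i" n] V zO by simp
    then show "\<exists>z\<in>Z 1 i (src T f). \<exists>w\<in>Sec (i - 1) (src T f). \<exists>v\<in>Sec i (src T f).
        d (i - 1) (src T f) w = P 1 i (src T f) v \<and>
        res (\<Omega> i) f x = P (nat i) i (src T f) (P n i (src T f) z \<oplus>\<^bsub>sec (\<Omega> i) (src T f)\<^esub> v)"
      using z Z_in[OF V w] v by blast
  qed
qed

abbreviation "ZP n i \<equiv> p_img D (nat i) i (Z (Suc n) i)"
abbreviation "BP n i \<equiv> p_img D (nat i) i (B (Suc n) i)"

lemma ZP_I: "\<lbrakk>U \<in> ob T; x \<in> Z (Suc n) i U\<rbrakk> \<Longrightarrow> P (nat i) i U x \<in> ZP n i U"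
  by (simp add: p_img_eq[OF sub_Z])

text \<open>The section v = p^{-1} dw is closed, since p dv = ddw = 0, and p^n z is in Z_{n+1}
  because z is in Z_1.\<close>

lemma Nphi_ZP:
  assumes U: "U \<in> ob T" and x: "x \<in> Nphi D n i U"
  shows "x \<in> ZP n i U"
proof (rule subsheaf_loc[OF sub_p_img[OF sub_Z] U subsheaf_in[OF sub_Nphi U x]], rule loc_mono[OF Nphi_loc[OF U x] U])
  fix f assume f: "f \<in> into T U"
  note V = intoD(3)[OF f]
  assume "\<exists>z\<in>Z 1 i (src T f). \<exists>w\<in>Sec (i - 1) (src T f). \<exists>v\<in>Sec i (src T f).
        d (i - 1) (src T f) w = P 1 i (src T f) v \<and>
        res (\<Omega> i) f x = P (nat i) i (src T f) (P n i (src T f) z \<oplus>\<^bsub>sec (\<Omega> i) (src T f)\<^esub> v)"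
  then obtain z w v where z: "z \<in> Z 1 i (src T f)" and w: "w \<in> Sec (i - 1) (src T f)"
    and v: "v \<in> Sec i (src T f)" "d (i - 1) (src T f) w = P 1 i (src T f) v"
    and eq: "res (\<Omega> i) f x = P (nat i) i (src T f) (P n i (src T f) z \<oplus>\<^bsub>sec (\<Omega> i) (src T f)\<^esub> v)" by blast
  have "d i (src T f) v = \<zero>\<^bsub>sec (\<Omega> (i + 1)) (src T f)\<^esub>"
    by (rule P_torsion[OF V, of _ _ 1]) (use V v d_P[OF V v(1), of 1] dd[OF V w] in simp_all)
  then have "v \<in> Z (Suc n) i (src T f)"
    using v(1) subsheaf_zero[OF sub_pOm V] by (simp add: Zsub_def)
  moreover have "P n i (src T f) z \<in> Z (Suc n) i (src T f)" using P_Z[OF V z, of n] by simp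
  ultimately show "res (\<Omega> i) f x \<in> ZP n i (src T f)"
    unfolding eq by (intro ZP_I[OF V] subsheaf_add[OF sub_Z V])
qed

text \<open>Each generator is rewritten through p y, which lies in Z_1: p^{i+n+1} y = p^{i+n} (p y)
  and p^i dy = p^{i-1} d(p y). The second equation needs i > 0; otherwise dy = 0.\<close>

lemma BP_Nphi:
  assumes U: "U \<in> ob T" and x: "x \<in> B (Suc n) i U"
  shows "P (nat i) i U x \<in> Nphi D n i U"
proof -
  have "x \<in> {x \<in> Sec i U. P (nat i) i U x \<in> Nphi D n i U}"
  proof (rule B_least[OF subsheaf_preimage[OF ab_Om ab_Om P_hom sub_Nphi] _ _ U x])
    fix V y assume V: "V \<in> ob T"
    show "P (Suc n) i V y \<in> {x \<in> Sec i V. P (nat i) i V x \<in> Nphi D n i V}" if y: "y \<in> Sec i V"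
      using Nphi_Z[OF V P_Sec_Z[OF V y], of n] P_P[OF V y, of n 1] V y by simp
    show "d (i - 1) V y \<in> {x \<in> Sec i V. P (nat i) i V x \<in> Nphi D n i V}" if y: "y \<in> Sec (i - 1) V"
    proof (cases "i \<le> 0")
      case True
      then show ?thesis
        using negative_degree(2)[OF True V y] P_zero[OF V] subsheaf_zero[OF sub_Nphi V] V by simp
    next
      case False
      have dy: "d (i - 1) V y \<in> Sec i V" using V y by simp
      have "P (nat i) i V (d (i - 1) V y) = P (nat (i - 1)) i V (d (i - 1) V (P 1 (i - 1) V y))"
        using d_P'[OF V y, of 1] P_P[OF V dy, of "nat (i - 1)" 1] nat_Suc[of i] False by simp
      then show ?thesis using Nphi_d[OF V P_Sec_Z[OF V y], of n] dy by simp
    qed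
  qed
  then show ?thesis by simp
qed

lemma BP_sub_Nphi: "\<lbrakk>U \<in> ob T; x \<in> BP n i U\<rbrakk> \<Longrightarrow> x \<in> Nphi D n i U"
  using BP_Nphi by (auto simp: p_img_eq[OF sub_B])

lemma phi_ZP: "\<lbrakk>U \<in> ob T; x \<in> Z n i U\<rbrakk> \<Longrightarrow> phi D i U x \<in> ZP n i U"
  using ZP_I[OF _ psi_Z] P_psi Z_in by metis

text \<open>On generators phi(p^n y) = p^{i+n} psi(y) and phi(dy) = d phi(y) = p^{i-1} d psi(y), and
  psi takes values in Z_1.\<close>

lemma phi_B_Nphi:
  assumes U: "U \<in> ob T" and x: "x \<in> B n i U"
  shows "phi D i U x \<in> Nphi D n i U"
proof -
  have "x \<in> {x \<in> Sec i U. phi D i U x \<in> Nphi D n i U}"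
  proof (rule B_least[OF subsheaf_preimage[OF ab_Om ab_Om phi_ab_hom sub_Nphi] _ _ U x])
    fix V y assume V: "V \<in> ob T"
    show "P n i V y \<in> {x \<in> Sec i V. phi D i V x \<in> Nphi D n i V}" if y: "y \<in> Sec i V"
    proof -
      have "phi D i V (P n i V y) = P (nat i) i V (P n i V (psi i V y))"
        using P_psi[OF V Om_closed(1)[OF V y], of n] psi_P[OF V y] by simp
      then show ?thesis using Nphi_Z[OF V psi_Z1[OF V y], of n] V y by simp
    qed
    show "d (i - 1) V y \<in> {x \<in> Sec i V. phi D i V x \<in> Nphi D n i V}" if y: "y \<in> Sec (i - 1) V"
    proof -
      have "phi D i V (d (i - 1) V y) = d (i - 1) V (P (nat (i - 1)) (i - 1) V (psi (i - 1) V y))"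
        using phi_diff[OF V y] P_psi[OF V y] by simp
      then show ?thesis
        using Nphi_d[OF V psi_Z1[OF V y], of n] d_P'[OF V psi_closed[OF V y], of "nat (i - 1)"] V y by simp
    qed
  qed
  then show ?thesis by simp
qed

text \<open>Cancelling p^i gives psi(y) = p^n z + v with z in Z_1 and p v = dw. After z and v are
  decomposed once more, every term is psi of an element of B_n or lies in B_{n+1}. So psi(y - s) is
  in B_{n+1} for some s in B_n, and \<open>psi_B\<close> applies to y - s.\<close>

lemma phi_Nphi_B:
  assumes U: "U \<in> ob T" and y: "y \<in> Sec i U" and N: "phi D i U y \<in> Nphi D n i U"
  shows "y \<in> B n i U"
proof (rule subsheaf_loc[OF sub_B U y], rule loc_trans[OF U Nphi_loc[OF U N]])
  fix f assume f: "f \<in> into T U"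
  note V = intoD(3)[OF f]
  let ?V = "src T f" and ?y = "res (\<Omega> i) f y"
  assume "\<exists>z\<in>Z 1 i ?V. \<exists>w\<in>Sec (i - 1) ?V. \<exists>v\<in>Sec i ?V. d (i - 1) ?V w = P 1 i ?V v \<and>
        res (\<Omega> i) f (phi D i U y) = P (nat i) i ?V (P n i ?V z \<oplus>\<^bsub>sec (\<Omega> i) ?V\<^esub> v)"
  then obtain z w v where z: "z \<in> Z 1 i ?V" and w: "w \<in> Sec (i - 1) ?V"
    and v: "v \<in> Sec i ?V" "d (i - 1) ?V w = P 1 i ?V v"
    and eq: "res (\<Omega> i) f (phi D i U y) = P (nat i) i ?V (P n i ?V z \<oplus>\<^bsub>sec (\<Omega> i) ?V\<^esub> v)" by blast
  have yV: "?y \<in> Sec i ?V" using O_res[OF f y] .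
  have zO: "z \<in> Sec i ?V" using Z_in[OF V z] .
  have c: "P n i ?V z \<in> Sec i ?V" using V zO by simp
  have psiy: "psi i ?V ?y = P n i ?V z \<oplus>\<^bsub>sec (\<Omega> i) ?V\<^esub> v"
  proof (rule P_inj[OF V])
    show "P (nat i) i ?V (psi i ?V ?y) = P (nat i) i ?V (P n i ?V z \<oplus>\<^bsub>sec (\<Omega> i) ?V\<^esub> v)"
      using P_psi[OF V yV] hom_res[OF phi_ab_hom f y] eq by simp
  qed (use V yV c v in simp_all)
  show "loc T ?V (\<lambda>g. res (\<Omega> i) (cmp T f g) y \<in> B n i (src T (cmp T f g)))"
  proof (rule loc_mono[OF loc_conj[OF L_loc[OF V psi_surj[OF V z]] div_d_loc[OF V w v] V] V])
    fix g assume g: "g \<in> into T ?V"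
    note W = intoD(3)[OF g]
    let ?W = "src T g"
    let ?y' = "res (\<Omega> i) g ?y"
    assume "(\<exists>y\<in>Z 0 i ?W. \<exists>u\<in>Sec i ?W. \<exists>w\<in>Sec (i - 1) ?W. res (\<Omega> i) g z = psi i ?W y \<oplus>\<^bsub>sec (\<Omega> i) ?W\<^esub>
        (P (Suc 0) i ?W u \<oplus>\<^bsub>sec (\<Omega> i) ?W\<^esub> d (i - 1) ?W w)) \<and>
      (\<exists>a\<in>Sec (i - 1) ?W. \<exists>b\<in>Sec (i - 1) ?W. res (\<Omega> i) g v
        = psi i ?W (d (i - 1) ?W a) \<oplus>\<^bsub>sec (\<Omega> i) ?W\<^esub> d (i - 1) ?W b)"
    then obtain z' u c a b where z': "z' \<in> Sec i ?W" and u: "u \<in> Sec i ?W"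
      and c: "c \<in> Sec (i - 1) ?W" and a: "a \<in> Sec (i - 1) ?W" and b: "b \<in> Sec (i - 1) ?W"
      and rz: "res (\<Omega> i) g z = psi i ?W z' \<oplus>\<^bsub>sec (\<Omega> i) ?W\<^esub> (P 1 i ?W u \<oplus>\<^bsub>sec (\<Omega> i) ?W\<^esub> d (i - 1) ?W c)"
      and rv: "res (\<Omega> i) g v = psi i ?W (d (i - 1) ?W a) \<oplus>\<^bsub>sec (\<Omega> i) ?W\<^esub> d (i - 1) ?W b"
      using Z_in[OF W] by (metis One_nat_def)
    interpret G: abelian_group "sec (\<Omega> i) ?W" using grp_Om[OF W] .
    have y': "?y' \<in> Sec i ?W" using O_res[OF g yV] .
    \<comment> \<open>\<open>s\<close> gathers the arguments of psi and \<open>r\<close> the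
      remaining terms of p^n z = psi(p^n z') + p^{n+1} u + d(p^n c) and v = psi(da) + db.\<close>
    define s where "s = P n i ?W z' \<oplus>\<^bsub>sec (\<Omega> i) ?W\<^esub> d (i - 1) ?W a"
    define r where "r = P (Suc n) i ?W u \<oplus>\<^bsub>sec (\<Omega> i) ?W\<^esub>
      (d (i - 1) ?W (P n (i - 1) ?W c) \<oplus>\<^bsub>sec (\<Omega> i) ?W\<^esub> d (i - 1) ?W b)"
    have sc: "s \<in> Sec i ?W" using W z' a by (simp add: s_def)
    have sB: "s \<in> B n i ?W"
      unfolding s_def by (intro subsheaf_add[OF sub_B W] P_in_B[OF W z'] d_in_B[OF W a])
    have rB: "r \<in> B (Suc n) i ?W"
      unfolding r_def
      by (intro subsheaf_add[OF sub_B W] P_in_B[OF W u] d_in_B[OF W b] d_in_B[OF W Om_closed(1)[OF W c]])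
    have m: "psi i ?W (P n i ?W z') \<in> Sec i ?W" "psi i ?W (d (i - 1) ?W a) \<in> Sec i ?W"
      "P (Suc n) i ?W u \<in> Sec i ?W" "d (i - 1) ?W (P n (i - 1) ?W c) \<in> Sec i ?W" "d (i - 1) ?W b \<in> Sec i ?W"
      using W z' a u c b by simp_all
    have psis: "psi i ?W s = psi i ?W (P n i ?W z') \<oplus>\<^bsub>sec (\<Omega> i) ?W\<^esub> psi i ?W (d (i - 1) ?W a)"
      unfolding s_def using psi_add[OF W] W z' a by simp
    have "P n i ?W (res (\<Omega> i) g z) = psi i ?W (P n i ?W z') \<oplus>\<^bsub>sec (\<Omega> i) ?W\<^esub>
        (P (Suc n) i ?W u \<oplus>\<^bsub>sec (\<Omega> i) ?W\<^esub> d (i - 1) ?W (P n (i - 1) ?W c))"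
      unfolding rz using W z' u c P_P[OF W u, of n 1] by (simp add: P_add psi_P d_P')
    then have "psi i ?W ?y' = (psi i ?W (P n i ?W z') \<oplus>\<^bsub>sec (\<Omega> i) ?W\<^esub>
        (P (Suc n) i ?W u \<oplus>\<^bsub>sec (\<Omega> i) ?W\<^esub> d (i - 1) ?W (P n (i - 1) ?W c))) \<oplus>\<^bsub>sec (\<Omega> i) ?W\<^esub>
        (psi i ?W (d (i - 1) ?W a) \<oplus>\<^bsub>sec (\<Omega> i) ?W\<^esub> d (i - 1) ?W b)"
      using psi_res[OF g yV] psiy ab_sheaf.res_plus[OF ab_Om g \<open>P n i ?V z \<in> Sec i ?V\<close> v(1)]
        P_res[OF g zO, of n] rv by simp
    also have "\<dots> = r \<oplus>\<^bsub>sec (\<Omega> i) ?W\<^esub> psi i ?W s"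
      unfolding psis r_def using m by (simp add: G.a_ac)
    finally have "psi i ?W (?y' \<ominus>\<^bsub>sec (\<Omega> i) ?W\<^esub> s) = r"
      using psi_minus[OF W y' sc] G.add_minus_cancel(1)[OF B_in[OF W rB] psi_closed[OF W sc]] by simp
    then obtain e where e: "e \<in> B n i ?W" "?y' \<ominus>\<^bsub>sec (\<Omega> i) ?W\<^esub> s = P 1 i ?W e"
      using psi_B[OF W O_minus[OF W y' sc]] rB by metis
    have "(?y' \<ominus>\<^bsub>sec (\<Omega> i) ?W\<^esub> s) \<oplus>\<^bsub>sec (\<Omega> i) ?W\<^esub> s \<in> B n i ?W"
      using subsheaf_add[OF sub_B W B_mono[OF W P_B[OF W e(1)]] sB] e(2) by simp
    then have "?y' \<in> B n i ?W" using G.add_minus_cancel(2)[OF y' sc] by simp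
    then show "res (\<Omega> i) (cmp T f g) y \<in> B n i (src T (cmp T f g))"
      using ab_sheaf.res_comp[OF ab_Om f g y] src_cmp[OF f g] by simp
  qed
qed

section \<open>The sheaves W_n and the isomorphism induced by phi\<close>

abbreviation "WQ n i \<equiv> quot T (subsh (\<Omega> i) (Z n i)) (B n i)"
abbreviation "prW n i \<equiv> quot_proj T (\<Omega> i) (B n i)"
abbreviation "NQ n i \<equiv> quot T (subsh (\<Omega> i) (ZP n i)) (Nphi D n i)"
abbreviation "prN n i \<equiv> quot_proj T (\<Omega> i) (Nphi D n i)"

lemma quot_W: "quot_sheaf T (subsh (\<Omega> i) (Z n i)) (B n i)"
  by (intro quot_sheaf.intro quot_sheaf_axioms.intro grothendieck_site_axioms
      ab_sheaf_subsh[OF ab_Om sub_Z] subsheaf_subsh[OF ab_Om sub_Z sub_B B_Z])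

lemma quot_N: "quot_sheaf T (subsh (\<Omega> i) (ZP n i)) (Nphi D n i)"
  by (intro quot_sheaf.intro quot_sheaf_axioms.intro grothendieck_site_axioms
      ab_sheaf_subsh[OF ab_Om sub_p_img[OF sub_Z]] subsheaf_subsh[OF ab_Om sub_p_img[OF sub_Z] sub_Nphi Nphi_ZP])

lemma quot_PB: "quot_sheaf T (subsh (\<Omega> i) (ZP n i)) (BP n i)"
  by (intro quot_sheaf.intro quot_sheaf_axioms.intro grothendieck_site_axioms
      ab_sheaf_subsh[OF ab_Om sub_p_img[OF sub_Z]] subsheaf_subsh[OF ab_Om sub_p_img[OF sub_Z] sub_p_img[OF sub_B]])
    (rule Nphi_ZP[OF _ BP_sub_Nphi])

lemmas ab_WQ = quot_sheaf.ab_quot[OF quot_W]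
lemmas ab_NQ = quot_sheaf.ab_quot[OF quot_N]

lemma prW_epi: "sheaf_epi T (subsh (\<Omega> i) (Z n i)) (WQ n i) (prW n i)"
  using quot_sheaf.pr_epi[OF quot_W] by simp

lemmas prW_hom = sheaf_epi_hom[OF prW_epi]

lemma prW_closed: "\<lbrakk>U \<in> ob T; x \<in> Z n i U\<rbrakk> \<Longrightarrow> prW n i U x \<in> sects (WQ n i) U"
  using hom_closed[OF prW_hom] by simp

lemma prW_zero: "\<lbrakk>U \<in> ob T; x \<in> Z n i U\<rbrakk> \<Longrightarrow> prW n i U x = \<zero>\<^bsub>sec (WQ n i) U\<^esub> \<longleftrightarrow> x \<in> B n i U"
  using quot_sheaf.pr_eq_zero_iff[OF quot_W] by simp

lemma prN_hom: "sheaf_ab_hom T (subsh (\<Omega> i) (ZP n i)) (NQ n i) (prN n i)"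
  using quot_sheaf.pr_hom[OF quot_N] by simp

lemma prN_zero: "\<lbrakk>U \<in> ob T; x \<in> ZP n i U\<rbrakk> \<Longrightarrow> prN n i U x = \<zero>\<^bsub>sec (NQ n i) U\<^esub> \<longleftrightarrow> x \<in> Nphi D n i U"
  using quot_sheaf.pr_eq_zero_iff[OF quot_N] by simp

text \<open>On classes the two sides of the definition of R become p^i x and phi(x) in one and the
  same quotient, where they can be compared.\<close>

lemma R_maps:
  shows R_phi_hom: "sheaf_ab_hom T (WQ n i) (NQ n i) (R_phi D n i)"
    and R_phi_pr: "\<lbrakk>U \<in> ob T; x \<in> Z n i U\<rbrakk> \<Longrightarrow> R_phi D n i U (prW n i U x) = prN n i U (phi D i U x)"
    and R_pm_hom: "sheaf_ab_hom T (WQ (Suc n) i) (NQ n i) (\<lambda>U t. R_proj D n i U (R_mul D n i U t))"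
    and R_pm_pr: "\<lbrakk>U \<in> ob T; x \<in> Z (Suc n) i U\<rbrakk> \<Longrightarrow>
      R_proj D n i U (R_mul D n i U (prW (Suc n) i U x)) = prN n i U (P (nat i) i U x)"
proof -
  have h1: "sheaf_ab_hom T (subsh (\<Omega> i) (Z n i)) (subsh (\<Omega> i) (ZP n i)) (phi D i)"
    by (rule hom_subsh[OF phi_ab_hom Z_in phi_ZP])
  note q1 = quot_sheaf.quot_map_props[OF quot_W quot_N h1 phi_B_Nphi, folded R_phi_def]
  show "sheaf_ab_hom T (WQ n i) (NQ n i) (R_phi D n i)" by (rule q1(1))
  show "R_phi D n i U (prW n i U x) = prN n i U (phi D i U x)" if "U \<in> ob T" "x \<in> Z n i U"
    by (rule q1(2)[unfolded quot_proj_subsh]) (use that in simp_all)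
  have h2: "sheaf_ab_hom T (subsh (\<Omega> i) (Z (Suc n) i)) (subsh (\<Omega> i) (ZP n i)) (P (nat i) i)"
    by (rule hom_subsh[OF P_hom Z_in ZP_I])
  have k2: "P (nat i) i V x \<in> BP n i V" if "V \<in> ob T" "x \<in> B (Suc n) i V" for V x
    using that by (simp add: p_img_eq[OF sub_B])
  note q2 = quot_sheaf.quot_map_props[OF quot_W quot_PB h2 k2, folded R_mul_def]
  have h3: "sheaf_ab_hom T (subsh (\<Omega> i) (ZP n i)) (subsh (\<Omega> i) (ZP n i)) (\<lambda>U x. x)"
    by (rule hom_incl)
  note q3 = quot_sheaf.quot_map_props[OF quot_PB quot_N h3 BP_sub_Nphi, folded R_proj_def]
  show "sheaf_ab_hom T (WQ (Suc n) i) (NQ n i) (\<lambda>U t. R_proj D n i U (R_mul D n i U t))"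
    by (rule hom_comp[OF q2(1) q3(1)])
  show "R_proj D n i U (R_mul D n i U (prW (Suc n) i U x)) = prN n i U (P (nat i) i U x)"
    if "U \<in> ob T" "x \<in> Z (Suc n) i U"
  proof -
    have "R_mul D n i U (prW (Suc n) i U x) = quot_proj T (\<Omega> i) (BP n i) U (P (nat i) i U x)"
      by (rule q2(2)[unfolded quot_proj_subsh]) (use that in simp_all)
    moreover have "R_proj D n i U (quot_proj T (\<Omega> i) (BP n i) U (P (nat i) i U x)) = prN n i U (P (nat i) i U x)"
      by (rule q3(2)[unfolded quot_proj_subsh]) (use that ZP_I[OF that] in simp_all)
    ultimately show ?thesis by simp
  qed
qed

text \<open>The form in which the decomposition of Z_{n+1} is used from here on: the last two
  summands of \<open>L_loc\<close> are joined to an element of B_{n+1}.\<close>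

lemma Z_Suc_loc:
  assumes U: "U \<in> ob T" and x: "x \<in> Z (Suc n) i U"
  shows "loc T U (\<lambda>f. \<exists>y\<in>Z n i (src T f). \<exists>b\<in>B (Suc n) i (src T f).
    res (\<Omega> i) f x = psi i (src T f) y \<oplus>\<^bsub>sec (\<Omega> i) (src T f)\<^esub> b)"
proof (rule loc_mono[OF L_loc[OF U Z_L[OF U x]] U])
  fix f assume f: "f \<in> into T U"
  note V = intoD(3)[OF f]
  assume "\<exists>y\<in>Z n i (src T f). \<exists>u\<in>Sec i (src T f). \<exists>w\<in>Sec (i - 1) (src T f).
      res (\<Omega> i) f x = psi i (src T f) y \<oplus>\<^bsub>sec (\<Omega> i) (src T f)\<^esub>
      (P (Suc n) i (src T f) u \<oplus>\<^bsub>sec (\<Omega> i) (src T f)\<^esub> d (i - 1) (src T f) w)"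
  then show "\<exists>y\<in>Z n i (src T f). \<exists>b\<in>B (Suc n) i (src T f).
      res (\<Omega> i) f x = psi i (src T f) y \<oplus>\<^bsub>sec (\<Omega> i) (src T f)\<^esub> b"
    using subsheaf_add[OF sub_B V P_in_B[OF V] d_in_B[OF V]] by blast
qed

text \<open>The term p^i b lies in the denominator by \<open>BP_Nphi\<close>, and p^i psi(y) =
  phi(y). This makes R computable.\<close>

lemma prN_psi:
  assumes U: "U \<in> ob T" and y: "y \<in> Z n i U" and b: "b \<in> B (Suc n) i U"
  shows "prN n i U (P (nat i) i U (psi i U y \<oplus>\<^bsub>sec (\<Omega> i) U\<^esub> b)) = prN n i U (phi D i U y)"
proof -
  interpret H: abelian_group "sec (NQ n i) U" using ab_sheaf.grp[OF ab_NQ U] .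
  have c: "P (nat i) i U b \<in> ZP n i U" using Nphi_ZP[OF U BP_Nphi[OF U b]] .
  note p = phi_ZP[OF U y]
  have "P (nat i) i U (psi i U y \<oplus>\<^bsub>sec (\<Omega> i) U\<^esub> b) = phi D i U y \<oplus>\<^bsub>sec (\<Omega> i) U\<^esub> P (nat i) i U b"
    using P_add[OF U psi_closed[OF U Z_in[OF U y]] B_in[OF U b]] P_psi[OF U Z_in[OF U y]] by simp
  then show ?thesis
    using hom_add[OF prN_hom U, of "phi D i U y" i n "P (nat i) i U b"] p c
      prN_zero[OF U c] BP_Nphi[OF U b] hom_closed[OF prN_hom U, of "phi D i U y"] by simp
qed

lemma psi_add_Z:
  assumes U: "U \<in> ob T" and y: "y \<in> Z n i U" and b: "b \<in> B (Suc n) i U"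
  shows "psi i U y \<oplus>\<^bsub>sec (\<Omega> i) U\<^esub> b \<in> Z (Suc n) i U"
  by (rule subsheaf_add[OF sub_Z U psi_Z[OF U y] B_Z[OF U b]])

text \<open>\<open>Z_Suc_loc\<close> supplies local preimages and \<open>phi_Nphi_B\<close> the
  kernel. This bijection gives \<open>the_inv_into\<close> in \<open>WR\<close> its meaning.\<close>

lemma R_phi_bij:
  assumes U: "U \<in> ob T"
  shows "bij_betw (R_phi D n i U) (sects (WQ n i) U) (sects (NQ n i) U)"
proof (rule epi_bij[OF ab_WQ ab_NQ prW_epi R_phi_hom _ _ _ U])
  have hb: "sheaf_ab_hom T (subsh (\<Omega> i) (Z n i)) (NQ n i) (\<lambda>U x. prN n i U (phi D i U x))"
    by (rule hom_comp[OF hom_subsh[OF phi_ab_hom Z_in phi_ZP] prN_hom])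
  show "sheaf_epi T (subsh (\<Omega> i) (Z n i)) (NQ n i) (\<lambda>U x. prN n i U (phi D i U x))"
    unfolding sheaf_epi_def
  proof (intro conjI hb ballI)
    fix U t assume U: "U \<in> ob T" and t: "t \<in> sects (NQ n i) U"
    have l: "loc T U (\<lambda>f. \<exists>c\<in>ZP n i (src T f). res (NQ n i) f t = prN n i (src T f) c)"
      using sheaf_epi_loc[OF quot_sheaf.pr_epi[OF quot_N] U t] by simp
    show "loc T U (\<lambda>f. \<exists>x\<in>sects (subsh (\<Omega> i) (Z n i)) (src T f).
        res (NQ n i) f t = prN n i (src T f) (phi D i (src T f) x))"
    proof (rule loc_trans[OF U l])
      fix f assume f: "f \<in> into T U" and "\<exists>c\<in>ZP n i (src T f). res (NQ n i) f t = prN n i (src T f) c"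
      note V = intoD(3)[OF f]
      obtain x where x: "x \<in> Z (Suc n) i (src T f)" "res (NQ n i) f t = prN n i (src T f) (P (nat i) i (src T f) x)"
        using \<open>\<exists>c\<in>ZP n i (src T f). _\<close> by (auto simp: p_img_eq[OF sub_Z V])
      show "loc T (src T f) (\<lambda>g. \<exists>y\<in>sects (subsh (\<Omega> i) (Z n i)) (src T (cmp T f g)).
          res (NQ n i) (cmp T f g) t = prN n i (src T (cmp T f g)) (phi D i (src T (cmp T f g)) y))"
      proof (rule loc_mono[OF Z_Suc_loc[OF V x(1)] V])
        fix g assume g: "g \<in> into T (src T f)"
          and "\<exists>y\<in>Z n i (src T g). \<exists>b\<in>B (Suc n) i (src T g). res (\<Omega> i) g x = psi i (src T g) y \<oplus>\<^bsub>sec (\<Omega> i) (src T g)\<^esub> b"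
        then obtain y b where y: "y \<in> Z n i (src T g)" and b: "b \<in> B (Suc n) i (src T g)"
          and eq: "res (\<Omega> i) g x = psi i (src T g) y \<oplus>\<^bsub>sec (\<Omega> i) (src T g)\<^esub> b" by blast
        have "res (NQ n i) (cmp T f g) t = prN n i (src T g) (P (nat i) i (src T g) (res (\<Omega> i) g x))"
          using ab_sheaf.res_comp[OF ab_NQ f g t] x(2) hom_res[OF prN_hom g, of "P (nat i) i (src T f) x" i n]
            ZP_I[OF V x(1)] P_res[OF g Z_in[OF V x(1)], of "nat i"] by simp
        then have "res (NQ n i) (cmp T f g) t = prN n i (src T g) (phi D i (src T g) y)"
          unfolding eq using prN_psi[OF intoD(3)[OF g] y b] by simp
        then show "\<exists>y\<in>sects (subsh (\<Omega> i) (Z n i)) (src T (cmp T f g)).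
          res (NQ n i) (cmp T f g) t = prN n i (src T (cmp T f g)) (phi D i (src T (cmp T f g)) y)"
          using y src_cmp[OF f g] by auto
      qed
    qed
  qed
  fix V x assume V: "V \<in> ob T" and "x \<in> sects (subsh (\<Omega> i) (Z n i)) V"
  then have x: "x \<in> Z n i V" by simp
  show "R_phi D n i V (prW n i V x) = prN n i V (phi D i V x)" by (rule R_phi_pr[OF V x])
  show "prW n i V x = \<zero>\<^bsub>sec (WQ n i) V\<^esub>" if "prN n i V (phi D i V x) = \<zero>\<^bsub>sec (NQ n i) V\<^esub>"
    using that prN_zero[OF V phi_ZP[OF V x]] phi_Nphi_B[OF V Z_in[OF V x]] prW_zero[OF V x] by simp
qed

lemma WR_hom: "sheaf_ab_hom T (WQ (Suc n) i) (WQ n i) (WR D n i)"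
proof -
  have "WR D n i = (\<lambda>U t. the_inv_into (sects (WQ n i) U) (R_phi D n i U) (R_proj D n i U (R_mul D n i U t)))"
    by (intro ext) (simp add: WR_def WOm_def)
  then show ?thesis
    using hom_comp[OF R_pm_hom iso_inverse[OF ab_WQ ab_NQ R_phi_hom R_phi_bij]] by simp
qed

lemma WR_pr:
  assumes U: "U \<in> ob T" and y: "y \<in> Z n i U" and b: "b \<in> B (Suc n) i U"
  shows "WR D n i U (prW (Suc n) i U (psi i U y \<oplus>\<^bsub>sec (\<Omega> i) U\<^esub> b)) = prW n i U y"
proof -
  have "R_proj D n i U (R_mul D n i U (prW (Suc n) i U (psi i U y \<oplus>\<^bsub>sec (\<Omega> i) U\<^esub> b)))
      = R_phi D n i U (prW n i U y)"
    using R_pm_pr[OF U psi_add_Z[OF U y b]] prN_psi[OF U y b] R_phi_pr[OF U y] by simp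
  then show ?thesis
    unfolding WR_def WOm_def
    using the_inv_into_f_f[OF bij_betw_imp_inj_on[OF R_phi_bij[OF U]] prW_closed[OF U y]] by simp
qed

text \<open>R has a formula only on classes of psi(y) + b, but every section of W_{n+1} is locally
  such a class. Identities that involve R are therefore checked on these classes.\<close>

lemma hom_eq_on_W:
  assumes Q: "ab_sheaf T Q" and f: "sheaf_ab_hom T (WQ (Suc n) i) Q f" and g: "sheaf_ab_hom T (WQ (Suc n) i) Q g"
    and eq: "\<And>V y b. \<lbrakk>V \<in> ob T; y \<in> Z n i V; b \<in> B (Suc n) i V\<rbrakk> \<Longrightarrow>
      f V (prW (Suc n) i V (psi i V y \<oplus>\<^bsub>sec (\<Omega> i) V\<^esub> b)) = g V (prW (Suc n) i V (psi i V y \<oplus>\<^bsub>sec (\<Omega> i) V\<^esub> b))"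
    and U: "U \<in> ob T" and t: "t \<in> sects (WQ (Suc n) i) U"
  shows "f U t = g U t"
proof (rule epi_eqI[OF Q prW_epi f g _ U t])
  fix V x assume V: "V \<in> ob T" and "x \<in> sects (subsh (\<Omega> i) (Z (Suc n) i)) V"
  then have x: "x \<in> Z (Suc n) i V" by simp
  note p = prW_closed[OF V x]
  show "f V (prW (Suc n) i V x) = g V (prW (Suc n) i V x)"
  proof (rule sheaf_eqI[OF Q V hom_closed[OF f V p] hom_closed[OF g V p]], rule loc_mono[OF Z_Suc_loc[OF V x] V])
    fix e assume e: "e \<in> into T V" and "\<exists>y\<in>Z n i (src T e). \<exists>b\<in>B (Suc n) i (src T e).
      res (\<Omega> i) e x = psi i (src T e) y \<oplus>\<^bsub>sec (\<Omega> i) (src T e)\<^esub> b"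
    then show "res Q e (f V (prW (Suc n) i V x)) = res Q e (g V (prW (Suc n) i V x))"
      using hom_res[OF f e p] hom_res[OF g e p] hom_res[OF prW_hom e, of x i "Suc n"] x eq[OF intoD(3)[OF e]] by auto
  qed
qed

end

section \<open>The filtrations $Z_n\Omega^i_1$ and $B_n\Omega^i_1$ and the operator $C$\<close>

context grothendieck_site
begin

text \<open>The inclusion of A/N in A'/N is injective, so its sheaf image is A/N itself and
  membership can be tested on a cover.\<close>

lemma subquot_mem:
  assumes M: "ab_sheaf T M" and A: "subsheaf T M A" and A': "subsheaf T M A'" and N: "subsheaf T M N"
    and NA: "\<And>U x. \<lbrakk>U \<in> ob T; x \<in> N U\<rbrakk> \<Longrightarrow> x \<in> A U" and AA': "\<And>U x. \<lbrakk>U \<in> ob T; x \<in> A U\<rbrakk> \<Longrightarrow> x \<in> A' U"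
    and U: "U \<in> ob T" and t: "t \<in> sects (quot T (subsh M A') N) U"
    and l: "loc T U (\<lambda>f. \<exists>x\<in>A (src T f). res (quot T (subsh M A') N) f t = quot_proj T M N (src T f) x)"
  shows "t \<in> sects (quot T (subsh M A) N) U"
proof -
  have NA': "\<And>U x. \<lbrakk>U \<in> ob T; x \<in> N U\<rbrakk> \<Longrightarrow> x \<in> A' U" using NA AA' by blast
  interpret q: quot_sheaf T "subsh M A" N
    by (intro quot_sheaf.intro grothendieck_site_axioms ab_sheaf_subsh[OF M A] quot_sheaf_axioms.intro
        subsheaf_subsh[OF M A N NA])
  interpret q': quot_sheaf T "subsh M A'" N
    by (intro quot_sheaf.intro grothendieck_site_axioms ab_sheaf_subsh[OF M A'] quot_sheaf_axioms.intro
        subsheaf_subsh[OF M A' N NA'])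
  note j = subquot_incl[OF M A A' N NA AA']
  have zero: "\<zero>\<^bsub>sec q.Q V\<^esub> = \<zero>\<^bsub>sec q'.Q V\<^esub>" for V by (simp add: quot_def)
  have "t \<in> sheaf_image T q'.Q (\<lambda>U t. t) (sects q.Q) U"
    unfolding mem_sheaf_image
  proof (intro conjI t, rule loc_mono[OF l U])
    fix f assume f: "f \<in> into T U" and "\<exists>x\<in>A (src T f). res q'.Q f t = quot_proj T M N (src T f) x"
    then obtain x where x: "x \<in> A (src T f)" "res q'.Q f t = quot_proj T M N (src T f) x" by blast
    have "quot_proj T M N (src T f) x \<in> sects q.Q (src T f)"
      using hom_closed[OF q.pr_hom intoD(3)[OF f], of x] x(1) by simp
    then show "\<exists>a\<in>sects q.Q (src T f). res q'.Q f t = a" using x(2) by blast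
  qed
  then show ?thesis
    using sheaf_image_inj[OF q.ab_quot q'.ab_quot j subsheaf_full[OF q.ab_quot] _ U] zero by auto
qed

lemma hom_factor_incl:
  assumes j: "sheaf_ab_hom T S Q (\<lambda>U t. t)" and h: "sheaf_ab_hom T M Q h"
    and hS: "\<And>U x. \<lbrakk>U \<in> ob T; x \<in> sects M U\<rbrakk> \<Longrightarrow> h U x \<in> sects S U"
  shows "sheaf_ab_hom T M S h"
proof (rule homI)
  fix U x assume U: "U \<in> ob T" and x: "x \<in> sects M U"
  show "h U x \<in> sects S U" using hS[OF U x] .
  show "h U (x \<oplus>\<^bsub>sec M U\<^esub> y) = h U x \<oplus>\<^bsub>sec S U\<^esub> h U y" if y: "y \<in> sects M U" for y
    using hom_add[OF h U x y] hom_add[OF j U hS[OF U x] hS[OF U y]] by simp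
next
  fix U f x assume f: "f \<in> into T U" and x: "x \<in> sects M U"
  show "res S f (h U x) = h (src T f) (res M f x)"
    using hom_res[OF h f x] hom_res[OF j f hS[OF intoD(4)[OF f] x]] by simp
qed

end

context dRW
begin

section \<open>The filtration Z_n Omega_1\<close>

abbreviation "cl i \<equiv> quot_proj T (Om1 D i) (BOm1 D i)"

lemma cls1_eq: "cls1 D i = cl i"
  by (simp add: cls1_def)

lemma cls1_epi: "sheaf_epi T (subsh (Om1 D i) (Ker1 D i)) (H1 D i) (cls1 D i)"
  unfolding H1_def cls1_def by (rule quot_sheaf.pr_epi[OF quot_H1])

definition cart_pre :: "int \<Rightarrow> ('o \<Rightarrow> ('m \<Rightarrow> 'a set) set) \<Rightarrow> 'o \<Rightarrow> ('m \<Rightarrow> 'a set) set" where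
  "cart_pre i A U = {x \<in> Ker1 D i U. cartier i U x \<in> A U}"

lemma sub_cart_pre:
  assumes A: "subsheaf T (Om1 D i) A"
  shows "subsheaf T (Om1 D i) (cart_pre i A)"
proof -
  have "cart_pre i A = (\<lambda>U. {x \<in> sects (subsh (Om1 D i) (Ker1 D i)) U. cartier i U x \<in> A U})"
    by (intro ext) (simp add: cart_pre_def)
  moreover have "subsheaf T (subsh (Om1 D i) (Ker1 D i)) \<dots>"
    by (rule subsheaf_preimage[OF ab_sheaf_subsh[OF ab_Om1 sub_Ker1] ab_Om1 cartier_hom A])
  ultimately show ?thesis
    using subsheaf_of_subsh[OF ab_Om1 sub_Ker1] by simp
qed

lemma Cinv_step_cart_pre:
  assumes U: "U \<in> ob T" and A: "A U \<subseteq> sects (Om1 D i) U"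
  shows "Cinv_step D i A U = cart_pre i A U"
proof (rule Set.set_eqI)
  fix x
  show "x \<in> Cinv_step D i A U \<longleftrightarrow> x \<in> cart_pre i A U"
    using cartier_eq_iff[OF U, of x i] cartier_closed[OF U, of x i] A
    by (auto simp: Cinv_step_def cart_pre_def image_iff)
qed

lemma BOm1_cart_pre: "\<lbrakk>subsheaf T (Om1 D i) A; U \<in> ob T; x \<in> BOm1 D i U\<rbrakk> \<Longrightarrow> x \<in> cart_pre i A U"
  using cartier_eq_zero[of U x i] BOm1_Ker1[of U x i] subsheaf_zero[of T "Om1 D i" A U]
  by (simp add: cart_pre_def)

text \<open>The Cartier map has kernel B Omega_1. So a subsheaf of the preimage that contains this
  kernel and reaches \<open>A\<close> locally is already the whole preimage.\<close>

lemma cart_pre_eqI: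
  assumes A: "subsheaf T (Om1 D i) A" and A': "subsheaf T (Om1 D i) A'"
    and sub: "\<And>V x. \<lbrakk>V \<in> ob T; x \<in> A' V\<rbrakk> \<Longrightarrow> x \<in> cart_pre i A V"
    and B: "\<And>V x. \<lbrakk>V \<in> ob T; x \<in> BOm1 D i V\<rbrakk> \<Longrightarrow> x \<in> A' V"
    and surj: "\<And>V a. \<lbrakk>V \<in> ob T; a \<in> A V\<rbrakk> \<Longrightarrow>
      loc T V (\<lambda>f. \<exists>x\<in>A' (src T f). res (Om1 D i) f a = cartier i (src T f) x)"
    and U: "U \<in> ob T"
  shows "cart_pre i A U = A' U"
proof (intro subset_antisym subsetI)
  show "x \<in> cart_pre i A U" if "x \<in> A' U" for x using sub[OF U that] .
  fix x assume "x \<in> cart_pre i A U"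
  then have k: "x \<in> Ker1 D i U" and a: "cartier i U x \<in> A U" by (auto simp: cart_pre_def)
  show "x \<in> A' U"
  proof (rule subsheaf_loc[OF A' U Ker1_in[OF k]], rule loc_mono[OF surj[OF U a] U])
    fix f assume f: "f \<in> into T U"
      and "\<exists>y\<in>A' (src T f). res (Om1 D i) f (cartier i U x) = cartier i (src T f) y"
    note V = intoD(3)[OF f]
    obtain y where y: "y \<in> A' (src T f)" "res (Om1 D i) f (cartier i U x) = cartier i (src T f) y"
      using \<open>\<exists>y\<in>A' (src T f). _\<close> by blast
    let ?x = "res (Om1 D i) f x"
    interpret G: abelian_group "sec (Om1 D i) (src T f)" using ab_sheaf.grp[OF ab_Om1 V] .
    have kx: "?x \<in> Ker1 D i (src T f)" using subsheaf_res[OF sub_Ker1 f k] .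
    have ky: "y \<in> Ker1 D i (src T f)" using sub[OF V y(1)] by (simp add: cart_pre_def)
    have "cartier i (src T f) (?x \<ominus>\<^bsub>sec (Om1 D i) (src T f)\<^esub> y) = \<zero>\<^bsub>sec (Om1 D i) (src T f)\<^esub>"
      using cartier_minus[OF V kx ky] cartier_res[OF f k] y(2) G.add_minus_cancel(3) cartier_closed[OF V ky] by simp
    then have "?x \<ominus>\<^bsub>sec (Om1 D i) (src T f)\<^esub> y \<in> BOm1 D i (src T f)"
      using cartier_eq_zero[OF V subsheaf_minus[OF sub_Ker1 V kx ky]] by simp
    then have "(?x \<ominus>\<^bsub>sec (Om1 D i) (src T f)\<^esub> y) \<oplus>\<^bsub>sec (Om1 D i) (src T f)\<^esub> y \<in> A' (src T f)"
      using subsheaf_add[OF A' V B[OF V] y(1)] by simp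
    then show "?x \<in> A' (src T f)" using G.add_minus_cancel(2)[OF Ker1_in[OF kx] Ker1_in[OF ky]] by simp
  qed
qed

lemma red_cart_pre_psi: "\<lbrakk>U \<in> ob T; y \<in> Sec i U; red D i U y \<in> A U\<rbrakk> \<Longrightarrow> red D i U (psi i U y) \<in> cart_pre i A U"
  using red_psi_Ker1 cartier_red_psi by (simp add: cart_pre_def)

text \<open>The recursive families are identified only over objects of the site, so equality of
  functions is not at hand.\<close>

lemma subsheaf_cong:
  assumes "subsheaf T M A" "\<And>U. U \<in> ob T \<Longrightarrow> A' U = A U"
  shows "subsheaf T M A'"
proof -
  have "loc T U (\<lambda>f. res M f x \<in> A (src T f))" if "U \<in> ob T" "loc T U (\<lambda>f. res M f x \<in> A' (src T f))" for U x
    by (rule loc_mono[OF that(2,1)]) (use assms(2) intoD(3) in blast)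
  then show ?thesis
    using assms(1) unfolding subsheaf_def using assms(2) intoD(3,4) by (smt (verit, best))
qed

text \<open>Induction along psi. The Cartier map sends the reduction of psi(y) to that of y, so
  psi(Z_n) inside Z_{n+1} gives surjectivity. Conversely Z_{n+1} is generated by psi(Z_n) and
  B_{n+1}, and B_{n+1} reduces into the kernel B Omega_1.\<close>

lemma ZOm1_eq: "U \<in> ob T \<Longrightarrow> ZOm1 D n i U = sheaf_image T (Om1 D i) (red D i) (Z n i) U"
proof (induction n arbitrary: U)
  case (0 U)
  have "x \<in> sheaf_image T (Om1 D i) (red D i) (Z 0 i) U" if x: "x \<in> sects (Om1 D i) U" for x
    unfolding mem_sheaf_image
    by (intro conjI x loc_mono[OF sheaf_epi_loc[OF red_epi 0 x] 0]) (simp add: Z_0 intoD)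
  then show ?case by (auto simp: mem_sheaf_image)
next
  case (Suc n U)
  let ?A = "sheaf_image T (Om1 D i) (red D i) (Z n i)" and ?A' = "sheaf_image T (Om1 D i) (red D i) (Z (Suc n) i)"
  note sub = subsheaf_image[OF ab_Om ab_Om1 red_hom sub_Z]
  have "ZOm1 D (Suc n) i U = cart_pre i (ZOm1 D n i) U"
    using Cinv_step_cart_pre[OF Suc.prems] Suc.IH[OF Suc.prems] by (simp add: mem_sheaf_image subset_iff)
  also have "\<dots> = cart_pre i ?A U" using Suc.IH[OF Suc.prems] by (simp add: cart_pre_def)
  also have "\<dots> = ?A' U"
  proof (rule cart_pre_eqI[OF sub sub _ _ _ Suc.prems])
    fix V assume V: "V \<in> ob T"
    show "x \<in> cart_pre i ?A V" if "x \<in> ?A' V" for x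
    proof (rule sheaf_image_least[OF sub_cart_pre[OF sub] _ V that])
      fix W z assume W: "W \<in> ob T" and z: "z \<in> Z (Suc n) i W"
      \<comment> \<open>Phrased as membership in a preimage subsheaf, so that \<open>L_least\<close>
        reduces it to psi(Z_n), p^{n+1} Omega and d Omega.\<close>
      have "z \<in> {z \<in> Sec i W. red D i W z \<in> cart_pre i ?A W}"
      proof (rule L_least[OF subsheaf_preimage[OF ab_Om ab_Om1 red_hom sub_cart_pre[OF sub]] _ _ _ W Z_L[OF W z]])
        show "psi i V y \<in> {z \<in> Sec i V. red D i V z \<in> cart_pre i ?A V}" if "V \<in> ob T" "y \<in> Z n i V" for V y
          using red_cart_pre_psi[OF that(1) Z_in[OF that]] sheaf_imageI[OF ab_Om1 red_hom sub_Z that]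
            psi_closed[OF that(1) Z_in[OF that]] by simp
        show "P (Suc n) i V y \<in> {z \<in> Sec i V. red D i V z \<in> cart_pre i ?A V}" if "V \<in> ob T" "y \<in> Sec i V" for V y
          using B_mono[OF that(1) P_in_B[OF that], of 1 "Suc n"] red_BOm1[OF that(1), of "P (Suc n) i V y" i]
            BOm1_cart_pre[OF sub that(1)] that by simp
        show "d (i - 1) V y \<in> {z \<in> Sec i V. red D i V z \<in> cart_pre i ?A V}" if "V \<in> ob T" "y \<in> Sec (i - 1) V" for V y
          using red_d_BOm1[OF that] BOm1_cart_pre[OF sub that(1)] that by simp
      qed
      then show "red D i W z \<in> cart_pre i ?A W" by simp
    qed
    show "x \<in> ?A' V" if x: "x \<in> BOm1 D i V" for x
      unfolding mem_sheaf_image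
      by (intro conjI subsheaf_in[OF sub_BOm1 V x] loc_mono[OF BOm1_loc[OF V x] V])
        (use d_Z[OF intoD(3)] in blast)
    fix a assume "a \<in> ?A V"
    then have l: "loc T V (\<lambda>f. \<exists>y\<in>Z n i (src T f). res (Om1 D i) f a = red D i (src T f) y)"
      by (simp add: mem_sheaf_image)
    show "loc T V (\<lambda>f. \<exists>x\<in>?A' (src T f). res (Om1 D i) f a = cartier i (src T f) x)"
    proof (rule loc_mono[OF l V])
      fix f assume f: "f \<in> into T V" and "\<exists>y\<in>Z n i (src T f). res (Om1 D i) f a = red D i (src T f) y"
      then obtain y where y: "y \<in> Z n i (src T f)" "res (Om1 D i) f a = red D i (src T f) y" by blast
      note W = intoD(3)[OF f]
      show "\<exists>x\<in>?A' (src T f). res (Om1 D i) f a = cartier i (src T f) x"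
        using cartier_red_psi[OF W Z_in[OF W y(1)]] y(2) sheaf_imageI[OF ab_Om1 red_hom sub_Z W psi_Z[OF W y(1)]]
        by (intro bexI[of _ "red D i (src T f) (psi i (src T f) y)"]) simp_all
    qed
  qed
  finally show ?case .
qed

lemma sub_ZOm1: "subsheaf T (Om1 D i) (ZOm1 D n i)"
  by (rule subsheaf_cong[OF subsheaf_image[OF ab_Om ab_Om1 red_hom sub_Z] ZOm1_eq])

lemma ZOm1_Suc: "U \<in> ob T \<Longrightarrow> ZOm1 D (Suc n) i U = cart_pre i (ZOm1 D n i) U"
  using Cinv_step_cart_pre[of U "ZOm1 D n i" i] subsheaf_in[OF sub_ZOm1] by (simp add: subset_iff)

lemma red_Z_epi: "sheaf_epi T (subsh (\<Omega> i) (Z n i)) (subsh (Om1 D i) (ZOm1 D n i)) (red D i)"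
  unfolding sheaf_epi_def
proof (intro conjI ballI)
  show "sheaf_ab_hom T (subsh (\<Omega> i) (Z n i)) (subsh (Om1 D i) (ZOm1 D n i)) (red D i)"
    by (rule hom_subsh[OF red_hom Z_in]) (simp_all add: ZOm1_eq sheaf_imageI[OF ab_Om1 red_hom sub_Z])
  show "loc T U (\<lambda>f. \<exists>x\<in>sects (subsh (\<Omega> i) (Z n i)) (src T f).
      res (subsh (Om1 D i) (ZOm1 D n i)) f y = red D i (src T f) x)"
    if "U \<in> ob T" "y \<in> sects (subsh (Om1 D i) (ZOm1 D n i)) U" for U y
    using that by (simp add: ZOm1_eq mem_sheaf_image)
qed

section \<open>The filtration B_n Omega_1\<close>

lemma BnOm1_1: "U \<in> ob T \<Longrightarrow> BnOm1 D (Suc 0) i U = BOm1 D i U"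
proof -
  assume U: "U \<in> ob T"
  interpret G: abelian_group "sec (Om1 D i) U" using ab_sheaf.grp[OF ab_Om1 U] .
  have "BnOm1 D (Suc 0) i U = cart_pre i (\<lambda>U. {\<zero>\<^bsub>sec (Om1 D i) U\<^esub>}) U"
    using Cinv_step_cart_pre[OF U, of "\<lambda>U. {\<zero>\<^bsub>sec (Om1 D i) U\<^esub>}" i] by simp
  then show ?thesis
    using cartier_eq_zero[OF U] BOm1_Ker1[OF U] by (auto simp: cart_pre_def)
qed

lemma sub_BnOm1: "subsheaf T (Om1 D i) (BnOm1 D n i)"
proof (induction n)
  case (Suc n)
  show ?case
    by (rule subsheaf_cong[OF sub_cart_pre[OF Suc]])
      (use Cinv_step_cart_pre[of _ "BnOm1 D n i" i] subsheaf_in[OF Suc] in \<open>simp add: subset_iff\<close>)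
qed (simp add: subsheaf_zero_sub[OF ab_Om1])

lemma BnOm1_Suc: "U \<in> ob T \<Longrightarrow> BnOm1 D (Suc n) i U = cart_pre i (BnOm1 D n i) U"
  using Cinv_step_cart_pre[of U "BnOm1 D n i" i] subsheaf_in[OF sub_BnOm1] by (simp add: subset_iff)

text \<open>p^{-n} d, which represents the operator d of W_n. It is meaningful on Z_n, the sections
  whose differential is divisible by p^n.\<close>

definition divd :: "nat \<Rightarrow> int \<Rightarrow> 'o \<Rightarrow> 'a \<Rightarrow> 'a" where
  "divd n i U x = pdiv D n (i + 1) U (d i U x)"

lemma divd_props:
  assumes U: "U \<in> ob T" and x: "x \<in> Z n i U"
  shows divd_closed: "divd n i U x \<in> Sec (i + 1) U" and P_divd: "P n (i + 1) U (divd n i U x) = d i U x"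
proof -
  obtain y where y: "y \<in> Sec (i + 1) U" "d i U x = P n (i + 1) U y" using x mem_Z[OF U] by blast
  then have "divd n i U x = y" unfolding divd_def using pdiv_eq[OF U] by simp
  then show "divd n i U x \<in> Sec (i + 1) U" "P n (i + 1) U (divd n i U x) = d i U x" using y by simp_all
qed

lemma divdI:
  assumes U: "U \<in> ob T" and y: "y \<in> Sec (i + 1) U" and eq: "d i U x = P n (i + 1) U y"
  shows "divd n i U x = y"
  unfolding divd_def eq by (rule pdiv_eq[OF U y])

lemma divd_hom: "sheaf_ab_hom T (subsh (\<Omega> i) (Z n i)) (\<Omega> (i + 1)) (divd n i)"
proof (rule homI)
  fix U x assume U: "U \<in> ob T" and "x \<in> sects (subsh (\<Omega> i) (Z n i)) U"
  then have x: "x \<in> Z n i U" by simp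
  show "divd n i U x \<in> Sec (i + 1) U" using divd_closed[OF U x] .
  show "divd n i U (x \<oplus>\<^bsub>sec (subsh (\<Omega> i) (Z n i)) U\<^esub> y) = divd n i U x \<oplus>\<^bsub>sec (\<Omega> (i + 1)) U\<^esub> divd n i U y"
    if "y \<in> sects (subsh (\<Omega> i) (Z n i)) U" for y
  proof (rule divdI[OF U])
    have y: "y \<in> Z n i U" using that by simp
    show "d i U (x \<oplus>\<^bsub>sec (subsh (\<Omega> i) (Z n i)) U\<^esub> y) = P n (i + 1) U (divd n i U x \<oplus>\<^bsub>sec (\<Omega> (i + 1)) U\<^esub> divd n i U y)"
      using P_add[OF U divd_closed[OF U x] divd_closed[OF U y]] P_divd[OF U x] P_divd[OF U y]
        d_add[OF U Z_in[OF U x] Z_in[OF U y]] by simp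
  qed (use divd_closed[OF U] x that U in simp_all)
next
  fix U f x assume f: "f \<in> into T U" and "x \<in> sects (subsh (\<Omega> i) (Z n i)) U"
  then have x: "x \<in> Z n i U" by simp
  note U = intoD(4)[OF f]
  show "res (\<Omega> (i + 1)) f (divd n i U x) = divd n i (src T f) (res (subsh (\<Omega> i) (Z n i)) f x)"
  proof (rule divdI[OF intoD(3)[OF f] O_res[OF f divd_closed[OF U x]], symmetric])
    show "d i (src T f) (res (subsh (\<Omega> i) (Z n i)) f x) = P n (i + 1) (src T f) (res (\<Omega> (i + 1)) f (divd n i U x))"
      using P_res[OF f divd_closed[OF U x], of n] P_divd[OF U x] d_res[OF f Z_in[OF U x]] by simp
  qed
qed

text \<open>Divide d psi = p psi d by p^{n+1}: psi intertwines p^{-n} d and p^{-(n+1)} d, which lets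
  the argument for Z_n be repeated for B_n.\<close>

lemma divd_psi:
  assumes U: "U \<in> ob T" and x: "x \<in> Z n i U"
  shows "divd (Suc n) i U (psi i U x) = psi (i + 1) U (divd n i U x)"
proof (rule divdI[OF U psi_closed[OF U divd_closed[OF U x]]])
  note c = divd_closed[OF U x]
  have "d i U (psi i U x) = P 1 (i + 1) U (psi (i + 1) U (P n (i + 1) U (divd n i U x)))"
    using d_psi[OF U Z_in[OF U x]] P_divd[OF U x] by simp
  then show "d i U (psi i U x) = P (Suc n) (i + 1) U (psi (i + 1) U (divd n i U x))"
    using psi_P[OF U c, of n] P_P[OF U psi_closed[OF U c], of 1 n] by simp
qed

lemma divd_P: "\<lbrakk>U \<in> ob T; u \<in> Sec i U\<rbrakk> \<Longrightarrow> divd n i U (P n i U u) = d i U u"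
  by (rule divdI) (simp_all add: d_P)

lemma divd_d: "\<lbrakk>U \<in> ob T; w \<in> Sec (i - 1) U\<rbrakk> \<Longrightarrow> divd n i U (d (i - 1) U w) = \<zero>\<^bsub>sec (\<Omega> (i + 1)) U\<^esub>"
  by (rule divdI) (simp_all add: dd P_zero)

text \<open>p^{-n} d modulo p. Its image turns out to be B_{n+1} Omega_1^{i+1}, and for n > 0 its
  class modulo boundaries represents F^{n-1} d.\<close>

definition del :: "nat \<Rightarrow> int \<Rightarrow> 'o \<Rightarrow> 'a \<Rightarrow> 'm \<Rightarrow> 'a set" where
  "del n i U x = red D (i + 1) U (divd n i U x)"

lemma del_hom: "sheaf_ab_hom T (subsh (\<Omega> i) (Z n i)) (Om1 D (i + 1)) (del n i)"
  unfolding del_def by (rule hom_comp[OF divd_hom red_hom])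

lemma sub_ZZ: "subsheaf T (subsh (\<Omega> i) (Z n i)) (Z n i)"
  by (rule subsheaf_subsh[OF ab_Om sub_Z sub_Z])

lemma ab_Z: "ab_sheaf T (subsh (\<Omega> i) (Z n i))"
  by (rule ab_sheaf_subsh[OF ab_Om sub_Z])

text \<open>The induction of \<open>ZOm1_eq\<close> with \<open>divd_psi\<close> supplying the lift.
  On Z_{n+1} the map \<open>del\<close> kills d Omega and sends p^{n+1} Omega to boundaries, so
  psi(Z_n) decides. The index is shifted because B_1 consists of the reductions of d Z_0.\<close>

lemma BnOm1_eq: "U \<in> ob T \<Longrightarrow>
    BnOm1 D (Suc n) (i + 1) U = sheaf_image T (Om1 D (i + 1)) (del n i) (Z n i) U"
proof (induction n arbitrary: U)
  case (0 U)
  note B1 = BnOm1_1[OF 0, of "i + 1"]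
  have del0: "del 0 i V x = red D (i + 1) V (d i V x)" if "V \<in> ob T" "x \<in> Sec i V" for V x
    using divd_P[OF that, of 0] P_0[OF that] by (simp add: del_def)
  show ?case
    unfolding B1
  proof (intro subset_antisym subsetI)
    fix x assume x: "x \<in> BOm1 D (i + 1) U"
    show "x \<in> sheaf_image T (Om1 D (i + 1)) (del 0 i) (Z 0 i) U"
      unfolding mem_sheaf_image
      by (intro conjI subsheaf_in[OF sub_BOm1 0 x] loc_mono[OF BOm1_loc[OF 0 x] 0])
        (use Z_0[OF intoD(3)] del0[OF intoD(3)] in auto)
  next
    fix x assume x: "x \<in> sheaf_image T (Om1 D (i + 1)) (del 0 i) (Z 0 i) U"
    show "x \<in> BOm1 D (i + 1) U"
    proof (rule sheaf_image_least[OF sub_BOm1 _ 0 x])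
      show "del 0 i V y \<in> BOm1 D (i + 1) V" if "V \<in> ob T" "y \<in> Z 0 i V" for V y
        using del0[OF that(1) Z_in[OF that]] red_d_BOm1[OF that(1), of y "i + 1"] Z_in[OF that] by simp
    qed
  qed
next
  case (Suc n U)
  let ?i = "i + 1"
  let ?A = "sheaf_image T (Om1 D ?i) (del n i) (Z n i)" and ?A' = "sheaf_image T (Om1 D ?i) (del (Suc n) i) (Z (Suc n) i)"
  have sub: "subsheaf T (Om1 D ?i) (sheaf_image T (Om1 D ?i) (del n i) (Z n i))" for n
    by (rule subsheaf_image[OF ab_Z ab_Om1 del_hom sub_ZZ])
  have imI: "del n i V x \<in> sheaf_image T (Om1 D ?i) (del n i) (Z n i) V" if "V \<in> ob T" "x \<in> Z n i V" for n V x
    by (rule sheaf_imageI[OF ab_Om1 del_hom sub_ZZ that])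
  have "BnOm1 D (Suc (Suc n)) ?i U = cart_pre ?i (BnOm1 D (Suc n) ?i) U" by (rule BnOm1_Suc[OF Suc.prems])
  also have "\<dots> = cart_pre ?i ?A U" using Suc.IH[OF Suc.prems] by (simp add: cart_pre_def)
  also have "\<dots> = ?A' U"
  proof (rule cart_pre_eqI[OF sub sub _ _ _ Suc.prems])
    fix V assume V: "V \<in> ob T"
    show "x \<in> cart_pre ?i ?A V" if "x \<in> ?A' V" for x
    proof (rule sheaf_image_least[OF sub_cart_pre[OF sub] _ V that])
      fix W z assume W: "W \<in> ob T" and z: "z \<in> Z (Suc n) i W"
      let ?C = "\<lambda>V. {z \<in> sects (subsh (\<Omega> i) (Z (Suc n) i)) V. del (Suc n) i V z \<in> cart_pre ?i ?A V}"
      have C: "subsheaf T (\<Omega> i) ?C"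
        by (rule subsheaf_of_subsh[OF ab_Om sub_Z subsheaf_preimage[OF ab_Z ab_Om1 del_hom sub_cart_pre[OF sub]]])
      have "z \<in> ?C W"
      proof (rule L_least[OF C _ _ _ W Z_L[OF W z]])
        show "psi i V y \<in> ?C V" if "V \<in> ob T" "y \<in> Z n i V" for V y
          using red_cart_pre_psi[OF that(1) divd_closed[OF that], of ?A] divd_psi[OF that] imI[OF that]
            psi_Z[OF that] by (simp add: del_def)
        show "P (Suc n) i V y \<in> ?C V" if "V \<in> ob T" "y \<in> Sec i V" for V y
          using red_d_BOm1[OF that(1), of y ?i] BOm1_cart_pre[OF sub that(1)] divd_P[OF that] that
            P_Sec_Z[OF that] by (simp add: del_def)
        show "d (i - 1) V y \<in> ?C V" if "V \<in> ob T" "y \<in> Sec (i - 1) V" for V y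
        proof -
          have "del (Suc n) i V (d (i - 1) V y) = \<zero>\<^bsub>sec (Om1 D ?i) V\<^esub>"
            using divd_d[OF that] hom_zero[OF ab_Om ab_Om1 red_hom that(1)] by (simp add: del_def)
          then show ?thesis using subsheaf_zero[OF sub_cart_pre[OF sub] that(1)] d_Z[OF that] by simp
        qed
      qed
      then show "del (Suc n) i W z \<in> cart_pre ?i ?A W" by simp
    qed
    show "x \<in> ?A' V" if x: "x \<in> BOm1 D ?i V" for x
      unfolding mem_sheaf_image
    proof (intro conjI subsheaf_in[OF sub_BOm1 V x], rule loc_mono[OF BOm1_loc[OF V x] V])
      fix f assume f: "f \<in> into T V"
        and "\<exists>w\<in>Sec (?i - 1) (src T f). res (Om1 D ?i) f x = red D ?i (src T f) (d (?i - 1) (src T f) w)"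
      then obtain w where w: "w \<in> Sec i (src T f)" "res (Om1 D ?i) f x = red D ?i (src T f) (d i (src T f) w)" by auto
      \<comment> \<open>A boundary dw is p^{-(n+1)} d of p^{n+1} w.\<close>
      then show "\<exists>a\<in>Z (Suc n) i (src T f). res (Om1 D ?i) f x = del (Suc n) i (src T f) a"
        using P_Sec_Z[OF intoD(3)[OF f] w(1)] divd_P[OF intoD(3)[OF f] w(1), of "Suc n"]
        by (intro bexI[of _ "P (Suc n) i (src T f) w"]) (simp_all add: del_def)
    qed
    fix a assume "a \<in> ?A V"
    then have l: "loc T V (\<lambda>f. \<exists>y\<in>Z n i (src T f). res (Om1 D ?i) f a = del n i (src T f) y)"
      by (simp add: mem_sheaf_image)
    show "loc T V (\<lambda>f. \<exists>x\<in>?A' (src T f). res (Om1 D ?i) f a = cartier ?i (src T f) x)"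
    proof (rule loc_mono[OF l V])
      fix f assume f: "f \<in> into T V" and "\<exists>y\<in>Z n i (src T f). res (Om1 D ?i) f a = del n i (src T f) y"
      then obtain y where y: "y \<in> Z n i (src T f)" "res (Om1 D ?i) f a = del n i (src T f) y" by blast
      note W = intoD(3)[OF f]
      have "cartier ?i (src T f) (del (Suc n) i (src T f) (psi i (src T f) y)) = del n i (src T f) y"
        using cartier_red_psi[OF W divd_closed[OF W y(1)]] divd_psi[OF W y(1)] by (simp add: del_def)
      then show "\<exists>x\<in>?A' (src T f). res (Om1 D ?i) f a = cartier ?i (src T f) x"
        using y(2) imI[OF W psi_Z[OF W y(1)]] by metis
    qed
  qed
  finally show ?case .
qed

lemma del_epi: "sheaf_epi T (subsh (\<Omega> i) (Z n i)) (subsh (Om1 D (i + 1)) (BnOm1 D (Suc n) (i + 1))) (del n i)"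
  unfolding sheaf_epi_def
proof (intro conjI ballI)
  show "sheaf_ab_hom T (subsh (\<Omega> i) (Z n i)) (subsh (Om1 D (i + 1)) (BnOm1 D (Suc n) (i + 1))) (del n i)"
  proof (rule homI)
    fix U x assume U: "U \<in> ob T" and x: "x \<in> sects (subsh (\<Omega> i) (Z n i)) U"
    then show "del n i U x \<in> sects (subsh (Om1 D (i + 1)) (BnOm1 D (Suc n) (i + 1))) U"
      using BnOm1_eq[OF U, of n i] sheaf_imageI[OF ab_Om1 del_hom sub_ZZ U] by simp
    show "del n i U (x \<oplus>\<^bsub>sec (subsh (\<Omega> i) (Z n i)) U\<^esub> y) =
        del n i U x \<oplus>\<^bsub>sec (subsh (Om1 D (i + 1)) (BnOm1 D (Suc n) (i + 1))) U\<^esub> del n i U y"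
      if "y \<in> sects (subsh (\<Omega> i) (Z n i)) U" for y
      using hom_add[OF del_hom U x that] by simp
  next
    fix U f x assume f: "f \<in> into T U" and x: "x \<in> sects (subsh (\<Omega> i) (Z n i)) U"
    show "res (subsh (Om1 D (i + 1)) (BnOm1 D (Suc n) (i + 1))) f (del n i U x)
        = del n i (src T f) (res (subsh (\<Omega> i) (Z n i)) f x)"
      using hom_res[OF del_hom f x] by simp
  qed
  show "loc T U (\<lambda>f. \<exists>x\<in>sects (subsh (\<Omega> i) (Z n i)) (src T f).
      res (subsh (Om1 D (i + 1)) (BnOm1 D (Suc n) (i + 1))) f y = del n i (src T f) x)"
    if "U \<in> ob T" "y \<in> sects (subsh (Om1 D (i + 1)) (BnOm1 D (Suc n) (i + 1))) U" for U y
    using that BnOm1_eq[OF that(1), of n i] by (simp add: mem_sheaf_image)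
qed

lemma BnOm1_2: "U \<in> ob T \<Longrightarrow> BnOm1 D 2 i U = cart_pre i (BOm1 D i) U"
  using BnOm1_Suc[of U "Suc 0" i] BnOm1_1[of U i] by (simp add: numeral_2_eq_2 cart_pre_def)

lemma quot_BOm1:
  assumes "subsheaf T (Om1 D i) A" "\<And>V x. \<lbrakk>V \<in> ob T; x \<in> BOm1 D i V\<rbrakk> \<Longrightarrow> x \<in> A V"
  shows "quot_sheaf T (subsh (Om1 D i) A) (BOm1 D i)"
  by (intro quot_sheaf.intro quot_sheaf_axioms.intro grothendieck_site_axioms
      ab_sheaf_subsh[OF ab_Om1 assms(1)] subsheaf_subsh[OF ab_Om1 assms(1) sub_BOm1 assms(2)])

section \<open>The operator C for a filtration defined by Cartier preimages\<close>

context
  fixes X :: "nat \<Rightarrow> int \<Rightarrow> 'o \<Rightarrow> ('m \<Rightarrow> 'a set) set" and n :: nat and i :: int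
  assumes sub_X: "subsheaf T (Om1 D i) (X n i)"
    and X_Suc: "\<And>U. U \<in> ob T \<Longrightarrow> X (Suc n) i U = cart_pre i (X n i) U"
    and BX: "\<And>V x. \<lbrakk>V \<in> ob T; x \<in> BOm1 D i V\<rbrakk> \<Longrightarrow> x \<in> X n i V"
begin

lemma sub_X': "subsheaf T (Om1 D i) (X (Suc n) i)"
  by (rule subsheaf_cong[OF sub_cart_pre[OF sub_X] X_Suc])

lemma BX': "\<lbrakk>V \<in> ob T; x \<in> BOm1 D i V\<rbrakk> \<Longrightarrow> x \<in> X (Suc n) i V"
  using X_Suc BOm1_cart_pre[OF sub_X] by simp

lemma X'_Ker1: "\<lbrakk>V \<in> ob T; x \<in> X (Suc n) i V\<rbrakk> \<Longrightarrow> x \<in> Ker1 D i V"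
  using X_Suc by (simp add: cart_pre_def)

lemma cartier_X': "\<lbrakk>V \<in> ob T; x \<in> X (Suc n) i V\<rbrakk> \<Longrightarrow> cartier i V x \<in> X n i V"
  using X_Suc by (simp add: cart_pre_def)

abbreviation "XQ \<equiv> quot T (subsh (Om1 D i) (X n i)) (BOm1 D i)"
abbreviation "XQ' \<equiv> quot T (subsh (Om1 D i) (X (Suc n) i)) (BOm1 D i)"
abbreviation "CQ \<equiv> quot T (subsh (Om1 D i) (X (Suc n) i)) (BnOm1 D 2 i)"
abbreviation "cl2 \<equiv> quot_proj T (Om1 D i) (BnOm1 D 2 i)"

lemma B2_X': "\<lbrakk>V \<in> ob T; x \<in> BnOm1 D 2 i V\<rbrakk> \<Longrightarrow> x \<in> X (Suc n) i V"
  using X_Suc BnOm1_2 BX by (auto simp: cart_pre_def)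

lemma quot_XC: "quot_sheaf T (subsh (Om1 D i) (X (Suc n) i)) (BnOm1 D 2 i)"
  by (intro quot_sheaf.intro quot_sheaf_axioms.intro grothendieck_site_axioms
      ab_sheaf_subsh[OF ab_Om1 sub_X'] subsheaf_subsh[OF ab_Om1 sub_X' sub_BnOm1 B2_X'])

lemmas quot_X = quot_BOm1[OF sub_X BX]
lemmas quot_X' = quot_BOm1[OF sub_X' BX']
lemmas ab_XQ = quot_sheaf.ab_quot[OF quot_X]
lemmas ab_CQ = quot_sheaf.ab_quot[OF quot_XC]

text \<open>B_2 Omega_1 is the Cartier preimage of B Omega_1, so vanishing modulo B_2 is tested
  after the Cartier map.\<close>

lemma cl2_zero: "\<lbrakk>U \<in> ob T; x \<in> X (Suc n) i U\<rbrakk> \<Longrightarrow> cl2 U x = \<zero>\<^bsub>sec CQ U\<^esub> \<longleftrightarrow> cartier i U x \<in> BOm1 D i U"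
  using quot_sheaf.pr_eq_zero_iff[OF quot_XC, of U x] BnOm1_2[of U i] X'_Ker1 by (simp add: cart_pre_def)

lemma C_proj_props:
  shows C_proj_hom: "sheaf_ab_hom T XQ' CQ (C_proj D X n i)"
    and C_proj_cl: "\<lbrakk>U \<in> ob T; x \<in> X (Suc n) i U\<rbrakk> \<Longrightarrow> C_proj D X n i U (cl i U x) = cl2 U x"
proof -
  have h: "sheaf_ab_hom T (subsh (Om1 D i) (X (Suc n) i)) (subsh (Om1 D i) (X (Suc n) i)) (\<lambda>U x. x)"
    by (rule hom_incl)
  have k: "x \<in> BnOm1 D 2 i V" if "V \<in> ob T" "x \<in> BOm1 D i V" for V x
    using BnOm1_2[OF that(1)] BOm1_cart_pre[OF sub_BOm1 that] by simp
  note q = quot_sheaf.quot_map_props[OF quot_X' quot_XC h k, folded C_proj_def]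
  show "sheaf_ab_hom T XQ' CQ (C_proj D X n i)" by (rule q(1))
  show "C_proj D X n i U (cl i U x) = cl2 U x" if "U \<in> ob T" "x \<in> X (Suc n) i U"
    by (rule q(2)[unfolded quot_proj_subsh]) (use that in simp_all)
qed

text \<open>A section of cohomology is locally the class of a cycle c, whose Cartier image is then
  the restriction of x. So c lies in the Cartier preimage of X_n, which is X_{n+1}.\<close>

lemma Cinv_loc:
  assumes U: "U \<in> ob T" and x: "x \<in> X n i U"
  shows "loc T U (\<lambda>f. \<exists>c\<in>X (Suc n) i (src T f). cartier i (src T f) c = res (Om1 D i) f x \<and>
    res (H1 D i) f (Cinv D i U x) = cl i (src T f) c)"
proof -
  have xO: "x \<in> sects (Om1 D i) U" using subsheaf_in[OF sub_X U x] .
  show ?thesis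
  proof (rule loc_mono[OF sheaf_epi_loc[OF cls1_epi U hom_closed[OF Cinv_hom U xO]] U])
    fix f assume f: "f \<in> into T U"
      and "\<exists>c\<in>sects (subsh (Om1 D i) (Ker1 D i)) (src T f). res (H1 D i) f (Cinv D i U x) = cls1 D i (src T f) c"
    then obtain c where c: "c \<in> Ker1 D i (src T f)" "res (H1 D i) f (Cinv D i U x) = cls1 D i (src T f) c" by auto
    note V = intoD(3)[OF f]
    have rx: "res (Om1 D i) f x \<in> X n i (src T f)" using subsheaf_res[OF sub_X f x] .
    have "cartier i (src T f) c = res (Om1 D i) f x"
      using cartier_eq_iff[OF V c(1) subsheaf_in[OF sub_X V rx]] c(2) hom_res[OF Cinv_hom f xO] by simp
    moreover have "c \<in> X (Suc n) i (src T f)"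
      using X_Suc[OF V] c(1) rx calculation by (simp add: cart_pre_def)
    ultimately show "\<exists>c\<in>X (Suc n) i (src T f). cartier i (src T f) c = res (Om1 D i) f x \<and>
        res (H1 D i) f (Cinv D i U x) = cl i (src T f) c"
      using c(2) cls1_eq by auto
  qed
qed

lemma XQ'_incl: "sheaf_ab_hom T XQ' (H1 D i) (\<lambda>U t. t)"
  unfolding H1_def
  by (rule subquot_incl[OF ab_Om1 sub_X' sub_Ker1 sub_BOm1 BX' X'_Ker1])

text \<open>C^{-1} is given with values in the whole cohomology sheaf. The local cycles of
  \<open>Cinv_loc\<close> show that on X_n its values are sections of X_{n+1} modulo
  boundaries.\<close>

lemma Cinv_X_hom: "sheaf_ab_hom T (subsh (Om1 D i) (X n i)) XQ' (Cinv D i)"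
proof (rule hom_factor_incl[OF XQ'_incl])
  show "sheaf_ab_hom T (subsh (Om1 D i) (X n i)) (H1 D i) (Cinv D i)"
    by (rule hom_domain[OF Cinv_hom subsheaf_in[OF sub_X]])
  show "Cinv D i U x \<in> sects XQ' U" if U: "U \<in> ob T" and "x \<in> sects (subsh (Om1 D i) (X n i)) U" for U x
  proof (rule subquot_mem[OF ab_Om1 sub_X' sub_Ker1 sub_BOm1 BX' X'_Ker1 U])
    have x: "x \<in> X n i U" using that by simp
    show "Cinv D i U x \<in> sects (quot T (subsh (Om1 D i) (Ker1 D i)) (BOm1 D i)) U"
      using hom_closed[OF Cinv_hom U subsheaf_in[OF sub_X U x]] by (simp add: H1_def)
    show "loc T U (\<lambda>f. \<exists>x'\<in>X (Suc n) i (src T f).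
        res (quot T (subsh (Om1 D i) (Ker1 D i)) (BOm1 D i)) f (Cinv D i U x) = cl i (src T f) x')"
      by (rule loc_mono[OF Cinv_loc[OF U x] U]) (auto simp: H1_def)
  qed
qed

lemma Cinv_C_loc:
  assumes U: "U \<in> ob T" and x: "x \<in> X n i U"
  shows "loc T U (\<lambda>f. \<exists>c\<in>X (Suc n) i (src T f). cartier i (src T f) c = res (Om1 D i) f x \<and>
    res CQ f (C_proj D X n i U (Cinv D i U x)) = cl2 (src T f) c)"
proof (rule loc_mono[OF Cinv_loc[OF U x] U])
  fix f assume f: "f \<in> into T U" and "\<exists>c\<in>X (Suc n) i (src T f). cartier i (src T f) c = res (Om1 D i) f x \<and>
    res (H1 D i) f (Cinv D i U x) = cl i (src T f) c"
  then obtain c where c: "c \<in> X (Suc n) i (src T f)" "cartier i (src T f) c = res (Om1 D i) f x"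
    "res (H1 D i) f (Cinv D i U x) = cl i (src T f) c" by blast
  have t: "Cinv D i U x \<in> sects XQ' U" using hom_closed[OF Cinv_X_hom U] x by simp
  have "res CQ f (C_proj D X n i U (Cinv D i U x)) = cl2 (src T f) c"
    using hom_res[OF C_proj_hom f t] hom_res[OF XQ'_incl f t] c(3) C_proj_cl[OF intoD(3)[OF f] c(1)] by simp
  then show "\<exists>c\<in>X (Suc n) i (src T f). cartier i (src T f) c = res (Om1 D i) f x \<and>
    res CQ f (C_proj D X n i U (Cinv D i U x)) = cl2 (src T f) c" using c by blast
qed

lemma Cinv_C_cartier:
  assumes U: "U \<in> ob T" and c: "c \<in> X (Suc n) i U"
  shows "C_proj D X n i U (Cinv D i U (cartier i U c)) = cl2 U c"
proof -
  have "Cinv D i U (cartier i U c) = cl i U c"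
    using cartier_eq_iff[OF U X'_Ker1[OF U c] cartier_closed[OF U X'_Ker1[OF U c]]] cls1_eq by simp
  then show ?thesis using C_proj_cl[OF U c] by simp
qed

lemma Cinv_C_hom: "sheaf_ab_hom T (subsh (Om1 D i) (X n i)) CQ (\<lambda>U x. C_proj D X n i U (Cinv D i U x))"
  by (rule hom_comp[OF Cinv_X_hom C_proj_hom])

text \<open>Locally C^{-1} x is the class of some c with Cartier image x, and this is zero modulo
  B_2 exactly when x is a boundary.\<close>

lemma Cinv_C_zero:
  assumes U: "U \<in> ob T" and x: "x \<in> X n i U"
  shows "C_proj D X n i U (Cinv D i U x) = \<zero>\<^bsub>sec CQ U\<^esub> \<longleftrightarrow> x \<in> BOm1 D i U"
proof
  note xO = subsheaf_in[OF sub_X U x]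
  have t: "C_proj D X n i U (Cinv D i U x) \<in> sects CQ U" using hom_closed[OF Cinv_C_hom U] x by simp
  interpret G: abelian_group "sec CQ U" using ab_sheaf.grp[OF ab_CQ U] .
  {
    assume 0: "C_proj D X n i U (Cinv D i U x) = \<zero>\<^bsub>sec CQ U\<^esub>"
    show "x \<in> BOm1 D i U"
    proof (rule subsheaf_loc[OF sub_BOm1 U xO], rule loc_mono[OF Cinv_C_loc[OF U x] U])
      fix f assume f: "f \<in> into T U" and "\<exists>c\<in>X (Suc n) i (src T f). cartier i (src T f) c = res (Om1 D i) f x \<and>
        res CQ f (C_proj D X n i U (Cinv D i U x)) = cl2 (src T f) c"
      then show "res (Om1 D i) f x \<in> BOm1 D i (src T f)"
        using cl2_zero[OF intoD(3)[OF f]] res_zero[OF ab_CQ f] 0 by force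
    qed
  }
  assume xB: "x \<in> BOm1 D i U"
  show "C_proj D X n i U (Cinv D i U x) = \<zero>\<^bsub>sec CQ U\<^esub>"
  proof (rule sheaf_eqI[OF ab_CQ U t G.zero_closed], rule loc_mono[OF Cinv_C_loc[OF U x] U])
    fix f assume f: "f \<in> into T U" and "\<exists>c\<in>X (Suc n) i (src T f). cartier i (src T f) c = res (Om1 D i) f x \<and>
        res CQ f (C_proj D X n i U (Cinv D i U x)) = cl2 (src T f) c"
    then show "res CQ f (C_proj D X n i U (Cinv D i U x)) = res CQ f \<zero>\<^bsub>sec CQ U\<^esub>"
      using cl2_zero[OF intoD(3)[OF f]] res_zero[OF ab_CQ f] subsheaf_res[OF sub_BOm1 f xB] by force
  qed
qed

lemma C_inv_props:
  shows C_inv_hom: "sheaf_ab_hom T XQ CQ (C_inv D X n i)"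
    and C_inv_cl: "\<lbrakk>U \<in> ob T; x \<in> X n i U\<rbrakk> \<Longrightarrow> C_inv D X n i U (cl i U x) = C_proj D X n i U (Cinv D i U x)"
proof -
  have k: "C_proj D X n i V (Cinv D i V x) = \<zero>\<^bsub>sec CQ V\<^esub>" if "V \<in> ob T" "x \<in> BOm1 D i V" for V x
    using Cinv_C_zero[OF that(1) BX[OF that]] that(2) by simp
  show "sheaf_ab_hom T XQ CQ (C_inv D X n i)"
    unfolding C_inv_def by (rule quot_sheaf.induced_hom[OF quot_X ab_CQ Cinv_C_hom k])
  show "C_inv D X n i U (cl i U x) = C_proj D X n i U (Cinv D i U x)" if "U \<in> ob T" "x \<in> X n i U"
    unfolding C_inv_def
    by (rule quot_sheaf.induced_pr[OF quot_X ab_CQ Cinv_C_hom k, unfolded quot_proj_subsh]) (use that in simp_all)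
qed

text \<open>A class modulo B_2 is locally that of some c, which is hit by the Cartier image of c;
  the kernel is given by \<open>Cinv_C_zero\<close>.\<close>

lemma C_inv_bij:
  assumes U: "U \<in> ob T"
  shows "bij_betw (C_inv D X n i U) (sects XQ U) (sects CQ U)"
proof (rule epi_bij[OF ab_XQ ab_CQ quot_sheaf.pr_epi[OF quot_X] C_inv_hom _ _ _ U])
  show "sheaf_epi T (subsh (Om1 D i) (X n i)) CQ (\<lambda>U x. C_proj D X n i U (Cinv D i U x))"
    unfolding sheaf_epi_def
  proof (intro conjI Cinv_C_hom ballI)
    fix U y assume U: "U \<in> ob T" and y: "y \<in> sects CQ U"
    show "loc T U (\<lambda>f. \<exists>x\<in>sects (subsh (Om1 D i) (X n i)) (src T f).
        res CQ f y = C_proj D X n i (src T f) (Cinv D i (src T f) x))"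
    proof (rule loc_mono[OF sheaf_epi_loc[OF quot_sheaf.pr_epi[OF quot_XC] U y] U])
      fix f assume f: "f \<in> into T U" and "\<exists>c\<in>sects (subsh (Om1 D i) (X (Suc n) i)) (src T f).
          res CQ f y = quot_proj T (subsh (Om1 D i) (X (Suc n) i)) (BnOm1 D 2 i) (src T f) c"
      then obtain c where c: "c \<in> X (Suc n) i (src T f)" "res CQ f y = cl2 (src T f) c" by auto
      then show "\<exists>x\<in>sects (subsh (Om1 D i) (X n i)) (src T f).
          res CQ f y = C_proj D X n i (src T f) (Cinv D i (src T f) x)"
        using Cinv_C_cartier[OF intoD(3)[OF f] c(1)] cartier_X'[OF intoD(3)[OF f] c(1)]
        by (intro bexI[of _ "cartier i (src T f) c"]) simp_all
    qed
  qed
  fix V x assume V: "V \<in> ob T" and "x \<in> sects (subsh (Om1 D i) (X n i)) V"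
  then have x: "x \<in> X n i V" by simp
  show "C_inv D X n i V (quot_proj T (subsh (Om1 D i) (X n i)) (BOm1 D i) V x) = C_proj D X n i V (Cinv D i V x)"
    using C_inv_cl[OF V x] by simp
  show "quot_proj T (subsh (Om1 D i) (X n i)) (BOm1 D i) V x = \<zero>\<^bsub>sec XQ V\<^esub>"
    if "C_proj D X n i V (Cinv D i V x) = \<zero>\<^bsub>sec CQ V\<^esub>"
    using that Cinv_C_zero[OF V x] quot_sheaf.pr_eq_zero_iff[OF quot_X V, of x] x by simp
qed

lemma C_op_hom: "sheaf_ab_hom T XQ' XQ (C_op D X n i)"
  using hom_comp[OF C_proj_hom iso_inverse[OF ab_XQ ab_CQ C_inv_hom C_inv_bij]]
  unfolding C_op_def .

text \<open>Once the inverse exists, C is the Cartier map on representatives. Later computations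
  with C go through this rule.\<close>

lemma C_op_cl:
  assumes U: "U \<in> ob T" and c: "c \<in> X (Suc n) i U"
  shows "C_op D X n i U (cl i U c) = cl i U (cartier i U c)"
proof -
  note x = cartier_X'[OF U c]
  have "C_proj D X n i U (cl i U c) = C_inv D X n i U (cl i U (cartier i U c))"
    using C_inv_cl[OF U x] Cinv_C_cartier[OF U c] C_proj_cl[OF U c] by simp
  moreover have "cl i U (cartier i U c) \<in> sects XQ U"
    using hom_closed[OF quot_sheaf.pr_hom[OF quot_X] U, of "cartier i U c"] x by simp
  ultimately show ?thesis
    unfolding C_op_def using the_inv_into_f_f[OF bij_betw_imp_inj_on[OF C_inv_bij[OF U]]] by simp
qed

end

end

section \<open>Scalars\<close>

declare ZOm1.simps(2) [simp del] BnOm1.simps(2) [simp del]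

lemma sheaf_epi_twist [simp]: "sheaf_epi T A (twist n P) h \<longleftrightarrow> sheaf_epi T A P h"
  by (simp add: sheaf_epi_def)

lemma witt_frob_teichmueller:
  assumes "CHAR('k::field) > 0"
  shows "witt_frob (teichmueller (c :: 'k)) = teichmueller (c ^ CHAR('k))"
  using assms by (auto simp: witt_frob_def teichmueller_def zero_power)

text \<open>Linearity of C^{-1} is given for scalars of the residue field, that is for
  multiplicative lifts. Twisting such a lift gives another one, so the twisted actions under
  \<open>kmod\<close> are covered.\<close>

lemma witt_frob_funpow_teichmueller:
  assumes "CHAR('k::field) > 0"
  shows "\<exists>e. (witt_frob ^^ n) (teichmueller (c :: 'k)) = teichmueller e"
  by (induction n) (auto simp: witt_frob_teichmueller[OF assms])

context grothendieck_site
begin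

lemma zero_hom: "ab_sheaf T P \<Longrightarrow> sheaf_ab_hom T M P (\<lambda>U x. \<zero>\<^bsub>sec P U\<^esub>)"
proof (rule homI)
  assume P: "ab_sheaf T P"
  fix U assume U: "U \<in> ob T"
  interpret G: abelian_group "sec P U" using ab_sheaf.grp[OF P U] .
  show "\<zero>\<^bsub>sec P U\<^esub> \<in> sects P U" "\<zero>\<^bsub>sec P U\<^esub> = \<zero>\<^bsub>sec P U\<^esub> \<oplus>\<^bsub>sec P U\<^esub> \<zero>\<^bsub>sec P U\<^esub>" by simp_all
qed (simp add: res_zero)

text \<open>Compatibility with a scalar is an equality of two morphisms, hence can be tested on
  representatives.\<close>

lemma epi_commute:
  assumes P: "ab_sheaf T P" and epi: "sheaf_epi T A Q \<pi>" and k: "sheaf_ab_hom T Q P k"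
    and sQ: "sheaf_ab_hom T Q Q sQ" and sP: "sheaf_ab_hom T P P sP"
    and eq: "\<And>V x. \<lbrakk>V \<in> ob T; x \<in> sects A V\<rbrakk> \<Longrightarrow> k V (sQ V (\<pi> V x)) = sP V (k V (\<pi> V x))"
    and U: "U \<in> ob T" and t: "t \<in> sects Q U"
  shows "k U (sQ U t) = sP U (k U t)"
  by (rule epi_eqI[OF P epi hom_comp[OF sQ k] hom_comp[OF k sP] eq U t])

end

context dRW
begin

section \<open>Scalars on Z_n, B_n and the filtrations\<close>

lemma smult_Om: "sheaf_ab_hom T (\<Omega> i) (\<Omega> i) (\<lambda>U x. a \<odot>\<^bsub>sec (\<Omega> i) U\<^esub> x)"
proof (rule homI)
  interpret S: sheaf_of_modules T witt_ring "\<Omega> i" by (rule Om_sheaf)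
  fix U x assume U: "U \<in> ob T" and x: "x \<in> Sec i U"
  interpret M: module witt_ring "sec (\<Omega> i) U" using S.sec_module[OF U] .
  have a: "a \<in> carrier witt_ring" by (simp add: witt_ring_def)
  show "a \<odot>\<^bsub>sec (\<Omega> i) U\<^esub> x \<in> Sec i U" using M.smult_closed[OF a x] .
  show "a \<odot>\<^bsub>sec (\<Omega> i) U\<^esub> (x \<oplus>\<^bsub>sec (\<Omega> i) U\<^esub> y) = a \<odot>\<^bsub>sec (\<Omega> i) U\<^esub> x \<oplus>\<^bsub>sec (\<Omega> i) U\<^esub> a \<odot>\<^bsub>sec (\<Omega> i) U\<^esub> y"
    if "y \<in> Sec i U" for y using M.smult_r_distr[OF a x that] .
next
  interpret S: sheaf_of_modules T witt_ring "\<Omega> i" by (rule Om_sheaf)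
  show "res (\<Omega> i) f (a \<odot>\<^bsub>sec (\<Omega> i) U\<^esub> x) = a \<odot>\<^bsub>sec (\<Omega> i) (src T f)\<^esub> res (\<Omega> i) f x"
    if "f \<in> into T U" "x \<in> Sec i U" for U f x
    using S.res_smult[of f x a] that by (auto simp: into_def)
qed

lemmas smult_closed [simp] = hom_closed[OF smult_Om]
lemmas smult_add = hom_add[OF smult_Om]

lemma P_smult: "\<lbrakk>U \<in> ob T; x \<in> Sec i U\<rbrakk> \<Longrightarrow> P k i U (a \<odot>\<^bsub>sec (\<Omega> i) U\<^esub> x) = a \<odot>\<^bsub>sec (\<Omega> i) U\<^esub> P k i U x"
  using hom_P[OF smult_Om] by simp

lemma d_smult: "\<lbrakk>U \<in> ob T; x \<in> Sec i U\<rbrakk> \<Longrightarrow> d i U (a \<odot>\<^bsub>sec (\<Omega> i) U\<^esub> x) = a \<odot>\<^bsub>sec (\<Omega> (i + 1)) U\<^esub> d i U x"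
  using diff_hom[of i] by (simp add: sheaf_mod_hom_def)

lemma d_smult': "\<lbrakk>U \<in> ob T; x \<in> Sec (i - 1) U\<rbrakk> \<Longrightarrow>
    d (i - 1) U (a \<odot>\<^bsub>sec (\<Omega> (i - 1)) U\<^esub> x) = a \<odot>\<^bsub>sec (\<Omega> i) U\<^esub> d (i - 1) U x"
  using d_smult[of U x "i - 1" a] by simp

text \<open>phi is linear into the Frobenius twist, and the factor p^i cancels.\<close>

lemma psi_smult:
  assumes U: "U \<in> ob T" and x: "x \<in> Sec i U"
  shows "psi i U (a \<odot>\<^bsub>sec (\<Omega> i) U\<^esub> x) = witt_frob a \<odot>\<^bsub>sec (\<Omega> i) U\<^esub> psi i U x"
proof (rule P_inj[OF U])
  have "phi D i U (a \<odot>\<^bsub>sec (\<Omega> i) U\<^esub> x) = witt_frob a \<odot>\<^bsub>sec (\<Omega> i) U\<^esub> phi D i U x"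
    using phi_hom[of i] U x by (simp add: sheaf_mod_hom_def)
  then show "P (nat i) i U (psi i U (a \<odot>\<^bsub>sec (\<Omega> i) U\<^esub> x)) = P (nat i) i U (witt_frob a \<odot>\<^bsub>sec (\<Omega> i) U\<^esub> psi i U x)"
    using P_psi[OF U smult_closed[OF U x]] P_psi[OF U x] P_smult[OF U psi_closed[OF U x]] by simp
qed (use U x in simp_all)

lemma Z_smult:
  assumes U: "U \<in> ob T" and x: "x \<in> Z n i U"
  shows "a \<odot>\<^bsub>sec (\<Omega> i) U\<^esub> x \<in> Z n i U"
proof -
  obtain y where y: "y \<in> Sec (i + 1) U" "d i U x = P n (i + 1) U y" using x mem_Z[OF U] by auto
  have "d i U (a \<odot>\<^bsub>sec (\<Omega> i) U\<^esub> x) = P n (i + 1) U (a \<odot>\<^bsub>sec (\<Omega> (i + 1)) U\<^esub> y)"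
    using d_smult[OF U Z_in[OF U x]] y P_smult[OF U y(1)] by simp
  then show ?thesis using mem_Z[OF U] U Z_in[OF U x] y(1) smult_closed by blast
qed

lemma B_smult:
  assumes U: "U \<in> ob T" and x: "x \<in> B n i U"
  shows "a \<odot>\<^bsub>sec (\<Omega> i) U\<^esub> x \<in> B n i U"
proof -
  have "x \<in> {x \<in> Sec i U. a \<odot>\<^bsub>sec (\<Omega> i) U\<^esub> x \<in> B n i U}"
  proof (rule B_least[OF subsheaf_preimage[OF ab_Om ab_Om smult_Om sub_B] _ _ U x])
    show "P n i V y \<in> {x \<in> Sec i V. a \<odot>\<^bsub>sec (\<Omega> i) V\<^esub> x \<in> B n i V}" if "V \<in> ob T" "y \<in> Sec i V" for V y
      using P_in_B[OF that(1) smult_closed[OF that]] P_smult[OF that] that by simp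
    show "d (i - 1) V y \<in> {x \<in> Sec i V. a \<odot>\<^bsub>sec (\<Omega> i) V\<^esub> x \<in> B n i V}" if "V \<in> ob T" "y \<in> Sec (i - 1) V" for V y
      using d_in_B[OF that(1) smult_closed[OF that]] d_smult'[OF that] that by simp
  qed
  then show ?thesis by simp
qed

lemma divd_smult:
  assumes U: "U \<in> ob T" and x: "x \<in> Z n i U"
  shows "divd n i U (a \<odot>\<^bsub>sec (\<Omega> i) U\<^esub> x) = a \<odot>\<^bsub>sec (\<Omega> (i + 1)) U\<^esub> divd n i U x"
  by (rule divdI[OF U])
    (use U x divd_closed[OF U x] P_divd[OF U x] P_smult[OF U divd_closed[OF U x]] d_smult[OF U Z_in[OF U x]] in simp_all)

lemma WQ_smult:
  shows WQ_smult_pr: "\<lbrakk>U \<in> ob T; x \<in> Z n i U\<rbrakk> \<Longrightarrow>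
      a \<odot>\<^bsub>sec (WQ n i) U\<^esub> prW n i U x = prW n i U (a \<odot>\<^bsub>sec (\<Omega> i) U\<^esub> x)"
    and WQ_smult_hom: "sheaf_ab_hom T (WQ n i) (WQ n i) (\<lambda>U t. a \<odot>\<^bsub>sec (WQ n i) U\<^esub> t)"
proof -
  have h: "sheaf_ab_hom T (subsh (\<Omega> i) (Z n i)) (subsh (\<Omega> i) (Z n i))
      (\<lambda>U x. a \<odot>\<^bsub>sec (subsh (\<Omega> i) (Z n i)) U\<^esub> x)"
    unfolding subsh_simps by (rule hom_subsh[OF smult_Om Z_in Z_smult])
  have k: "a \<odot>\<^bsub>sec (subsh (\<Omega> i) (Z n i)) V\<^esub> x \<in> B n i V" if "V \<in> ob T" "x \<in> B n i V" for V x
    using B_smult[OF that] by simp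
  show "a \<odot>\<^bsub>sec (WQ n i) U\<^esub> prW n i U x = prW n i U (a \<odot>\<^bsub>sec (\<Omega> i) U\<^esub> x)" if "U \<in> ob T" "x \<in> Z n i U"
    by (rule quot_sheaf.pr_smult(1)[OF quot_W h k, unfolded subsh_simps quot_proj_subsh]) (use that in simp_all)
  show "sheaf_ab_hom T (WQ n i) (WQ n i) (\<lambda>U t. a \<odot>\<^bsub>sec (WQ n i) U\<^esub> t)"
    by (rule quot_sheaf.pr_smult(2)[OF quot_W h k])
qed

lemma Om1_smult:
  shows Om1_smult_red: "\<lbrakk>U \<in> ob T; x \<in> Sec i U\<rbrakk> \<Longrightarrow>
      a \<odot>\<^bsub>sec (Om1 D i) U\<^esub> red D i U x = red D i U (a \<odot>\<^bsub>sec (\<Omega> i) U\<^esub> x)"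
    and Om1_smult_hom: "sheaf_ab_hom T (Om1 D i) (Om1 D i) (\<lambda>U t. a \<odot>\<^bsub>sec (Om1 D i) U\<^esub> t)"
proof -
  have k: "a \<odot>\<^bsub>sec (\<Omega> i) V\<^esub> x \<in> pOm D 1 i V" if V: "V \<in> ob T" and x: "x \<in> pOm D 1 i V" for V x
  proof -
    obtain y where y: "y \<in> Sec i V" "x = P 1 i V y" using pOmE[OF x V] .
    show ?thesis
      unfolding y(2) P_smult[OF V y(1), symmetric] by (rule pOmI[OF V smult_closed[OF V y(1)]])
  qed
  show "a \<odot>\<^bsub>sec (Om1 D i) U\<^esub> red D i U x = red D i U (a \<odot>\<^bsub>sec (\<Omega> i) U\<^esub> x)" if "U \<in> ob T" "x \<in> Sec i U"
    unfolding Om1_def red_def by (rule quot_sheaf.pr_smult(1)[OF quot_Om1 smult_Om k]) (use that in simp_all)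
  show "sheaf_ab_hom T (Om1 D i) (Om1 D i) (\<lambda>U t. a \<odot>\<^bsub>sec (Om1 D i) U\<^esub> t)"
    unfolding Om1_def by (rule quot_sheaf.pr_smult(2)[OF quot_Om1 smult_Om k])
qed

lemma ZOm1_smult: "stable T (\<lambda>U t. a \<odot>\<^bsub>sec (Om1 D i) U\<^esub> t) (ZOm1 D n i)"
proof -
  have "stable T (\<lambda>U t. a \<odot>\<^bsub>sec (Om1 D i) U\<^esub> t) (sheaf_image T (Om1 D i) (red D i) (Z n i))"
    by (rule stable_image[OF Om1_smult_hom, where s' = "\<lambda>U x. a \<odot>\<^bsub>sec (\<Omega> i) U\<^esub> x"])
      (use Z_smult in \<open>auto simp: stable_def Om1_smult_red Z_in\<close>)
  then show ?thesis by (simp add: stable_def ZOm1_eq)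
qed

text \<open>Stated in degree i + 1 because B_{n+1} Omega_1^{i+1} is described as an image from
  degree i.\<close>

lemma BnOm1_smult: "stable T (\<lambda>U t. a \<odot>\<^bsub>sec (Om1 D (i + 1)) U\<^esub> t) (BnOm1 D (Suc n) (i + 1))"
proof -
  have "stable T (\<lambda>U t. a \<odot>\<^bsub>sec (Om1 D (i + 1)) U\<^esub> t) (sheaf_image T (Om1 D (i + 1)) (del n i) (Z n i))"
    by (rule stable_image[OF Om1_smult_hom, where s' = "\<lambda>U x. a \<odot>\<^bsub>sec (\<Omega> i) U\<^esub> x"])
      (use Z_smult in \<open>auto simp: stable_def del_def Om1_smult_red divd_closed divd_smult\<close>)
  then show ?thesis by (simp add: stable_def BnOm1_eq)
qed

text \<open>The cycles are Z_1 Omega_1, so their stability is a case of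
  \<open>ZOm1_smult\<close>.\<close>

lemma Ker1_smult: "\<lbrakk>U \<in> ob T; x \<in> Ker1 D i U\<rbrakk> \<Longrightarrow> a \<odot>\<^bsub>sec (Om1 D i) U\<^esub> x \<in> Ker1 D i U"
proof -
  have "ZOm1 D (Suc 0) i U = Ker1 D i U" if "U \<in> ob T" for U
    using ZOm1_Suc[OF that, of 0 i] cartier_closed[OF that] by (auto simp: cart_pre_def)
  then show "\<lbrakk>U \<in> ob T; x \<in> Ker1 D i U\<rbrakk> \<Longrightarrow> a \<odot>\<^bsub>sec (Om1 D i) U\<^esub> x \<in> Ker1 D i U"
    using stableD[OF ZOm1_smult[where n = "Suc 0" and i = i and a = a], of U x] by simp
qed

lemma BOm1_smult: "\<lbrakk>U \<in> ob T; x \<in> BOm1 D i U\<rbrakk> \<Longrightarrow> a \<odot>\<^bsub>sec (Om1 D i) U\<^esub> x \<in> BOm1 D i U"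
  using stableD[OF BnOm1_smult[where n = 0 and i = "i - 1" and a = a], of U x] BnOm1_1[of U i] by simp

lemma quot_BOm1_smult:
  assumes A: "subsheaf T (Om1 D i) A" and BA: "\<And>V x. \<lbrakk>V \<in> ob T; x \<in> BOm1 D i V\<rbrakk> \<Longrightarrow> x \<in> A V"
    and st: "\<And>V x. \<lbrakk>V \<in> ob T; x \<in> A V\<rbrakk> \<Longrightarrow> a \<odot>\<^bsub>sec (Om1 D i) V\<^esub> x \<in> A V"
  shows "\<lbrakk>U \<in> ob T; x \<in> A U\<rbrakk> \<Longrightarrow> a \<odot>\<^bsub>sec (quot T (subsh (Om1 D i) A) (BOm1 D i)) U\<^esub> cl i U x
      = cl i U (a \<odot>\<^bsub>sec (Om1 D i) U\<^esub> x)"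
    and "sheaf_ab_hom T (quot T (subsh (Om1 D i) A) (BOm1 D i)) (quot T (subsh (Om1 D i) A) (BOm1 D i))
      (\<lambda>U t. a \<odot>\<^bsub>sec (quot T (subsh (Om1 D i) A) (BOm1 D i)) U\<^esub> t)"
proof -
  have h: "sheaf_ab_hom T (subsh (Om1 D i) A) (subsh (Om1 D i) A) (\<lambda>U x. a \<odot>\<^bsub>sec (subsh (Om1 D i) A) U\<^esub> x)"
    unfolding subsh_simps by (rule hom_subsh[OF Om1_smult_hom subsheaf_in[OF A] st])
  have k: "a \<odot>\<^bsub>sec (subsh (Om1 D i) A) V\<^esub> x \<in> BOm1 D i V" if "V \<in> ob T" "x \<in> BOm1 D i V" for V x
    using BOm1_smult[OF that] by simp
  show "a \<odot>\<^bsub>sec (quot T (subsh (Om1 D i) A) (BOm1 D i)) U\<^esub> cl i U x = cl i U (a \<odot>\<^bsub>sec (Om1 D i) U\<^esub> x)"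
    if "U \<in> ob T" "x \<in> A U"
    by (rule quot_sheaf.pr_smult(1)[OF quot_BOm1[OF A BA] h k, unfolded subsh_simps quot_proj_subsh])
      (use that in simp_all)
  show "sheaf_ab_hom T (quot T (subsh (Om1 D i) A) (BOm1 D i)) (quot T (subsh (Om1 D i) A) (BOm1 D i))
      (\<lambda>U t. a \<odot>\<^bsub>sec (quot T (subsh (Om1 D i) A) (BOm1 D i)) U\<^esub> t)"
    by (rule quot_sheaf.pr_smult(2)[OF quot_BOm1[OF A BA] h k])
qed

text \<open>Read C^{-1}(a y) = sigma(a) C^{-1}(y) backwards, for a a multiplicative lift: the
  Cartier map is semilinear for the inverse of Frobenius.\<close>

lemma cartier_smult:
  assumes U: "U \<in> ob T" and x: "x \<in> Ker1 D i U"
  shows "cartier i U (witt_frob (teichmueller c) \<odot>\<^bsub>sec (Om1 D i) U\<^esub> x)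
    = teichmueller c \<odot>\<^bsub>sec (Om1 D i) U\<^esub> cartier i U x"
proof -
  let ?y = "cartier i U x" and ?a = "witt_frob (teichmueller c)"
  have y: "?y \<in> sects (Om1 D i) U" using cartier_closed[OF U x] .
  have "Cinv D i U (teichmueller c \<odot>\<^bsub>sec (Om1 D i) U\<^esub> ?y) = ?a \<odot>\<^bsub>sec (H1 D i) U\<^esub> Cinv D i U ?y"
    using cond_iv[of i] U y by (simp add: sheaf_mod_iso_def sheaf_mod_hom_def)
  also have "\<dots> = ?a \<odot>\<^bsub>sec (H1 D i) U\<^esub> cl i U x"
    using cartier_eq_iff[OF U x y] cls1_eq by simp
  also have "\<dots> = cl i U (?a \<odot>\<^bsub>sec (Om1 D i) U\<^esub> x)"
    unfolding H1_def by (rule quot_BOm1_smult(1)[OF sub_Ker1 BOm1_Ker1 Ker1_smult U x])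
  finally show ?thesis
    using cartier_eq_iff[OF U Ker1_smult[OF U x] hom_closed[OF Om1_smult_hom U y]] cls1_eq by simp
qed

lemma C_op_smult:
  assumes sub_X: "subsheaf T (Om1 D i) (X n i)"
    and X_Suc: "\<And>U. U \<in> ob T \<Longrightarrow> X (Suc n) i U = cart_pre i (X n i) U"
    and BX: "\<And>V x. \<lbrakk>V \<in> ob T; x \<in> BOm1 D i V\<rbrakk> \<Longrightarrow> x \<in> X n i V"
    and st: "\<And>a V x. \<lbrakk>V \<in> ob T; x \<in> X n i V\<rbrakk> \<Longrightarrow> a \<odot>\<^bsub>sec (Om1 D i) V\<^esub> x \<in> X n i V"
    and st': "\<And>a V x. \<lbrakk>V \<in> ob T; x \<in> X (Suc n) i V\<rbrakk> \<Longrightarrow> a \<odot>\<^bsub>sec (Om1 D i) V\<^esub> x \<in> X (Suc n) i V"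
    and U: "U \<in> ob T" and t: "t \<in> sects (XQ' X n i) U"
  shows "C_op D X n i U (witt_frob (teichmueller c) \<odot>\<^bsub>sec (XQ' X n i) U\<^esub> t)
    = teichmueller c \<odot>\<^bsub>sec (XQ X n i) U\<^esub> C_op D X n i U t"
proof -
  note X = sub_X X_Suc BX
  note sX' = sub_X'[where X = X and n = n and i = i, OF X] and bX' = BX'[where X = X and n = n and i = i, OF X]
  have kX': "x \<in> Ker1 D i V" and cX': "cartier i V x \<in> X n i V" if "V \<in> ob T" "x \<in> X (Suc n) i V" for V x
    using X_Suc that by (auto simp: cart_pre_def)
  have C_cl: "C_op D X n i V (cl i V x) = cl i V (cartier i V x)" if "V \<in> ob T" "x \<in> X (Suc n) i V" for V x
    by (rule C_op_cl[where X = X and n = n and i = i, OF X that])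
  have q'1: "a \<odot>\<^bsub>sec (XQ' X n i) V\<^esub> cl i V x = cl i V (a \<odot>\<^bsub>sec (Om1 D i) V\<^esub> x)"
    if "V \<in> ob T" "x \<in> X (Suc n) i V" for a V x
    by (rule quot_BOm1_smult(1)[OF sX' bX' st' that])
  have q'2: "sheaf_ab_hom T (XQ' X n i) (XQ' X n i) (\<lambda>U t. a \<odot>\<^bsub>sec (XQ' X n i) U\<^esub> t)" for a
    by (rule quot_BOm1_smult(2)[OF sX' bX' st'])
  have q1: "a \<odot>\<^bsub>sec (XQ X n i) V\<^esub> cl i V x = cl i V (a \<odot>\<^bsub>sec (Om1 D i) V\<^esub> x)"
    if "V \<in> ob T" "x \<in> X n i V" for a V x
    by (rule quot_BOm1_smult(1)[OF sub_X BX st that])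
  have q2: "sheaf_ab_hom T (XQ X n i) (XQ X n i) (\<lambda>U t. a \<odot>\<^bsub>sec (XQ X n i) U\<^esub> t)" for a
    by (rule quot_BOm1_smult(2)[OF sub_X BX st])
  show ?thesis
  proof (rule epi_commute[OF ab_XQ[where X = X and n = n and i = i, OF X]
        quot_sheaf.pr_epi[OF quot_X'[where X = X and n = n and i = i, OF X]]
        C_op_hom[where X = X and n = n and i = i, OF X] q'2 q2 _ U t])
    fix V x assume V: "V \<in> ob T" and "x \<in> sects (subsh (Om1 D i) (X (Suc n) i)) V"
    then have x: "x \<in> X (Suc n) i V" by simp
    have kx: "x \<in> Ker1 D i V" using kX'[OF V x] .
    show "C_op D X n i V (witt_frob (teichmueller c) \<odot>\<^bsub>sec (XQ' X n i) V\<^esub>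
        quot_proj T (subsh (Om1 D i) (X (Suc n) i)) (BOm1 D i) V x)
      = teichmueller c \<odot>\<^bsub>sec (XQ X n i) V\<^esub> C_op D X n i V (quot_proj T (subsh (Om1 D i) (X (Suc n) i)) (BOm1 D i) V x)"
      unfolding quot_proj_subsh q'1[OF V x] C_cl[OF V x] C_cl[OF V st'[OF V x]]
        cartier_smult[OF V kx] q1[OF V cX'[OF V x]] ..
  qed
qed

section \<open>The operators $F$, $V$ and $d$\<close>

lemma WF_maps:
  shows WF_hom: "sheaf_ab_hom T (WQ (Suc n) i) (WQ n i) (WF D n i)"
    and WF_pr: "\<lbrakk>U \<in> ob T; x \<in> Z (Suc n) i U\<rbrakk> \<Longrightarrow> WF D n i U (prW (Suc n) i U x) = prW n i U x"
proof -
  have z: "x \<in> Z n i V" if "V \<in> ob T" "x \<in> Z (Suc n) i V" for V x using Z_mono[OF that] by simp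
  have h: "sheaf_ab_hom T (subsh (\<Omega> i) (Z (Suc n) i)) (subsh (\<Omega> i) (Z n i)) (\<lambda>U x. x)"
    by (rule hom_incl[OF z])
  have k: "x \<in> B n i V" if "V \<in> ob T" "x \<in> B (Suc n) i V" for V x using B_mono[OF that] by simp
  note q = quot_sheaf.quot_map_props[OF quot_W quot_W h k, folded WF_def]
  show "sheaf_ab_hom T (WQ (Suc n) i) (WQ n i) (WF D n i)" by (rule q(1))
  show "WF D n i U (prW (Suc n) i U x) = prW n i U x" if "U \<in> ob T" "x \<in> Z (Suc n) i U"
    by (rule q(2)[unfolded quot_proj_subsh]) (use that in simp_all)
qed

lemma WV_maps:
  shows WV_hom: "sheaf_ab_hom T (WQ n i) (WQ (Suc n) i) (WV D n i)"
    and WV_pr: "\<lbrakk>U \<in> ob T; x \<in> Z n i U\<rbrakk> \<Longrightarrow> WV D n i U (prW n i U x) = prW (Suc n) i U (P 1 i U x)"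
proof -
  have h: "sheaf_ab_hom T (subsh (\<Omega> i) (Z n i)) (subsh (\<Omega> i) (Z (Suc n) i)) (P 1 i)"
    by (rule hom_subsh[OF P_hom Z_in]) (use P_Z[of _ _ n i 1] in simp_all)
  note q = quot_sheaf.quot_map_props[OF quot_W quot_W h P_B, folded WV_def]
  show "sheaf_ab_hom T (WQ n i) (WQ (Suc n) i) (WV D n i)" by (rule q(1))
  show "WV D n i U (prW n i U x) = prW (Suc n) i U (P 1 i U x)" if "U \<in> ob T" "x \<in> Z n i U"
    by (rule q(2)[unfolded quot_proj_subsh]) (use that in simp_all)
qed

text \<open>p^{-n} dx is closed, because p^n times its differential is ddx = 0; so it lies in every
  Z_m.\<close>

lemma divd_Z:
  assumes U: "U \<in> ob T" and x: "x \<in> Z n i U"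
  shows "divd n i U x \<in> Z m (i + 1) U"
proof -
  note c = divd_closed[OF U x]
  have "d (i + 1) U (divd n i U x) = \<zero>\<^bsub>sec (\<Omega> (i + 1 + 1)) U\<^esub>"
    by (rule P_torsion[OF U, of _ _ n])
      (use U c Om_closed(2)[OF U c] Z_in[OF U x] d_P[OF U c, of n] P_divd[OF U x] diff_diff[OF U Z_in[OF U x]] in simp_all)
  then show ?thesis using c subsheaf_zero[OF sub_pOm U] by (simp add: Zsub_def)
qed

text \<open>On generators p^{-n} d(p^n y) = dy and p^{-n} ddw = 0, which lie in every B_m. For m = n
  this makes d well defined on W_n.\<close>

lemma divd_B:
  assumes U: "U \<in> ob T" and x: "x \<in> B n i U"
  shows "divd n i U x \<in> B m (i + 1) U"
proof -
  let ?C = "\<lambda>U. {x \<in> sects (subsh (\<Omega> i) (Z n i)) U. divd n i U x \<in> B m (i + 1) U}"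
  have "subsheaf T (\<Omega> i) ?C"
    by (rule subsheaf_of_subsh[OF ab_Om sub_Z subsheaf_preimage[OF ab_Z ab_Om divd_hom sub_B]])
  then have "x \<in> ?C U"
  proof (rule B_least[OF _ _ _ U x])
    show "P n i V y \<in> ?C V" if "V \<in> ob T" "y \<in> Sec i V" for V y
      using divd_P[OF that] P_Sec_Z[OF that] d_in_B[OF that(1), of y "i + 1"] that by simp
    show "d (i - 1) V y \<in> ?C V" if "V \<in> ob T" "y \<in> Sec (i - 1) V" for V y
      using divd_d[OF that] d_Z[OF that] subsheaf_zero[OF sub_B that(1)] by simp
  qed
  then show ?thesis by simp
qed

lemma Wd_maps:
  shows Wd_hom: "sheaf_ab_hom T (WQ n i) (WQ n (i + 1)) (Wd D n i)"
    and Wd_pr: "\<lbrakk>U \<in> ob T; x \<in> Z n i U\<rbrakk> \<Longrightarrow> Wd D n i U (prW n i U x) = prW n (i + 1) U (divd n i U x)"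
proof -
  have h: "sheaf_ab_hom T (subsh (\<Omega> i) (Z n i)) (subsh (\<Omega> (i + 1)) (Z n (i + 1))) (divd n i)"
    by (rule homI)
      (simp_all add: divd_Z hom_add[OF divd_hom, simplified] hom_res[OF divd_hom, simplified])
  note q = quot_sheaf.quot_map_props[OF quot_W quot_W h divd_B, unfolded divd_def[abs_def], folded Wd_def]
  show "sheaf_ab_hom T (WQ n i) (WQ n (i + 1)) (Wd D n i)" by (rule q(1))
  show "Wd D n i U (prW n i U x) = prW n (i + 1) U (divd n i U x)" if "U \<in> ob T" "x \<in> Z n i U"
    unfolding divd_def by (rule q(2)[unfolded quot_proj_subsh]) (use that in simp_all)
qed

text \<open>F is induced by the identity, so F^m keeps the representative and only changes the
  denominator.\<close>

lemma WF_iter_maps: "sheaf_ab_hom T (WQ (Suc m) i) (WQ 1 i) (WF_iter D m i) \<and>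
    (\<forall>U\<in>ob T. \<forall>x\<in>Z (Suc m) i U. WF_iter D m i U (prW (Suc m) i U x) = prW 1 i U x)"
proof (induction m)
  case 0
  show ?case by (auto intro!: homI)
next
  case (Suc m)
  have "WF_iter D (Suc m) i = (\<lambda>U t. WF_iter D m i U (WF D (Suc m) i U t))" by (intro ext) simp
  then have "sheaf_ab_hom T (WQ (Suc (Suc m)) i) (WQ 1 i) (WF_iter D (Suc m) i)"
    using hom_comp[OF WF_hom conjunct1[OF Suc]] by simp
  moreover have "WF_iter D (Suc m) i U (prW (Suc (Suc m)) i U x) = prW 1 i U x"
    if "U \<in> ob T" "x \<in> Z (Suc (Suc m)) i U" for U x
    using WF_pr[OF that] Suc Z_mono[OF that, of "Suc m"] that(1) by simp
  ultimately show ?case by blast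
qed

text \<open>Reduction modulo p carries Z_1 to cycles and B_1 to boundaries.\<close>

lemma W1_maps:
  shows W1_hom: "sheaf_ab_hom T (WQ 1 i) (H1 D i) (W1_ident D i)"
    and W1_pr: "\<lbrakk>U \<in> ob T; x \<in> Z 1 i U\<rbrakk> \<Longrightarrow> W1_ident D i U (prW 1 i U x) = cl i U (red D i U x)"
proof -
  have h: "sheaf_ab_hom T (subsh (\<Omega> i) (Z 1 i)) (subsh (Om1 D i) (Ker1 D i)) (red D i)"
    by (rule hom_subsh[OF red_hom Z_in]) (simp_all add: red_Ker1[OF _ Z_in])
  have k: "red D i V x \<in> BOm1 D i V" if "V \<in> ob T" "x \<in> B 1 i V" for V x
    using red_BOm1[OF that(1) B_in[OF that]] that(2) by simp
  note q = quot_sheaf.quot_map_props[OF quot_W quot_H1 h k, folded W1_ident_def]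
  show "sheaf_ab_hom T (WQ 1 i) (H1 D i) (W1_ident D i)" unfolding H1_def by (rule q(1))
  show "W1_ident D i U (prW 1 i U x) = cl i U (red D i U x)" if "U \<in> ob T" "x \<in> Z 1 i U"
    by (rule q(2)[unfolded quot_proj_subsh]) (use that in simp_all)
qed

lemma WFn_hom_H1: "sheaf_ab_hom T (WQ (Suc m) i) (H1 D i) (WFn D m i)"
  using hom_comp[OF conjunct1[OF WF_iter_maps] W1_hom] unfolding WFn_def .

lemma WFn_pr: "\<lbrakk>U \<in> ob T; x \<in> Z (Suc m) i U\<rbrakk> \<Longrightarrow> WFn D m i U (prW (Suc m) i U x) = cl i U (red D i U x)"
  unfolding WFn_def using WF_iter_maps W1_pr[of U x i] Z_mono[of U x "Suc m" i 1] by simp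

lemma WFd_hom_H1: "sheaf_ab_hom T (WQ (Suc m) i) (H1 D (i + 1)) (WFd D (Suc m) i)"
  using hom_comp[OF Wd_hom WFn_hom_H1] unfolding WFd_def by simp

lemma WFd_pr: "\<lbrakk>U \<in> ob T; x \<in> Z (Suc m) i U\<rbrakk> \<Longrightarrow>
    WFd D (Suc m) i U (prW (Suc m) i U x) = cl (i + 1) U (del (Suc m) i U x)"
  unfolding WFd_def using Wd_pr WFn_pr divd_Z by (simp add: del_def)

section \<open>F^n and F^{n-1} d as morphisms into the filtrations\<close>

abbreviation "ZQ n i \<equiv> quot T (subsh (Om1 D i) (ZOm1 D (Suc n) i)) (BOm1 D i)"
abbreviation "BQ n i \<equiv> quot T (subsh (Om1 D i) (BnOm1 D (Suc n) i)) (BOm1 D i)"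

lemma BOm1_ZOm1: "\<lbrakk>U \<in> ob T; x \<in> BOm1 D i U\<rbrakk> \<Longrightarrow> x \<in> ZOm1 D n i U"
  using ZOm1_Suc BOm1_cart_pre[OF sub_ZOm1] subsheaf_in[OF sub_BOm1] by (cases n) auto

lemma BOm1_BnOm1: "\<lbrakk>U \<in> ob T; x \<in> BOm1 D i U\<rbrakk> \<Longrightarrow> x \<in> BnOm1 D (Suc n) i U"
  using BnOm1_Suc BOm1_cart_pre[OF sub_BnOm1] by auto

lemma ZOm1_Ker1: "\<lbrakk>U \<in> ob T; x \<in> ZOm1 D (Suc n) i U\<rbrakk> \<Longrightarrow> x \<in> Ker1 D i U"
  using ZOm1_Suc by (auto simp: cart_pre_def)

lemma BnOm1_Ker1: "\<lbrakk>U \<in> ob T; x \<in> BnOm1 D (Suc n) i U\<rbrakk> \<Longrightarrow> x \<in> Ker1 D i U"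
  using BnOm1_Suc by (auto simp: cart_pre_def)

lemmas quot_ZQ = quot_BOm1[OF sub_ZOm1 BOm1_ZOm1]
lemmas quot_BQ = quot_BOm1[OF sub_BnOm1 BOm1_BnOm1]
lemmas ab_ZQ = quot_sheaf.ab_quot[OF quot_ZQ]
lemmas ab_BQ = quot_sheaf.ab_quot[OF quot_BQ]

text \<open>F^n and F^{n-1} d are built with values in cohomology. A formula on representatives with
  values in \<open>A\<close> forces every value into \<open>A\<close> modulo boundaries, because
  this can be tested on a cover.\<close>

lemma hom_into_subquot:
  assumes h: "sheaf_ab_hom T (WQ n j) (H1 D i) h" and A: "subsheaf T (Om1 D i) A"
    and BA: "\<And>V x. \<lbrakk>V \<in> ob T; x \<in> BOm1 D i V\<rbrakk> \<Longrightarrow> x \<in> A V" and AK: "\<And>V x. \<lbrakk>V \<in> ob T; x \<in> A V\<rbrakk> \<Longrightarrow> x \<in> Ker1 D i V"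
    and b: "\<And>V x. \<lbrakk>V \<in> ob T; x \<in> Z n j V\<rbrakk> \<Longrightarrow> b V x \<in> A V \<and> h V (prW n j V x) = cl i V (b V x)"
  shows "sheaf_ab_hom T (WQ n j) (quot T (subsh (Om1 D i) A) (BOm1 D i)) h"
proof (rule hom_factor_incl[OF subquot_incl[OF ab_Om1 A sub_Ker1 sub_BOm1 BA AK]])
  show "sheaf_ab_hom T (WQ n j) (quot T (subsh (Om1 D i) (Ker1 D i)) (BOm1 D i)) h"
    using h by (simp add: H1_def)
  fix U t assume U: "U \<in> ob T" and t: "t \<in> sects (WQ n j) U"
  show "h U t \<in> sects (quot T (subsh (Om1 D i) A) (BOm1 D i)) U"
  proof (rule subquot_mem[OF ab_Om1 A sub_Ker1 sub_BOm1 BA AK U])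
    show "h U t \<in> sects (quot T (subsh (Om1 D i) (Ker1 D i)) (BOm1 D i)) U"
      using hom_closed[OF h U t] by (simp add: H1_def)
    show "loc T U (\<lambda>f. \<exists>x\<in>A (src T f).
        res (quot T (subsh (Om1 D i) (Ker1 D i)) (BOm1 D i)) f (h U t) = cl i (src T f) x)"
      by (rule loc_mono[OF sheaf_epi_loc[OF prW_epi U t] U])
        (use b[OF intoD(3)] hom_res[OF h _ t] in \<open>auto simp: H1_def\<close>)
  qed
qed

lemma WFn_hom: "sheaf_ab_hom T (WQ (Suc m) i) (ZQ m i) (WFn D m i)"
  by (rule hom_into_subquot[OF WFn_hom_H1 sub_ZOm1 BOm1_ZOm1 ZOm1_Ker1, where b = "red D i"])
    (use hom_closed[OF sheaf_epi_hom[OF red_Z_epi]] WFn_pr in auto)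

lemma WFd_hom: "sheaf_ab_hom T (WQ (Suc m) i) (BQ (Suc m) (i + 1)) (WFd D (Suc m) i)"
  by (rule hom_into_subquot[OF WFd_hom_H1 sub_BnOm1 BOm1_BnOm1 BnOm1_Ker1, where b = "del (Suc m) i"])
    (use hom_closed[OF sheaf_epi_hom[OF del_epi]] WFd_pr in auto)

lemma red_cl_epi: "sheaf_epi T (subsh (\<Omega> i) (Z (Suc n) i)) (ZQ n i) (\<lambda>U x. cl i U (red D i U x))"
  using epi_comp[OF ab_ZQ red_Z_epi quot_sheaf.pr_epi[OF quot_ZQ]] by simp

lemma del_cl_epi: "sheaf_epi T (subsh (\<Omega> i) (Z n i)) (BQ n (i + 1)) (\<lambda>U x. cl (i + 1) U (del n i U x))"
  using epi_comp[OF ab_BQ del_epi quot_sheaf.pr_epi[OF quot_BQ]] by simp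

lemma cl_zero_ZQ: "\<lbrakk>U \<in> ob T; x \<in> ZOm1 D (Suc n) i U\<rbrakk> \<Longrightarrow> cl i U x = \<zero>\<^bsub>sec (ZQ n i) U\<^esub> \<longleftrightarrow> x \<in> BOm1 D i U"
  using quot_sheaf.pr_eq_zero_iff[OF quot_ZQ] by simp

lemma cl_zero_BQ: "\<lbrakk>U \<in> ob T; x \<in> BnOm1 D (Suc n) i U\<rbrakk> \<Longrightarrow> cl i U x = \<zero>\<^bsub>sec (BQ n i) U\<^esub> \<longleftrightarrow> x \<in> BOm1 D i U"
  using quot_sheaf.pr_eq_zero_iff[OF quot_BQ] by simp

lemma red_ZOm1: "\<lbrakk>U \<in> ob T; x \<in> Z n i U\<rbrakk> \<Longrightarrow> red D i U x \<in> ZOm1 D n i U"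
  using hom_closed[OF sheaf_epi_hom[OF red_Z_epi], of U x i n] by simp

lemma del_BnOm1: "\<lbrakk>U \<in> ob T; x \<in> Z n i U\<rbrakk> \<Longrightarrow> del n i U x \<in> BnOm1 D (Suc n) (i + 1) U"
  using hom_closed[OF sheaf_epi_hom[OF del_epi], of U x i n] by simp

lemma ZQ_smult:
  shows ZQ_smult_cl: "\<lbrakk>U \<in> ob T; x \<in> ZOm1 D (Suc n) i U\<rbrakk> \<Longrightarrow>
      a \<odot>\<^bsub>sec (ZQ n i) U\<^esub> cl i U x = cl i U (a \<odot>\<^bsub>sec (Om1 D i) U\<^esub> x)"
    and ZQ_smult_hom: "sheaf_ab_hom T (ZQ n i) (ZQ n i) (\<lambda>U t. a \<odot>\<^bsub>sec (ZQ n i) U\<^esub> t)"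
  by (rule quot_BOm1_smult[OF sub_ZOm1 BOm1_ZOm1 stableD[OF ZOm1_smult]]; simp)+

lemma WFn_smult:
  assumes U: "U \<in> ob T" and t: "t \<in> sects (WQ (Suc n) i) U"
  shows "WFn D n i U (a \<odot>\<^bsub>sec (WQ (Suc n) i) U\<^esub> t) = a \<odot>\<^bsub>sec (ZQ n i) U\<^esub> WFn D n i U t"
proof (rule epi_commute[OF ab_ZQ prW_epi WFn_hom WQ_smult_hom ZQ_smult_hom _ U t])
  fix V x assume V: "V \<in> ob T" and "x \<in> sects (subsh (\<Omega> i) (Z (Suc n) i)) V"
  then have x: "x \<in> Z (Suc n) i V" by simp
  show "WFn D n i V (a \<odot>\<^bsub>sec (WQ (Suc n) i) V\<^esub> prW (Suc n) i V x)
      = a \<odot>\<^bsub>sec (ZQ n i) V\<^esub> WFn D n i V (prW (Suc n) i V x)"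
    using WQ_smult_pr[OF V x] WFn_pr[OF V x] WFn_pr[OF V Z_smult[OF V x]]
      ZQ_smult_cl[OF V red_ZOm1[OF V x]] Om1_smult_red[OF V Z_in[OF V x]] by simp
qed

lemma WV_smult:
  assumes U: "U \<in> ob T" and t: "t \<in> sects (WQ n i) U"
  shows "WV D n i U (a \<odot>\<^bsub>sec (WQ n i) U\<^esub> t) = a \<odot>\<^bsub>sec (WQ (Suc n) i) U\<^esub> WV D n i U t"
proof (rule epi_commute[OF ab_WQ prW_epi WV_hom WQ_smult_hom WQ_smult_hom _ U t])
  fix V x assume V: "V \<in> ob T" and "x \<in> sects (subsh (\<Omega> i) (Z n i)) V"
  then have x: "x \<in> Z n i V" by simp
  have "P 1 i V x \<in> Z (Suc n) i V" using P_Z[OF V x, of 1] by simp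
  then show "WV D n i V (a \<odot>\<^bsub>sec (WQ n i) V\<^esub> prW n i V x) = a \<odot>\<^bsub>sec (WQ (Suc n) i) V\<^esub> WV D n i V (prW n i V x)"
    using WQ_smult_pr[OF V x] WV_pr[OF V x] WV_pr[OF V Z_smult[OF V x]] WQ_smult_pr[OF V, of "P 1 i V x"]
      P_smult[OF V Z_in[OF V x]] by simp
qed

text \<open>R undoes psi, so it is semilinear for the inverse of Frobenius. The additional twist on
  its source turns this into linearity.\<close>

lemma WR_smult:
  assumes U: "U \<in> ob T" and t: "t \<in> sects (WQ (Suc n) i) U"
  shows "WR D n i U (witt_frob a \<odot>\<^bsub>sec (WQ (Suc n) i) U\<^esub> t) = a \<odot>\<^bsub>sec (WQ n i) U\<^esub> WR D n i U t"
proof (rule hom_eq_on_W[OF ab_WQ hom_comp[OF WQ_smult_hom WR_hom] hom_comp[OF WR_hom WQ_smult_hom] _ U t])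
  fix V y b assume V: "V \<in> ob T" and y: "y \<in> Z n i V" and b: "b \<in> B (Suc n) i V"
  let ?a = "witt_frob a"
  have "?a \<odot>\<^bsub>sec (\<Omega> i) V\<^esub> (psi i V y \<oplus>\<^bsub>sec (\<Omega> i) V\<^esub> b)
      = psi i V (a \<odot>\<^bsub>sec (\<Omega> i) V\<^esub> y) \<oplus>\<^bsub>sec (\<Omega> i) V\<^esub> ?a \<odot>\<^bsub>sec (\<Omega> i) V\<^esub> b"
    using smult_add[OF V psi_closed[OF V Z_in[OF V y]] B_in[OF V b]] psi_smult[OF V Z_in[OF V y]] by simp
  then show "WR D n i V (?a \<odot>\<^bsub>sec (WQ (Suc n) i) V\<^esub> prW (Suc n) i V (psi i V y \<oplus>\<^bsub>sec (\<Omega> i) V\<^esub> b))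
      = a \<odot>\<^bsub>sec (WQ n i) V\<^esub> WR D n i V (prW (Suc n) i V (psi i V y \<oplus>\<^bsub>sec (\<Omega> i) V\<^esub> b))"
    using WQ_smult_pr[OF V psi_add_Z[OF V y b]] WR_pr[OF V Z_smult[OF V y] B_smult[OF V b]]
      WR_pr[OF V y b] WQ_smult_pr[OF V y] by simp
qed

section \<open>The maps $F^n$ and $F^{n-1}d$ and their kernels\<close>

lemma cartier_add_BOm1:
  assumes U: "U \<in> ob T" and x: "x \<in> Ker1 D i U" and b: "b \<in> BOm1 D i U"
  shows "cartier i U (x \<oplus>\<^bsub>sec (Om1 D i) U\<^esub> b) = cartier i U x"
proof -
  interpret G: abelian_group "sec (Om1 D i) U" using ab_sheaf.grp[OF ab_Om1 U] .
  show ?thesis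
    using hom_add[OF cartier_hom U, of x i b] x b BOm1_Ker1[OF U b] cartier_eq_zero[OF U BOm1_Ker1[OF U b]]
      cartier_closed[OF U x] by simp
qed

text \<open>Assertion (2) for n = m + 1. On the class of psi(y) + b both sides are the class of y
  modulo p: C undoes psi and kills the boundary coming from b, while R returns y itself.\<close>

lemma CZ_WFn:
  assumes U: "U \<in> ob T" and t: "t \<in> sects (WQ (Suc (Suc m)) i) U"
  shows "CZ D (Suc m) i U (WFn D (Suc m) i U t) = WFn D m i U (WR D (Suc m) i U t)"
proof (rule hom_eq_on_W[OF ab_ZQ _ hom_comp[OF WR_hom WFn_hom] _ U t])
  note X = sub_ZOm1 ZOm1_Suc BOm1_ZOm1
  show "sheaf_ab_hom T (WQ (Suc (Suc m)) i) (ZQ m i) (\<lambda>U t. CZ D (Suc m) i U (WFn D (Suc m) i U t))"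
    unfolding CZ_def by (rule hom_comp[OF WFn_hom C_op_hom[where X = "ZOm1 D", OF X]])
  fix V y b assume V: "V \<in> ob T" and y: "y \<in> Z (Suc m) i V" and b: "b \<in> B (Suc (Suc m)) i V"
  let ?x = "psi i V y \<oplus>\<^bsub>sec (\<Omega> i) V\<^esub> b"
  note yO = Z_in[OF V y] and xZ = psi_add_Z[OF V y b]
  have "red D i V b \<in> BOm1 D i V" using red_BOm1[OF V B_in[OF V b]] B_mono[OF V b] by simp
  then have "cartier i V (red D i V ?x) = red D i V y"
    using cartier_add_BOm1[OF V red_psi_Ker1[OF V yO]] red_add[OF V psi_closed[OF V yO] B_in[OF V b]]
      cartier_red_psi[OF V yO] by simp
  then show "CZ D (Suc m) i V (WFn D (Suc m) i V (prW (Suc (Suc m)) i V ?x))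
      = WFn D m i V (WR D (Suc m) i V (prW (Suc (Suc m)) i V ?x))"
    unfolding WFn_pr[OF V xZ] WR_pr[OF V y b] WFn_pr[OF V y] CZ_def
    using C_op_cl[where X = "ZOm1 D", OF X V red_ZOm1[OF V xZ]] by simp
qed

lemma del_B_BOm1:
  assumes U: "U \<in> ob T" and b: "b \<in> B n i U"
  shows "del n i U b \<in> BOm1 D (i + 1) U"
  unfolding del_def
  using red_BOm1[OF U divd_closed[OF U B_Z[OF U b]]] divd_B[OF U b, of 1] by simp

text \<open>Assertion (4) for n = m + 1, tested on the same classes. Now p^{-(n+1)} d psi(y) =
  psi(p^{-n} dy), so C returns the class of p^{-n} dy, and b contributes a boundary by
  \<open>del_B_BOm1\<close>.\<close>

lemma CB_WFd:
  assumes U: "U \<in> ob T" and t: "t \<in> sects (WQ (Suc (Suc m)) i) U"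
  shows "CB D (Suc (Suc m)) (i + 1) U (WFd D (Suc (Suc m)) i U t) = WFd D (Suc m) i U (WR D (Suc m) i U t)"
proof (rule hom_eq_on_W[OF ab_BQ _ hom_comp[OF WR_hom WFd_hom] _ U t])
  note X = sub_BnOm1 BnOm1_Suc BOm1_BnOm1
  show "sheaf_ab_hom T (WQ (Suc (Suc m)) i) (BQ (Suc m) (i + 1))
      (\<lambda>U t. CB D (Suc (Suc m)) (i + 1) U (WFd D (Suc (Suc m)) i U t))"
    unfolding CB_def by (rule hom_comp[OF WFd_hom C_op_hom[where X = "BnOm1 D", OF X]])
  fix V y b assume V: "V \<in> ob T" and y: "y \<in> Z (Suc m) i V" and b: "b \<in> B (Suc (Suc m)) i V"
  let ?x = "psi i V y \<oplus>\<^bsub>sec (\<Omega> i) V\<^esub> b" and ?i = "i + 1"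
  note xZ = psi_add_Z[OF V y b] and c = divd_closed[OF V y]
  have psiy: "del (Suc (Suc m)) i V (psi i V y) = red D ?i V (psi ?i V (divd (Suc m) i V y))"
    using divd_psi[OF V y] by (simp add: del_def)
  have "del (Suc (Suc m)) i V ?x = del (Suc (Suc m)) i V (psi i V y) \<oplus>\<^bsub>sec (Om1 D ?i) V\<^esub> del (Suc (Suc m)) i V b"
    using hom_add[OF del_hom V, of "psi i V y" i "Suc (Suc m)" b] psi_Z[OF V y] B_Z[OF V b] by simp
  then have "cartier ?i V (del (Suc (Suc m)) i V ?x) = del (Suc m) i V y"
    using cartier_add_BOm1[OF V red_psi_Ker1[OF V c] del_B_BOm1[OF V b]] psiy
      cartier_red_psi[OF V c] by (simp add: del_def)
  then show "CB D (Suc (Suc m)) ?i V (WFd D (Suc (Suc m)) i V (prW (Suc (Suc m)) i V ?x))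
      = WFd D (Suc m) i V (WR D (Suc m) i V (prW (Suc (Suc m)) i V ?x))"
    unfolding WFd_pr[OF V xZ] WR_pr[OF V y b] WFd_pr[OF V y] CB_def
    using C_op_cl[where X = "BnOm1 D", OF X V del_BnOm1[OF V xZ]] by simp
qed

section \<open>The cokernel of V and assertion (1)\<close>

abbreviation "NV n i \<equiv> sheaf_image T (WOm D (Suc n) i) (WV D n i) (sects (twist 1 (WOm D n i)))"
abbreviation "NF n i \<equiv> sheaf_image T (twist 1 (WOm D n i)) (WF D n i) (sects (WOm D (Suc n) i))"

lemma ab_WOm: "ab_sheaf T (WOm D n i)"
  by (simp add: WOm_def ab_WQ)

lemma prW_epi_WOm: "sheaf_epi T (subsh (\<Omega> i) (Z n i)) (WOm D n i) (prW n i)"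
  unfolding WOm_def using prW_epi by simp

lemma NV_eq: "NV n i = sheaf_image T (WOm D (Suc n) i) (WV D n i) (sects (WOm D n i))"
  by (simp add: twist_simps(1)[abs_def])

lemma WV_hom_WOm: "sheaf_ab_hom T (WOm D n i) (WOm D (Suc n) i) (WV D n i)"
  by (simp add: WOm_def WV_hom)

lemma sub_NV: "subsheaf T (WOm D (Suc n) i) (NV n i)"
  unfolding NV_eq by (rule subsheaf_image[OF ab_WOm ab_WOm WV_hom_WOm subsheaf_full[OF ab_WOm]])

lemma quot_NV: "quot_sheaf T (WOm D (Suc n) i) (NV n i)"
  by (intro quot_sheaf.intro quot_sheaf_axioms.intro grothendieck_site_axioms ab_WOm sub_NV)

lemma WFn_hom_ZW: "sheaf_ab_hom T (WOm D (Suc n) i) (ZW D n i) (WFn D n i)"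
  by (simp add: WOm_def ZW_def WFn_hom)

lemma ab_ZW: "ab_sheaf T (ZW D n i)"
  by (simp add: ZW_def ab_ZQ)

lemma ab_BW: "ab_sheaf T (BW D n i)"
  by (simp add: BW_def ab_BQ)

text \<open>On representatives F^n V is multiplication by p, which vanishes modulo p.\<close>

lemma WFn_NV:
  assumes V: "V \<in> ob T" and x: "x \<in> NV n i V"
  shows "WFn D n i V x = \<zero>\<^bsub>sec (ZW D n i) V\<^esub>"
proof -
  have eq: "WFn D n i V (WV D n i V t) = \<zero>\<^bsub>sec (ZQ n i) V\<^esub>" if V: "V \<in> ob T" and t: "t \<in> sects (WQ n i) V" for V t
  proof (rule epi_eqI[OF ab_ZQ prW_epi hom_comp[OF WV_hom WFn_hom] zero_hom[OF ab_ZQ] _ V t])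
    fix V u assume V: "V \<in> ob T" and "u \<in> sects (subsh (\<Omega> i) (Z n i)) V"
    then have u: "u \<in> Z n i V" by simp
    have PZ: "P 1 i V u \<in> Z (Suc n) i V" using P_Z[OF V u, of 1] by simp
    have "red D i V (P 1 i V u) \<in> BOm1 D i V"
      using red_BOm1[OF V] V Z_in[OF V u] P_in_B[OF V Z_in[OF V u], of 1] by simp
    then show "WFn D n i V (WV D n i V (prW n i V u)) = \<zero>\<^bsub>sec (ZQ n i) V\<^esub>"
      using WV_pr[OF V u] WFn_pr[OF V PZ] cl_zero_ZQ[OF V red_ZOm1[OF V PZ]] by simp
  qed
  have "x \<in> {x \<in> sects (WOm D (Suc n) i) V. WFn D n i V x \<in> {\<zero>\<^bsub>sec (ZW D n i) V\<^esub>}}"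
  proof (rule sheaf_image_least[OF subsheaf_preimage[OF ab_WOm ab_ZW WFn_hom_ZW subsheaf_zero_sub[OF ab_ZW]] _ V x])
    fix V t assume V: "V \<in> ob T" and "t \<in> sects (twist 1 (WOm D n i)) V"
    then have t: "t \<in> sects (WQ n i) V" by (simp add: WOm_def)
    show "WV D n i V t \<in> {x \<in> sects (WOm D (Suc n) i) V. WFn D n i V x \<in> {\<zero>\<^bsub>sec (ZW D n i) V\<^esub>}}"
      using eq[OF V t] hom_closed[OF WV_hom V t] by (simp add: WOm_def ZW_def)
  qed
  then show ?thesis by simp
qed

lemma WFn_ind_hom: "sheaf_ab_hom T (quot T (WOm D (Suc n) i) (NV n i)) (ZW D n i) (induced T (ZW D n i) (WFn D n i))"
  by (rule quot_sheaf.induced_hom[OF quot_NV ab_ZW WFn_hom_ZW WFn_NV])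

lemma WFn_ind_pr: "\<lbrakk>U \<in> ob T; x \<in> sects (WOm D (Suc n) i) U\<rbrakk> \<Longrightarrow>
    induced T (ZW D n i) (WFn D n i) U (quot_proj T (WOm D (Suc n) i) (NV n i) U x) = WFn D n i U x"
  by (rule quot_sheaf.induced_pr[OF quot_NV ab_ZW WFn_hom_ZW WFn_NV])

text \<open>On a cover x = p u + dw. As dw is closed, p u is in Z_{n+1}, and cancelling p in its
  differential gives u in Z_n. Since dw is zero in W_{n+1}, the class of x is V of the class of
  u.\<close>

lemma ker_WFn:
  assumes U: "U \<in> ob T" and x: "x \<in> Z (Suc n) i U" and B: "x \<in> B 1 i U"
  shows "prW (Suc n) i U x \<in> NV n i U"
proof (rule subsheaf_loc[OF sub_NV U])
  show p: "prW (Suc n) i U x \<in> sects (WOm D (Suc n) i) U" using prW_closed[OF U x] by (simp add: WOm_def)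
  show "loc T U (\<lambda>f. res (WOm D (Suc n) i) f (prW (Suc n) i U x) \<in> NV n i (src T f))"
  proof (rule loc_mono[OF B_loc[OF U B] U])
    fix f assume f: "f \<in> into T U" and "\<exists>u\<in>Sec i (src T f). \<exists>w\<in>Sec (i - 1) (src T f).
      res (\<Omega> i) f x = P 1 i (src T f) u \<oplus>\<^bsub>sec (\<Omega> i) (src T f)\<^esub> d (i - 1) (src T f) w"
    then obtain u w where u: "u \<in> Sec i (src T f)" and w: "w \<in> Sec (i - 1) (src T f)"
      and eq: "res (\<Omega> i) f x = P 1 i (src T f) u \<oplus>\<^bsub>sec (\<Omega> i) (src T f)\<^esub> d (i - 1) (src T f) w" by blast
    let ?V = "src T f"
    note V = intoD(3)[OF f]
    have rx: "res (\<Omega> i) f x \<in> Z (Suc n) i ?V" using subsheaf_res[OF sub_Z f x] .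
    have dw: "d (i - 1) ?V w \<in> Z (Suc n) i ?V" using d_Z[OF V w] .
    interpret G: abelian_group "sec (\<Omega> i) ?V" using grp_Om[OF V] .
    interpret H: abelian_group "sec (WQ (Suc n) i) ?V" using ab_sheaf.grp[OF ab_WQ V] .
    have PZ: "P 1 i ?V u \<in> Z (Suc n) i ?V"
      using subsheaf_cancel[OF ab_Om sub_Z V dw Om_closed(1)[OF V u], of 1] rx eq
        G.a_comm[OF Om_closed(1)[OF V u, of 1] Om_closed(3)[OF V w]] by simp
    then obtain e where e: "e \<in> Sec (i + 1) ?V" "d i ?V (P 1 i ?V u) = P (Suc n) (i + 1) ?V e"
      using mem_Z[OF V] by auto
    have "d i ?V u = P n (i + 1) ?V e"
    proof (rule P_inj[OF V])
      show "P 1 (i + 1) ?V (d i ?V u) = P 1 (i + 1) ?V (P n (i + 1) ?V e)"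
        using e d_P[OF V u, of 1] P_P[OF V e(1), of 1 n] by simp
    qed (use V u e in simp_all)
    then have uZ: "u \<in> Z n i ?V" using u e(1) mem_Z[OF V] by blast
    have "prW (Suc n) i ?V (res (\<Omega> i) f x) = prW (Suc n) i ?V (P 1 i ?V u) \<oplus>\<^bsub>sec (WQ (Suc n) i) ?V\<^esub> prW (Suc n) i ?V (d (i - 1) ?V w)"
      unfolding eq using hom_add[OF prW_hom V, of "P 1 i ?V u" i "Suc n"] PZ dw by simp
    also have "\<dots> = prW (Suc n) i ?V (P 1 i ?V u)"
      using prW_zero[OF V dw] d_in_B[OF V w] prW_closed[OF V PZ] by simp
    also have "\<dots> = WV D n i ?V (prW n i ?V u)" using WV_pr[OF V uZ] by simp
    finally have "res (WOm D (Suc n) i) f (prW (Suc n) i U x) = WV D n i ?V (prW n i ?V u)"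
      using hom_res[OF prW_hom f, of x i "Suc n"] x by (simp add: WOm_def)
    then show "res (WOm D (Suc n) i) f (prW (Suc n) i U x) \<in> NV n i ?V"
      unfolding NV_eq
      using sheaf_imageI[OF ab_WOm WV_hom_WOm subsheaf_full[OF ab_WOm] V, of "prW n i ?V u"] prW_closed[OF V uZ]
      by (simp add: WOm_def)
  qed
qed

text \<open>Composed with the projection from Z_{n+1}, the induced map takes x to the class of its
  reduction. This is locally surjective by \<open>ZOm1_eq\<close>, and \<open>ker_WFn\<close> puts
  its kernel into the image of V.\<close>

lemma WFn_iso:
  assumes U: "U \<in> ob T"
  shows "bij_betw (induced T (ZW D n i) (WFn D n i) U) (sects (quot T (WOm D (Suc n) i) (NV n i)) U) (sects (ZW D n i) U)"
proof (rule epi_bij[OF quot_sheaf.ab_quot[OF quot_NV] ab_ZW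
      epi_comp[OF quot_sheaf.ab_quot[OF quot_NV] prW_epi_WOm quot_sheaf.pr_epi[OF quot_NV]] WFn_ind_hom _ _ _ U])
  show "sheaf_epi T (subsh (\<Omega> i) (Z (Suc n) i)) (ZW D n i) (\<lambda>U x. cl i U (red D i U x))"
    unfolding ZW_def using red_cl_epi by simp
  fix V x assume V: "V \<in> ob T" and "x \<in> sects (subsh (\<Omega> i) (Z (Suc n) i)) V"
  then have x: "x \<in> Z (Suc n) i V" by simp
  have p: "prW (Suc n) i V x \<in> sects (WOm D (Suc n) i) V" using prW_closed[OF V x] by (simp add: WOm_def)
  show "induced T (ZW D n i) (WFn D n i) V (quot_proj T (WOm D (Suc n) i) (NV n i) V (prW (Suc n) i V x))
      = cl i V (red D i V x)"
    using WFn_ind_pr[OF V p] WFn_pr[OF V x] by simp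
  assume "cl i V (red D i V x) = \<zero>\<^bsub>sec (ZW D n i) V\<^esub>"
  then have "red D i V x \<in> BOm1 D i V" using cl_zero_ZQ[OF V red_ZOm1[OF V x]] by (simp add: ZW_def)
  then have "x \<in> B 1 i V" using red_BOm1[OF V Z_in[OF V x]] by simp
  then show "quot_proj T (WOm D (Suc n) i) (NV n i) V (prW (Suc n) i V x)
      = \<zero>\<^bsub>sec (quot T (WOm D (Suc n) i) (NV n i)) V\<^esub>"
    using quot_sheaf.pr_eq_zero_iff[OF quot_NV V p] ker_WFn[OF V x] by simp
qed

lemma WOm_smult_hom: "sheaf_ab_hom T (WOm D n i) (WOm D n i) (\<lambda>U t. a \<odot>\<^bsub>sec (WOm D n i) U\<^esub> t)"
  unfolding WOm_def twist_simps using WQ_smult_hom by simp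

lemma ZW_smult_hom: "sheaf_ab_hom T (ZW D n i) (ZW D n i) (\<lambda>U t. a \<odot>\<^bsub>sec (ZW D n i) U\<^esub> t)"
  unfolding ZW_def twist_simps using ZQ_smult_hom by simp

lemma WFn_mod_hom: "sheaf_mod_hom T (WOm D (Suc n) i) (ZW D n i) (WFn D n i)"
  unfolding sheaf_mod_hom_def using WFn_hom_ZW WFn_smult by (simp add: WOm_def ZW_def)

lemma NV_smult: "\<lbrakk>U \<in> ob T; x \<in> NV n i U\<rbrakk> \<Longrightarrow> a \<odot>\<^bsub>sec (WOm D (Suc n) i) U\<^esub> x \<in> NV n i U"
proof -
  \<comment> \<open>On W_{n+1} a scalar acts through n + 1 Frobenius twists. On the source of V
    these are the n twists of W_n and the explicit one.\<close>
  let ?a = "(witt_frob ^^ Suc n) a"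
  have "stable T (\<lambda>U t. a \<odot>\<^bsub>sec (WOm D (Suc n) i) U\<^esub> t) (NV n i)"
  proof (rule stable_image[OF WOm_smult_hom, where s' = "\<lambda>U t. ?a \<odot>\<^bsub>sec (WQ n i) U\<^esub> t"])
    show "stable T (\<lambda>U t. ?a \<odot>\<^bsub>sec (WQ n i) U\<^esub> t) (sects (twist 1 (WOm D n i)))"
      using hom_closed[OF WQ_smult_hom] by (simp add: stable_def WOm_def)
    show "a \<odot>\<^bsub>sec (WOm D (Suc n) i) V\<^esub> WV D n i V x = WV D n i V (?a \<odot>\<^bsub>sec (WQ n i) V\<^esub> x)"
      if "V \<in> ob T" "x \<in> sects (twist 1 (WOm D n i)) V" for V x
      using that WV_smult[where U = V and t = x and n = n and i = i and a = ?a] by (simp add: WOm_def)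
  qed
  then show "\<lbrakk>U \<in> ob T; x \<in> NV n i U\<rbrakk> \<Longrightarrow> a \<odot>\<^bsub>sec (WOm D (Suc n) i) U\<^esub> x \<in> NV n i U"
    by (rule stableD)
qed

lemma WFn_mod_iso: "sheaf_mod_iso T (kmod (quot T (WOm D (Suc n) i) (NV n i))) (kmod (ZW D n i))
    (induced T (ZW D n i) (WFn D n i))"
  unfolding sheaf_mod_iso_def sheaf_mod_hom_def
proof (intro conjI ballI allI)
  let ?Q = "quot T (WOm D (Suc n) i) (NV n i)" and ?k = "induced T (ZW D n i) (WFn D n i)"
  show "sheaf_ab_hom T (kmod ?Q) (kmod (ZW D n i)) ?k" using WFn_ind_hom by simp
  show "bij_betw (?k U) (sects (kmod ?Q) U) (sects (kmod (ZW D n i)) U)" if "U \<in> ob T" for U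
    using WFn_iso[OF that] by simp
  fix U t and c :: 'k assume U: "U \<in> ob T" and "t \<in> sects (kmod ?Q) U"
  then have t: "t \<in> sects ?Q U" by simp
  let ?a = "teichmueller c"
  have q1: "a \<odot>\<^bsub>sec ?Q V\<^esub> quot_proj T (WOm D (Suc n) i) (NV n i) V x
      = quot_proj T (WOm D (Suc n) i) (NV n i) V (a \<odot>\<^bsub>sec (WOm D (Suc n) i) V\<^esub> x)"
    if "V \<in> ob T" "x \<in> sects (WOm D (Suc n) i) V" for a V x
    by (rule quot_sheaf.pr_smult(1)[OF quot_NV WOm_smult_hom NV_smult that])
  have q2: "sheaf_ab_hom T ?Q ?Q (\<lambda>U t. a \<odot>\<^bsub>sec ?Q U\<^esub> t)" for a
    by (rule quot_sheaf.pr_smult(2)[OF quot_NV WOm_smult_hom NV_smult])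
  have "?k U (?a \<odot>\<^bsub>sec ?Q U\<^esub> t) = ?a \<odot>\<^bsub>sec (ZW D n i) U\<^esub> ?k U t"
  proof (rule epi_commute[OF ab_ZW quot_sheaf.pr_epi[OF quot_NV] WFn_ind_hom q2 ZW_smult_hom _ U t])
    fix V x assume V: "V \<in> ob T" and x: "x \<in> sects (WOm D (Suc n) i) V"
    show "?k V (?a \<odot>\<^bsub>sec ?Q V\<^esub> quot_proj T (WOm D (Suc n) i) (NV n i) V x)
        = ?a \<odot>\<^bsub>sec (ZW D n i) V\<^esub> ?k V (quot_proj T (WOm D (Suc n) i) (NV n i) V x)"
      using q1[OF V x, of ?a] WFn_ind_pr[OF V x] WFn_mod_hom[where n = n and i = i] V x
        WFn_ind_pr[OF V hom_closed[OF WOm_smult_hom V x], of ?a] by (simp add: sheaf_mod_hom_def)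
  qed
  then show "?k U (c \<odot>\<^bsub>sec (kmod ?Q) U\<^esub> t) = c \<odot>\<^bsub>sec (kmod (ZW D n i)) U\<^esub> ?k U t" by simp
qed

section \<open>Linearity of R and C\<close>

lemma WR_ab_hom: "sheaf_ab_hom T (WOm D (Suc n) i) (WOm D n i) (WR D n i)"
  by (simp add: WOm_def WR_hom)

lemma WR_mod_hom: "sheaf_mod_hom T (WOm D (Suc n) i) (WOm D n i) (WR D n i)"
  unfolding sheaf_mod_hom_def using WR_ab_hom WR_smult by (simp add: WOm_def)

lemma C_op_mod_hom:
  assumes X: "subsheaf T (Om1 D i) (X n i)" "\<And>U. U \<in> ob T \<Longrightarrow> X (Suc n) i U = cart_pre i (X n i) U"
    "\<And>V x. \<lbrakk>V \<in> ob T; x \<in> BOm1 D i V\<rbrakk> \<Longrightarrow> x \<in> X n i V"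
    and st: "\<And>a V x. \<lbrakk>V \<in> ob T; x \<in> X n i V\<rbrakk> \<Longrightarrow> a \<odot>\<^bsub>sec (Om1 D i) V\<^esub> x \<in> X n i V"
      "\<And>a V x. \<lbrakk>V \<in> ob T; x \<in> X (Suc n) i V\<rbrakk> \<Longrightarrow> a \<odot>\<^bsub>sec (Om1 D i) V\<^esub> x \<in> X (Suc n) i V"
  shows "sheaf_mod_hom T (kmod (twist (Suc m) (XQ' X n i))) (kmod (twist m (XQ X n i))) (C_op D X n i)"
  unfolding sheaf_mod_hom_def
proof (intro conjI ballI allI)
  show "sheaf_ab_hom T (kmod (twist (Suc m) (XQ' X n i))) (kmod (twist m (XQ X n i))) (C_op D X n i)"
    using C_op_hom[where X = X and n = n and i = i, OF X] by simp
  fix U t and c :: 'k assume U: "U \<in> ob T" and "t \<in> sects (kmod (twist (Suc m) (XQ' X n i))) U"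
  then have t: "t \<in> sects (XQ' X n i) U" by simp
  \<comment> \<open>The target acts through m twists of the multiplicative lift of c, which is again
    a multiplicative lift. The source has one twist more, and this is the Frobenius in
    \<open>C_op_smult\<close>.\<close>
  obtain e where e: "(witt_frob ^^ m) (teichmueller c) = teichmueller e"
    using witt_frob_funpow_teichmueller[OF char_pos] by blast
  have "C_op D X n i U (witt_frob (teichmueller e) \<odot>\<^bsub>sec (XQ' X n i) U\<^esub> t)
      = teichmueller e \<odot>\<^bsub>sec (XQ X n i) U\<^esub> C_op D X n i U t"
    by (rule C_op_smult[where X = X and n = n and i = i, OF X st U t])
  then show "C_op D X n i U (c \<odot>\<^bsub>sec (kmod (twist (Suc m) (XQ' X n i))) U\<^esub> t)
      = c \<odot>\<^bsub>sec (kmod (twist m (XQ X n i))) U\<^esub> C_op D X n i U t"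
    using e by simp
qed

lemma CZ_mod_hom: "sheaf_mod_hom T (kmod (ZW D (Suc m) i)) (kmod (ZW D m i)) (CZ D (Suc m) i)"
  unfolding ZW_def CZ_def
  by (rule C_op_mod_hom[where X = "ZOm1 D", OF sub_ZOm1 ZOm1_Suc BOm1_ZOm1])
    (use stableD[OF ZOm1_smult] in blast)+

lemma CB_mod_hom: "sheaf_mod_hom T (kmod (BW D (Suc m) (i + 1))) (kmod (BW D m (i + 1))) (CB D (Suc m) (i + 1))"
  unfolding BW_def CB_def
  by (rule C_op_mod_hom[where X = "BnOm1 D", OF sub_BnOm1 BnOm1_Suc BOm1_BnOm1])
    (use stableD[OF BnOm1_smult] in blast)+

section \<open>The cokernel of F and assertion (3)\<close>

lemma WFd_ab_hom: "sheaf_ab_hom T (twist 1 (WOm D (Suc m) i)) (BW D (Suc m) (i + 1)) (WFd D (Suc m) i)"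
  by (simp add: WOm_def BW_def WFd_hom)

lemma WF_hom_WOm: "sheaf_ab_hom T (WOm D (Suc n) i) (twist 1 (WOm D n i)) (WF D n i)"
  by (simp add: WOm_def WF_hom)

lemma ab_tWOm: "ab_sheaf T (twist 1 (WOm D n i))"
  by (simp add: ab_WOm)

lemma sub_NF: "subsheaf T (twist 1 (WOm D n i)) (NF n i)"
  by (rule subsheaf_image[OF ab_WOm ab_tWOm WF_hom_WOm subsheaf_full[OF ab_WOm]])

lemma quot_NF: "quot_sheaf T (twist 1 (WOm D n i)) (NF n i)"
  by (intro quot_sheaf.intro quot_sheaf_axioms.intro grothendieck_site_axioms ab_tWOm sub_NF)

text \<open>With n = m + 1, a representative x of a class of W_{n+1} has dx divisible by p^{n+1}, so
  p^{-n} dx is p times a section and reduces to 0.\<close>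

lemma WFd_NF:
  assumes V: "V \<in> ob T" and x: "x \<in> NF (Suc m) i V"
  shows "WFd D (Suc m) i V x = \<zero>\<^bsub>sec (BW D (Suc m) (i + 1)) V\<^esub>"
proof -
  have eq: "WFd D (Suc m) i V (WF D (Suc m) i V t) = \<zero>\<^bsub>sec (BQ (Suc m) (i + 1)) V\<^esub>"
    if V: "V \<in> ob T" and t: "t \<in> sects (WQ (Suc (Suc m)) i) V" for V t
  proof (rule epi_eqI[OF ab_BQ prW_epi hom_comp[OF WF_hom WFd_hom] zero_hom[OF ab_BQ] _ V t])
    fix V u assume V: "V \<in> ob T" and "u \<in> sects (subsh (\<Omega> i) (Z (Suc (Suc m)) i)) V"
    then have u: "u \<in> Z (Suc (Suc m)) i V" by simp
    have u': "u \<in> Z (Suc m) i V" using Z_mono[OF V u] by simp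
    note c = divd_closed[OF V u]
    have "divd (Suc m) i V u = P 1 (i + 1) V (divd (Suc (Suc m)) i V u)"
      by (rule divdI[OF V]) (use V c P_divd[OF V u] P_P[OF V c, of "Suc m" 1] in simp_all)
    then have "del (Suc m) i V u \<in> BOm1 D (i + 1) V"
      using red_BOm1[OF V divd_closed[OF V u']] P_in_B[OF V c, of 1] by (simp add: del_def)
    then show "WFd D (Suc m) i V (WF D (Suc m) i V (prW (Suc (Suc m)) i V u)) = \<zero>\<^bsub>sec (BQ (Suc m) (i + 1)) V\<^esub>"
      using WF_pr[OF V u] WFd_pr[OF V u'] cl_zero_BQ[OF V del_BnOm1[OF V u']] by simp
  qed
  have "x \<in> {x \<in> sects (twist 1 (WOm D (Suc m) i)) V. WFd D (Suc m) i V x \<in> {\<zero>\<^bsub>sec (BW D (Suc m) (i + 1)) V\<^esub>}}"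
  proof (rule sheaf_image_least[OF subsheaf_preimage[OF ab_tWOm ab_BW WFd_ab_hom subsheaf_zero_sub[OF ab_BW]] _ V x])
    fix V t assume V: "V \<in> ob T" and "t \<in> sects (WOm D (Suc (Suc m)) i) V"
    then have t: "t \<in> sects (WQ (Suc (Suc m)) i) V" by (simp add: WOm_def)
    show "WF D (Suc m) i V t \<in> {x \<in> sects (twist 1 (WOm D (Suc m) i)) V.
        WFd D (Suc m) i V x \<in> {\<zero>\<^bsub>sec (BW D (Suc m) (i + 1)) V\<^esub>}}"
      using eq[OF V t] hom_closed[OF WF_hom V t] by (simp add: WOm_def BW_def)
  qed
  then show ?thesis by simp
qed

text \<open>On a cover p^{-n} dx = p u + dw, so x - p^n w has differential p^{n+1} u. Its class in
  W_n therefore comes from W_{n+1} under F, and it equals the class of x because p^n w is zero in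
  W_n.\<close>

lemma ker_WFd:
  assumes U: "U \<in> ob T" and x: "x \<in> Z n i U" and B: "divd n i U x \<in> B 1 (i + 1) U"
  shows "prW n i U x \<in> NF n i U"
proof (rule subsheaf_loc[OF sub_NF U])
  show p: "prW n i U x \<in> sects (twist 1 (WOm D n i)) U" using prW_closed[OF U x] by (simp add: WOm_def)
  show "loc T U (\<lambda>f. res (twist 1 (WOm D n i)) f (prW n i U x) \<in> NF n i (src T f))"
  proof (rule loc_mono[OF B_loc[OF U B] U])
    fix f assume f: "f \<in> into T U" and "\<exists>u\<in>Sec (i + 1) (src T f). \<exists>w\<in>Sec (i + 1 - 1) (src T f).
      res (\<Omega> (i + 1)) f (divd n i U x) = P 1 (i + 1) (src T f) u \<oplus>\<^bsub>sec (\<Omega> (i + 1)) (src T f)\<^esub> d (i + 1 - 1) (src T f) w"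
    then obtain u w where u: "u \<in> Sec (i + 1) (src T f)" and w: "w \<in> Sec i (src T f)"
      and eq: "res (\<Omega> (i + 1)) f (divd n i U x) = P 1 (i + 1) (src T f) u \<oplus>\<^bsub>sec (\<Omega> (i + 1)) (src T f)\<^esub> d i (src T f) w"
      by auto
    let ?V = "src T f" and ?x = "res (\<Omega> i) f x"
    note V = intoD(3)[OF f]
    have rx: "?x \<in> Z n i ?V" using subsheaf_res[OF sub_Z f x] .
    have xO: "?x \<in> Sec i ?V" using Z_in[OF V rx] .
    have Pw: "P n i ?V w \<in> Sec i ?V" using V w by simp
    interpret G: abelian_group "sec (\<Omega> i) ?V" using grp_Om[OF V] .
    interpret G': abelian_group "sec (\<Omega> (i + 1)) ?V" using grp_Om[OF V] .
    interpret H: abelian_group "sec (WQ n i) ?V" using ab_sheaf.grp[OF ab_WQ V] .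
    let ?y = "?x \<ominus>\<^bsub>sec (\<Omega> i) ?V\<^esub> P n i ?V w"
    have "d i ?V ?x = P n (i + 1) ?V (P 1 (i + 1) ?V u \<oplus>\<^bsub>sec (\<Omega> (i + 1)) ?V\<^esub> d i ?V w)"
      using P_divd[OF V rx] hom_res[OF divd_hom f, of x i n] x eq by simp
    also have "\<dots> = P (Suc n) (i + 1) ?V u \<oplus>\<^bsub>sec (\<Omega> (i + 1)) ?V\<^esub> d i ?V (P n i ?V w)"
      using P_add[OF V, of "P 1 (i + 1) ?V u" "i + 1" "d i ?V w" n] P_P[OF V u, of n 1] d_P[OF V w, of n] V u w by simp
    finally have "d i ?V ?y = P (Suc n) (i + 1) ?V u"
      using d_minus[OF V xO Pw] G'.add_minus_cancel(1)[of "P (Suc n) (i + 1) ?V u" "d i ?V (P n i ?V w)"] V u Pw by simp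
    then have yZ: "?y \<in> Z (Suc n) i ?V" using mem_Z[OF V] u O_minus[OF V xO Pw] by blast
    have yZ': "?y \<in> Z n i ?V" using Z_mono[OF V yZ] by simp
    have "prW n i ?V (?y \<oplus>\<^bsub>sec (\<Omega> i) ?V\<^esub> P n i ?V w) = prW n i ?V ?y \<oplus>\<^bsub>sec (WQ n i) ?V\<^esub> prW n i ?V (P n i ?V w)"
      using hom_add[OF prW_hom V, of ?y i n "P n i ?V w"] yZ' P_Sec_Z[OF V w] by simp
    also have "\<dots> = prW n i ?V ?y"
      using prW_zero[OF V P_Sec_Z[OF V w]] P_in_B[OF V w] prW_closed[OF V yZ'] by simp
    also have "\<dots> = WF D n i ?V (prW (Suc n) i ?V ?y)" using WF_pr[OF V yZ] by simp
    finally have "res (twist 1 (WOm D n i)) f (prW n i U x) = WF D n i ?V (prW (Suc n) i ?V ?y)"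
      using hom_res[OF prW_hom f, of x i n] x G.add_minus_cancel(2)[OF xO Pw] by (simp add: WOm_def)
    then show "res (twist 1 (WOm D n i)) f (prW n i U x) \<in> NF n i ?V"
      using sheaf_imageI[OF ab_tWOm WF_hom_WOm subsheaf_full[OF ab_WOm] V, of "prW (Suc n) i ?V ?y"] prW_closed[OF V yZ]
      by (simp add: WOm_def)
  qed
qed

lemma WFd_ind_hom: "sheaf_ab_hom T (quot T (twist 1 (WOm D (Suc m) i)) (NF (Suc m) i)) (BW D (Suc m) (i + 1))
    (induced T (BW D (Suc m) (i + 1)) (WFd D (Suc m) i))"
  by (rule quot_sheaf.induced_hom[OF quot_NF ab_BW WFd_ab_hom WFd_NF])

lemma WFd_ind_pr: "\<lbrakk>U \<in> ob T; x \<in> sects (twist 1 (WOm D (Suc m) i)) U\<rbrakk> \<Longrightarrow>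
    induced T (BW D (Suc m) (i + 1)) (WFd D (Suc m) i) U (quot_proj T (twist 1 (WOm D (Suc m) i)) (NF (Suc m) i) U x)
      = WFd D (Suc m) i U x"
  by (rule quot_sheaf.induced_pr[OF quot_NF ab_BW WFd_ab_hom WFd_NF])

text \<open>The argument of \<open>WFn_iso\<close> with \<open>del\<close> in the role of reduction:
  for n = m + 1 it maps Z_n onto B_{n+1} Omega_1^{i+1}, and the class of its value vanishes only if
  p^{-n} dx lies in B_1, where \<open>ker_WFd\<close> applies.\<close>

lemma WFd_iso: "sheaf_ab_iso T (quot T (twist 1 (WOm D (Suc m) i)) (NF (Suc m) i)) (BW D (Suc m) (i + 1))
    (induced T (BW D (Suc m) (i + 1)) (WFd D (Suc m) i))"
  unfolding sheaf_ab_iso_def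
proof (intro conjI ballI WFd_ind_hom)
  let ?Q = "quot T (twist 1 (WOm D (Suc m) i)) (NF (Suc m) i)"
  have e: "sheaf_epi T (subsh (\<Omega> i) (Z (Suc m) i)) (twist 1 (WOm D (Suc m) i)) (prW (Suc m) i)"
    using prW_epi_WOm by simp
  fix U assume U: "U \<in> ob T"
  show "bij_betw (induced T (BW D (Suc m) (i + 1)) (WFd D (Suc m) i) U) (sects ?Q U) (sects (BW D (Suc m) (i + 1)) U)"
  proof (rule epi_bij[OF quot_sheaf.ab_quot[OF quot_NF] ab_BW
      epi_comp[OF quot_sheaf.ab_quot[OF quot_NF] e quot_sheaf.pr_epi[OF quot_NF]] WFd_ind_hom _ _ _ U])
    show "sheaf_epi T (subsh (\<Omega> i) (Z (Suc m) i)) (BW D (Suc m) (i + 1)) (\<lambda>U x. cl (i + 1) U (del (Suc m) i U x))"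
      unfolding BW_def using del_cl_epi by simp
    fix V x assume V: "V \<in> ob T" and "x \<in> sects (subsh (\<Omega> i) (Z (Suc m) i)) V"
    then have x: "x \<in> Z (Suc m) i V" by simp
    have p: "prW (Suc m) i V x \<in> sects (twist 1 (WOm D (Suc m) i)) V" using prW_closed[OF V x] by (simp add: WOm_def)
    show "induced T (BW D (Suc m) (i + 1)) (WFd D (Suc m) i) V
        (quot_proj T (twist 1 (WOm D (Suc m) i)) (NF (Suc m) i) V (prW (Suc m) i V x)) = cl (i + 1) V (del (Suc m) i V x)"
      using WFd_ind_pr[OF V p] WFd_pr[OF V x] by simp
    assume "cl (i + 1) V (del (Suc m) i V x) = \<zero>\<^bsub>sec (BW D (Suc m) (i + 1)) V\<^esub>"
    then have "del (Suc m) i V x \<in> BOm1 D (i + 1) V" using cl_zero_BQ[OF V del_BnOm1[OF V x]] by (simp add: BW_def)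
    then have "divd (Suc m) i V x \<in> B 1 (i + 1) V" using red_BOm1[OF V divd_closed[OF V x]] by (simp add: del_def)
    then show "quot_proj T (twist 1 (WOm D (Suc m) i)) (NF (Suc m) i) V (prW (Suc m) i V x) = \<zero>\<^bsub>sec ?Q V\<^esub>"
      using quot_sheaf.pr_eq_zero_iff[OF quot_NF V p] ker_WFd[OF V x] by simp
  qed
qed

end

theorem proposition3p4:
  fixes D :: "('o, 'm, 'k::field, 'a) frob_triple" and i :: int and n :: nat
  assumes char_pos: "CHAR('k) > 0"
    and perfect: "surj (\<lambda>x::'k. x ^ CHAR('k))"
    and triple: "dR_triple D"
    and i: "0 \<le> i" and n: "1 \<le> n"
  shows
    "sheaf_mod_iso (site_of D)
       (kmod (quot (site_of D) (WOm D (n + 1) i)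
         (sheaf_image (site_of D) (WOm D (n + 1) i) (WV D n i) (sects (twist 1 (WOm D n i))))))
       (kmod (ZW D n i))
       (induced (site_of D) (ZW D n i) (WFn D n i))
   \<and>
     (sheaf_mod_hom (site_of D) (WOm D (n + 1) i) (ZW D n i) (WFn D n i) \<and>
      sheaf_mod_hom (site_of D) (kmod (ZW D n i)) (kmod (ZW D (n - 1) i)) (CZ D n i) \<and>
      sheaf_mod_hom (site_of D) (WOm D (n + 1) i) (WOm D n i) (WR D n i) \<and>
      sheaf_mod_hom (site_of D) (WOm D n i) (ZW D (n - 1) i) (WFn D (n - 1) i) \<and>
      (\<forall>U\<in>ob (site_of D). \<forall>x\<in>sects (WOm D (n + 1) i) U.
         CZ D n i U (WFn D n i U x) = WFn D (n - 1) i U (WR D n i U x)))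
   \<and>
     sheaf_ab_iso (site_of D)
       (quot (site_of D) (twist 1 (WOm D n i))
         (sheaf_image (site_of D) (twist 1 (WOm D n i)) (WF D n i) (sects (WOm D (n + 1) i))))
       (BW D n (i + 1))
       (induced (site_of D) (BW D n (i + 1)) (WFd D n i))
   \<and>
     (sheaf_ab_hom (site_of D) (twist 1 (WOm D (n + 1) i)) (BW D (n + 1) (i + 1)) (WFd D (n + 1) i) \<and>
      sheaf_mod_hom (site_of D) (kmod (BW D (n + 1) (i + 1))) (kmod (BW D n (i + 1))) (CB D (n + 1) (i + 1)) \<and>
      sheaf_ab_hom (site_of D) (twist 1 (WOm D (n + 1) i)) (twist 1 (WOm D n i)) (WR D n i) \<and>
      sheaf_ab_hom (site_of D) (twist 1 (WOm D n i)) (BW D n (i + 1)) (WFd D n i) \<and>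
      (\<forall>U\<in>ob (site_of D). \<forall>x\<in>sects (twist 1 (WOm D (n + 1) i)) U.
         CB D (n + 1) (i + 1) U (WFd D (n + 1) i U x) = WFd D n i U (WR D n i U x)))"
proof -
  interpret dRW D
    using triple char_pos by (intro dRW.intro dRW_axioms.intro)
  \<comment> \<open>The preceding results are stated for n = m + 1, which turns the truncated
    difference n - 1 of F^{n-1} into m.\<close>
  obtain m where m: "n = Suc m" using n by (cases n) auto
  have CZ: "CZ D n i U (WFn D n i U x) = WFn D (n - 1) i U (WR D n i U x)"
    if "U \<in> ob T" "x \<in> sects (WOm D (Suc n) i) U" for U x
    using CZ_WFn[where U = U and t = x and m = m and i = i] that by (simp add: m WOm_def)
  have CB: "CB D (Suc n) (i + 1) U (WFd D (Suc n) i U x) = WFd D n i U (WR D n i U x)"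
    if "U \<in> ob T" "x \<in> sects (twist 1 (WOm D (Suc n) i)) U" for U x
    using CB_WFd[where U = U and t = x and m = m and i = i] that by (simp add: m WOm_def)
  have R: "sheaf_ab_hom T (twist 1 (WOm D (Suc n) i)) (twist 1 (WOm D n i)) (WR D n i)"
    using WR_ab_hom by simp
  show ?thesis
    unfolding Suc_eq_plus1[symmetric]
    using WFn_mod_iso WFn_mod_hom CZ_mod_hom WR_mod_hom CZ WFd_iso WFd_ab_hom CB_mod_hom R CB
    by (intro conjI ballI) (simp_all add: m)
qed

end
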